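(* Let $K$ be a field of characteristic $0$ and let $n,m\ge 1$ be integers. Then $\beta(n,m)\le n^6$; that is, the invariant ring $R(n,m)$ is generated as a $K$-algebra by invariants of degree $\le n^6$.
   Context: $\mathrm{Mat}_{n,n}$ is the space of $n\times n$ matrices over $K$. The group $G=\mathrm{SL}_n\times \mathrm{SL}_n$ acts on $V=\mathrm{Mat}_{n,n}^m$ by $(A,B)\cdot(X_1,\dots,X_m)=(AX_1B^{-1},\dots,AX_mB^{-1})$. $R(n,m)=K[V]^G$ is the graded ring of $G$-invariant polynomial functions on $V$. $\beta(n,m)$ is the smallest nonnegative integer $d$ such that $R(n,m)$ is generated by invariants of degree $\le d$. *)

theory Defs
  imports
    "Jordan_Normal_Form.Determinant"
    "HOL-Library.FuncSet"
    "HOL-Library.Poly_Mapping"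
begin

section \<open>The group and its action\<close>

definition SL :: "nat \<Rightarrow> 'a::field mat monoid" where
  "SL n = \<lparr>carrier = {A \<in> carrier_mat n n. det A = 1}, mult = (*), one = 1\<^sub>m n\<rparr>"

lemma group_SL: "group (SL n :: 'a::field mat monoid)"
proof (rule groupI)
  fix A :: "'a mat"
  assume "A \<in> carrier (SL n)"
  then have A: "A \<in> carrier_mat n n" and d: "det A = 1" by (auto simp: SL_def)
  have inv: "adj_mat A * A = 1\<^sub>m n" and c: "adj_mat A \<in> carrier_mat n n"
    using adj_mat[OF A] d by (auto intro!: eq_matI)
  have "det (adj_mat A) * det A = 1"
    using det_mult[OF c A] inv by simp
  then have "det (adj_mat A) = 1" using d by simp
  then show "\<exists>B\<in>carrier (SL n). B \<otimes>\<^bsub>SL n\<^esub> A = \<one>\<^bsub>SL n\<^esub>"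
    using inv c by (auto simp: SL_def)
qed (auto simp: SL_def det_mult)

text \<open>Tuples are indexed from 0 and are \<open>undefined\<close> at indices \<open>\<ge> m\<close>.\<close>

definition mat_tuples :: "nat \<Rightarrow> nat \<Rightarrow> (nat \<Rightarrow> 'a::field mat) set" where
  "mat_tuples n m = {..<m} \<rightarrow>\<^sub>E carrier_mat n n"

definition act ::
  "nat \<Rightarrow> nat \<Rightarrow> 'a::field mat \<times> 'a mat \<Rightarrow> (nat \<Rightarrow> 'a mat) \<Rightarrow> (nat \<Rightarrow> 'a mat)" where
  "act n m = (\<lambda>(A, B) X. \<lambda>k\<in>{..<m}. A * X k * inv\<^bsub>SL n\<^esub> B)"

lemma act_closed:
  assumes "g \<in> carrier (SL n \<times>\<times> SL n)" and "X \<in> mat_tuples n m"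
  shows "act n m g X \<in> mat_tuples n m"
proof -
  obtain A B where g: "g = (A, B)" by fastforce
  have "B \<in> carrier (SL n)" using assms(1) g by (auto simp: DirProd_def)
  then have "inv\<^bsub>SL n\<^esub> B \<in> carrier (SL n)"
    by (rule group.inv_closed[OF group_SL])
  then show ?thesis
    using assms g by (auto simp: act_def mat_tuples_def SL_def DirProd_def intro!: mult_carrier_mat)
qed

section \<open>Polynomial functions\<close>

text \<open>
  A polynomial is a finitely supported family of coefficients indexed by monomials, and a
  monomial is a finitely supported family of exponents. The variable \<open>(k, i, j)\<close> stands for
  the \<open>(i, j)\<close> entry of the \<open>k\<close>-th matrix.
\<close>

type_synonym monomial = "nat \<times> nat \<times> nat \<Rightarrow>\<^sub>0 nat"

definition eval_mpoly :: "(monomial \<Rightarrow>\<^sub>0 'a) \<Rightarrow> (nat \<Rightarrow> 'a mat) \<Rightarrow> 'a::field" where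
  "eval_mpoly p X =
    (\<Sum>t\<in>Poly_Mapping.keys p. Poly_Mapping.lookup p t *
      (\<Prod>(k, i, j)\<in>Poly_Mapping.keys t. (X k $$ (i, j)) ^ Poly_Mapping.lookup t (k, i, j)))"

definition poly_vars :: "(monomial \<Rightarrow>\<^sub>0 'a::zero) \<Rightarrow> (nat \<times> nat \<times> nat) set" where
  "poly_vars p = (\<Union>t\<in>Poly_Mapping.keys p. Poly_Mapping.keys t)"

definition monomial_degree :: "monomial \<Rightarrow> nat" where
  "monomial_degree t = (\<Sum>v\<in>Poly_Mapping.keys t. Poly_Mapping.lookup t v)"

text \<open>
  Elements of \<open>K[V]\<close> are functions on \<open>V = mat_tuples n m\<close>, made \<open>undefined\<close> outside \<open>V\<close> so that
  equality of functions is equality on \<open>V\<close>.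
\<close>

definition poly_functions_le :: "nat \<Rightarrow> nat \<Rightarrow> nat \<Rightarrow> ((nat \<Rightarrow> 'a::field mat) \<Rightarrow> 'a) set" where
  "poly_functions_le n m d =
    {restrict (eval_mpoly p) (mat_tuples n m) | p.
       poly_vars p \<subseteq> {..<m} \<times> {..<n} \<times> {..<n} \<and> (\<forall>t\<in>Poly_Mapping.keys p. monomial_degree t \<le> d)}"

definition poly_functions :: "nat \<Rightarrow> nat \<Rightarrow> ((nat \<Rightarrow> 'a::field mat) \<Rightarrow> 'a) set" where
  "poly_functions n m = (\<Union>d. poly_functions_le n m d)"

section \<open>The invariant ring and its generation in bounded degree\<close>

definition invariant_ring :: "nat \<Rightarrow> nat \<Rightarrow> ((nat \<Rightarrow> 'a::field mat) \<Rightarrow> 'a) set" where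
  "invariant_ring n m =
    {f \<in> poly_functions n m.
       \<forall>g \<in> carrier (SL n \<times>\<times> SL n). \<forall>X \<in> mat_tuples n m. f (act n m g X) = f X}"

text \<open>The \<open>K\<close>-subalgebra generated by \<open>S\<close> in the algebra of functions on \<open>V\<close>:\<close>

inductive_set generated_algebra :: "'v set \<Rightarrow> ('v \<Rightarrow> 'a::field) set \<Rightarrow> ('v \<Rightarrow> 'a) set"
  for V :: "'v set" and S :: "('v \<Rightarrow> 'a) set" where
  gen: "f \<in> S \<Longrightarrow> f \<in> generated_algebra V S"
| const: "(\<lambda>x\<in>V. c) \<in> generated_algebra V S"
| add: "f \<in> generated_algebra V S \<Longrightarrow> g \<in> generated_algebra V S \<Longrightarrow>
    (\<lambda>x\<in>V. f x + g x) \<in> generated_algebra V S"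
| mult: "f \<in> generated_algebra V S \<Longrightarrow> g \<in> generated_algebra V S \<Longrightarrow>
    (\<lambda>x\<in>V. f x * g x) \<in> generated_algebra V S"

definition generated_in_degree_le :: "'a::field itself \<Rightarrow> nat \<Rightarrow> nat \<Rightarrow> nat \<Rightarrow> bool" where
  "generated_in_degree_le K n m d \<longleftrightarrow>
    generated_algebra (mat_tuples n m)
      (invariant_ring n m \<inter> poly_functions_le n m d :: ((nat \<Rightarrow> 'a mat) \<Rightarrow> 'a) set)
    = invariant_ring n m"

text \<open>
  \<open>LEAST\<close> over an empty set is unspecified, so a bound on \<open>beta\<close> is meaningful only together with
  \<open>generated_in_degree_le\<close> for some degree.
\<close>

definition beta :: "'a::field itself \<Rightarrow> nat \<Rightarrow> nat \<Rightarrow> nat" where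
  "beta K n m = (LEAST d. generated_in_degree_le K n m d)"

end

theory Submission
  imports
    Defs
    "HOL-Library.Product_Lexorder"
    "Jordan_Normal_Form.Char_Poly"
    "HOL-Analysis.Continuum_Not_Denumerable"
    "HOL-Computational_Algebra.Fundamental_Theorem_Algebra"
begin

text \<open>
  Coordinates of \<open>K\<close> over the rationals reduce everything to rational invariants. If all
  \<open>det (\<Sum>\<^sub>i X\<^sub>i \<otimes> T\<^sub>i)\<close> with \<open>T\<^sub>i\<close> of size \<open>n\<close> vanish at \<open>X\<close>, then so do those of every size
  \<open>k \<ge> n\<close> (descent from \<open>k + 1\<close> to \<open>k\<close> by the regularity lemma), and hence all invariants of
  positive degree, since polarizing a semi-invariant expresses it through such determinants. So the
  null cone is cut out by invariants of degree \<open>n\<^sup>2\<close>, in fact by \<open>N = m n\<^sup>2\<close> of them, \<open>f\<^sub>1, \<dots>, f\<^sub>N\<close>.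

  The invariant ring is a finite module over \<open>\<rat>[f\<^sub>1, \<dots>, f\<^sub>N]\<close>. If \<open>g\<close> is an invariant of degree
  \<open>> N n\<^sup>2\<close>, a degree count shows that, up to denominators, \<open>g\<^sup>p\<close> lies in the ideal of the \<open>f\<^sub>i\<^sup>p\<close> for all
  large primes \<open>p\<close>; modulo \<open>p\<close> the Frobenius map turns this into membership of \<open>g\<close> in the ideal of the
  \<open>f\<^sub>i\<close>, and the Reynolds operator makes the coefficients invariant. This takes the place of the
  Cohen-Macaulay property of invariant rings. It gives the bound when \<open>m \<le> n\<^sup>2\<close>, as then
  \<open>N n\<^sup>2 \<le> n\<^sup>6\<close>. For larger \<open>m\<close> one uses Weyl's polarization argument: the indecomposable part of
  the invariant ring is stable under linear combinations of the matrices, so it vanishes if it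
  vanishes on \<open>n\<^sup>2\<close> matrices.
\<close>

section \<open>Polynomials\<close>

text \<open>Three fields take part. Over \<open>\<rat>\<close> there are primes to reduce by and
  positive definite forms to project with; over the complex numbers, uncountability yields the
  Nullstellensatz and Hermitian forms detect kernels; \<open>K\<close> enters only at the end. Ideal
  membership is carried between them by linear functionals. Complete reducibility comes from the
  apolar form: the adjoint of a linear substitution is the transposed substitution and the acting
  set is closed under transposition, so orthogonal projection is a Reynolds operator. In the degree
  count, a product of \<open>r\<close> parameters of degree \<open>\<delta>\<close> and a module
  generator of bounded degree has degree \<open>p * e\<close> with \<open>e > r * \<delta>\<close>
  only if some exponent reaches \<open>p\<close>. The denominators of \<open>g ^ p\<close> are
  \<open>c * d ^ p\<close> with \<open>c\<close>, \<open>d\<close> independent of \<open>p\<close>,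
  so large primes avoid them. The bound is \<open>n^2\<close> (matrices) times \<open>n^2\<close>
  (entries) times \<open>n^2\<close> (degree): every variable is counted as a parameter. The size
  \<open>n\<close> is where the descent stops: deleting a block row leaves \<open>n - 1\<close>
  linear conditions, and regularity at size \<open>k\<close> tolerates fewer than
  \<open>k\<close>.\<close>

type_synonym 'v mono = "'v \<Rightarrow>\<^sub>0 nat"
type_synonym ('v, 'a) mp = "'v mono \<Rightarrow>\<^sub>0 'a"

abbreviation "cf \<equiv> Poly_Mapping.lookup"
abbreviation "supp \<equiv> Poly_Mapping.keys"
abbreviation "sgl \<equiv> Poly_Mapping.single"

definition mdeg :: "'v mono \<Rightarrow> nat" where
  "mdeg t = (\<Sum>v\<in>supp t. cf t v)"

definition mev :: "('v \<Rightarrow> 'b::comm_ring_1) \<Rightarrow> 'v mono \<Rightarrow> 'b" where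
  "mev x t = (\<Prod>v\<in>supp t. x v ^ cf t v)"

text \<open>One notion for three uses: evaluation (\<open>\<phi>\<close> the identity), substitution
  of polynomials (\<open>\<phi> = Const\<close>) and evaluation of a rational polynomial over a
  larger field (\<open>\<phi> = of_rat\<close>).\<close>

definition hev :: "('a::zero \<Rightarrow> 'b) \<Rightarrow> ('v \<Rightarrow> 'b::comm_ring_1) \<Rightarrow> ('v, 'a) mp \<Rightarrow> 'b" where
  "hev \<phi> x p = (\<Sum>t\<in>supp p. \<phi> (cf p t) * mev x t)"

definition Const :: "'a::zero \<Rightarrow> ('v, 'a) mp" where
  "Const c = sgl 0 c"

definition Var :: "'v \<Rightarrow> ('v, 'a::zero_neq_one) mp" where
  "Var v = sgl (sgl v 1) 1"

lemma supp_add_nat: "supp (s + t) = supp s \<union> supp (t :: 'v mono)"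
  by (auto simp: in_keys_iff lookup_add)

lemma mdeg_superset: "finite V \<Longrightarrow> supp t \<subseteq> V \<Longrightarrow> mdeg t = (\<Sum>v\<in>V. cf t v)"
  unfolding mdeg_def by (rule sum.mono_neutral_left) (auto simp: in_keys_iff)

lemma mdeg_add [simp]: "mdeg (s + t) = mdeg s + mdeg t"
proof -
  have "mdeg (s + t) = (\<Sum>v\<in>supp s \<union> supp t. cf s v + cf t v)"
    by (subst mdeg_superset[of "supp s \<union> supp t"]) (auto simp: supp_add_nat lookup_add)
  also have "\<dots> = mdeg s + mdeg t"
    by (simp add: sum.distrib mdeg_superset[of "supp s \<union> supp t" s] mdeg_superset[of "supp s \<union> supp t" t])
  finally show ?thesis .
qed

lemma mdeg_0 [simp]: "mdeg 0 = 0" by (simp add: mdeg_def)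
lemma mdeg_sgl [simp]: "mdeg (sgl v k) = k" by (simp add: mdeg_def lookup_single)

lemma mdeg_eq_0_iff: "mdeg t = 0 \<longleftrightarrow> t = 0"
  by (auto simp: mdeg_def in_keys_iff intro: poly_mapping_eqI)

lemma mev_superset: "finite V \<Longrightarrow> supp t \<subseteq> V \<Longrightarrow> mev x t = (\<Prod>v\<in>V. x v ^ cf t v)"
  unfolding mev_def by (rule prod.mono_neutral_left) (auto simp: in_keys_iff)

lemma mev_add: "mev x (s + t) = mev x s * mev x t"
proof -
  have "mev x (s + t) = (\<Prod>v\<in>supp s \<union> supp t. x v ^ cf s v * x v ^ cf t v)"
    by (subst mev_superset[of "supp s \<union> supp t"]) (auto simp: supp_add_nat lookup_add power_add)
  also have "\<dots> = mev x s * mev x t"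
    by (simp add: prod.distrib mev_superset[of "supp s \<union> supp t" s] mev_superset[of "supp s \<union> supp t" t])
  finally show ?thesis .
qed

lemma mev_0 [simp]: "mev x 0 = 1" by (simp add: mev_def)
lemma mev_sgl [simp]: "mev x (sgl v k) = x v ^ k"
  by (cases "k = 0") (auto simp: mev_def)

lemma hev_superset:
  assumes "finite T" "supp p \<subseteq> T" "\<phi> 0 = 0"
  shows "hev \<phi> x p = (\<Sum>t\<in>T. \<phi> (cf p t) * mev x t)"
  unfolding hev_def by (rule sum.mono_neutral_left) (use assms in \<open>auto simp: in_keys_iff\<close>)

lemma hev_sgl: "\<phi> 0 = 0 \<Longrightarrow> hev \<phi> x (sgl t c) = \<phi> c * mev x t"
  by (cases "c = 0") (auto simp: hev_def)

lemma mp_decomp: "p = (\<Sum>t\<in>supp p. sgl t (cf p t))"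
  by (rule poly_mapping_eqI) (auto simp: lookup_sum lookup_single when_def in_keys_iff sum.delta')

lemma mp_induct_sgl:
  assumes "\<And>t c. t \<in> supp p \<Longrightarrow> c = cf p t \<Longrightarrow> P (sgl t c)" "P 0" "\<And>a b. P a \<Longrightarrow> P b \<Longrightarrow> P (a + b)"
  shows "P (p :: ('v, 'a::comm_monoid_add) mp)"
proof -
  have "P (\<Sum>t\<in>T. sgl t (cf p t))" if "T \<subseteq> supp p" for T
    using finite_subset[OF that finite_keys] that
    by (induction T rule: finite_induct) (auto intro: assms)
  from this[of "supp p"] show ?thesis by (simp flip: mp_decomp)
qed

context comm_ring_hom
begin

lemma hev_add: "hev hom x (p + q) = hev hom x p + hev hom x q"
proof -
  have "hev hom x (p + q) = (\<Sum>t\<in>supp p \<union> supp q. hom (cf (p + q) t) * mev x t)"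
    by (rule hev_superset) (use keys_add[of p q] in auto)
  also have "\<dots> = hev hom x p + hev hom x q"
    by (simp add: lookup_add hom_add distrib_right sum.distrib hev_superset[of "supp p \<union> supp q" p]
      hev_superset[of "supp p \<union> supp q" q])
  finally show ?thesis .
qed

lemma hev_0: "hev hom x 0 = 0" by (simp add: hev_def)

lemma hev_Const: "hev hom x (Const c) = hom c" by (simp add: Const_def hev_sgl)
lemma hev_Var: "hev hom x (Var v) = x v" by (simp add: Var_def hev_sgl)
lemma hev_1: "hev hom x 1 = 1" using hev_sgl[of hom x 0 1] by simp

lemma hev_sum: "hev hom x (\<Sum>i\<in>I. f i) = (\<Sum>i\<in>I. hev hom x (f i))"
  by (induction I rule: infinite_finite_induct) (auto simp: hev_0 hev_add)

lemma hev_mult: "hev hom x (p * q) = hev hom x p * hev hom x q"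
proof -
  have s: "hev hom x (sgl s c * sgl t d) = hev hom x (sgl s c) * hev hom x (sgl t d)" for s t c d
    by (simp add: mult_single hev_sgl hom_mult mev_add)
  have "hev hom x (p * q) = hev hom x ((\<Sum>t\<in>supp p. sgl t (cf p t)) * (\<Sum>t\<in>supp q. sgl t (cf q t)))"
    by (simp flip: mp_decomp)
  also have "\<dots> = hev hom x (\<Sum>t\<in>supp p. sgl t (cf p t)) * hev hom x (\<Sum>t\<in>supp q. sgl t (cf q t))"
    by (simp add: sum_product hev_sum s)
  finally show ?thesis by (simp flip: mp_decomp)
qed

lemma comm_ring_hom_hev: "comm_ring_hom (hev hom x)"
  by unfold_locales (auto simp: hev_add hev_mult hev_0 hev_1)

end

lemma mp_Const_mult_cf: "cf (Const c * p) t = c * cf (p :: ('v, 'a::comm_ring_1) mp) t"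
  by (simp add: Const_def flip: mult_map_scale_conv_mult) (simp add: map.rep_eq when_def)

lemma Const_add: "Const (a + b) = Const a + (Const b :: ('v, 'a::comm_ring_1) mp)" by (simp add: Const_def single_add)
lemma Const_mult: "Const (a * b) = Const a * (Const b :: ('v, 'a::comm_ring_1) mp)" by (simp add: Const_def mult_single)
lemma Const_0 [simp]: "Const 0 = 0" by (simp add: Const_def)
lemma Const_1 [simp]: "Const 1 = 1" by (simp add: Const_def)

lemma comm_ring_hom_Const: "comm_ring_hom (Const :: 'a::comm_ring_1 \<Rightarrow> ('v, 'a) mp)"
  by unfold_locales (auto simp: Const_add Const_mult)

abbreviation ev :: "('v \<Rightarrow> 'a::comm_ring_1) \<Rightarrow> ('v, 'a) mp \<Rightarrow> 'a" where
  "ev \<equiv> hev (\<lambda>c. c)"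

lemma comm_ring_hom_id: "comm_ring_hom (\<lambda>c :: 'a::comm_ring_1. c)"
  by unfold_locales auto

interpretation ev: comm_ring_hom "ev x"
  by (rule comm_ring_hom.comm_ring_hom_hev[OF comm_ring_hom_id])

lemma comm_ring_hom_comp: "comm_ring_hom f \<Longrightarrow> comm_ring_hom g \<Longrightarrow> comm_ring_hom (\<lambda>c. f (g c))"
proof -
  assume "comm_ring_hom f" "comm_ring_hom g"
  then interpret f: comm_ring_hom f + g: comm_ring_hom g .
  show ?thesis by unfold_locales (auto simp: g.hom_add g.hom_mult f.hom_add f.hom_mult)
qed

lemma sgl_eq_Const_mult: "sgl t c = Const c * sgl t (1 :: 'a::comm_ring_1)"
  by (simp add: Const_def mult_single)

section \<open>Polynomials in a given set of variables, homogeneous polynomials\<close>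

definition PV :: "'v set \<Rightarrow> ('v, 'a::zero) mp set" where
  "PV V = {p. \<forall>t\<in>supp p. supp t \<subseteq> V}"

text \<open>Zero belongs to \<open>HP V e\<close> for every \<open>e\<close>, which makes these sets
  linear subspaces.\<close>

definition HP :: "'v set \<Rightarrow> nat \<Rightarrow> ('v, 'a::zero) mp set" where
  "HP V e = {p. \<forall>t\<in>supp p. supp t \<subseteq> V \<and> mdeg t = e}"

lemma HP_PV: "p \<in> HP V e \<Longrightarrow> p \<in> PV V" by (auto simp: HP_def PV_def)

lemma supp_split_var:
  assumes "v \<in> supp (t :: 'v mono)"
  obtains t' where "t = sgl v 1 + t'" "supp t' \<subseteq> supp t"
proof
  show "t = sgl v 1 + (t - sgl v 1)"
    by (rule poly_mapping_eqI) (use assms in \<open>auto simp: lookup_add lookup_minus lookup_single when_def in_keys_iff\<close>)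
  show "supp (t - sgl v 1) \<subseteq> supp t" by (auto simp: in_keys_iff lookup_minus)
qed

lemma PV_induct [consumes 1, case_names Const add Var]:
  assumes "p \<in> PV V"
    and "\<And>c. P (Const c)"
    and "\<And>p q. P p \<Longrightarrow> P q \<Longrightarrow> P (p + q)"
    and "\<And>v p. v \<in> V \<Longrightarrow> p \<in> PV V \<Longrightarrow> P p \<Longrightarrow> P (Var v * p)"
  shows "P (p :: ('v, 'a::comm_ring_1) mp)"
proof (rule mp_induct_sgl)
  have *: "supp t \<subseteq> V \<Longrightarrow> P (sgl t c)" for t c
  proof (induction "mdeg t" arbitrary: t)
    case 0
    then have "t = 0" by (simp add: mdeg_eq_0_iff)
    then show ?case using assms(2)[of c] by (simp add: Const_def)
  next
    case (Suc k)
    then have "t \<noteq> 0" by auto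
    then obtain v where v: "v \<in> supp t" by (metis ex_in_conv keys_eq_empty)
    then obtain t' where t': "t = sgl v 1 + t'" "supp t' \<subseteq> supp t" by (rule supp_split_var)
    have "P (sgl t' c)" using Suc t' by auto
    moreover have "sgl t c = Var v * sgl t' c" by (simp add: t' Var_def mult_single)
    moreover have "sgl t' c \<in> PV V" using t' Suc by (auto simp: PV_def)
    ultimately show ?case using v Suc.prems assms(4)[of v "sgl t' c"] by auto
  qed
  show "P (sgl t c)" if "t \<in> supp p" for t c using that assms(1) * by (auto simp: PV_def)
  show "P 0" using assms(2)[of 0] by simp
qed (fact assms(3))

lemma PV_UNIV [simp]: "p \<in> PV UNIV" by (simp add: PV_def)

text \<open>Universal property of the polynomial ring: both sides are homomorphisms that agree on
  constants and variables. Its main consequence is \<open>hev_subst\<close>.\<close>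

lemma hom_eq_hev:
  assumes "comm_ring_hom H"
  shows "H p = hev (\<lambda>c. H (Const c)) (\<lambda>v. H (Var v)) p"
proof -
  interpret H: comm_ring_hom H by fact
  interpret HC: comm_ring_hom "\<lambda>c. H (Const c)"
    by (rule comm_ring_hom_comp[OF assms comm_ring_hom_Const])
  have "p \<in> PV UNIV" by simp
  then show ?thesis
    by (induction p rule: PV_induct) (auto simp: HC.hev_Const HC.hev_add H.hom_add HC.hev_mult HC.hev_Var H.hom_mult)
qed

lemma hev_cong:
  assumes "\<And>v. v \<in> V \<Longrightarrow> x v = y v" "p \<in> PV V"
  shows "hev \<phi> x p = hev \<phi> y p"
  unfolding hev_def
proof (rule sum.cong[OF refl])
  fix t assume "t \<in> supp p"
  then have "\<And>v. v \<in> supp t \<Longrightarrow> x v = y v" using assms by (auto simp: PV_def)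
  then show "\<phi> (cf p t) * mev x t = \<phi> (cf p t) * mev y t"
    by (simp add: mev_def)
qed

abbreviation subst :: "('v \<Rightarrow> ('w, 'a) mp) \<Rightarrow> ('v, 'a::comm_ring_1) mp \<Rightarrow> ('w, 'a) mp" where
  "subst \<equiv> hev Const"

interpretation subst: comm_ring_hom "subst y"
  by (rule comm_ring_hom.comm_ring_hom_hev[OF comm_ring_hom_Const])

lemma hev_subst:
  assumes "comm_ring_hom \<phi>"
  shows "hev \<phi> x (subst y p) = hev \<phi> (\<lambda>v. hev \<phi> x (y v)) p"
proof -
  interpret f: comm_ring_hom \<phi> by fact
  interpret C: comm_ring_hom Const by (rule comm_ring_hom_Const)
  have "comm_ring_hom (\<lambda>p. hev \<phi> x (subst y p))"
    by (rule comm_ring_hom_comp[OF f.comm_ring_hom_hev C.comm_ring_hom_hev])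
  from hom_eq_hev[OF this, of p] show ?thesis
    by (simp only: C.hev_Const C.hev_Var f.hev_Const)
qed

lemmas ev_subst = hev_subst[OF comm_ring_hom_id]
lemma subst_Const [simp]: "subst y (Const c) = Const c"
  and subst_Var [simp]: "subst y (Var v) = y v"
  by (rule comm_ring_hom.hev_Const comm_ring_hom.hev_Var, rule comm_ring_hom_Const)+

lemma ev_Const [simp]: "ev x (Const c) = c"
  and ev_Var [simp]: "ev x (Var v) = x v"
  by (rule comm_ring_hom.hev_Const comm_ring_hom.hev_Var, rule comm_ring_hom_id)+

abbreviation pmap :: "('a::zero \<Rightarrow> 'b::zero) \<Rightarrow> ('v, 'a) mp \<Rightarrow> ('v, 'b) mp" where
  "pmap \<equiv> Poly_Mapping.map"

lemma cf_pmap: "\<phi> 0 = 0 \<Longrightarrow> cf (pmap \<phi> p) t = \<phi> (cf p t)"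
  by (simp add: map.rep_eq when_def)

lemma supp_pmap: "\<phi> 0 = 0 \<Longrightarrow> supp (pmap \<phi> p) \<subseteq> supp p"
  by (auto simp: in_keys_iff cf_pmap)

lemma pmap_PV: "\<phi> 0 = 0 \<Longrightarrow> p \<in> PV V \<Longrightarrow> pmap \<phi> p \<in> PV V"
  unfolding PV_def using supp_pmap[of \<phi> p] by blast

lemma pmap_HP: "\<phi> 0 = 0 \<Longrightarrow> p \<in> HP V e \<Longrightarrow> pmap \<phi> p \<in> HP V e"
  unfolding HP_def using supp_pmap[of \<phi> p] by blast

lemma mev_Var: "mev Var t = (sgl t 1 :: ('v, 'a::comm_ring_1) mp)"
proof (induction "mdeg t" arbitrary: t)
  case 0
  then show ?case by (simp add: mdeg_eq_0_iff)
next
  case (Suc k)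
  then have "t \<noteq> 0" by auto
  then obtain v where v: "v \<in> supp t" by (metis ex_in_conv keys_eq_empty)
  then obtain t' where t': "t = sgl v 1 + t'" by (rule supp_split_var)
  then show ?case using Suc by (simp add: mev_add) (simp add: Var_def mult_single)
qed

lemma pmap_eq_hev:
  fixes p :: "('v, 'a::comm_ring_1) mp" and \<phi> :: "'a \<Rightarrow> 'b::comm_ring_1"
  assumes "comm_ring_hom \<phi>" shows "pmap \<phi> p = hev (\<lambda>c. Const (\<phi> c)) Var p"
proof -
  interpret f: comm_ring_hom \<phi> by fact
  interpret C: comm_ring_hom "\<lambda>c. Const (\<phi> c)"
    by (rule comm_ring_hom_comp[OF comm_ring_hom_Const assms])
  show ?thesis
  proof (rule poly_mapping_eqI)
    fix s
    have "cf (hev (\<lambda>c. Const (\<phi> c)) Var p) s = (\<Sum>t\<in>supp p. if t = s then \<phi> (cf p t) else 0)"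
      unfolding hev_def lookup_sum
      by (intro sum.cong refl) (simp add: mp_Const_mult_cf mev_Var lookup_single when_def)
    also have "\<dots> = \<phi> (cf p s)"
      by (simp add: sum.delta' in_keys_iff)
    finally show "cf (pmap \<phi> p) s = cf (hev (\<lambda>c. Const (\<phi> c)) Var p) s"
      by (simp add: cf_pmap)
  qed
qed

lemma comm_ring_hom_pmap:
  fixes \<phi> :: "'a::comm_ring_1 \<Rightarrow> 'b::comm_ring_1"
  assumes "comm_ring_hom \<phi>" shows "comm_ring_hom (pmap \<phi> :: ('v, 'a) mp \<Rightarrow> ('v, 'b) mp)"
proof -
  interpret C: comm_ring_hom "\<lambda>c. Const (\<phi> c) :: ('v, 'b) mp"
    by (rule comm_ring_hom_comp[OF comm_ring_hom_Const assms])
  have "pmap \<phi> = (hev (\<lambda>c. Const (\<phi> c)) Var :: ('v, 'a) mp \<Rightarrow> ('v, 'b) mp)"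
    by (rule ext) (rule pmap_eq_hev[OF assms])
  then show ?thesis using C.comm_ring_hom_hev by metis
qed

lemma pmap_Const: "\<phi> 0 = 0 \<Longrightarrow> pmap \<phi> (Const c) = Const (\<phi> c)"
  and pmap_Var: "\<phi> 0 = 0 \<Longrightarrow> \<phi> 1 = 1 \<Longrightarrow> pmap \<phi> (Var v) = Var v"
  by (simp_all add: Const_def Var_def)

lemma hev_pmap:
  assumes "\<psi> 0 = 0" "\<phi> 0 = 0" shows "hev \<psi> x (pmap \<phi> p) = hev (\<lambda>c. \<psi> (\<phi> c)) x p"
proof -
  have "hev \<psi> x (pmap \<phi> p) = (\<Sum>t\<in>supp p. \<psi> (cf (pmap \<phi> p) t) * mev x t)"
    by (rule hev_superset) (use supp_pmap assms in auto)
  then show ?thesis by (simp add: hev_def cf_pmap assms)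
qed

lemma ev_pmap: "\<phi> 0 = 0 \<Longrightarrow> ev x (pmap \<phi> p) = hev \<phi> x p"
  by (simp add: hev_pmap)

lemma supp_mult: "supp (p * q) \<subseteq> {s + t | s t. s \<in> supp p \<and> t \<in> supp (q :: ('v, 'a::comm_ring_1) mp)}"
  using keys_mult[of p q] by auto

lemma HP_0 [simp]: "0 \<in> HP V e" by (simp add: HP_def)
lemma HP_add: "p \<in> HP V e \<Longrightarrow> q \<in> HP V e \<Longrightarrow> p + q \<in> HP V e"
  unfolding HP_def using keys_add[of p q] by blast
lemma HP_uminus: "p \<in> HP V e \<Longrightarrow> - p \<in> HP V e"
  by (auto simp: HP_def in_keys_iff)
lemma HP_diff: "p \<in> HP V e \<Longrightarrow> q \<in> HP V e \<Longrightarrow> p - q \<in> HP V (e :: nat)" for p :: "('v, 'a::comm_ring_1) mp"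
  using HP_add[of p V e "- q"] HP_uminus[of q V e] by simp
lemma HP_sum: "(\<And>i. i \<in> I \<Longrightarrow> f i \<in> HP V e) \<Longrightarrow> (\<Sum>i\<in>I. f i) \<in> HP V e"
  by (induction I rule: infinite_finite_induct) (auto intro: HP_add)
lemma HP_mult: "p \<in> HP V d \<Longrightarrow> q \<in> HP V e \<Longrightarrow> p * q \<in> HP V (d + e)" for p :: "('v, 'a::comm_ring_1) mp"
  unfolding HP_def using supp_mult[of p q] by (fastforce simp: supp_add_nat)
lemma HP_Const: "Const c \<in> HP V 0"
  by (auto simp: HP_def Const_def)
lemma HP_Const_mult: "p \<in> HP V e \<Longrightarrow> Const c * p \<in> HP V e" for p :: "('v, 'a::comm_ring_1) mp"
  using HP_mult[OF HP_Const] by fastforce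
lemma HP_1: "(1 :: ('v, 'a::comm_ring_1) mp) \<in> HP V 0"
  using HP_Const[of "1 :: 'a"] by simp
lemma HP_Var: "v \<in> V \<Longrightarrow> Var v \<in> HP V 1"
  by (auto simp: HP_def Var_def)
lemma HP_prod: "finite I \<Longrightarrow> (\<And>i. i \<in> I \<Longrightarrow> f i \<in> HP V (d i)) \<Longrightarrow> (\<Prod>i\<in>I. f i) \<in> HP V (\<Sum>i\<in>I. d i)"
  for f :: "'i \<Rightarrow> ('v, 'a::comm_ring_1) mp"
  by (induction I rule: finite_induct) (auto intro: HP_mult HP_1)
lemma HP_power: "p \<in> HP V d \<Longrightarrow> p ^ k \<in> HP V (k * d)" for p :: "('v, 'a::comm_ring_1) mp"
  by (induction k) (auto intro: HP_mult HP_1)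
lemma HP_0_eq: "p \<in> HP V 0 \<Longrightarrow> p = Const (cf p 0)"
  by (rule poly_mapping_eqI) (auto simp: HP_def mdeg_eq_0_iff Const_def lookup_single when_def in_keys_iff)
lemma HP_sgl: "supp t \<subseteq> V \<Longrightarrow> sgl t c \<in> HP V (mdeg t)"
  by (auto simp: HP_def)

lemma PV_0 [simp]: "0 \<in> PV V" by (simp add: PV_def)
lemma PV_add: "p \<in> PV V \<Longrightarrow> q \<in> PV V \<Longrightarrow> p + q \<in> PV V"
  unfolding PV_def using keys_add[of p q] by blast
lemma PV_uminus: "p \<in> PV V \<Longrightarrow> - p \<in> PV V"
  by (auto simp: PV_def in_keys_iff)
lemma PV_diff: "p \<in> PV V \<Longrightarrow> q \<in> PV V \<Longrightarrow> p - q \<in> PV V" for p :: "('v, 'a::comm_ring_1) mp"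
  using PV_add[of p V "- q"] PV_uminus[of q V] by simp
lemma PV_sum: "(\<And>i. i \<in> I \<Longrightarrow> f i \<in> PV V) \<Longrightarrow> (\<Sum>i\<in>I. f i) \<in> PV V"
  by (induction I rule: infinite_finite_induct) (auto intro: PV_add)
lemma PV_mult: "p \<in> PV V \<Longrightarrow> q \<in> PV V \<Longrightarrow> p * q \<in> PV V" for p :: "('v, 'a::comm_ring_1) mp"
  unfolding PV_def using supp_mult[of p q] by (fastforce simp: supp_add_nat)
lemma PV_Const: "Const c \<in> PV V" by (rule HP_PV[OF HP_Const])
lemma PV_1: "(1 :: ('v, 'a::comm_ring_1) mp) \<in> PV V" by (rule HP_PV[OF HP_1])
lemma PV_Var: "v \<in> V \<Longrightarrow> Var v \<in> PV V" by (rule HP_PV[OF HP_Var])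
lemma PV_prod: "(\<And>i. i \<in> I \<Longrightarrow> f i \<in> PV V) \<Longrightarrow> (\<Prod>i\<in>I. f i) \<in> PV V"
  for f :: "'i \<Rightarrow> ('v, 'a::comm_ring_1) mp"
  by (induction I rule: infinite_finite_induct) (auto intro: PV_mult PV_1)
lemma PV_power: "p \<in> PV V \<Longrightarrow> p ^ k \<in> PV V" for p :: "('v, 'a::comm_ring_1) mp"
  by (induction k) (auto intro: PV_mult PV_1)
lemma HP_mono: "V \<subseteq> W \<Longrightarrow> p \<in> HP V e \<Longrightarrow> p \<in> HP W e" by (auto simp: HP_def)

lemma mev_HP:
  assumes "supp t \<subseteq> V" "\<And>v. v \<in> V \<Longrightarrow> y v \<in> HP W 1"
  shows "mev y t \<in> HP W (mdeg t)"
  unfolding mev_def mdeg_def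
  by (rule HP_prod) (use HP_power[OF assms(2)] assms(1) in auto)

lemma subst_HP:
  assumes "p \<in> HP V e" "\<And>v. v \<in> V \<Longrightarrow> y v \<in> HP W 1"
  shows "subst y p \<in> HP W e"
  unfolding hev_def
proof (intro HP_sum HP_Const_mult)
  fix t assume "t \<in> supp p"
  then have "supp t \<subseteq> V" "mdeg t = e" using assms(1) by (auto simp: HP_def)
  then show "mev y t \<in> HP W e" using mev_HP[of t V y W] assms(2) by blast
qed

section \<open>Homogeneous components\<close>

definition hcomp :: "nat \<Rightarrow> ('v, 'a::comm_monoid_add) mp \<Rightarrow> ('v, 'a) mp" where
  "hcomp e p = (\<Sum>t\<in>{t\<in>supp p. mdeg t = e}. sgl t (cf p t))"

lemma cf_hcomp: "cf (hcomp e p) t = (if mdeg t = e then cf p t else 0)"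
  by (auto simp: hcomp_def lookup_sum lookup_single when_def in_keys_iff sum.delta')

lemma hcomp_HP: "p \<in> PV V \<Longrightarrow> hcomp e p \<in> HP V e"
  by (auto simp: HP_def PV_def in_keys_iff cf_hcomp split: if_splits)

lemma sum_hcomp: "p = (\<Sum>e\<in>mdeg ` supp p. hcomp e p)"
  by (rule poly_mapping_eqI) (auto simp: lookup_sum cf_hcomp in_keys_iff sum.delta)

lemma hcomp_sum: "hcomp e (\<Sum>i\<in>I. f i) = (\<Sum>i\<in>I. hcomp e (f i))"
  by (rule poly_mapping_eqI) (simp add: cf_hcomp lookup_sum)

lemma hcomp_same: "p \<in> HP V e \<Longrightarrow> hcomp e p = p"
  by (rule poly_mapping_eqI) (auto simp: cf_hcomp HP_def in_keys_iff)

lemma hcomp_other: "p \<in> HP V d \<Longrightarrow> d \<noteq> e \<Longrightarrow> hcomp e p = 0"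
  by (rule poly_mapping_eqI) (auto simp: cf_hcomp HP_def in_keys_iff)

lemma hcomp_mult_HP:
  fixes a :: "('v, 'a::comm_ring_1) mp"
  assumes "a \<in> HP V d" "d \<le> e" "h \<in> PV V"
  shows "hcomp e (a * h) = a * hcomp (e - d) h"
proof -
  have "hcomp e (a * h) = hcomp e (a * (\<Sum>i\<in>mdeg ` supp h. hcomp i h))"
    by (simp flip: sum_hcomp)
  also have "\<dots> = (\<Sum>i\<in>mdeg ` supp h. hcomp e (a * hcomp i h))"
    by (simp add: sum_distrib_left hcomp_sum)
  also have "\<dots> = (\<Sum>i\<in>mdeg ` supp h. if i = e - d then a * hcomp i h else 0)"
  proof (rule sum.cong[OF refl])
    fix i
    have "a * hcomp i h \<in> HP V (d + i)" by (intro HP_mult hcomp_HP assms)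
    then show "hcomp e (a * hcomp i h) = (if i = e - d then a * hcomp i h else 0)"
      using assms(2) by (auto dest: hcomp_same hcomp_other[of _ _ _ e])
  qed
  also have "\<dots> = a * hcomp (e - d) h"
  proof -
    have "hcomp (e - d) h = 0" if "e - d \<notin> mdeg ` supp h"
    proof (rule poly_mapping_eqI)
      fix k
      have "mdeg k = e - d \<Longrightarrow> k \<notin> supp h" using that by (metis image_eqI)
      then show "cf (hcomp (e - d) h) k = cf 0 k" by (auto simp: cf_hcomp in_keys_iff)
    qed
    then show ?thesis by (auto simp: sum.delta)
  qed
  finally show ?thesis .
qed

text \<open>Induction on the variables: specializing the old ones keeps a nonzero coefficient, and
  the remaining polynomial in the new variable has finitely many roots. The set \<open>S\<close> of
  admissible values serves to find rational points at which a complex polynomial does not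
  vanish.\<close>

lemma mp_nonzero_point_in:
  assumes S: "infinite S" and "finite V" "p \<in> PV V" "p \<noteq> (0 :: ('v, 'a::field) mp)"
  shows "\<exists>x. (\<forall>v. x v \<in> S) \<and> ev x p \<noteq> 0"
  using assms(2-4)
proof (induction V arbitrary: p rule: finite_induct)
  case empty
  then have "\<forall>t\<in>supp p. t = 0" by (auto simp: PV_def)
  then have "p = Const (cf p 0)"
    by (intro poly_mapping_eqI) (auto simp: Const_def lookup_single when_def in_keys_iff)
  then have "ev x p \<noteq> 0" for x using empty by (metis ev_Const Const_0)
  moreover obtain s where "s \<in> S" using S by fastforce
  ultimately show ?case by (intro exI[of _ "\<lambda>_. s"]) simp
next
  case (insert v V)
  define rm where "rm t = t - sgl v (cf t v)" for t :: "'v mono"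
  have t_rm: "t = sgl v (cf t v) + rm t" for t
    by (rule poly_mapping_eqI) (auto simp: rm_def lookup_add lookup_minus lookup_single when_def)
  have rm_v: "cf (rm t) v = 0" for t by (simp add: rm_def lookup_minus)
  have rm_supp: "supp (rm t) \<subseteq> supp t" for t by (auto simp: rm_def in_keys_iff lookup_minus)
  define q where "q k = (\<Sum>t\<in>{t\<in>supp p. cf t v = k}. sgl (rm t) (cf p t))" for k
  have "supp (rm t) \<subseteq> V" if "t \<in> supp p" for t
  proof -
    have "supp (rm t) \<subseteq> insert v V" using rm_supp[of t] insert.prems(1) that unfolding PV_def by blast
    moreover have "v \<notin> supp (rm t)" using rm_v[of t] by (simp add: in_keys_iff)
    ultimately show ?thesis by blast
  qed
  then have qV: "q k \<in> PV V" for k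
    unfolding q_def by (intro PV_sum HP_PV[OF HP_sgl]) auto
  obtain t0 where t0: "t0 \<in> supp p" using insert.prems by (metis ex_in_conv keys_eq_empty)
  define k0 where "k0 = cf t0 v"
  \<comment> \<open>\<open>q k0\<close> is the coefficient of the \<open>k0\<close>-th power of
    \<open>v\<close>. A monomial is determined by its exponent at \<open>v\<close> together with
    \<open>rm\<close>, so nothing cancels the contribution of \<open>t0\<close>.\<close>
  have "cf (q k0) (rm t0) = (\<Sum>t\<in>{t\<in>supp p. cf t v = k0}. if t = t0 then cf p t else 0)"
    unfolding q_def lookup_sum
  proof (rule sum.cong[OF refl])
    fix t assume "t \<in> {t \<in> supp p. cf t v = k0}"
    then have "rm t = rm t0 \<longleftrightarrow> t = t0" using t_rm[of t] t_rm[of t0] by (metis (mono_tags) k0_def mem_Collect_eq)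
    then show "cf (sgl (rm t) (cf p t)) (rm t0) = (if t = t0 then cf p t else 0)"
      by (simp add: lookup_single when_def)
  qed
  also have "\<dots> = cf p t0" using t0 by (simp add: sum.delta' k0_def)
  finally have "q k0 \<noteq> 0" using t0 by (auto simp: in_keys_iff)
  from insert.IH[OF qV this] obtain x where x: "\<forall>v. x v \<in> S" "ev x (q k0) \<noteq> 0" by blast
  define P where "P = (\<Sum>t\<in>supp p. monom (cf p t * mev x (rm t)) (cf t v))"
  have "coeff P k0 = (\<Sum>t\<in>supp p. if cf t v = k0 then cf p t * mev x (rm t) else 0)"
    unfolding P_def coeff_sum by (intro sum.cong) auto
  also have "\<dots> = ev x (q k0)"
    unfolding q_def ev.hom_sum
    by (simp add: sum.inter_filter hev_sgl)
  finally have "P \<noteq> 0" using x(2) by auto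
  then have "finite {y. poly P y = 0}" by (rule poly_roots_finite)
  then obtain y where y: "y \<in> S" "poly P y \<noteq> 0"
    using S by (metis (mono_tags, lifting) finite_subset mem_Collect_eq subsetI)
  have "mev (x(v := y)) t = y ^ cf t v * mev x (rm t)" for t
  proof -
    have "mev (x(v := y)) t = y ^ cf t v * mev (x(v := y)) (rm t)"
      using arg_cong[OF t_rm[of t], of "mev (x(v := y))"] by (simp add: mev_add)
    moreover have "mev (x(v := y)) (rm t) = mev x (rm t)"
      unfolding mev_def using rm_v[of t] by (intro prod.cong) (auto simp: in_keys_iff)
    ultimately show ?thesis by simp
  qed
  then have "ev (x(v := y)) p = poly P y"
    by (simp add: hev_def P_def poly_sum poly_monom mult_ac)
  then have "ev (x(v := y)) p \<noteq> 0" using y(2) by simp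
  moreover have "\<forall>w. (x(v := y)) w \<in> S" using x(1) y(1) by simp
  ultimately show ?case by blast
qed

lemma mp_nonzero_point:
  "finite V \<Longrightarrow> p \<in> PV V \<Longrightarrow> p \<noteq> (0 :: ('v, 'a::field_char_0) mp) \<Longrightarrow> \<exists>x. ev x p \<noteq> 0"
  using mp_nonzero_point_in[of UNIV V p] infinite_UNIV_char_0 by blast

lemma finite_vars: "finite (\<Union>t\<in>supp p. supp t)" by simp

lemma mp_eqI:
  assumes "\<And>x. ev x p = ev x q" shows "p = (q :: ('v, 'a::field_char_0) mp)"
proof (rule ccontr)
  assume "p \<noteq> q"
  then have "\<exists>x. ev x (p - q) \<noteq> 0"
    by (intro mp_nonzero_point[OF finite_vars]) (auto simp: PV_def)
  then show False using assms by (simp add: ev.hom_minus)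
qed

section \<open>A Nullstellensatz over the complex numbers\<close>

text \<open>Gaussian elimination with the pivot \<open>M j i0\<close>. Later dimension counts are
  made with this lemma, by comparing numbers of unknowns and equations.\<close>

lemma underdetermined_system:
  fixes M :: "'j \<Rightarrow> 'i \<Rightarrow> 'a::field"
  assumes "finite J" "finite I" "card J < card I"
  shows "\<exists>x. (\<exists>i\<in>I. x i \<noteq> 0) \<and> (\<forall>j\<in>J. (\<Sum>i\<in>I. M j i * x i) = 0)"
  using assms
proof (induction J arbitrary: I M rule: finite_induct)
  case empty
  then obtain i where "i \<in> I" by fastforce
  then show ?case by (intro exI[of _ "\<lambda>_. 1"]) auto
next
  case (insert j J)
  show ?case
  proof (cases "\<forall>i\<in>I. M j i = 0")
    case True
    have "card J < card I" using insert by simp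
    then obtain x where "\<exists>i\<in>I. x i \<noteq> 0" "\<forall>j\<in>J. (\<Sum>i\<in>I. M j i * x i) = 0"
      using insert.IH[of I M] insert.prems by blast
    then show ?thesis using True by (intro exI[of _ x]) auto
  next
    case False
    then obtain i0 where i0: "i0 \<in> I" "M j i0 \<noteq> 0" by blast
    define M' where "M' j' i = M j' i - M j' i0 * M j i / M j i0" for j' i
    have "card J < card (I - {i0})" using insert i0 by auto
    then obtain x where x: "\<exists>i\<in>I - {i0}. x i \<noteq> 0" "\<And>j'. j' \<in> J \<Longrightarrow> (\<Sum>i\<in>I - {i0}. M' j' i * x i) = 0"
      using insert.IH[of "I - {i0}" M'] insert.prems by blast
    define c where "c = - (\<Sum>i\<in>I - {i0}. M j i * x i) / M j i0"
    define y where "y = x(i0 := c)"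
    have S: "(\<Sum>i\<in>I. M j' i * y i) = M j' i0 * c + (\<Sum>i\<in>I - {i0}. M j' i * x i)" for j'
      by (subst sum.remove[OF insert.prems(1) i0(1)]) (auto simp: y_def intro!: sum.cong)
    have "(\<Sum>i\<in>I. M j' i * y i) = 0" if "j' \<in> insert j J" for j'
    proof (cases "j' = j")
      case True
      then show ?thesis using i0 by (simp add: S c_def)
    next
      case False
      then have "(\<Sum>i\<in>I - {i0}. M' j' i * x i) = 0" using x(2) that by blast
      moreover have "(\<Sum>i\<in>I - {i0}. M' j' i * x i)
          = (\<Sum>i\<in>I - {i0}. M j' i * x i) - (\<Sum>i\<in>I - {i0}. M j' i0 / M j i0 * (M j i * x i))"
        unfolding sum_subtractf[symmetric] by (intro sum.cong refl) (simp add: M'_def left_diff_distrib)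
      ultimately have "(\<Sum>i\<in>I - {i0}. M j' i * x i) = (\<Sum>i\<in>I - {i0}. M j' i0 / M j i0 * (M j i * x i))"
        by simp
      also have "\<dots> = - M j' i0 * c"
        unfolding sum_distrib_left[symmetric] by (simp add: c_def)
      finally show ?thesis by (simp add: S)
    qed
    moreover have "\<exists>i\<in>I. y i \<noteq> 0" using x(1) by (auto simp: y_def)
    ultimately show ?thesis by blast
  qed
qed

definition ideal_in :: "'v set \<Rightarrow> ('v, 'a::comm_ring_1) mp set \<Rightarrow> bool" where
  "ideal_in V I \<longleftrightarrow> I \<subseteq> PV V \<and> 0 \<in> I \<and> (\<forall>p\<in>I. \<forall>q\<in>I. p + q \<in> I) \<and> (\<forall>p\<in>I. \<forall>h\<in>PV V. h * p \<in> I)"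

lemma ideal_inD:
  assumes "ideal_in V I"
  shows "0 \<in> I" "p \<in> I \<Longrightarrow> q \<in> I \<Longrightarrow> p + q \<in> I" "p \<in> I \<Longrightarrow> h \<in> PV V \<Longrightarrow> h * p \<in> I"
    "p \<in> I \<Longrightarrow> p \<in> PV V"
  using assms by (auto simp: ideal_in_def)

lemma ideal_in_sum: "ideal_in V I \<Longrightarrow> (\<And>i. i \<in> A \<Longrightarrow> f i \<in> I) \<Longrightarrow> (\<Sum>i\<in>A. f i) \<in> I"
  by (induction A rule: infinite_finite_induct) (auto simp: ideal_inD)

lemma ideal_in_diff: "ideal_in V I \<Longrightarrow> p \<in> I \<Longrightarrow> q \<in> I \<Longrightarrow> p - q \<in> I"
  using ideal_inD(2)[of V I p "- q"] ideal_inD(3)[of V I q "- 1"] by (simp add: PV_uminus PV_1)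

lemma finite_monos: "finite V \<Longrightarrow> finite {t :: 'v mono. supp t \<subseteq> V \<and> mdeg t \<le> L}"
proof -
  assume V: "finite V"
  let ?T = "{t :: 'v mono. supp t \<subseteq> V \<and> mdeg t \<le> L}"
  have "cf t v \<le> L" if "t \<in> ?T" "v \<in> V" for t v
    using that member_le_sum[of v V "cf t"] V by (auto simp: mdeg_superset[of V])
  then have "(\<lambda>t. restrict (cf t) V) ` ?T \<subseteq> V \<rightarrow>\<^sub>E {..L}" by auto
  moreover have "finite (V \<rightarrow>\<^sub>E {..L})" using V by (intro finite_PiE) auto
  ultimately have fin: "finite ((\<lambda>t. restrict (cf t) V) ` ?T)" by (rule finite_subset)
  have inj: "inj_on (\<lambda>t. restrict (cf t) V) ?T"
  proof (rule inj_onI, rule poly_mapping_eqI)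
    fix s t k assume *: "s \<in> ?T" "t \<in> ?T" "restrict (cf s) V = restrict (cf t) V"
    show "cf s k = cf t k"
    proof (cases "k \<in> V")
      case True
      then show ?thesis using fun_cong[OF *(3), of k] by simp
    next
      case False
      then have "k \<notin> supp s" "k \<notin> supp t" using * by auto
      then show ?thesis by (simp add: in_keys_iff)
    qed
  qed
  show ?thesis by (rule finite_imageD[OF fin inj])
qed

text \<open>The complex numbers are uncountable and there are countably many pairs. In the
  application a pair consists of an exponent of \<open>h\<close> and a degree bound.\<close>

lemma infinite_fibre:
  fixes f :: "complex \<Rightarrow> nat \<times> nat"
  shows "\<exists>y. infinite (f -` {y})"
proof (rule ccontr)
  assume "\<not> ?thesis"
  then have "countable (\<Union>y. f -` {y})" by (intro countable_UN) (auto intro: countable_finite)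
  moreover have "(\<Union>y. f -` {y}) = UNIV" by auto
  ultimately show False using uncountable_UNIV_complex by simp
qed

text \<open>The polynomials \<open>q a\<close> below live in a space of countable dimension while \<open>a\<close> ranges over
  an uncountable set; a linear relation between them puts a nonzero polynomial in one variable,
  times a power of \<open>h\<close>, into the ideal.\<close>

lemma ideal_add_linear:
  fixes I :: "('v, complex) mp set"
  assumes V: "finite V" and I: "ideal_in V I" and v: "v \<in> V" and h: "h \<in> PV V"
    and notin: "\<And>s. h ^ s \<notin> I"
  shows "\<exists>a. \<forall>s. h ^ s \<notin> {i + q * (Var v - Const a) | i q. i \<in> I \<and> q \<in> PV V}"
proof (rule ccontr)
  assume "\<not> ?thesis"
  then have "\<forall>a. \<exists>s i q. h ^ s = i + q * (Var v - Const a) \<and> i \<in> I \<and> q \<in> PV V" by blast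
  then obtain S i0 Q where S: "\<And>a. h ^ S a = i0 a + Q a * (Var v - Const a)" "\<And>a. i0 a \<in> I" "\<And>a. Q a \<in> PV V"
    by metis
  then have diffI: "h ^ S a - Q a * (Var v - Const a) \<in> I" for a by simp
  \<comment> \<open>\<open>U R\<close> is the one-variable polynomial \<open>R\<close> read as a
    polynomial in the variable \<open>v\<close>.\<close>
  define U where "U R = poly (map_poly Const R) (Var v :: ('v, complex) mp)" for R :: "complex poly"
  interpret C: comm_ring_hom "Const :: complex \<Rightarrow> ('v, complex) mp" by (rule comm_ring_hom_Const)
  interpret MC: map_poly_comm_ring_hom "Const :: complex \<Rightarrow> ('v, complex) mp" ..
  have U_mult: "U (p * q) = U p * U q" for p q by (simp add: U_def MC.hom_mult)
  have U_sum: "U (\<Sum>i\<in>A. f i) = (\<Sum>i\<in>A. U (f i))" for A :: "complex set" and f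
    by (simp add: U_def MC.hom_sum poly_sum)
  have U_prod: "U (\<Prod>i\<in>A. f i) = (\<Prod>i\<in>A. U (f i))" for A :: "complex set" and f
    by (simp add: U_def MC.hom_prod poly_prod)
  have U_lin: "U [:- b, 1:] = Var v - Const b" for b
    by (simp add: U_def C.hom_uminus)
  have U_const: "U [:c:] = Const c" for c by (cases "c = 0") (simp_all add: U_def map_poly_pCons)
  have U_PV: "U R \<in> PV V" for R
    by (induction R rule: pCons_induct) (auto simp: U_def v map_poly_pCons intro!: PV_add PV_mult PV_Const PV_Var)
  have lin_PV: "Var v - Const a \<in> PV V" for a :: complex by (intro PV_diff PV_Var PV_Const v)
  \<comment> \<open>Linear factors of \<open>R\<close> are removed one by one: modulo the ideal,
    \<open>Q \<rho> * (Var v - Const \<rho>)\<close> equals \<open>h ^ S \<rho>\<close>, so a root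
    \<open>\<rho>\<close> is traded for more factors \<open>h\<close>. In the end a constant times a
    power of \<open>h\<close> lies in the ideal.\<close>
  have no_U: False if "R \<noteq> 0" "U R * h ^ s \<in> I" for R s
    using that
  proof (induction "degree R" arbitrary: R s)
    case 0
    from 0(1) obtain c where c: "R = [:c:]" by (metis degree_eq_zeroE)
    with 0(2) have "c \<noteq> 0" by auto
    have "Const (1 / c) * (U R * h ^ s) \<in> I" by (rule ideal_inD(3)[OF I 0(3) PV_Const])
    then show False using notin[of s] c \<open>c \<noteq> 0\<close>
      by (simp add: U_const mult.assoc[symmetric] Const_mult[symmetric])
  next
    case (Suc k)
    then have "\<not> constant (poly R)" by (simp add: constant_degree)
    then obtain \<rho> where "poly R \<rho> = 0" using fundamental_theorem_of_algebra by blast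
    then obtain R' where R': "R = [:- \<rho>, 1:] * R'" by (metis poly_eq_0_iff_dvd dvdE)
    have R'0: "R' \<noteq> 0" using R' Suc.prems by auto
    have deg: "degree R' = k" using Suc(2) R'0 unfolding R' by (subst (asm) degree_mult_eq) auto
    have "Q \<rho> * (U R * h ^ s) + (U R' * h ^ s) * (h ^ S \<rho> - Q \<rho> * (Var v - Const \<rho>)) \<in> I"
      by (intro ideal_inD(2)[OF I] ideal_inD(3)[OF I] Suc.prems diffI PV_mult PV_power h U_PV S)
    also have "Q \<rho> * (U R * h ^ s) + (U R' * h ^ s) * (h ^ S \<rho> - Q \<rho> * (Var v - Const \<rho>)) = U R' * h ^ (s + S \<rho>)"
      unfolding R' U_mult U_lin by (simp add: algebra_simps power_add)
    finally show False using Suc(1)[of R' "s + S \<rho>"] deg R'0 by simp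
  qed
  \<comment> \<open>A degree bound for \<open>Q a\<close>. On an infinite set of \<open>a\<close>
    both the exponent \<open>S a\<close> and this bound are constant, so the \<open>Q a\<close>
    there lie in one finite-dimensional space and are linearly dependent.\<close>
  define L where "L a = Max (insert 0 (mdeg ` supp (Q a)))" for a
  obtain s l where inf: "infinite ((\<lambda>a. (S a, L a)) -` {(s, l)})"
    using infinite_fibre[of "\<lambda>a. (S a, L a)"] by (metis surj_pair)
  define T where "T = {t :: 'v mono. supp t \<subseteq> V \<and> mdeg t \<le> l}"
  have finT: "finite T" unfolding T_def by (rule finite_monos[OF V])
  obtain A where A: "A \<subseteq> (\<lambda>a. (S a, L a)) -` {(s, l)}" "card A = Suc (card T)" "finite A"
    using infinite_arbitrarily_large[OF inf] by metis
  obtain c where c: "\<exists>a\<in>A. c a \<noteq> 0" "\<And>t. t \<in> T \<Longrightarrow> (\<Sum>a\<in>A. cf (Q a) t * c a) = 0"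
    using underdetermined_system[OF finT A(3), of "\<lambda>t a. cf (Q a) t"] A(2) by auto
  have suppT: "supp (Q a) \<subseteq> T" if "a \<in> A" for a
  proof
    fix t assume t: "t \<in> supp (Q a)"
    then have "mdeg t \<le> L a" by (auto simp: L_def intro!: Max_ge)
    then show "t \<in> T" using t S(3)[of a] A(1) that by (auto simp: T_def PV_def)
  qed
  have cQ: "(\<Sum>a\<in>A. Const (c a) * Q a) = 0"
  proof (rule poly_mapping_eqI)
    fix t
    show "cf (\<Sum>a\<in>A. Const (c a) * Q a) t = cf 0 t"
    proof (cases "t \<in> T")
      case True
      then show ?thesis using c(2)[of t] by (simp add: lookup_sum mp_Const_mult_cf mult.commute[of "c _"])
    next
      case False
      then have "cf (Q a) t = 0" if "a \<in> A" for a using suppT[OF that] by (auto simp: in_keys_iff)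
      then show ?thesis by (simp add: lookup_sum mp_Const_mult_cf)
    qed
  qed
  \<comment> \<open>The numerator of the sum of the fractions \<open>c a / (v - a)\<close>. It is
    nonzero because its value at \<open>a0\<close> is \<open>c a0\<close> times a product of nonzero
    differences.\<close>
  define R where "R = (\<Sum>a\<in>A. [:c a:] * (\<Prod>b\<in>A - {a}. [:- b, 1:]))"
  have UR: "U R = (\<Sum>a\<in>A. Const (c a) * (\<Prod>b\<in>A - {a}. (Var v - Const b)))"
    unfolding R_def U_sum U_mult U_prod U_lin U_const ..
  obtain a0 where a0: "a0 \<in> A" "c a0 \<noteq> 0" using c(1) by blast
  have "poly R a0 = (\<Sum>a\<in>A. c a * (\<Prod>b\<in>A - {a}. a0 - b))"
    by (simp add: R_def poly_sum poly_prod)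
  also have "\<dots> = (\<Sum>a\<in>A. if a = a0 then c a * (\<Prod>b\<in>A - {a}. a0 - b) else 0)"
    using a0 A(3) by (intro sum.cong) (auto intro!: prod_zero)
  also have "\<dots> = c a0 * (\<Prod>b\<in>A - {a0}. a0 - b)" using a0 A(3) by (simp add: sum.delta')
  also have "\<dots> \<noteq> 0" using a0 A(3) by auto
  finally have R0: "R \<noteq> 0" by auto
  \<comment> \<open>Combining the relations with these cofactors gives each \<open>Q a\<close> the
    same factor, the product over all of \<open>A\<close>, and the sum of the
    \<open>c a * Q a\<close> is zero.\<close>
  have "(\<Sum>a\<in>A. Const (c a) * (\<Prod>b\<in>A - {a}. (Var v - Const b)) * (h ^ s - Q a * (Var v - Const a))) \<in> I"
  proof (rule ideal_in_sum[OF I])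
    fix a assume "a \<in> A"
    then have "S a = s" using A(1) by auto
    then have "h ^ s - Q a * (Var v - Const a) \<in> I" using diffI[of a] by simp
    then show "Const (c a) * (\<Prod>b\<in>A - {a}. (Var v - Const b)) * (h ^ s - Q a * (Var v - Const a)) \<in> I"
      by (intro ideal_inD(3)[OF I] PV_mult PV_Const PV_prod lin_PV)
  qed
  also have "(\<Sum>a\<in>A. Const (c a) * (\<Prod>b\<in>A - {a}. (Var v - Const b)) * (h ^ s - Q a * (Var v - Const a)))
      = U R * h ^ s - (\<Sum>a\<in>A. Const (c a) * Q a * ((Var v - Const a) * (\<Prod>b\<in>A - {a}. (Var v - Const b))))"
  proof -
    have *: "d * P * (H - q * l) = d * P * H - d * q * (l * P)" for d P H q l :: "('v, complex) mp"
      by (simp add: algebra_simps)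
    show ?thesis unfolding UR sum_distrib_right sum_subtractf[symmetric] by (intro sum.cong refl *)
  qed
  also have "(\<Sum>a\<in>A. Const (c a) * Q a * ((Var v - Const a) * (\<Prod>b\<in>A - {a}. (Var v - Const b))))
      = (\<Sum>a\<in>A. Const (c a) * Q a) * (\<Prod>b\<in>A. (Var v - Const b))"
    unfolding sum_distrib_right
    by (intro sum.cong refl) (simp add: prod.remove[OF A(3)])
  finally have "U R * h ^ s \<in> I" by (simp add: cQ)
  then show False using no_U[OF R0] by blast
qed

lemma ideal_in_add_principal:
  assumes "ideal_in V I" "f \<in> PV V"
  shows "ideal_in V {i + q * f | i q. i \<in> I \<and> q \<in> PV V}" (is "ideal_in V ?J")
proof -
  have J: "p \<in> ?J" if "p = i + q * f" "i \<in> I" "q \<in> PV V" for p i q using that by blast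
  have 1: "?J \<subseteq> PV V" using assms(2) ideal_inD(4)[OF assms(1)] by (auto intro!: PV_add PV_mult)
  have 2: "0 \<in> ?J" by (rule J[of _ 0 0]) (use ideal_inD(1)[OF assms(1)] in auto)
  have 3: "p + p' \<in> ?J" if pp': "p \<in> ?J" "p' \<in> ?J" for p p'
  proof -
    from pp' obtain i q i' q' where "p = i + q * f" "i \<in> I" "q \<in> PV V" "p' = i' + q' * f" "i' \<in> I" "q' \<in> PV V"
      by blast
    then show ?thesis using ideal_inD(2)[OF assms(1)]
      by (intro J[of _ "i + i'" "q + q'"]) (auto simp: algebra_simps PV_add)
  qed
  have 4: "h * p \<in> ?J" if h: "p \<in> ?J" "h \<in> PV V" for p h
  proof -
    from h obtain i q where "p = i + q * f" "i \<in> I" "q \<in> PV V" by blast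
    then show ?thesis using ideal_inD(3)[OF assms(1)] h(2)
      by (intro J[of _ "h * i" "h * q"]) (simp_all add: distrib_left mult.assoc PV_mult)
  qed
  show ?thesis unfolding ideal_in_def by (intro conjI ballI 1 2 3 4)
qed

text \<open>If no power of \<open>h\<close> lies in \<open>I\<close>, the linear polynomials
  \<open>Var v - Const (x v)\<close> are adjoined for one variable after the other, always keeping
  the powers of \<open>h\<close> out. The point \<open>x\<close> is then a zero of \<open>I\<close>
  but not of \<open>h\<close>.\<close>

theorem nullstellensatz_complex:
  fixes I :: "('v, complex) mp set"
  assumes V: "finite V" and I: "ideal_in V I" and h: "h \<in> PV V"
    and van: "\<And>x. (\<And>f. f \<in> I \<Longrightarrow> ev x f = 0) \<Longrightarrow> ev x h = 0"
  shows "\<exists>s. h ^ s \<in> I"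
proof (rule ccontr)
  assume "\<nexists>s. h ^ s \<in> I"
  then have notin: "h ^ s \<notin> I" for s by blast
  have "\<exists>J x. ideal_in V J \<and> I \<subseteq> J \<and> (\<forall>s. h ^ s \<notin> J) \<and> (\<forall>v\<in>W. Var v - Const (x v) \<in> J)" if "W \<subseteq> V" for W
    using finite_subset[OF that V] that
  proof (induction W rule: finite_induct)
    case empty
    then show ?case using I notin by blast
  next
    case (insert w W)
    then obtain J x where J: "ideal_in V J" "I \<subseteq> J" "\<And>s. h ^ s \<notin> J" "\<forall>v\<in>W. Var v - Const (x v) \<in> J" by blast
    have w: "w \<in> V" using insert by simp
    obtain a where a: "\<forall>s. h ^ s \<notin> {i + q * (Var w - Const a) | i q. i \<in> J \<and> q \<in> PV V}" (is "\<forall>s. _ \<notin> ?J")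
      using ideal_add_linear[OF V J(1) w h J(3)] by blast
    have J': "ideal_in V ?J" by (intro ideal_in_add_principal J PV_diff PV_Var PV_Const w)
    have mem: "i + q * (Var w - Const a) \<in> ?J" if "i \<in> J" "q \<in> PV V" for i q using that by blast
    have sub: "i \<in> ?J" if "i \<in> J" for i using mem[OF that PV_0] by simp
    have "Var w - Const a \<in> ?J" using mem[OF ideal_inD(1)[OF J(1)] PV_1] by simp
    then have "Var v - Const ((x(w := a)) v) \<in> ?J" if "v \<in> insert w W" for v
      using that J(4) sub[of "Var v - Const (x v)"] by (cases "v = w") simp_all
    moreover have "I \<subseteq> ?J" using J(2) sub by (intro subsetI) (rule sub, erule subsetD)
    ultimately show ?case using J' a by (intro exI[of _ ?J] exI[of _ "x(w := a)"] conjI) blast+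
  qed
  from this[OF subset_refl] obtain J x where J: "ideal_in V J" "I \<subseteq> J" "\<And>s. h ^ s \<notin> J"
    and Jx: "\<forall>v\<in>V. Var v - Const (x v) \<in> J"
    by blast
  \<comment> \<open>Modulo \<open>J\<close> a polynomial is its value at \<open>x\<close>. A nonzero
    value of some \<open>f\<close> in \<open>I\<close> would put \<open>1 = h ^ 0\<close> into
    \<open>J\<close>, and the value 0 of \<open>h\<close> would put \<open>h ^ 1\<close> into
    \<open>J\<close>.\<close>
  have red: "p - Const (ev x p) \<in> J" if "p \<in> PV V" for p
    using that
  proof (induction rule: PV_induct)
    case (Const c)
    then show ?case using J(1) by (simp add: ideal_inD)
  next
    case (add p q)
    from ideal_inD(2)[OF J(1) this] show ?case by (simp add: ev.hom_add Const_add algebra_simps)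
  next
    case (Var v p)
    have "Var v * (p - Const (ev x p)) + Const (ev x p) * (Var v - Const (x v)) \<in> J"
      by (intro ideal_inD(2,3)[OF J(1)] Var PV_Var PV_Const bspec[OF Jx])
    then show ?case by (simp add: ev.hom_mult Const_mult algebra_simps)
  qed
  have "1 \<notin> J" using J(3)[of 0] by simp
  have "ev x f = 0" if f: "f \<in> I" for f
  proof (rule ccontr)
    assume *: "ev x f \<noteq> 0"
    have fJ: "f \<in> J" using f J(2) by (rule rev_subsetD)
    have "Const (ev x f) \<in> J"
      using ideal_in_diff[OF J(1) fJ red[OF ideal_inD(4)[OF J(1) fJ]]] by simp
    then have "Const (1 / ev x f) * Const (ev x f) \<in> J" by (intro ideal_inD(3)[OF J(1)] PV_Const)
    then show False using * \<open>1 \<notin> J\<close> by (simp add: Const_mult[symmetric])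
  qed
  then have "ev x h = 0" by (rule van)
  then show False using red[OF h] J(3)[of 1] by simp
qed

section \<open>Blow-ups of a matrix space: the regularity lemma\<close>

text \<open>For unknowns that are coefficient families: the equations are given by a linear map
  \<open>F\<close>, whose matrix consists of the values on unit vectors.\<close>

lemma underdetermined_linear:
  fixes F :: "('i \<Rightarrow> 'a::field) \<Rightarrow> 'j \<Rightarrow> 'a"
  assumes "finite J" "finite I" "card J < card I"
    and add: "\<And>x y j. F (\<lambda>i. x i + y i) j = F x j + F y j"
    and smult: "\<And>c x j. F (\<lambda>i. c * x i) j = c * F x j"
  shows "\<exists>x. (\<exists>i\<in>I. x i \<noteq> 0) \<and> (\<forall>i. i \<notin> I \<longrightarrow> x i = 0) \<and> (\<forall>j\<in>J. F x j = 0)"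
proof -
  define e where "e i = (\<lambda>k. if k = i then 1 else 0 :: 'a)" for i :: 'i
  obtain x where x: "\<exists>i\<in>I. x i \<noteq> 0" "\<forall>j\<in>J. (\<Sum>i\<in>I. F (e i) j * x i) = 0"
    using underdetermined_system[OF assms(1-3), of "\<lambda>j i. F (e i) j"] by blast
  define y where "y = (\<lambda>i. if i \<in> I then x i else 0)"
  have F0: "F (\<lambda>i. 0) j = 0" for j using smult[of 0 "\<lambda>i. 0" j] by simp
  have "F (\<lambda>i. if i \<in> K then x i else 0) j = (\<Sum>i\<in>K. F (e i) j * x i)" if "finite K" for K j
    using that
  proof (induction K rule: finite_induct)
    case empty
    then show ?case by (simp add: F0)
  next
    case (insert k K)
    have "(\<lambda>i. if i \<in> insert k K then x i else 0) = (\<lambda>i. x k * e k i + (if i \<in> K then x i else 0))"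
      using insert(2) by (auto simp: e_def fun_eq_iff)
    then show ?case using insert by (simp add: add smult mult.commute)
  qed
  then have "F y j = (\<Sum>i\<in>I. F (e i) j * x i)" for j using assms(2) by (simp add: y_def)
  then show ?thesis using x by (intro exI[of _ y]) (auto simp: y_def)
qed

lemma det_eq_0_iff_kernel:
  fixes A :: "nat \<Rightarrow> nat \<Rightarrow> 'a::field"
  shows "det (mat N N (\<lambda>(p, q). A p q)) = 0 \<longleftrightarrow>
    (\<exists>v. (\<exists>q<N. v q \<noteq> 0) \<and> (\<forall>p<N. (\<Sum>q<N. A p q * v q) = 0))" (is "?L \<longleftrightarrow> ?R")
proof -
  let ?M = "mat N N (\<lambda>(p, q). A p q)"
  have M: "?M \<in> carrier_mat N N" by simp
  have mult: "(?M *\<^sub>v w) $ p = (\<Sum>q<N. A p q * w $ q)" if "p < N" "w \<in> carrier_vec N" for w p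
    using that by (auto simp: scalar_prod_def lessThan_atLeast0 intro!: sum.cong)
  have "?L \<longleftrightarrow> (\<exists>w. w \<in> carrier_vec N \<and> w \<noteq> 0\<^sub>v N \<and> ?M *\<^sub>v w = 0\<^sub>v N)"
    by (rule det_0_iff_vec_prod_zero[OF M])
  also have "\<dots> \<longleftrightarrow> ?R"
  proof
    assume "\<exists>w. w \<in> carrier_vec N \<and> w \<noteq> 0\<^sub>v N \<and> ?M *\<^sub>v w = 0\<^sub>v N"
    then obtain w where w: "w \<in> carrier_vec N" "w \<noteq> 0\<^sub>v N" "?M *\<^sub>v w = 0\<^sub>v N" by blast
    have "\<exists>q<N. w $ q \<noteq> 0"
    proof (rule ccontr)
      assume "\<not> ?thesis"
      then have "w = 0\<^sub>v N" using w(1) by (intro eq_vecI) auto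
      then show False using w by simp
    qed
    moreover have "(\<Sum>q<N. A p q * w $ q) = 0" if "p < N" for p
      using mult[OF that w(1)] w(3) that by simp
    ultimately show ?R by blast
  next
    assume ?R
    then obtain v where v: "\<exists>q<N. v q \<noteq> 0" "\<forall>p<N. (\<Sum>q<N. A p q * v q) = 0" by blast
    have "vec N v \<noteq> 0\<^sub>v N" using v(1) by (metis index_vec index_zero_vec(1))
    moreover have "?M *\<^sub>v vec N v = 0\<^sub>v N"
    proof (rule eq_vecI)
      fix p assume "p < dim_vec (0\<^sub>v N :: 'a vec)"
      then have p: "p < N" by simp
      have "(?M *\<^sub>v vec N v) $ p = (\<Sum>q<N. A p q * v q)"
        unfolding mult[OF p vec_carrier] by (intro sum.cong) auto
      then show "(?M *\<^sub>v vec N v) $ p = 0\<^sub>v N $ p" using v(2) p by simp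
    qed simp
    ultimately show "\<exists>w. w \<in> carrier_vec N \<and> w \<noteq> 0\<^sub>v N \<and> ?M *\<^sub>v w = 0\<^sub>v N"
      by (intro exI[of _ "vec N v"]) simp
  qed
  finally show ?thesis .
qed

lemma det_eq_0E:
  fixes A :: "nat \<Rightarrow> nat \<Rightarrow> 'a::field"
  assumes "det (mat N N (\<lambda>(p, q). A p q)) = 0"
  obtains v q where "q < N" "v q \<noteq> 0" "\<And>p. p < N \<Longrightarrow> (\<Sum>q<N. A p q * v q) = 0"
  using assms unfolding det_eq_0_iff_kernel by blast

lemma det_mat_transpose: "det (mat N N (\<lambda>(p, q). A q p)) = det (mat N N (\<lambda>(p, q). A p q :: 'a::field))"
proof -
  have "mat N N (\<lambda>(p, q). A q p) = transpose_mat (mat N N (\<lambda>(p, q). A p q))" by (auto intro!: eq_matI)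
  then show ?thesis by (simp add: det_transpose[of _ N])
qed

lemma sum_blocks: "(\<Sum>q<d * n. f q) = (\<Sum>j<d. \<Sum>v<n. f (j * n + v))" for f :: "nat \<Rightarrow> 'a::comm_monoid_add"
proof (induction d)
  case (Suc d)
  have split: "{..<Suc d * n} = {..<d * n} \<union> {d * n..<d * n + n}" by auto
  have "(\<Sum>q<Suc d * n. f q) = (\<Sum>q<d * n. f q) + (\<Sum>q\<in>{d * n..<d * n + n}. f q)"
    unfolding split by (rule sum.union_disjoint) auto
  also have "(\<Sum>q\<in>{d * n..<d * n + n}. f q) = (\<Sum>v<n. f (d * n + v))"
    using sum.shift_bounds_nat_ivl[of f 0 "d * n" n] by (simp add: lessThan_atLeast0 add.commute)
  finally show ?case by (simp add: Suc)
qed simp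

lemma block_index_less:
  fixes n :: nat
  assumes "j < d" "v < n"
  shows "j * n + v < d * n"
proof -
  have "Suc j * n \<le> d * n" using assms(1) by (intro mult_le_mono1) simp
  then show ?thesis using assms(2) by simp
qed

text \<open>The matrix \<open>\<Sum>\<^sub>i T\<^sub>i \<otimes> X\<^sub>i\<close>; the row index \<open>j * n + a\<close> stands for the pair of \<open>j < d\<close> and \<open>a < n\<close>.\<close>

definition blow :: "nat \<Rightarrow> nat \<Rightarrow> (nat \<Rightarrow> nat \<Rightarrow> nat \<Rightarrow> 'a::comm_ring_1) \<Rightarrow> (nat \<Rightarrow> nat \<Rightarrow> nat \<Rightarrow> 'a) \<Rightarrow> nat \<Rightarrow> nat \<Rightarrow> 'a" where
  "blow n m X T p q = (\<Sum>i<m. T i (p div n) (q div n) * X i (p mod n) (q mod n))"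

abbreviation blow_det :: "nat \<Rightarrow> nat \<Rightarrow> nat \<Rightarrow> (nat \<Rightarrow> nat \<Rightarrow> nat \<Rightarrow> 'a::comm_ring_1) \<Rightarrow> (nat \<Rightarrow> nat \<Rightarrow> nat \<Rightarrow> 'a) \<Rightarrow> 'a" where
  "blow_det n m d X T \<equiv> det (mat (d * n) (d * n) (\<lambda>(p, q). blow n m X T p q))"

text \<open>
  Elements of the quantum plane with generators \<open>x\<close>, \<open>y\<close> and \<open>x y = \<zeta> y x\<close> are families of
  coefficients \<open>c a b\<close> of \<open>x\<^sup>a y\<^sup>b\<close>; \<open>qev L M c s\<close> is the image (truncated to \<open>a, b < L\<close>) in the
  matrix algebra under \<open>x \<mapsto> s \<cdot> diag(\<zeta>\<^sup>i)\<close>, \<open>y \<mapsto> s\<^sup>M \<cdot> (cyclic shift)\<close>.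
\<close>

locale quantum_plane =
  fixes d :: nat and \<zeta> :: complex
  assumes d: "0 < d" and root: "\<zeta> ^ d = 1" and prim: "inj_on (\<lambda>i. \<zeta> ^ i) {..<d}"
begin

text \<open>The product written in normal order: moving the \<open>(a - a1)\<close>-th power of
  \<open>x\<close> to the left past the \<open>b1\<close>-th power of \<open>y\<close> costs the
  factor \<open>inverse \<zeta> ^ ((a - a1) * b1)\<close>.\<close>

definition star :: "(nat \<Rightarrow> nat \<Rightarrow> complex) \<Rightarrow> (nat \<Rightarrow> nat \<Rightarrow> complex) \<Rightarrow> nat \<Rightarrow> nat \<Rightarrow> complex" where
  "star c e a b = (\<Sum>a1\<le>a. \<Sum>b1\<le>b. c a1 b1 * e (a - a1) (b - b1) * inverse \<zeta> ^ ((a - a1) * b1))"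

definition mon :: "nat \<Rightarrow> nat \<Rightarrow> nat \<Rightarrow> nat \<Rightarrow> complex" where
  "mon a b i j = (if i = (j + b) mod d then \<zeta> ^ (a * i) else 0)"

definition qev :: "nat \<Rightarrow> nat \<Rightarrow> (nat \<Rightarrow> nat \<Rightarrow> complex) \<Rightarrow> complex \<Rightarrow> nat \<Rightarrow> nat \<Rightarrow> complex" where
  "qev L M c s i j = (\<Sum>a<L. \<Sum>b<L. c a b * s ^ (a + M * b) * mon a b i j)"

definition bounded :: "nat \<Rightarrow> (nat \<Rightarrow> nat \<Rightarrow> complex) \<Rightarrow> bool" where
  "bounded L c \<longleftrightarrow> (\<forall>a b. L \<le> a \<or> L \<le> b \<longrightarrow> c a b = 0)"

text \<open>The polynomial \<open>z\<close> in the \<open>d\<close>-th powers of \<open>x\<close>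
  and \<open>y\<close>, which are central because \<open>\<zeta> ^ d = 1\<close>.\<close>

definition central :: "(nat \<Rightarrow> nat \<Rightarrow> complex) \<Rightarrow> nat \<Rightarrow> nat \<Rightarrow> complex" where
  "central z a b = (if d dvd a \<and> d dvd b then z (a div d) (b div d) else 0)"

lemma zeta_nz: "\<zeta> \<noteq> 0" using root d by (auto simp: zero_power)

lemma zeta_mod: "\<zeta> ^ (a * (k mod d)) = \<zeta> ^ (a * k)"
proof -
  have "a * k = d * (a * (k div d)) + a * (k mod d)"
    by (metis distrib_left mult.left_commute mult_div_mod_eq)
  then have "\<zeta> ^ (a * k) = (\<zeta> ^ d) ^ (a * (k div d)) * \<zeta> ^ (a * (k mod d))"
    by (simp only: power_add power_mult)
  then show ?thesis by (simp add: root)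
qed

lemma mon_mult:
  assumes "i < d" "k < d"
  shows "(\<Sum>j<d. mon a b i j * mon a' b' j k) = inverse \<zeta> ^ (a' * b) * mon (a + a') (b + b') i k"
proof -
  let ?j = "(k + b') mod d"
  have "(\<Sum>j<d. mon a b i j * mon a' b' j k) = (\<Sum>j<d. if j = ?j then mon a b i j * \<zeta> ^ (a' * j) else 0)"
    by (intro sum.cong) (auto simp: mon_def)
  also have "\<dots> = mon a b i ?j * \<zeta> ^ (a' * ?j)" using d by simp
  also have "\<dots> = inverse \<zeta> ^ (a' * b) * mon (a + a') (b + b') i k"
  proof (cases "i = (k + (b + b')) mod d")
    case True
    then have i: "i = (?j + b) mod d" by (simp add: mod_simps ac_simps)
    have "\<zeta> ^ (a' * i) = \<zeta> ^ (a' * (?j + b))" unfolding i by (rule zeta_mod)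
    then have "\<zeta> ^ (a' * ?j) = inverse \<zeta> ^ (a' * b) * \<zeta> ^ (a' * i)"
      using zeta_nz by (simp add: power_add distrib_left power_inverse field_simps)
    then show ?thesis using True i by (simp add: mon_def power_add distrib_right)
  next
    case False
    then have "i \<noteq> (?j + b) mod d" by (simp add: mod_simps ac_simps)
    then show ?thesis using False by (simp add: mon_def)
  qed
  finally show ?thesis .
qed

lemma qev_bound: "bounded L c \<Longrightarrow> L \<le> L' \<Longrightarrow> qev L' M c s i j = qev L M c s i j"
proof -
  assume c: "bounded L c" and L: "L \<le> L'"
  have "qev L' M c s i j = (\<Sum>a<L'. \<Sum>b<L. c a b * s ^ (a + M * b) * mon a b i j)"
    unfolding qev_def
    by (rule sum.cong[OF refl], rule sum.mono_neutral_right) (use c L in \<open>auto simp: bounded_def\<close>)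
  also have "\<dots> = qev L M c s i j"
    unfolding qev_def
    by (intro sum.mono_neutral_right) (use c L in \<open>auto simp: bounded_def\<close>)
  finally show ?thesis .
qed

lemma cauchy_sum:
  fixes G :: "nat \<Rightarrow> nat \<Rightarrow> complex"
  assumes "\<And>a a'. L1 \<le> a \<or> L2 \<le> a' \<Longrightarrow> G a a' = 0"
  shows "(\<Sum>a<L1. \<Sum>a'<L2. G a a') = (\<Sum>A<L1 + L2. \<Sum>a\<le>A. G a (A - a))"
proof -
  have "(\<Sum>A<L1 + L2. \<Sum>a\<le>A. G a (A - a)) = (\<Sum>(i, j)\<in>{(i, j). i + j < L1 + L2}. G i j)"
    by (rule sum.triangle_reindex[symmetric])
  also have "\<dots> = (\<Sum>(i, j)\<in>{..<L1} \<times> {..<L2}. G i j)"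
  proof (rule sum.mono_neutral_right)
    have sub: "{(i, j). i + j < L1 + L2} \<subseteq> {..<L1 + L2} \<times> {..<L1 + L2}" by auto
    show "finite {(i, j). i + j < L1 + L2}" by (rule finite_subset[OF sub]) simp
    show "{..<L1} \<times> {..<L2} \<subseteq> {(i, j). i + j < L1 + L2}" by auto
    show "\<forall>x\<in>{(i, j). i + j < L1 + L2} - {..<L1} \<times> {..<L2}. (case x of (i, j) \<Rightarrow> G i j) = 0"
      by (auto simp: not_less intro!: assms)
  qed
  also have "\<dots> = (\<Sum>a<L1. \<Sum>a'<L2. G a a')" by (rule sum.cartesian_product[symmetric])
  finally show ?thesis by simp
qed

text \<open>The matrices that represent \<open>x\<close> and \<open>y\<close> satisfy the
  commutation rule of the quantum plane (\<open>mon_mult\<close>), so evaluation is multiplicative;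
  the bound \<open>L1 + L2\<close> leaves room for every product of monomials.\<close>

lemma qev_star:
  assumes "bounded L1 c" "bounded L2 e" "i < d" "k < d"
  shows "qev (L1 + L2) M (star c e) s i k = (\<Sum>j<d. qev L1 M c s i j * qev L2 M e s j k)"
proof -
  define G where "G a b a' b' = c a b * e a' b' * inverse \<zeta> ^ (a' * b) * s ^ (a + a' + M * (b + b')) * mon (a + a') (b + b') i k"
    for a b a' b'
  define H where "H j a b a' b' = c a b * s ^ (a + M * b) * (e a' b' * s ^ (a' + M * b')) * (mon a b i j * mon a' b' j k)"
    for j a b a' b'
  have HG: "(\<Sum>j<d. H j a b a' b') = G a b a' b'" for a b a' b'
    unfolding H_def sum_distrib_left[symmetric] mon_mult[OF assms(3,4)]
    by (simp add: G_def power_add distrib_left mult_ac)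
  have "(\<Sum>j<d. qev L1 M c s i j * qev L2 M e s j k)
     = (\<Sum>j<d. \<Sum>a<L1. \<Sum>a'<L2. \<Sum>b<L1. \<Sum>b'<L2. H j a b a' b')"
    unfolding qev_def sum_product by (simp add: H_def mult_ac)
  also have "\<dots> = (\<Sum>j<d. \<Sum>a<L1. \<Sum>b<L1. \<Sum>a'<L2. \<Sum>b'<L2. H j a b a' b')"
    by (rule sum.cong[OF refl], rule sum.cong[OF refl], rule sum.swap)
  also have "\<dots> = (\<Sum>a<L1. \<Sum>j<d. \<Sum>b<L1. \<Sum>a'<L2. \<Sum>b'<L2. H j a b a' b')"
    by (rule sum.swap)
  also have "\<dots> = (\<Sum>a<L1. \<Sum>b<L1. \<Sum>j<d. \<Sum>a'<L2. \<Sum>b'<L2. H j a b a' b')"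
    by (rule sum.cong[OF refl], rule sum.swap)
  also have "\<dots> = (\<Sum>a<L1. \<Sum>b<L1. \<Sum>a'<L2. \<Sum>j<d. \<Sum>b'<L2. H j a b a' b')"
    by (rule sum.cong[OF refl], rule sum.cong[OF refl], rule sum.swap)
  also have "\<dots> = (\<Sum>a<L1. \<Sum>b<L1. \<Sum>a'<L2. \<Sum>b'<L2. \<Sum>j<d. H j a b a' b')"
    by (rule sum.cong[OF refl], rule sum.cong[OF refl], rule sum.cong[OF refl], rule sum.swap)
  also have "\<dots> = (\<Sum>a<L1. \<Sum>b<L1. \<Sum>a'<L2. \<Sum>b'<L2. G a b a' b')"
    by (simp only: HG)
  also have "\<dots> = (\<Sum>a<L1. \<Sum>a'<L2. \<Sum>b<L1. \<Sum>b'<L2. G a b a' b')"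
    by (rule sum.cong[OF refl], rule sum.swap)
  also have "\<dots> = (\<Sum>a<L1. \<Sum>a'<L2. \<Sum>B<L1 + L2. \<Sum>b\<le>B. G a b a' (B - b))"
    by (rule sum.cong[OF refl], rule sum.cong[OF refl], rule cauchy_sum)
      (use assms(1,2) in \<open>auto simp: G_def bounded_def\<close>)
  also have "\<dots> = (\<Sum>A<L1 + L2. \<Sum>a\<le>A. \<Sum>B<L1 + L2. \<Sum>b\<le>B. G a b (A - a) (B - b))"
    by (rule cauchy_sum, intro sum.neutral ballI) (use assms(1,2) in \<open>auto simp: G_def bounded_def\<close>)
  also have "\<dots> = (\<Sum>A<L1 + L2. \<Sum>B<L1 + L2. \<Sum>a\<le>A. \<Sum>b\<le>B. G a b (A - a) (B - b))"
    by (rule sum.cong[OF refl], rule sum.swap)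
  also have "\<dots> = qev (L1 + L2) M (star c e) s i k"
    unfolding qev_def star_def sum_distrib_right G_def
    by (intro sum.cong refl) auto
  finally show ?thesis by simp
qed

lemma star_bounded: "bounded L1 c \<Longrightarrow> bounded L2 e \<Longrightarrow> bounded (L1 + L2) (star c e)"
  unfolding bounded_def star_def
proof (intro allI impI sum.neutral ballI)
  fix a b a1 b1
  assume *: "\<forall>a b. L1 \<le> a \<or> L1 \<le> b \<longrightarrow> c a b = 0" "\<forall>a b. L2 \<le> a \<or> L2 \<le> b \<longrightarrow> e a b = 0"
    "L1 + L2 \<le> a \<or> L1 + L2 \<le> b"
  then have "L1 \<le> a1 \<or> L1 \<le> b1 \<or> L2 \<le> a - a1 \<or> L2 \<le> b - b1" by linarith
  then show "c a1 b1 * e (a - a1) (b - b1) * inverse \<zeta> ^ ((a - a1) * b1) = 0" using * by auto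
qed

text \<open>No zero divisors: multiply the lexicographically smallest monomials.\<close>

lemma star_nonzero:
  assumes "c a b \<noteq> 0" "e a' b' \<noteq> 0"
  shows "\<exists>a b. star c e a b \<noteq> 0"
proof -
  define a0 where "a0 = (LEAST a. \<exists>b. c a b \<noteq> 0)"
  define b0 where "b0 = (LEAST b. c a0 b \<noteq> 0)"
  define a1 where "a1 = (LEAST a. \<exists>b. e a b \<noteq> 0)"
  define b1 where "b1 = (LEAST b. e a1 b \<noteq> 0)"
  have "\<exists>b. c a0 b \<noteq> 0" unfolding a0_def by (rule LeastI_ex[of "\<lambda>a. \<exists>b. c a b \<noteq> 0"]) (use assms(1) in blast)
  then have c0: "c a0 b0 \<noteq> 0" unfolding b0_def by (rule LeastI_ex)
  have "\<exists>b. e a1 b \<noteq> 0" unfolding a1_def by (rule LeastI_ex[of "\<lambda>a. \<exists>b. e a b \<noteq> 0"]) (use assms(2) in blast)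
  then have e1: "e a1 b1 \<noteq> 0" unfolding b1_def by (rule LeastI_ex)
  have ca: "c a b = 0" if "a < a0" for a b using not_less_Least[OF that[unfolded a0_def]] by blast
  have cb: "c a0 b = 0" if "b < b0" for b using not_less_Least[OF that[unfolded b0_def]] by blast
  have ea: "e a b = 0" if "a < a1" for a b using not_less_Least[OF that[unfolded a1_def]] by blast
  have eb: "e a1 b = 0" if "b < b1" for b using not_less_Least[OF that[unfolded b1_def]] by blast
  let ?t = "\<lambda>a b. c a b * e (a0 + a1 - a) (b0 + b1 - b) * inverse \<zeta> ^ ((a0 + a1 - a) * b)"
  have "star c e (a0 + a1) (b0 + b1) = (\<Sum>a\<le>a0 + a1. if a = a0 then \<Sum>b\<le>b0 + b1. ?t a0 b else 0)"
    unfolding star_def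
  proof (intro sum.cong refl)
    fix a assume "a \<in> {..a0 + a1}"
    then consider "a < a0" | "a = a0" | "a0 + a1 - a < a1" by fastforce
    then show "(\<Sum>b\<le>b0 + b1. ?t a b) = (if a = a0 then \<Sum>b\<le>b0 + b1. ?t a0 b else 0)"
      by cases (auto simp: ca ea intro!: sum.neutral)
  qed
  also have "\<dots> = (\<Sum>b\<le>b0 + b1. ?t a0 b)" by simp
  also have "\<dots> = (\<Sum>b\<le>b0 + b1. if b = b0 then ?t a0 b0 else 0)"
  proof (intro sum.cong refl)
    fix b assume "b \<in> {..b0 + b1}"
    then consider "b < b0" | "b = b0" | "b0 + b1 - b < b1" by fastforce
    then show "?t a0 b = (if b = b0 then ?t a0 b0 else 0)"
      by cases (auto simp: cb eb)
  qed
  also have "\<dots> = ?t a0 b0" by simp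
  also have "\<dots> \<noteq> 0" using c0 e1 zeta_nz by simp
  finally show ?thesis by blast
qed

definition act :: "nat \<Rightarrow> (nat \<Rightarrow> nat \<Rightarrow> nat \<Rightarrow> nat \<Rightarrow> complex) \<Rightarrow> (nat \<Rightarrow> nat \<Rightarrow> nat \<Rightarrow> complex) \<Rightarrow> nat \<Rightarrow> nat \<Rightarrow> nat \<Rightarrow> complex" where
  "act n B w u a b = (\<Sum>v<n. star (B u v) (w v) a b)"

lemma star_add: "star c (\<lambda>a b. e a b + f a b) a b = star c e a b + star c f a b"
  by (simp add: star_def algebra_simps sum.distrib)

lemma star_smult: "star c (\<lambda>a b. r * e a b) a b = r * star c e a b"
  by (simp add: star_def sum_distrib_left mult_ac)

text \<open>
  Left multiplication by an injective matrix of bounded degree is onto up to central elements: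
  the elements of degree \<open>< L\<close> have dimension \<open>n L\<^sup>2\<close>, their images have degree \<open>< L + K\<close>, and the
  central elements contribute \<open>(L / d)\<^sup>2\<close> more unknowns.
\<close>

lemma central_multiple:
  assumes B: "\<And>u v. u < n \<Longrightarrow> v < n \<Longrightarrow> bounded K (B u v)"
    and inj: "\<And>w L v a b. (\<And>v. v < n \<Longrightarrow> bounded L (w v)) \<Longrightarrow> v < n \<Longrightarrow> w v a b \<noteq> 0 \<Longrightarrow> \<exists>u a b. u < n \<and> act n B w u a b \<noteq> 0"
    and u: "u < n"
  shows "\<exists>L w z. (\<forall>v<n. bounded L (w v)) \<and> bounded L z \<and> (\<exists>a b. z a b \<noteq> 0)
    \<and> (\<forall>v<n. \<forall>a b. act n B w v a b = (if v = u then central z a b else 0))"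
proof -
  \<comment> \<open>With \<open>L = d * R\<close> the inequality
    \<open>n * (L + K)^2 < n * L^2 + R^2\<close> amounts to
    \<open>n * (2 * d * R * K + K^2) < R^2\<close>, and this \<open>R\<close> satisfies it.\<close>
  define R where "R = n * (2 * d * K + K * K) + 1"
  define L where "L = d * R"
  define I where "I = ({..<n} \<times> {..<L} \<times> {..<L}) <+> ({..<R} \<times> {..<R})"
  define J where "J = {..<n} \<times> {..<L + K} \<times> {..<L + K}"
  have "n * ((L + K) * (L + K)) < n * (L * L) + R * R"
  proof -
    have "n * ((L + K) * (L + K)) = n * (L * L) + n * (2 * L * K + K * K)" by (simp add: algebra_simps)
    also have "n * (2 * L * K + K * K) \<le> n * (2 * d * K + K * K) * R"
    proof -
      have "n * K * K \<le> n * K * K * R" by (simp add: R_def)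
      then show ?thesis unfolding L_def by (simp add: algebra_simps)
    qed
    also have "\<dots> < R * R" unfolding R_def by (intro mult_strict_right_mono) auto
    finally show ?thesis by simp
  qed
  then have card: "card J < card I" by (simp add: I_def J_def card_Plus card_cartesian_product)
  define W where "W x v a b = x (Inl (v, a, b))" for x :: "nat \<times> nat \<times> nat + nat \<times> nat \<Rightarrow> complex" and v a b
  define Z where "Z x a b = x (Inr (a, b))" for x :: "nat \<times> nat \<times> nat + nat \<times> nat \<Rightarrow> complex" and a b
  define F where "F x = (\<lambda>(v, a, b). act n B (W x) v a b - (if v = u then central (Z x) a b else 0))" for x
  have "F (\<lambda>i. x i + y i) j = F x j + F y j" for x y j
  proof -
    obtain v a b where j: "j = (v, a, b)" by (metis surj_pair)
    have "W (\<lambda>i. x i + y i) v' = (\<lambda>a b. W x v' a b + W y v' a b)" for v' by (simp add: W_def fun_eq_iff)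
    then show ?thesis by (simp add: j F_def act_def star_add sum.distrib central_def Z_def)
  qed
  moreover have "F (\<lambda>i. c * x i) j = c * F x j" for c x j
  proof -
    obtain v a b where j: "j = (v, a, b)" by (metis surj_pair)
    have "W (\<lambda>i. c * x i) v' = (\<lambda>a b. c * W x v' a b)" for v' by (simp add: W_def fun_eq_iff)
    then show ?thesis by (simp add: j F_def act_def star_smult sum_distrib_left central_def Z_def right_diff_distrib)
  qed
  moreover have "finite I" "finite J" by (auto simp: I_def J_def)
  ultimately obtain x where x: "\<exists>i\<in>I. x i \<noteq> 0" "\<And>i. i \<notin> I \<Longrightarrow> x i = 0" "\<And>j. j \<in> J \<Longrightarrow> F x j = 0"
    using underdetermined_linear[of J I F] card by blast
  define w where "w = W x"
  define z where "z = Z x"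
  have wL: "bounded L (w v)" for v unfolding bounded_def w_def W_def by (auto simp: I_def intro!: x(2))
  have zR: "bounded R z" unfolding bounded_def z_def Z_def by (auto simp: I_def intro!: x(2))
  have RL: "R \<le> L" using d by (simp add: L_def)
  have eq: "act n B w v a b = (if v = u then central z a b else 0)" if vn: "v < n" for v a b
  proof (cases "a < L + K \<and> b < L + K")
    case True
    then have "(v, a, b) \<in> J" using vn by (simp add: J_def)
    from x(3)[OF this] show ?thesis by (simp add: F_def w_def z_def)
  next
    case False
    then have "act n B w v a b = 0"
      unfolding act_def using star_bounded[OF B[OF vn] wL]
      by (intro sum.neutral) (auto simp: bounded_def add.commute)
    moreover have "central z a b = 0"
    proof -
      have "R * d \<le> a \<or> R * d \<le> b" using False by (auto simp: L_def mult.commute)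
      then have "R \<le> a div d \<or> R \<le> b div d"
        by (simp add: less_eq_div_iff_mult_less_eq[OF d])
      then show ?thesis using zR by (auto simp: central_def bounded_def)
    qed
    ultimately show ?thesis by simp
  qed
  \<comment> \<open>If \<open>z\<close> were zero, the nontrivial solution would be a nonzero
    \<open>w\<close> killed by \<open>B\<close>.\<close>
  have "\<exists>a b. z a b \<noteq> 0"
  proof (rule ccontr)
    assume z0: "\<not> ?thesis"
    then obtain v a b where "v < n" "w v a b \<noteq> 0"
      using x(1) by (auto simp: I_def w_def W_def z_def Z_def)
    then obtain u' a b where "u' < n" "act n B w u' a b \<noteq> 0" using inj[of L w v a b] wL by blast
    then show False using eq z0 by (auto simp: central_def split: if_splits)
  qed
  moreover have "bounded L z" using zR RL unfolding bounded_def by auto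
  ultimately show ?thesis using wL eq by (intro exI[of _ L] exI[of _ w] exI[of _ z]) auto
qed

text \<open>The one-by-one case of \<open>central_multiple\<close>; left multiplication by a nonzero
  element is injective by \<open>star_nonzero\<close>.\<close>

lemma central_multiple_element:
  assumes c: "bounded K c" "c a0 b0 \<noteq> 0"
  shows "\<exists>L e z. bounded L e \<and> bounded L z \<and> (\<exists>a b. z a b \<noteq> 0) \<and> (\<forall>a b. star c e a b = central z a b)"
proof -
  have inj: "\<exists>u a b. u < 1 \<and> act 1 (\<lambda>_ _. c) w u a b \<noteq> 0"
    if "\<And>v. v < 1 \<Longrightarrow> bounded L (w v)" "v < 1" "w v a b \<noteq> 0" for w :: "nat \<Rightarrow> nat \<Rightarrow> nat \<Rightarrow> complex" and L v a b
    using star_nonzero[of c a0 b0 "w 0"] c(2) that(2,3) by (auto simp: act_def)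
  have "\<exists>L w z. (\<forall>v<1. bounded L (w v)) \<and> bounded L z \<and> (\<exists>a b. z a b \<noteq> 0)
    \<and> (\<forall>v<1. \<forall>a b. act 1 (\<lambda>_ _. c) w v a b = (if v = 0 then central z a b else 0))"
  proof (rule central_multiple[of 1 K "\<lambda>_ _. c" 0])
    fix w :: "nat \<Rightarrow> nat \<Rightarrow> nat \<Rightarrow> complex" and L v a b
    assume "\<And>v. v < 1 \<Longrightarrow> bounded L (w v)" "v < 1" "w v a b \<noteq> 0"
    then show "\<exists>u a b. u < 1 \<and> act 1 (\<lambda>_ _. c) w u a b \<noteq> 0" by (rule inj)
  qed (use c(1) in simp_all)
  then obtain L w z where H: "(\<forall>v<1. bounded L (w v)) \<and> bounded L z \<and> (\<exists>a b. z a b \<noteq> 0)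
    \<and> (\<forall>v<1. \<forall>a b. act 1 (\<lambda>_ _. c) w v a b = (if v = 0 then central z a b else 0))" by (elim exE)
  show ?thesis
    by (rule exI[of _ L], rule exI[of _ "w 0"], rule exI[of _ z]) (use H in \<open>simp add: act_def\<close>)
qed

text \<open>The scalar by which the central element given by \<open>z\<close> acts under
  \<open>qev\<close>, as a polynomial in \<open>s\<close> (see \<open>qev_central\<close>).\<close>

definition cpoly :: "nat \<Rightarrow> nat \<Rightarrow> (nat \<Rightarrow> nat \<Rightarrow> complex) \<Rightarrow> complex poly" where
  "cpoly L M z = (\<Sum>a<L. \<Sum>b<L. monom (z a b) (d * (a + M * b)))"

text \<open>Kronecker substitution: for \<open>a < L\<close> and \<open>L \<le> M\<close>, division
  of \<open>a + M * b\<close> by \<open>M\<close> recovers \<open>a\<close> and \<open>b\<close>, so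
  distinct coefficients of \<open>z\<close> sit at distinct powers of \<open>s\<close>.\<close>

lemma cpoly_nonzero:
  assumes "bounded L z" "z a b \<noteq> 0" "L \<le> M"
  shows "cpoly L M z \<noteq> 0"
proof -
  have ab: "a < L" "b < L" using assms(1,2) not_le unfolding bounded_def by blast+
  have "d * (a' + M * b') = d * (a + M * b) \<longleftrightarrow> a' = a \<and> b' = b" if "a' < L" "b' < L" for a' b'
  proof -
    have "d * (a' + M * b') = d * (a + M * b) \<longleftrightarrow> a' + M * b' = a + M * b" using d by simp
    also have "\<dots> \<longleftrightarrow> a' = a \<and> b' = b"
    proof
      assume *: "a' + M * b' = a + M * b"
      have "(a' + M * b') mod M = a'" "(a + M * b) mod M = a" using that ab assms(3) by auto
      then have "a' = a" using * by simp
      then show "a' = a \<and> b' = b" using * ab assms(3) by simp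
    qed simp
    finally show ?thesis .
  qed
  then have "coeff (cpoly L M z) (d * (a + M * b)) = (\<Sum>a'<L. \<Sum>b'<L. if a' = a \<and> b' = b then z a' b' else 0)"
    unfolding cpoly_def coeff_sum by (intro sum.cong refl) auto
  also have "\<dots> = (\<Sum>a'<L. if a' = a then (\<Sum>b'<L. if b' = b then z a' b' else 0) else 0)"
    by (intro sum.cong refl) auto
  also have "\<dots> = z a b" using ab by simp
  finally show ?thesis using assms(2) by auto
qed

lemma qev_central:
  assumes "bounded L z" "i < d" "j < d"
  shows "qev (d * L) M (central z) s i j = (if i = j then poly (cpoly L M z) s else 0)"
proof -
  have img: "(\<Sum>a<d * L. if d dvd a then f (a div d) a else 0) = (\<Sum>a<L. f a (d * a))" for f :: "nat \<Rightarrow> nat \<Rightarrow> complex"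
  proof -
    have "(\<Sum>a<d * L. if d dvd a then f (a div d) a else 0) = (\<Sum>a\<in>{a \<in> {..<d * L}. d dvd a}. f (a div d) a)"
      by (rule sum.inter_filter[symmetric]) simp
    also have "\<dots> = (\<Sum>a<L. f a (d * a))"
      by (rule sum.reindex_bij_witness[of _ "\<lambda>a. d * a" "\<lambda>a. a div d"]) (use d in auto)
    finally show ?thesis .
  qed
  have mon: "mon (d * a) (d * b) i j = (if i = j then 1 else 0)" for a b
  proof -
    have "\<zeta> ^ (d * a * i) = 1" by (simp add: power_mult root mult.assoc)
    then show ?thesis using assms(2,3) by (auto simp: mon_def)
  qed
  have "qev (d * L) M (central z) s i j
    = (\<Sum>a<d * L. if d dvd a then (\<Sum>b<d * L. if d dvd b then z (a div d) (b div d) * s ^ (a + M * b) * mon a b i j else 0) else 0)"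
    unfolding qev_def by (intro sum.cong refl) (auto simp: central_def intro!: sum.cong)
  also have "\<dots> = (\<Sum>a<L. \<Sum>b<d * L. if d dvd b then z a (b div d) * s ^ (d * a + M * b) * mon (d * a) b i j else 0)"
    by (rule img[of "\<lambda>q a. \<Sum>b<d * L. if d dvd b then z q (b div d) * s ^ (a + M * b) * mon a b i j else 0"])
  also have "\<dots> = (\<Sum>a<L. \<Sum>b<L. z a b * s ^ (d * a + M * (d * b)) * mon (d * a) (d * b) i j)"
  proof (rule sum.cong[OF refl])
    fix a
    show "(\<Sum>b<d * L. if d dvd b then z a (b div d) * s ^ (d * a + M * b) * mon (d * a) b i j else 0)
      = (\<Sum>b<L. z a b * s ^ (d * a + M * (d * b)) * mon (d * a) (d * b) i j)"
      by (rule img[of "\<lambda>r b. z a r * s ^ (d * a + M * b) * mon (d * a) b i j"])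
  qed
  also have "\<dots> = (if i = j then poly (cpoly L M z) s else 0)"
    unfolding mon by (cases "i = j") (simp_all add: cpoly_def poly_sum poly_monom distrib_left mult.left_commute)
  finally show ?thesis .
qed

text \<open>Fourier inversion along each cyclic diagonal: the monomials with \<open>a, b < d\<close>
  span all matrices of size \<open>d\<close>. Thus every matrix is the value at \<open>s = 1\<close>
  of an element of the quantum plane of degree less than \<open>d\<close> in \<open>x\<close> and in
  \<open>y\<close>.\<close>

lemma fourier:
  obtains \<tau> where "\<And>i j. i < d \<Longrightarrow> j < d \<Longrightarrow> (\<Sum>a<d. \<Sum>b<d. \<tau> a b * mon a b i j) = T i j"
proof
  define \<tau> where "\<tau> a b = (\<Sum>k<d. T k ((k + (d - b)) mod d) / \<zeta> ^ (a * k)) / of_nat d" for a b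
  fix i j assume i: "i < d" and j: "j < d"
  define b0 where "b0 = (i + (d - j)) mod d"
  have b0: "i = (j + b) mod d \<longleftrightarrow> b = b0" if "b < d" for b
  proof
    assume "i = (j + b) mod d"
    then have "b0 = ((j + b) + (d - j)) mod d" by (simp add: b0_def mod_simps)
    also have "\<dots> = b" using j that by simp
    finally show "b = b0" by simp
  next
    assume "b = b0"
    then have "(j + b) mod d = (j + (i + (d - j))) mod d" by (simp add: b0_def mod_simps)
    also have "\<dots> = i" using i j by simp
    finally show "i = (j + b) mod d" by simp
  qed
  have b0d: "b0 < d" using d by (simp add: b0_def)
  have orth: "(\<Sum>a<d. \<zeta> ^ (a * i) / \<zeta> ^ (a * k)) = (if k = i then of_nat d else 0)" if k: "k < d" for k
  proof -
    let ?w = "\<zeta> ^ i / \<zeta> ^ k"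
    have eq: "\<zeta> ^ (a * i) / \<zeta> ^ (a * k) = ?w ^ a" for a
      by (simp add: power_divide power_mult[symmetric] mult.commute)
    show ?thesis
    proof (cases "k = i")
      case True
      then show ?thesis using zeta_nz by simp
    next
      case False
      then have "\<zeta> ^ i \<noteq> \<zeta> ^ k" using prim i k by (auto simp: inj_on_def)
      then have "?w \<noteq> 1" using zeta_nz by simp
      moreover have "(\<zeta> ^ j) ^ d = 1" for j by (metis root power_mult mult.commute power_one)
      then have "?w ^ d = 1" by (simp add: power_divide)
      ultimately show ?thesis using False unfolding eq by (simp add: geometric_sum)
    qed
  qed
  have "(\<Sum>a<d. \<Sum>b<d. \<tau> a b * mon a b i j) = (\<Sum>a<d. \<Sum>b<d. if b = b0 then \<tau> a b * \<zeta> ^ (a * i) else 0)"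
    by (intro sum.cong refl) (auto simp: mon_def b0)
  also have "\<dots> = (\<Sum>a<d. \<tau> a b0 * \<zeta> ^ (a * i))" using b0d by simp
  also have "\<dots> = (\<Sum>a<d. \<Sum>k<d. T k ((k + (d - b0)) mod d) / of_nat d * (\<zeta> ^ (a * i) / \<zeta> ^ (a * k)))"
    by (simp add: \<tau>_def sum_distrib_left sum_distrib_right sum_divide_distrib mult_ac)
  also have "\<dots> = (\<Sum>k<d. T k ((k + (d - b0)) mod d) / of_nat d * (\<Sum>a<d. \<zeta> ^ (a * i) / \<zeta> ^ (a * k)))"
    by (subst sum.swap) (simp add: sum_distrib_left)
  also have "\<dots> = (\<Sum>k<d. if k = i then T k ((k + (d - b0)) mod d) / of_nat d * of_nat d else 0)"
    by (intro sum.cong refl) (auto simp: orth)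
  also have "\<dots> = T i ((i + (d - b0)) mod d)" using i d by simp
  also have "(i + (d - b0)) mod d = j"
  proof -
    have "i = (j + b0) mod d" using b0[OF b0d] by simp
    then have "(i + (d - b0)) mod d = ((j + b0) + (d - b0)) mod d" by (simp add: mod_simps)
    then show ?thesis using b0d j by simp
  qed
  finally show "(\<Sum>a<d. \<Sum>b<d. \<tau> a b * mon a b i j) = T i j" .
qed

end

lemma poly_common_nonroot:
  fixes P :: "'i \<Rightarrow> 'a::{idom, ring_char_0} poly"
  assumes "finite I" "\<And>i. i \<in> I \<Longrightarrow> P i \<noteq> 0"
  shows "\<exists>s. \<forall>i\<in>I. poly (P i) s \<noteq> 0"
proof -
  have "(\<Prod>i\<in>I. P i) \<noteq> 0" using assms by simp
  then have "finite {s. poly (\<Prod>i\<in>I. P i) s = 0}" by (rule poly_roots_finite)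
  then have "\<exists>s. poly (\<Prod>i\<in>I. P i) s \<noteq> 0"
    using infinite_UNIV_char_0 by (metis (mono_tags, lifting) UNIV_I finite_subset mem_Collect_eq subsetI)
  then show ?thesis using assms(1) by (auto simp: poly_prod)
qed

text \<open>There are two sums because the regularity lemma adds the squares of its linear forms to
  the squares of the rows of a matrix.\<close>

lemma sum_cnj_self_eq_0:
  assumes "finite R" "(\<Sum>r\<in>R. cnj (z r) * z r) + (\<Sum>l\<in>S. cnj (w l) * w l) = 0" "finite S"
  shows "\<forall>r\<in>R. z r = 0" "\<forall>l\<in>S. w l = 0"
proof -
  have c: "cnj x * x = complex_of_real ((cmod x)\<^sup>2)" for x
    by (metis complex_norm_square mult.commute)
  have "complex_of_real ((\<Sum>r\<in>R. (cmod (z r))\<^sup>2) + (\<Sum>l\<in>S. (cmod (w l))\<^sup>2)) = 0"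
    using assms(2) by (simp add: c)
  then have "(\<Sum>r\<in>R. (cmod (z r))\<^sup>2) + (\<Sum>l\<in>S. (cmod (w l))\<^sup>2) = 0"
    by (simp only: of_real_eq_0_iff)
  moreover have "0 \<le> (\<Sum>r\<in>R. (cmod (z r))\<^sup>2)" "0 \<le> (\<Sum>l\<in>S. (cmod (w l))\<^sup>2)"
    by (auto intro: sum_nonneg)
  ultimately have "(\<Sum>r\<in>R. (cmod (z r))\<^sup>2) = 0" "(\<Sum>l\<in>S. (cmod (w l))\<^sup>2) = 0" by linarith+
  then show "\<forall>r\<in>R. z r = 0" "\<forall>l\<in>S. w l = 0"
    using assms by (simp_all add: sum_nonneg_eq_0_iff)
qed

context quantum_plane
begin

lemma qev_sum: "(\<Sum>v\<in>A. qev L M (c v) s i k) = qev L M (\<lambda>a b. \<Sum>v\<in>A. c v a b) s i k"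
proof -
  have "(\<Sum>v\<in>A. qev L M (c v) s i k) = (\<Sum>a<L. \<Sum>v\<in>A. \<Sum>b<L. c v a b * s ^ (a + M * b) * mon a b i k)"
    unfolding qev_def by (rule sum.swap)
  also have "\<dots> = (\<Sum>a<L. \<Sum>b<L. \<Sum>v\<in>A. c v a b * s ^ (a + M * b) * mon a b i k)"
    by (rule sum.cong[OF refl], rule sum.swap)
  finally show ?thesis by (simp add: qev_def sum_distrib_right)
qed

lemma qev_act:
  assumes "\<And>v. v < n \<Longrightarrow> bounded K (B u v)" "\<And>v. v < n \<Longrightarrow> bounded L (w v)" "i < d" "k < d"
  shows "(\<Sum>j<d. \<Sum>v<n. qev K M (B u v) s i j * qev L M (w v) s j k) = qev (K + L) M (act n B w u) s i k"
proof -
  have "(\<Sum>j<d. \<Sum>v<n. qev K M (B u v) s i j * qev L M (w v) s j k)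
      = (\<Sum>v<n. \<Sum>j<d. qev K M (B u v) s i j * qev L M (w v) s j k)" by (rule sum.swap)
  also have "\<dots> = (\<Sum>v<n. qev (K + L) M (star (B u v) (w v)) s i k)"
    using assms by (intro sum.cong refl) (simp add: qev_star)
  finally show ?thesis by (simp add: qev_sum act_def[abs_def])
qed

lemma qev_eq_central:
  assumes "bounded K c" "bounded L z" "\<And>a b. c a b = central z a b" "i < d" "k < d"
  shows "qev K M c s i k = (if i = k then poly (cpoly L M z) s else 0)"
proof -
  have cL: "bounded (d * L) (central z)"
    unfolding bounded_def central_def
  proof (intro allI impI)
    fix a b assume "d * L \<le> a \<or> d * L \<le> b"
    then have "L \<le> a div d \<or> L \<le> b div d" by (simp add: less_eq_div_iff_mult_less_eq[OF d] mult.commute)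
    then show "(if d dvd a \<and> d dvd b then z (a div d) (b div d) else 0) = 0"
      using assms(2) by (auto simp: bounded_def)
  qed
  have c: "c = central z" using assms(3) by (simp add: fun_eq_iff)
  have "qev K M c s i k = qev (K + d * L) M c s i k" by (rule qev_bound[symmetric, OF assms(1)]) simp
  also have "\<dots> = qev (d * L) M (central z) s i k" unfolding c by (rule qev_bound[OF cL]) simp
  finally show ?thesis using qev_central[OF assms(2,4,5)] by simp
qed

text \<open>The rank of the blow-up of size \<open>d\<close> is a multiple of \<open>d\<close>, in the form: if the kernel of some
  member is cut down to zero by fewer than \<open>d\<close> linear forms, then some member is invertible.\<close>

theorem regularity:
  fixes X T :: "nat \<Rightarrow> nat \<Rightarrow> nat \<Rightarrow> complex" and V :: "nat \<Rightarrow> nat \<Rightarrow> complex"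
  assumes n: "0 < n"
    and ker: "\<And>v. (\<forall>p<d * n. (\<Sum>q<d * n. blow n m X T p q * v q) = 0) \<Longrightarrow>
      (\<forall>l<d - 1. (\<Sum>q<d * n. V l q * v q) = 0) \<Longrightarrow> \<forall>q<d * n. v q = 0"
  shows "\<exists>T'. blow_det n m d X T' \<noteq> 0"
proof -
  have "\<exists>\<tau>. \<forall>i j k. j < d \<longrightarrow> k < d \<longrightarrow> (\<Sum>a<d. \<Sum>b<d. \<tau> i a b * mon a b j k) = T i j k"
  proof (rule choice, rule allI)
    fix i
    obtain \<tau> where "\<And>j k. j < d \<Longrightarrow> k < d \<Longrightarrow> (\<Sum>a<d. \<Sum>b<d. \<tau> a b * mon a b j k) = T i j k"
      using fourier[of "T i"] by blast
    then show "\<exists>\<tau>. \<forall>j k. j < d \<longrightarrow> k < d \<longrightarrow> (\<Sum>a<d. \<Sum>b<d. \<tau> a b * mon a b j k) = T i j k" by blast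
  qed
  then obtain \<tau> where \<tau>: "\<And>i j k. j < d \<Longrightarrow> k < d \<Longrightarrow> (\<Sum>a<d. \<Sum>b<d. \<tau> i a b * mon a b j k) = T i j k" by blast
  \<comment> \<open>The \<open>n\<close> by \<open>n\<close> matrix over the quantum plane that
    specializes to the given blow-up at \<open>s = 1\<close>; \<open>TT M s\<close> are the
    coefficient matrices of its specialization at \<open>s\<close>.\<close>
  define B where "B u v a b = (if a < d \<and> b < d then \<Sum>i<m. X i u v * \<tau> i a b else 0)" for u v a b
  define TT where "TT M s i j k = (\<Sum>a<d. \<Sum>b<d. \<tau> i a b * s ^ (a + M * b) * mon a b j k)" for M s i j k
  define N where "N = d * n"
  have B: "bounded d (B u v)" for u v by (auto simp: bounded_def B_def)
  have div: "p div n < d" "p mod n < n" if "p < N" for p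
    using that n by (auto simp: N_def less_mult_imp_div_less)
  have blow_TT: "blow n m X (TT M s) p q = qev d M (B (p mod n) (q mod n)) s (p div n) (q div n)" for M s p q
  proof -
    have "blow n m X (TT M s) p q
      = (\<Sum>i<m. \<Sum>a<d. \<Sum>b<d. X i (p mod n) (q mod n) * \<tau> i a b * s ^ (a + M * b) * mon a b (p div n) (q div n))"
      by (simp add: blow_def TT_def sum_distrib_right sum_distrib_left mult_ac)
    also have "\<dots> = (\<Sum>a<d. \<Sum>i<m. \<Sum>b<d. X i (p mod n) (q mod n) * \<tau> i a b * s ^ (a + M * b) * mon a b (p div n) (q div n))"
      by (rule sum.swap)
    also have "\<dots> = (\<Sum>a<d. \<Sum>b<d. \<Sum>i<m. X i (p mod n) (q mod n) * \<tau> i a b * s ^ (a + M * b) * mon a b (p div n) (q div n))"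
      by (rule sum.cong[OF refl], rule sum.swap)
    also have "\<dots> = qev d M (B (p mod n) (q mod n)) s (p div n) (q div n)"
      unfolding qev_def by (intro sum.cong refl) (simp add: B_def sum_distrib_right)
    finally show ?thesis .
  qed
  have TT1: "blow n m X (TT M 1) p q = blow n m X T p q" if "p < N" "q < N" for M p q
    unfolding blow_def using \<tau> div that by (intro sum.cong refl) (simp add: TT_def)
  \<comment> \<open>Either \<open>B\<close> is injective on vectors over the quantum plane; then it
    has a right inverse up to central elements, and a suitable specialization is invertible. Or it
    kills a vector \<open>w\<close>; then almost all specializations have a kernel of dimension at
    least \<open>d\<close>, which fewer than \<open>d\<close> linear forms cannot cut down to
    zero.\<close>
  show ?thesis
  proof (cases "\<forall>w L v a b. (\<forall>v<n. bounded L (w v)) \<longrightarrow> v < n \<longrightarrow> w v a b \<noteq> 0 \<longrightarrow> (\<exists>u a b. u < n \<and> act n B w u a b \<noteq> 0)")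
    case True
    define Q where "Q u L w z \<longleftrightarrow> (\<forall>v<n. bounded L (w v)) \<and> bounded L z \<and> (\<exists>a b. z a b \<noteq> 0)
      \<and> (\<forall>v<n. \<forall>a b. act n B w v a b = (if v = u then central z a b else 0))" for u L w z
    have "\<exists>L w z. Q u L w z" if "u < n" for u
      unfolding Q_def
    proof (rule central_multiple[OF B _ that])
      fix w L v a b
      assume *: "\<And>v. v < n \<Longrightarrow> bounded L (w v)" "v < n" "w v a b \<noteq> (0::complex)"
      then show "\<exists>u a b. u < n \<and> act n B w u a b \<noteq> 0" using True[THEN spec[of _ w], THEN spec[of _ L], THEN spec[of _ v], THEN spec[of _ a], THEN spec[of _ b]]
        by simp
    qed
    then have "\<exists>x. Q u (fst x) (fst (snd x)) (snd (snd x))" if "u < n" for u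
      using that by fastforce
    then have "\<forall>u\<in>{..<n}. \<exists>x. Q u (fst x) (fst (snd x)) (snd (snd x))" by simp
    from bchoice[OF this] obtain x where x: "\<And>u. u < n \<Longrightarrow> Q u (fst (x u)) (fst (snd (x u))) (snd (snd (x u)))"
      by auto
    define L where "L u = fst (x u)" for u
    define w where "w u = fst (snd (x u))" for u
    define z where "z u = snd (snd (x u))" for u
    have LWZ: "(\<forall>v<n. bounded (L u) (w u v)) \<and> bounded (L u) (z u) \<and> (\<exists>a b. z u a b \<noteq> 0)
      \<and> (\<forall>v<n. \<forall>a b. act n B (w u) v a b = (if v = u then central (z u) a b else 0))" if "u < n" for u
      using x[OF that] unfolding Q_def L_def w_def z_def .
    \<comment> \<open>One \<open>M\<close> above all the \<open>L u\<close>, so that Kronecker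
      substitution separates the exponents for every \<open>u\<close>.\<close>
    define M where "M = (\<Sum>u<n. L u)"
    have LM: "L u \<le> M" if "u < n" for u
      unfolding M_def using that by (intro member_le_sum) auto
    have cp: "cpoly (L u) M (z u) \<noteq> 0" if un: "u < n" for u
    proof -
      obtain a b where "z u a b \<noteq> 0" using LWZ[OF un] by auto
      then show ?thesis using LWZ[OF un] cpoly_nonzero[of "L u" "z u" a b M] LM[OF un] by simp
    qed
    then obtain s where s: "\<And>u. u < n \<Longrightarrow> poly (cpoly (L u) M (z u)) s \<noteq> 0"
      using poly_common_nonroot[of "{..<n}" "\<lambda>u. cpoly (L u) M (z u)"] cp by auto
    have "blow_det n m d X (TT M s) \<noteq> 0"
    proof
      assume "blow_det n m d X (TT M s) = 0"
      \<comment> \<open>Transposition yields a row vector \<open>y\<close> that annihilates the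
        matrix. Multiplying by column \<open>k\<close> of the evaluated \<open>w u\<close> isolates
        the entry \<open>y (k * n + u)\<close> with a nonzero scalar.\<close>
      then have "det (mat N N (\<lambda>(p, q). blow n m X (TT M s) q p)) = 0"
        unfolding N_def by (subst det_mat_transpose)
      then obtain y q where y: "q < N" "y q \<noteq> 0" "\<And>p. p < N \<Longrightarrow> (\<Sum>q<N. blow n m X (TT M s) q p * y q) = 0"
        by (rule det_eq_0E) (rule that)
      have yz: "y (k * n + u) = 0" if k: "k < d" and u: "u < n" for k u
      proof -
        have bw: "bounded (L u) (w u v)" if "v < n" for v using LWZ[OF u] that by simp
        have prod: "(\<Sum>j<d. \<Sum>v<n. qev d M (B u' v) s i j * qev (L u) M (w u v) s j k)
          = (if u' = u then if i = k then poly (cpoly (L u) M (z u)) s else 0 else 0)" if "u' < n" "i < d" for u' i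
        proof -
          have act_b: "bounded (d + L u) (act n B (w u) u')"
            unfolding act_def[abs_def] using star_bounded[OF B bw]
            by (auto simp: bounded_def intro!: sum.neutral)
          have "(\<Sum>j<d. \<Sum>v<n. qev d M (B u' v) s i j * qev (L u) M (w u v) s j k)
            = qev (d + L u) M (act n B (w u) u') s i k"
            by (rule qev_act[OF B bw that(2) k])
          also have "\<dots> = (if u' = u then if i = k then poly (cpoly (L u) M (z u)) s else 0 else 0)"
          proof (cases "u' = u")
            case True
            have "qev (d + L u) M (act n B (w u) u) s i k = (if i = k then poly (cpoly (L u) M (z u)) s else 0)"
              by (rule qev_eq_central) (use LWZ[OF u] u that(2) k act_b True in simp_all)
            then show ?thesis using True by simp
          next
            case False
            then have "act n B (w u) u' a b = 0" for a b using LWZ[OF u] that by simp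
            then show ?thesis using False by (simp add: qev_def)
          qed
          finally show ?thesis .
        qed
        have "0 = (\<Sum>j<d. \<Sum>v<n. (\<Sum>q<N. blow n m X (TT M s) q (j * n + v) * y q) * qev (L u) M (w u v) s j k)"
        proof (rule sym, intro sum.neutral ballI)
          fix j v assume "j \<in> {..<d}" "v \<in> {..<n}"
          then have "j * n + v < N"
            unfolding N_def using block_index_less[of j d v n] by simp
          then show "(\<Sum>q<N. blow n m X (TT M s) q (j * n + v) * y q) * qev (L u) M (w u v) s j k = 0"
            using y(3) by simp
        qed
        also have "\<dots> = (\<Sum>j<d. \<Sum>v<n. \<Sum>q<N. y q * (qev d M (B (q mod n) v) s (q div n) j * qev (L u) M (w u v) s j k))"
          unfolding sum_distrib_right blow_TT by (intro sum.cong refl) (simp add: mult_ac)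
        also have "\<dots> = (\<Sum>j<d. \<Sum>q<N. \<Sum>v<n. y q * (qev d M (B (q mod n) v) s (q div n) j * qev (L u) M (w u v) s j k))"
          by (rule sum.cong[OF refl], rule sum.swap)
        also have "\<dots> = (\<Sum>q<N. \<Sum>j<d. \<Sum>v<n. y q * (qev d M (B (q mod n) v) s (q div n) j * qev (L u) M (w u v) s j k))"
          by (rule sum.swap)
        also have "\<dots> = (\<Sum>q<N. y q * (if q mod n = u then if q div n = k then poly (cpoly (L u) M (z u)) s else 0 else 0))"
          unfolding sum_distrib_left[symmetric] by (rule sum.cong[OF refl]) (simp add: prod div)
        also have "\<dots> = (\<Sum>q<N. if q = k * n + u then y q * poly (cpoly (L u) M (z u)) s else 0)"
        proof (rule sum.cong[OF refl])
          fix q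
          have "q mod n = u \<and> q div n = k \<longleftrightarrow> q = k * n + u" using u by auto
          then show "y q * (if q mod n = u then if q div n = k then poly (cpoly (L u) M (z u)) s else 0 else 0)
            = (if q = k * n + u then y q * poly (cpoly (L u) M (z u)) s else 0)" by auto
        qed
        also have "\<dots> = y (k * n + u) * poly (cpoly (L u) M (z u)) s"
          using block_index_less[OF k u] by (simp add: N_def)
        finally show ?thesis using s[OF u] by simp
      qed
      have "y q = 0" if "q < N" for q using yz[OF div[OF that]] by simp
      then show False using y(1,2) by auto
    qed
    then show ?thesis by blast
  next
    case False
    then obtain w L v0 a0 b0 where w': "\<forall>v<n. bounded L (w v)" and v0: "v0 < n" "w v0 a0 b0 \<noteq> 0"
      and act0': "\<not> (\<exists>u a b. u < n \<and> act n B w u a b \<noteq> 0)"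
      unfolding not_all not_imp by (elim exE conjE) (rule that)
    have w: "bounded L (w v)" if "v < n" for v using w' that by simp
    have act0: "act n B w u a b = 0" if "u < n" for u a b using act0' that by auto
    obtain L' e z a1 b1 where e: "bounded L' e" "bounded L' z" "z a1 b1 \<noteq> 0" "\<And>a b. star (w v0) e a b = central z a b"
      using central_multiple_element[OF w[OF v0(1)] v0(2)] by blast
    define M where "M = L'"
    define A where "A s p q = blow n m X (TT M s) p q" for s p q
    \<comment> \<open>\<open>A(1)* A(s) + V* V\<close>, with stars for conjugate transposes. At
      \<open>s = 1\<close> it is positive definite by \<open>ker\<close>; since only the matrix at 1
      is conjugated, the entries are polynomials in \<open>s\<close> and the determinant is nonzero
      at almost every \<open>s\<close>.\<close>
    define G where "G s p q = (\<Sum>r<N. cnj (A 1 r p) * A s r q) + (\<Sum>l<d - 1. cnj (V l p) * V l q)" for s p q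
    define Ap where "Ap p q = (\<Sum>a<d. \<Sum>b<d. monom (B (p mod n) (q mod n) a b * mon a b (p div n) (q div n)) (a + M * b))" for p q
    define Gp where "Gp p q = (\<Sum>r<N. smult (cnj (A 1 r p)) (Ap r q)) + [:\<Sum>l<d - 1. cnj (V l p) * V l q:]" for p q
    define D where "D = det (mat N N (\<lambda>(p, q). Gp p q))"
    have Ap: "poly (Ap p q) s = A s p q" for p q s
      by (simp add: A_def blow_TT Ap_def qev_def poly_sum poly_monom mult_ac)
    have Gp: "poly (Gp p q) s = G s p q" for p q s
      by (simp add: Gp_def G_def poly_sum Ap)
    have D: "poly D s = det (mat N N (\<lambda>(p, q). G s p q))" for s
      unfolding D_def by (rule poly_det_cong[of _ N]) (auto simp: Gp)
    have eqG: "(\<Sum>q<N. G s p q * v q) = (\<Sum>r<N. cnj (A 1 r p) * (\<Sum>q<N. A s r q * v q))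
      + (\<Sum>l<d - 1. cnj (V l p) * (\<Sum>q<N. V l q * v q))" for s p v
    proof -
      have "(\<Sum>q<N. G s p q * v q) = (\<Sum>q<N. \<Sum>r<N. cnj (A 1 r p) * (A s r q * v q)) + (\<Sum>q<N. \<Sum>l<d - 1. cnj (V l p) * (V l q * v q))"
        by (simp add: G_def distrib_right sum.distrib sum_distrib_right mult.assoc)
      also have "\<dots> = (\<Sum>r<N. \<Sum>q<N. cnj (A 1 r p) * (A s r q * v q)) + (\<Sum>l<d - 1. \<Sum>q<N. cnj (V l p) * (V l q * v q))"
        by (rule arg_cong2[of _ _ _ _ "(+)"]; rule sum.swap)
      finally show ?thesis by (simp only: sum_distrib_left)
    qed
    have "poly D 1 \<noteq> 0"
    proof
      assume "poly D 1 = 0"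
      then obtain v q where v: "q < N" "v q \<noteq> 0" "\<And>p. p < N \<Longrightarrow> (\<Sum>q<N. G 1 p q * v q) = 0"
        unfolding D by (rule det_eq_0E) (rule that)
      have "0 = (\<Sum>p<N. cnj (v p) * (\<Sum>q<N. G 1 p q * v q))" using v(3) by simp
      also have "\<dots> = (\<Sum>p<N. \<Sum>r<N. cnj (v p) * cnj (A 1 r p) * (\<Sum>q<N. A 1 r q * v q))
        + (\<Sum>p<N. \<Sum>l<d - 1. cnj (v p) * cnj (V l p) * (\<Sum>q<N. V l q * v q))"
        unfolding eqG distrib_left sum.distrib by (simp only: sum_distrib_left mult.assoc)
      also have "\<dots> = (\<Sum>r<N. \<Sum>p<N. cnj (v p) * cnj (A 1 r p) * (\<Sum>q<N. A 1 r q * v q))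
        + (\<Sum>l<d - 1. \<Sum>p<N. cnj (v p) * cnj (V l p) * (\<Sum>q<N. V l q * v q))"
        by (rule arg_cong2[of _ _ _ _ "(+)"]; rule sum.swap)
      also have "\<dots> = (\<Sum>r<N. cnj (\<Sum>q<N. A 1 r q * v q) * (\<Sum>q<N. A 1 r q * v q))
        + (\<Sum>l<d - 1. cnj (\<Sum>q<N. V l q * v q) * (\<Sum>q<N. V l q * v q))"
        unfolding cnj_sum complex_cnj_mult sum_distrib_right by (simp only: mult.commute[of "cnj (v _)"])
      finally have e0: "(\<Sum>r<N. cnj (\<Sum>q<N. A 1 r q * v q) * (\<Sum>q<N. A 1 r q * v q))
        + (\<Sum>l<d - 1. cnj (\<Sum>q<N. V l q * v q) * (\<Sum>q<N. V l q * v q)) = 0" by (rule sym)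
      have z1: "\<forall>r\<in>{..<N}. (\<Sum>q<N. A 1 r q * v q) = 0"
        by (rule sum_cnj_self_eq_0(1)[OF finite_lessThan e0 finite_lessThan])
      have z2: "\<forall>l\<in>{..<d - 1}. (\<Sum>q<N. V l q * v q) = 0"
        by (rule sum_cnj_self_eq_0(2)[OF finite_lessThan e0 finite_lessThan])
      have "(\<Sum>q<d * n. blow n m X T p q * v q) = 0" if "p < d * n" for p
      proof -
        have "(\<Sum>q<d * n. blow n m X T p q * v q) = (\<Sum>q<N. A 1 p q * v q)"
          using that by (intro sum.cong) (auto simp: A_def N_def TT1)
        then show ?thesis using z1 that by (simp add: N_def)
      qed
      then have "\<forall>q<d * n. v q = 0" using ker z2 by (simp add: N_def)
      then show False using v(1,2) by (simp add: N_def)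
    qed
    then have "D \<noteq> 0" by auto
    moreover have "cpoly L' M z \<noteq> 0" using cpoly_nonzero[OF e(2,3)] by (simp add: M_def)
    ultimately have "\<exists>s. \<forall>b\<in>{True, False}. poly (if b then D else cpoly L' M z) s \<noteq> 0"
      by (intro poly_common_nonroot) auto
    then obtain s where s: "poly D s \<noteq> 0" "poly (cpoly L' M z) s \<noteq> 0" by auto
    \<comment> \<open>The \<open>d\<close> columns of \<open>w\<close> times \<open>e\<close>,
      evaluated at \<open>s\<close>. Each is in the kernel, and they are independent because their
      entries in the slots \<open>v0\<close> form a nonzero scalar matrix.\<close>
    define y where "y k q = (\<Sum>j<d. qev L M (w (q mod n)) s (q div n) j * qev L' M e s j k)" for k q
    have Ay: "(\<Sum>q<N. A s p q * y k q) = 0" if p: "p < N" and k: "k < d" for p k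
    proof -
      have "(\<Sum>q<N. A s p q * y k q) = (\<Sum>i<d. \<Sum>v<n. \<Sum>j<d. qev d M (B (p mod n) v) s (p div n) i * qev L M (w v) s i j * qev L' M e s j k)"
        unfolding N_def sum_blocks
        by (intro sum.cong refl) (simp add: y_def A_def blow_TT sum_distrib_left mult.assoc)
      also have "\<dots> = (\<Sum>i<d. \<Sum>j<d. \<Sum>v<n. qev d M (B (p mod n) v) s (p div n) i * qev L M (w v) s i j * qev L' M e s j k)"
        by (rule sum.cong[OF refl], rule sum.swap)
      also have "\<dots> = (\<Sum>j<d. \<Sum>i<d. \<Sum>v<n. qev d M (B (p mod n) v) s (p div n) i * qev L M (w v) s i j * qev L' M e s j k)"
        by (rule sum.swap)
      also have "\<dots> = (\<Sum>j<d. qev (d + L) M (act n B w (p mod n)) s (p div n) j * qev L' M e s j k)"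
        unfolding sum_distrib_right[symmetric]
      proof (rule sum.cong[OF refl])
        fix j assume "j \<in> {..<d}"
        then have "(\<Sum>i<d. \<Sum>v<n. qev d M (B (p mod n) v) s (p div n) i * qev L M (w v) s i j)
          = qev (d + L) M (act n B w (p mod n)) s (p div n) j"
          by (intro qev_act[where B = B and w = w and u = "p mod n" and n = n] B w div(1)[OF p]) simp_all
        then show "(\<Sum>i<d. \<Sum>v<n. qev d M (B (p mod n) v) s (p div n) i * qev L M (w v) s i j) * qev L' M e s j k
          = qev (d + L) M (act n B w (p mod n)) s (p div n) j * qev L' M e s j k" by simp
      qed
      also have "\<dots> = 0" using act0 div[OF p] by (simp add: qev_def)
      finally show ?thesis .
    qed
    have yv0: "y k (j * n + v0) = (if j = k then poly (cpoly L' M z) s else 0)" if "j < d" "k < d" for j k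
    proof -
      have "y k (j * n + v0) = qev (L + L') M (star (w v0) e) s j k"
        using qev_star[OF w[OF v0(1)] e(1) that, of M s] v0(1) by (simp add: y_def)
      also have "\<dots> = (if j = k then poly (cpoly L' M z) s else 0)"
        by (rule qev_eq_central[OF star_bounded[OF w[OF v0(1)] e(1)] e(2) e(4) that])
      finally show ?thesis .
    qed
    \<comment> \<open>Only \<open>d - 1\<close> conditions on \<open>d\<close> coefficients: some
      nonzero combination of the columns is also killed by all the forms \<open>V l\<close>.\<close>
    obtain \<alpha> where \<alpha>: "\<exists>k\<in>{..<d}. \<alpha> k \<noteq> 0" "\<forall>l\<in>{..<d - 1}. (\<Sum>k<d. (\<Sum>q<N. V l q * y k q) * \<alpha> k) = 0"
      using underdetermined_system[of "{..<d - 1}" "{..<d}" "\<lambda>l k. \<Sum>q<N. V l q * y k q"] d by auto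
    define Y where "Y q = (\<Sum>k<d. y k q * \<alpha> k)" for q
    have lin: "(\<Sum>q<N. f q * Y q) = (\<Sum>k<d. (\<Sum>q<N. f q * y k q) * \<alpha> k)" for f
    proof -
      have "(\<Sum>q<N. f q * Y q) = (\<Sum>q<N. \<Sum>k<d. f q * y k q * \<alpha> k)" by (simp add: Y_def sum_distrib_left mult.assoc)
      also have "\<dots> = (\<Sum>k<d. \<Sum>q<N. f q * y k q * \<alpha> k)" by (rule sum.swap)
      finally show ?thesis by (simp add: sum_distrib_right)
    qed
    have AY: "(\<Sum>q<N. A s r q * Y q) = 0" if "r < N" for r using Ay that by (simp add: lin)
    have VY: "(\<Sum>q<N. V l q * Y q) = 0" if "l < d - 1" for l using \<alpha>(2) that by (simp add: lin)
    have "(\<Sum>q<N. G s p q * Y q) = 0" for p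
      unfolding eqG using AY VY by simp
    moreover have "\<exists>q<N. Y q \<noteq> 0"
    proof -
      obtain j where j: "j < d" "\<alpha> j \<noteq> 0" using \<alpha>(1) by auto
      have "Y (j * n + v0) = (\<Sum>k<d. if k = j then poly (cpoly L' M z) s * \<alpha> j else 0)"
        unfolding Y_def using j yv0 by (intro sum.cong) auto
      then have "Y (j * n + v0) \<noteq> 0" using j s by simp
      then show ?thesis using block_index_less[OF j(1) v0(1)] by (auto simp: N_def)
    qed
    ultimately have "poly D s = 0" unfolding D det_eq_0_iff_kernel by blast
    then show ?thesis using s by simp
  qed
qed

end

section \<open>Descent in the size of the blow-up\<close>

lemma quantum_plane_exists:
  assumes "0 < d" obtains \<zeta> where "quantum_plane d \<zeta>"
proof
  define \<zeta> where "\<zeta> = cis (2 * pi / real d)"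
  have pow: "\<zeta> ^ k = cis (2 * pi * real k / real d)" for k
    by (simp add: \<zeta>_def DeMoivre mult_ac)
  show "quantum_plane d \<zeta>"
  proof
    show "\<zeta> ^ d = 1" using assms by (simp add: pow)
    show "inj_on (\<lambda>i. \<zeta> ^ i) {..<d}"
      using bij_betw_roots_unity[OF assms] by (simp add: pow bij_betw_def)
  qed fact
qed

text \<open>Solving \<open>A c = \<kappa> e\<^sub>0\<close> and deleting the first block row together with a block column in which \<open>c\<close>
  does not vanish, the kernel of what remains is cut out by the \<open>n - 1\<close> remaining rows of the
  deleted block row.\<close>

lemma blow_descent:
  fixes X T :: "nat \<Rightarrow> nat \<Rightarrow> nat \<Rightarrow> complex"
  assumes n: "0 < n" and nd: "n \<le> d" and det: "blow_det n m (Suc d) X T \<noteq> 0"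
  shows "\<exists>T'. blow_det n m d X T' \<noteq> 0"
proof -
  define N where "N = Suc d * n"
  define A where "A = blow n m X T"
  have inj: "v q = 0" if "\<And>p. p < N \<Longrightarrow> (\<Sum>q<N. A p q * v q) = 0" "q < N" for v q
  proof (rule ccontr)
    assume "v q \<noteq> 0"
    then have "det (mat N N (\<lambda>(p, q). A p q)) = 0"
      unfolding det_eq_0_iff_kernel using that by blast
    then show False using det by (simp add: N_def A_def)
  qed
  \<comment> \<open>The unknown with index \<open>N\<close> is the multiple of the first unit vector
    that \<open>A\<close> should produce, which gives \<open>N\<close> equations in
    \<open>N + 1\<close> unknowns.\<close>
  define S where "S p i = (if i < N then A p i else if p = 0 then - 1 else 0)" for p i :: nat
  obtain x where x: "\<exists>i\<in>{..N}. x i \<noteq> 0" "\<forall>p\<in>{..<N}. (\<Sum>i\<le>N. S p i * x i) = 0"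
    using underdetermined_system[of "{..<N}" "{..N}" S] by auto
  have N0: "0 < N" using n by (simp add: N_def)
  have Ax: "(\<Sum>q<N. A p q * x q) = (if p = 0 then x N else 0)" if "p < N" for p
  proof -
    have "{..N} = insert N {..<N}" by auto
    then have "(\<Sum>i\<le>N. S p i * x i) = S p N * x N + (\<Sum>i<N. S p i * x i)" by simp
    then show ?thesis using x(2) that by (auto simp: S_def)
  qed
  have xN: "x N \<noteq> 0"
  proof
    assume *: "x N = 0"
    then have "x q = 0" if "q < N" for q using inj[of x q] Ax that by simp
    then show False using x(1) * by (metis atMost_iff le_neq_implies_less)
  qed
  have "\<exists>p<N. x p \<noteq> 0"
  proof (rule ccontr)
    assume "\<not> ?thesis"
    then show False using Ax[OF N0] xN by simp
  qed
  then obtain p0 where p0: "p0 < N" "x p0 \<noteq> 0" by blast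
  \<comment> \<open>The block column to be deleted; \<open>skip\<close> enumerates the
    others.\<close>
  define l where "l = p0 div n"
  have l: "l < Suc d" using p0(1) unfolding l_def N_def by (simp add: less_mult_imp_div_less)
  define skip where "skip j = (if j < l then j else Suc j)" for j
  define emb where "emb q = skip (q div n) * n + q mod n" for q
  define T' where "T' i j k = T i (Suc j) (skip k)" for i j k
  \<comment> \<open>Rows \<open>1, ..., n - 1\<close> of the deleted block row. They fit among the
    \<open>d - 1\<close> forms allowed by \<open>regularity\<close> because
    \<open>n \<le> d\<close>.\<close>
  define V where "V k q = (if k < n - 1 then A (Suc k) (emb q) else 0)" for k q
  have blow': "blow n m X T' p q = A (p + n) (emb q)" for p q
    using n by (simp add: blow_def A_def T'_def emb_def)
  obtain \<zeta> where "quantum_plane d \<zeta>" using quantum_plane_exists[of d] n nd by auto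
  then interpret quantum_plane d \<zeta> .
  show ?thesis
  proof (rule regularity[OF n, of m X T' V])
    fix v
    assume v1: "\<forall>p<d * n. (\<Sum>q<d * n. blow n m X T' p q * v q) = 0"
      and v2: "\<forall>k<d - 1. (\<Sum>q<d * n. V k q * v q) = 0"
    \<comment> \<open>\<open>v\<close> extended by zero on the deleted block column.\<close>
    define w where "w r = (if r div n < l then v r else if r div n = l then 0 else v (r - n))" for r
    have w_emb: "w (skip j * n + a) = v (j * n + a)" if "a < n" for j a
      using that n by (auto simp: w_def skip_def)
    have Aw: "(\<Sum>r<N. A p r * w r) = (\<Sum>q<d * n. A p (emb q) * v q)" for p
    proof -
      let ?f = "\<lambda>j. \<Sum>a<n. A p (j * n + a) * w (j * n + a)"
      have "?f l = 0" using n by (intro sum.neutral) (auto simp: w_def)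
      then have "(\<Sum>r<N. A p r * w r) = (\<Sum>j\<in>{..<Suc d} - {l}. ?f j)"
        unfolding N_def sum_blocks using l by (subst sum.remove[of _ l]) auto
      also have "{..<Suc d} - {l} = skip ` {..<d}"
      proof (intro equalityI subsetI)
        fix j assume j: "j \<in> {..<Suc d} - {l}"
        then have "j = skip (if j < l then j else j - 1)" "(if j < l then j else j - 1) < d"
          using l by (auto simp: skip_def)
        then show "j \<in> skip ` {..<d}" by blast
      qed (auto simp: skip_def split: if_splits)
      also have "(\<Sum>j\<in>skip ` {..<d}. ?f j) = (\<Sum>j<d. ?f (skip j))"
        by (rule sum.reindex_cong[of skip]) (auto simp: inj_on_def skip_def split: if_splits)
      also have "\<dots> = (\<Sum>q<d * n. A p (emb q) * v q)"
        unfolding sum_blocks using w_emb by (intro sum.cong refl) (simp add: emb_def)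
      finally show ?thesis .
    qed
    define \<kappa> where "\<kappa> = (\<Sum>r<N. A 0 r * w r)"
    have Aw': "(\<Sum>r<N. A p r * w r) = (if p = 0 then \<kappa> else 0)" if p: "p < N" for p
    proof -
      consider "p = 0" | "0 < p" "p < n" | "n \<le> p" by linarith
      then show ?thesis
      proof cases
        case 2
        then have "p - 1 < n - 1" "p - 1 < d - 1" "Suc (p - 1) = p" using nd by auto
        then show ?thesis using v2[rule_format, of "p - 1"] 2 by (simp add: Aw V_def)
      next
        case 3
        then have "p - n < d * n" "(p - n) + n = p" using p by (auto simp: N_def)
        then show ?thesis using v1[rule_format, of "p - n"] 3 n by (simp add: Aw blow')
      qed (simp add: \<kappa>_def)
    qed
    \<comment> \<open>Both \<open>A w\<close> and \<open>A x\<close> are multiples of the first unit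
      vector, so injectivity makes \<open>w\<close> and \<open>x\<close> proportional. At
      \<open>p0\<close> the vector \<open>w\<close> vanishes and \<open>x\<close> does not, which
      forces \<open>\<kappa> = 0\<close>.\<close>
    have "x N * w q - \<kappa> * x q = 0" if "q < N" for q
    proof (rule inj[OF _ that])
      fix p assume p: "p < N"
      have "(\<Sum>q<N. A p q * (x N * w q - \<kappa> * x q)) = x N * (\<Sum>q<N. A p q * w q) - \<kappa> * (\<Sum>q<N. A p q * x q)"
        by (simp add: right_diff_distrib sum_subtractf sum_distrib_left mult_ac)
      then show "(\<Sum>q<N. A p q * (x N * w q - \<kappa> * x q)) = 0" by (simp add: Aw'[OF p] Ax[OF p])
    qed
    then have wx: "x N * w q = \<kappa> * x q" if "q < N" for q using that by simp
    have "w p0 = 0" by (simp add: w_def l_def)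
    then have "\<kappa> = 0" using wx[OF p0(1)] p0(2) by simp
    then have w0: "w q = 0" if "q < N" for q using wx[OF that] xN by simp
    show "\<forall>q<d * n. v q = 0"
    proof (intro allI impI)
      fix q assume q: "q < d * n"
      then have "q div n < d" "q mod n < n" using n by (auto simp: less_mult_imp_div_less)
      then have "skip (q div n) < Suc d" by (auto simp: skip_def)
      then have "w (skip (q div n) * n + q mod n) = 0"
        using w0 block_index_less[of "skip (q div n)" "Suc d" "q mod n" n] n by (simp add: N_def)
      then show "v q = 0" using w_emb[of "q mod n" "q div n"] n by simp
    qed
  qed
qed

theorem blow_full_at_n:
  fixes X T :: "nat \<Rightarrow> nat \<Rightarrow> nat \<Rightarrow> complex"
  assumes n: "0 < n" and k: "n \<le> k" and "blow_det n m k X T \<noteq> 0"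
  shows "\<exists>T'. blow_det n m n X T' \<noteq> 0"
  using k assms(3)
proof (induction k arbitrary: T rule: dec_induct)
  case base
  then show ?case by blast
next
  case (step k)
  then show ?case using blow_descent[OF n step(1) step.prems] by blast
qed

section \<open>Semi-invariants vanish where all blow-ups are singular\<close>

text \<open>Polarization by inclusion and exclusion: applied to a form of degree \<open>N\<close>
  evaluated at the sum of the arguments with index in \<open>I\<close>, it extracts the part in
  which each of the \<open>N\<close> arguments occurs exactly once.\<close>

definition pol :: "nat \<Rightarrow> (nat set \<Rightarrow> 'a::comm_ring_1) \<Rightarrow> 'a" where
  "pol N F = (\<Sum>I\<in>Pow {..<N}. (- 1) ^ card ({..<N} - I) * F I)"

abbreviation funs :: "nat \<Rightarrow> 'b set \<Rightarrow> (nat \<Rightarrow> 'b) set" where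
  "funs N S \<equiv> PiE {..<N} (\<lambda>_. S)"

abbreviation perms :: "nat \<Rightarrow> (nat \<Rightarrow> nat) set" where
  "perms N \<equiv> {\<pi>. \<pi> permutes {..<N}}"

lemma pol_sum: "pol N (\<lambda>I. \<Sum>t\<in>T. F t I) = (\<Sum>t\<in>T. pol N (F t))"
  unfolding pol_def sum_distrib_left by (rule sum.swap)

lemma pol_mult_left: "pol N (\<lambda>I. c * F I) = c * pol N F"
  unfolding pol_def sum_distrib_left by (intro sum.cong refl) (simp add: mult_ac)

lemma pol_mult_right: "pol N (\<lambda>I. F I * c) = pol N F * c"
  using pol_mult_left[of N c F] by (simp add: mult.commute)

text \<open>Both sides expand the product over \<open>x < N\<close> of \<open>1 + g x\<close>, where
  \<open>g\<close> is 0 on \<open>J\<close> and -1 outside.\<close>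

lemma inclusion_exclusion_surj:
  assumes "J \<subseteq> {..<N}"
  shows "pol N (\<lambda>I. if J \<subseteq> I then 1 else 0) = (if J = {..<N} then 1 else 0 :: 'a::comm_ring_1)"
proof -
  let ?g = "\<lambda>x. if x \<in> J then 0 else - 1 :: 'a"
  have "(\<Prod>x\<in>{..<N}. 1 + ?g x) = (\<Sum>I\<in>Pow {..<N}. (\<Prod>x\<in>I. 1) * (\<Prod>x\<in>{..<N} - I. ?g x))"
    by (rule prod_add) simp
  also have "\<dots> = pol N (\<lambda>I. if J \<subseteq> I then 1 else 0)"
    unfolding pol_def
  proof (rule sum.cong[OF refl])
    fix I
    show "(\<Prod>x\<in>I. 1) * (\<Prod>x\<in>{..<N} - I. ?g x) = (- 1) ^ card ({..<N} - I) * (if J \<subseteq> I then 1 else 0)"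
    proof (cases "J \<subseteq> I")
      case True
      then have "(\<Prod>x\<in>{..<N} - I. ?g x) = (\<Prod>x\<in>{..<N} - I. - 1)" by (intro prod.cong) auto
      then show ?thesis using True by simp
    next
      case False
      then have "\<exists>x\<in>{..<N} - I. ?g x = 0" using assms by auto
      then have "(\<Prod>x\<in>{..<N} - I. ?g x) = 0" by (intro prod_zero) auto
      then show ?thesis using False by simp
    qed
  qed
  also have "(\<Prod>x\<in>{..<N}. 1 + ?g x) = (if J = {..<N} then 1 else 0)"
  proof (cases "J = {..<N}")
    case False
    then have "\<exists>x\<in>{..<N}. 1 + ?g x = 0" using assms by auto
    then have "(\<Prod>x\<in>{..<N}. 1 + ?g x) = 0" by (intro prod_zero) auto
    then show ?thesis using False by simp
  qed simp
  finally show ?thesis by simp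
qed

text \<open>Ryser's formula for the permanent: after expansion into maps \<open>\<phi>\<close> from
  \<open>{..<N}\<close> to itself, inclusion and exclusion leaves only the surjective ones.\<close>

lemma ryser:
  fixes z :: "nat \<Rightarrow> nat \<Rightarrow> 'a::comm_ring_1"
  shows "pol N (\<lambda>I. \<Prod>s<N. \<Sum>j\<in>I. z s j) = (\<Sum>\<pi>\<in>perms N. \<Prod>s<N. z s (\<pi> s))"
proof -
  have "pol N (\<lambda>I. \<Prod>s<N. \<Sum>j\<in>I. z s j) = pol N (\<lambda>I. \<Sum>\<phi>\<in>funs N {..<N}. (if \<phi> ` {..<N} \<subseteq> I then 1 else 0) * (\<Prod>s<N. z s (\<phi> s)))"
    unfolding pol_def
  proof (rule sum.cong[OF refl])
    fix I assume I: "I \<in> Pow {..<N}"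
    then have fI: "finite I" by (auto intro: finite_subset)
    have "(\<Prod>s<N. \<Sum>j\<in>I. z s j) = (\<Sum>\<phi>\<in>funs N I. \<Prod>s<N. z s (\<phi> s))"
      using fI by (intro prod_sum_PiE) auto
    also have "funs N I = {\<phi> \<in> funs N {..<N}. \<phi> ` {..<N} \<subseteq> I}"
      using I by (auto simp: PiE_iff extensional_def)
    also have "(\<Sum>\<phi>\<in>{\<phi> \<in> funs N {..<N}. \<phi> ` {..<N} \<subseteq> I}. \<Prod>s<N. z s (\<phi> s))
      = (\<Sum>\<phi>\<in>funs N {..<N}. if \<phi> ` {..<N} \<subseteq> I then \<Prod>s<N. z s (\<phi> s) else 0)"
      by (rule sum.inter_filter) (simp add: finite_PiE)
    finally show "(- 1) ^ card ({..<N} - I) * (\<Prod>s<N. \<Sum>j\<in>I. z s j)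
      = (- 1) ^ card ({..<N} - I) * (\<Sum>\<phi>\<in>funs N {..<N}. (if \<phi> ` {..<N} \<subseteq> I then 1 else 0) * (\<Prod>s<N. z s (\<phi> s)))"
      by (simp add: if_distrib[of "\<lambda>x. x * _"] cong: if_cong)
  qed
  also have "\<dots> = (\<Sum>\<phi>\<in>funs N {..<N}. pol N (\<lambda>I. if \<phi> ` {..<N} \<subseteq> I then 1 else 0) * (\<Prod>s<N. z s (\<phi> s)))"
    unfolding pol_sum by (simp only: pol_mult_right)
  also have "\<dots> = (\<Sum>\<phi>\<in>funs N {..<N}. if \<phi> ` {..<N} = {..<N} then \<Prod>s<N. z s (\<phi> s) else 0)"
  proof (rule sum.cong[OF refl])
    fix \<phi> assume "\<phi> \<in> funs N {..<N}"
    then have "\<phi> ` {..<N} \<subseteq> {..<N}" by auto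
    then show "pol N (\<lambda>I. if \<phi> ` {..<N} \<subseteq> I then 1 else 0) * (\<Prod>s<N. z s (\<phi> s))
      = (if \<phi> ` {..<N} = {..<N} then \<Prod>s<N. z s (\<phi> s) else 0)"
      by (simp add: inclusion_exclusion_surj)
  qed
  also have "\<dots> = (\<Sum>\<phi>\<in>{\<phi> \<in> funs N {..<N}. \<phi> ` {..<N} = {..<N}}. \<Prod>s<N. z s (\<phi> s))"
    by (rule sum.inter_filter[symmetric]) (simp add: finite_PiE)
  also have "\<dots> = (\<Sum>\<pi>\<in>perms N. \<Prod>s<N. z s (\<pi> s))"
  proof (rule sum.reindex_bij_witness[of _ "\<lambda>\<pi>. restrict \<pi> {..<N}" "\<lambda>\<phi> x. if x < N then \<phi> x else x"])
    fix \<phi> assume "\<phi> \<in> {\<phi> \<in> funs N {..<N}. \<phi> ` {..<N} = {..<N}}"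
    then have \<phi>: "\<phi> \<in> extensional {..<N}" "\<phi> ` {..<N} = {..<N}" by (auto simp: PiE_def)
    show "restrict (\<lambda>x. if x < N then \<phi> x else x) {..<N} = \<phi>"
      using \<phi>(1) by (auto simp: extensional_def restrict_def fun_eq_iff)
    have "inj_on \<phi> {..<N}" using \<phi>(2) by (intro eq_card_imp_inj_on) auto
    then have "bij_betw (\<lambda>x. if x < N then \<phi> x else x) {..<N} {..<N}"
      using \<phi>(2) by (auto simp: bij_betw_def inj_on_def)
    then show "(\<lambda>x. if x < N then \<phi> x else x) \<in> perms N"
      using bij_imp_permutes[of "\<lambda>x. if x < N then \<phi> x else x" "{..<N}"] by auto
    show "(\<Prod>s<N. z s (if s < N then \<phi> s else s)) = (\<Prod>s<N. z s (\<phi> s))" by (intro prod.cong) auto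
  next
    fix \<pi> assume "\<pi> \<in> perms N"
    then have \<pi>: "\<pi> permutes {..<N}" by simp
    show "(\<lambda>x. if x < N then restrict \<pi> {..<N} x else x) = \<pi>"
      using permutes_not_in[OF \<pi>] by (auto simp: fun_eq_iff)
    have "restrict \<pi> {..<N} ` {..<N} = {..<N}" using permutes_image[OF \<pi>] by simp
    moreover have "restrict \<pi> {..<N} \<in> funs N {..<N}" using permutes_in_image[OF \<pi>] by auto
    ultimately show "restrict \<pi> {..<N} \<in> {\<phi> \<in> funs N {..<N}. \<phi> ` {..<N} = {..<N}}" by simp
  qed
  finally show ?thesis .
qed

section \<open>Determinants and mixed discriminants\<close>

lemma det_eq_perms:
  "det (mat N N (\<lambda>(p, q). A p q)) = (\<Sum>\<sigma>\<in>perms N. of_int (sign \<sigma>) * (\<Prod>p<N. A p (\<sigma> p)))"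
proof -
  have "det (mat N N (\<lambda>(p, q). A p q)) = (\<Sum>\<sigma>\<in>perms N. of_int (sign \<sigma>) * (\<Prod>p<N. mat N N (\<lambda>(p, q). A p q) $$ (p, \<sigma> p)))"
    by (subst det_def'[of _ N]) (auto simp: lessThan_atLeast0)
  also have "\<dots> = (\<Sum>\<sigma>\<in>perms N. of_int (sign \<sigma>) * (\<Prod>p<N. A p (\<sigma> p)))"
  proof (intro sum.cong refl arg_cong2[of _ _ _ _ "(*)"] prod.cong)
    fix \<sigma> p assume "\<sigma> \<in> perms N" "p \<in> {..<N}"
    then have "\<sigma> p < N" using permutes_in_image[of \<sigma> "{..<N}" p] by simp
    then show "mat N N (\<lambda>(p, q). A p q) $$ (p, \<sigma> p) = A p (\<sigma> p)" using \<open>p \<in> {..<N}\<close> by simp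
  qed
  finally show ?thesis .
qed

text \<open>The determinant of the vectors \<open>w 0, ..., w (N - 1)\<close> by Leibniz' formula,
  kept free of matrices for the sake of multilinearity.\<close>

definition altprod :: "nat \<Rightarrow> (nat \<Rightarrow> nat \<Rightarrow> 'a::comm_ring_1) \<Rightarrow> 'a" where
  "altprod N w = (\<Sum>\<pi>\<in>perms N. of_int (sign \<pi>) * (\<Prod>s<N. w s (\<pi> s)))"

lemma altprod_multilinear:
  assumes "finite S"
  shows "altprod N (\<lambda>s p. \<Sum>a\<in>S. w s a * e s a p) = (\<Sum>\<alpha>\<in>funs N S. (\<Prod>s<N. w s (\<alpha> s)) * altprod N (\<lambda>s. e s (\<alpha> s)))"
proof -
  have "altprod N (\<lambda>s p. \<Sum>a\<in>S. w s a * e s a p)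
    = (\<Sum>\<pi>\<in>perms N. \<Sum>\<alpha>\<in>funs N S. of_int (sign \<pi>) * (\<Prod>s<N. w s (\<alpha> s) * e s (\<alpha> s) (\<pi> s)))"
    unfolding altprod_def sum_distrib_left[symmetric]
    by (intro sum.cong refl arg_cong2[of _ _ _ _ "(*)"] prod_sum_PiE) (use assms in auto)
  also have "\<dots> = (\<Sum>\<alpha>\<in>funs N S. \<Sum>\<pi>\<in>perms N. of_int (sign \<pi>) * (\<Prod>s<N. w s (\<alpha> s) * e s (\<alpha> s) (\<pi> s)))"
    by (rule sum.swap)
  also have "\<dots> = (\<Sum>\<alpha>\<in>funs N S. (\<Prod>s<N. w s (\<alpha> s)) * altprod N (\<lambda>s. e s (\<alpha> s)))"
    unfolding altprod_def sum_distrib_left prod.distrib by (simp only: mult_ac)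
  finally show ?thesis .
qed

text \<open>\<open>mixdisc N M\<close> is the mixed discriminant of the \<open>N \<times> N\<close> matrices \<open>M 0, \<dots>, M (N - 1)\<close>.\<close>

definition mixdisc :: "nat \<Rightarrow> (nat \<Rightarrow> nat \<Rightarrow> nat \<Rightarrow> 'a::comm_ring_1) \<Rightarrow> 'a" where
  "mixdisc N M = pol N (\<lambda>I. det (mat N N (\<lambda>(p, q). \<Sum>j\<in>I. M j p q)))"

lemma mixdisc_eq:
  "mixdisc N M = (\<Sum>\<pi>\<in>perms N. \<Sum>\<sigma>\<in>perms N. of_int (sign \<sigma>) * (\<Prod>p<N. M (\<pi> p) p (\<sigma> p)))"
proof -
  have "mixdisc N M = (\<Sum>\<sigma>\<in>perms N. of_int (sign \<sigma>) * pol N (\<lambda>I. \<Prod>p<N. \<Sum>j\<in>I. M j p (\<sigma> p)))"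
    unfolding mixdisc_def det_eq_perms pol_sum pol_mult_left ..
  also have "\<dots> = (\<Sum>\<sigma>\<in>perms N. \<Sum>\<pi>\<in>perms N. of_int (sign \<sigma>) * (\<Prod>p<N. M (\<pi> p) p (\<sigma> p)))"
    unfolding ryser sum_distrib_left ..
  also have "\<dots> = (\<Sum>\<pi>\<in>perms N. \<Sum>\<sigma>\<in>perms N. of_int (sign \<sigma>) * (\<Prod>p<N. M (\<pi> p) p (\<sigma> p)))"
    by (rule sum.swap)
  finally show ?thesis .
qed

lemma mixdisc_permute:
  assumes "\<tau> permutes {..<N}" shows "mixdisc N (\<lambda>j. M (\<tau> j)) = mixdisc N M"
  unfolding mixdisc_eq
  using setum_permutations_compose_left[OF assms,
      of "\<lambda>\<pi>. \<Sum>\<sigma>\<in>perms N. of_int (sign \<sigma>) * (\<Prod>p<N. M (\<pi> p) p (\<sigma> p))"]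
  by simp

text \<open>Replacing \<open>\<pi>\<close> by its inverse and \<open>\<sigma>\<close> by
  \<open>\<sigma>\<close> composed with \<open>\<pi>\<close> treats rows and columns alike; in this
  form a rank one matrix splits into its two vectors.\<close>

lemma mixdisc_sym:
  "mixdisc N M = (\<Sum>\<pi>\<in>perms N. \<Sum>\<sigma>\<in>perms N. of_int (sign \<pi>) * of_int (sign \<sigma>) * (\<Prod>s<N. M s (\<pi> s) (\<sigma> s)))"
proof -
  define G where "G \<pi> \<sigma> = (\<Prod>s<N. M s (\<pi> s) (\<sigma> s))" for \<pi> \<sigma>
  have prm: "permutation \<pi>" if "\<pi> \<in> perms N" for \<pi>
    using that permutation_permutes by blast
  have "mixdisc N M = (\<Sum>\<pi>\<in>perms N. \<Sum>\<sigma>\<in>perms N. of_int (sign \<sigma>) * G (inv_into UNIV \<pi>) (\<sigma> \<circ> inv_into UNIV \<pi>))"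
    unfolding mixdisc_eq
  proof (intro sum.cong refl arg_cong2[of _ _ _ _ "(*)"])
    fix \<pi> \<sigma> assume "\<pi> \<in> perms N"
    then show "(\<Prod>p<N. M (\<pi> p) p (\<sigma> p)) = G (inv_into UNIV \<pi>) (\<sigma> \<circ> inv_into UNIV \<pi>)"
      using prod.permutes_inv[of \<pi> "{..<N}" "\<lambda>s p. M s p (\<sigma> p)"] by (simp add: G_def)
  qed
  also have "\<dots> = (\<Sum>\<pi>\<in>perms N. \<Sum>\<sigma>\<in>perms N. of_int (sign \<sigma>) * G \<pi> (\<sigma> \<circ> \<pi>))"
    by (rule sum_permutations_inverse[symmetric, of "\<lambda>\<pi>. \<Sum>\<sigma>\<in>perms N. of_int (sign \<sigma>) * G \<pi> (\<sigma> \<circ> \<pi>)"])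
  also have "\<dots> = (\<Sum>\<pi>\<in>perms N. \<Sum>\<sigma>\<in>perms N. of_int (sign \<pi>) * of_int (sign \<sigma>) * G \<pi> \<sigma>)"
  proof (rule sum.cong[OF refl])
    fix \<pi> assume \<pi>: "\<pi> \<in> perms N"
    then have \<pi>': "inv_into UNIV \<pi> permutes {..<N}" by (simp add: permutes_inv)
    have "(\<Sum>\<sigma>\<in>perms N. of_int (sign \<sigma>) * G \<pi> (\<sigma> \<circ> \<pi>)) = (\<Sum>\<sigma>\<in>perms N. of_int (sign (\<sigma> \<circ> inv_into UNIV \<pi>)) * G \<pi> ((\<sigma> \<circ> inv_into UNIV \<pi>) \<circ> \<pi>))"
      by (rule sum_permutations_compose_right[OF \<pi>'])
    also have "\<dots> = (\<Sum>\<sigma>\<in>perms N. of_int (sign \<pi>) * of_int (sign \<sigma>) * G \<pi> \<sigma>)"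
    proof (rule sum.cong[OF refl])
      fix \<sigma> assume \<sigma>: "\<sigma> \<in> perms N"
      have "sign (\<sigma> \<circ> inv_into UNIV \<pi>) = sign \<sigma> * sign \<pi>"
        using prm[OF \<sigma>] prm[OF \<pi>] by (simp add: sign_compose sign_inverse permutation_inverse)
      moreover have "(\<sigma> \<circ> inv_into UNIV \<pi>) \<circ> \<pi> = \<sigma>"
        using \<pi> by (simp add: comp_assoc permutes_inv_o)
      ultimately show "of_int (sign (\<sigma> \<circ> inv_into UNIV \<pi>)) * G \<pi> ((\<sigma> \<circ> inv_into UNIV \<pi>) \<circ> \<pi>) = of_int (sign \<pi>) * of_int (sign \<sigma>) * G \<pi> \<sigma>"
        by (simp add: mult.commute)
    qed
    finally show "(\<Sum>\<sigma>\<in>perms N. of_int (sign \<sigma>) * G \<pi> (\<sigma> \<circ> \<pi>)) = (\<Sum>\<sigma>\<in>perms N. of_int (sign \<pi>) * of_int (sign \<sigma>) * G \<pi> \<sigma>)" .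
  qed
  finally show ?thesis unfolding G_def .
qed

text \<open>The mixed discriminant is multilinear, and on rank one matrices it is the product of the
  determinant of the column vectors and that of the row vectors.\<close>

lemma mixdisc_rank_one_sums:
  assumes "finite S" and M: "\<And>s p q. s < N \<Longrightarrow> p < N \<Longrightarrow> q < N \<Longrightarrow> M s p q = (\<Sum>b\<in>S. u s b p * v s b q)"
  shows "mixdisc N M = (\<Sum>\<beta>\<in>funs N S. altprod N (\<lambda>s. u s (\<beta> s)) * altprod N (\<lambda>s. v s (\<beta> s)))"
proof -
  have "mixdisc N M = (\<Sum>\<pi>\<in>perms N. \<Sum>\<sigma>\<in>perms N. \<Sum>\<beta>\<in>funs N S.
      of_int (sign \<pi>) * of_int (sign \<sigma>) * (\<Prod>s<N. u s (\<beta> s) (\<pi> s) * v s (\<beta> s) (\<sigma> s)))"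
    unfolding mixdisc_sym sum_distrib_left[symmetric]
  proof (intro sum.cong refl arg_cong2[of _ _ _ _ "(*)"])
    fix \<pi> \<sigma> assume "\<pi> \<in> perms N" "\<sigma> \<in> perms N"
    then have "(\<Prod>s<N. M s (\<pi> s) (\<sigma> s)) = (\<Prod>s<N. \<Sum>b\<in>S. u s b (\<pi> s) * v s b (\<sigma> s))"
      using permutes_in_image[of _ "{..<N}"] by (intro prod.cong refl M) auto
    also have "\<dots> = (\<Sum>\<beta>\<in>funs N S. \<Prod>s<N. u s (\<beta> s) (\<pi> s) * v s (\<beta> s) (\<sigma> s))"
      using assms(1) by (intro prod_sum_PiE) auto
    finally show "(\<Prod>s<N. M s (\<pi> s) (\<sigma> s)) = (\<Sum>\<beta>\<in>funs N S. \<Prod>s<N. u s (\<beta> s) (\<pi> s) * v s (\<beta> s) (\<sigma> s))" .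
  qed
  also have "\<dots> = (\<Sum>\<pi>\<in>perms N. \<Sum>\<beta>\<in>funs N S. \<Sum>\<sigma>\<in>perms N.
      of_int (sign \<pi>) * of_int (sign \<sigma>) * (\<Prod>s<N. u s (\<beta> s) (\<pi> s) * v s (\<beta> s) (\<sigma> s)))"
    by (rule sum.cong[OF refl], rule sum.swap)
  also have "\<dots> = (\<Sum>\<beta>\<in>funs N S. \<Sum>\<pi>\<in>perms N. \<Sum>\<sigma>\<in>perms N.
      of_int (sign \<pi>) * of_int (sign \<sigma>) * (\<Prod>s<N. u s (\<beta> s) (\<pi> s) * v s (\<beta> s) (\<sigma> s)))"
    by (rule sum.swap)
  also have "\<dots> = (\<Sum>\<beta>\<in>funs N S. altprod N (\<lambda>s. u s (\<beta> s)) * altprod N (\<lambda>s. v s (\<beta> s)))"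
    unfolding altprod_def sum_product prod.distrib by (simp only: mult_ac)
  finally show ?thesis .
qed

section \<open>Polarization of powers of the determinant\<close>

lemma det_block_diagonal:
  fixes A :: "nat \<Rightarrow> nat \<Rightarrow> 'a::idom"
  assumes n: "0 < n"
  shows "det (mat (k * n) (k * n) (\<lambda>(p, q). if p div n = q div n then A (p mod n) (q mod n) else 0))
    = det (mat n n (\<lambda>(a, b). A a b)) ^ k"
proof (induction k)
  case 0
  show ?case by simp
next
  case (Suc k)
  let ?f = "\<lambda>(p, q). if p div n = q div n then A (p mod n) (q mod n) else 0"
  let ?P = "mat (k * n) (k * n) ?f" and ?Q = "mat n n (\<lambda>(a, b). A a b)"
  have "mat (Suc k * n) (Suc k * n) ?f = four_block_mat ?P (0\<^sub>m (k * n) n) (0\<^sub>m n (k * n)) ?Q"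
  proof (rule eq_matI)
    fix p q assume "p < dim_row (four_block_mat ?P (0\<^sub>m (k * n) n) (0\<^sub>m n (k * n)) ?Q)"
      "q < dim_col (four_block_mat ?P (0\<^sub>m (k * n) n) (0\<^sub>m n (k * n)) ?Q)"
    then have pq: "p < k * n + n" "q < k * n + n" by auto
    have lt: "x div n < k" if "x < k * n" for x using that by (simp add: less_mult_imp_div_less)
    have ge: "x div n = k" "x mod n = x - k * n" if "\<not> x < k * n" "x < k * n + n" for x
    proof -
      have "x = (x - k * n) + k * n" "x - k * n < n" using that by auto
      then show "x div n = k" "x mod n = x - k * n" using n
        by (metis add.right_neutral add_cancel_right_left div_mult_self3 div_less less_numeral_extra(3) add.commute,
            metis mod_mult_self1 mod_less)
    qed
    show "mat (Suc k * n) (Suc k * n) ?f $$ (p, q) = four_block_mat ?P (0\<^sub>m (k * n) n) (0\<^sub>m n (k * n)) ?Q $$ (p, q)"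
      using pq lt[of p] lt[of q] ge[of p] ge[of q]
      by (cases "p < k * n"; cases "q < k * n") (auto simp: add.commute)
  qed auto
  then show ?case
    using det_four_block_mat_lower_left_zero[of ?P "k * n" "0\<^sub>m (k * n) n" n "0\<^sub>m n (k * n)" ?Q]
    by (simp add: Suc)
qed

text \<open>The unit vector of size \<open>k * n\<close> for position \<open>a\<close> in block
  \<open>b\<close>.\<close>

definition slot :: "nat \<Rightarrow> nat \<Rightarrow> nat \<Rightarrow> nat \<Rightarrow> complex" where
  "slot n b a p = (if p = b * n + a then 1 else 0)"

text \<open>The full polarization of \<open>det A ^ k\<close>, taken at the matrix units with row
  \<open>\<rho> s\<close> and column \<open>\<alpha> s\<close>. It is the mixed discriminant of
  block diagonal matrices with \<open>k\<close> equal blocks (\<open>pairing_eq_mixdisc\<close>),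
  written through its rank one terms.\<close>

definition pairing :: "nat \<Rightarrow> nat \<Rightarrow> nat \<Rightarrow> (nat \<Rightarrow> nat) \<Rightarrow> (nat \<Rightarrow> nat) \<Rightarrow> complex" where
  "pairing n k N \<rho> \<alpha> = (\<Sum>\<beta>\<in>funs N {..<k}. altprod N (\<lambda>s. slot n (\<beta> s) (\<rho> s)) * altprod N (\<lambda>s. slot n (\<beta> s) (\<alpha> s)))"

definition unit_entry :: "nat \<Rightarrow> nat \<Rightarrow> nat \<Rightarrow> nat \<Rightarrow> complex" where
  "unit_entry \<rho> \<alpha> r a = (if r = \<rho> \<and> a = \<alpha> then 1 else 0)"

lemma pairing_eq_mixdisc:
  assumes n: "0 < n" and N: "N = k * n" and "\<And>s. s < N \<Longrightarrow> \<rho> s < n" "\<And>s. s < N \<Longrightarrow> \<alpha> s < n"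
  shows "mixdisc N (\<lambda>s p q. if p div n = q div n then unit_entry (\<rho> s) (\<alpha> s) (p mod n) (q mod n) else 0) = pairing n k N \<rho> \<alpha>"
  unfolding pairing_def
proof (rule mixdisc_rank_one_sums[of "{..<k}" N _ "\<lambda>s b. slot n b (\<rho> s)" "\<lambda>s b. slot n b (\<alpha> s)"])
  fix s p q assume s: "s < N" and p: "p < N" "q < N"
  then have "p div n < k" by (simp add: N less_mult_imp_div_less)
  have iff: "x = b * n + a \<longleftrightarrow> b = x div n \<and> x mod n = a" if "a < n" for x b a using that by auto
  have "(\<Sum>b<k. slot n b (\<rho> s) p * slot n b (\<alpha> s) q)
    = (\<Sum>b<k. if b = p div n then (if p div n = q div n then unit_entry (\<rho> s) (\<alpha> s) (p mod n) (q mod n) else 0) else 0)"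
    using assms(3,4)[OF s] by (intro sum.cong refl) (auto simp: slot_def unit_entry_def iff)
  then show "(if p div n = q div n then unit_entry (\<rho> s) (\<alpha> s) (p mod n) (q mod n) else 0)
    = (\<Sum>b<k. slot n b (\<rho> s) p * slot n b (\<alpha> s) q)"
    using \<open>p div n < k\<close> by simp
qed simp

lemma funs_less: "\<rho> \<in> funs N {..<n} \<Longrightarrow> s < N \<Longrightarrow> \<rho> s < n" by auto

text \<open>Inherited from the symmetry of the mixed discriminant in its matrices.\<close>

lemma pairing_permute:
  assumes "0 < n" "N = k * n" "\<rho> \<in> funs N {..<n}" "\<alpha> \<in> funs N {..<n}" "\<pi> permutes {..<N}"
  shows "pairing n k N (\<rho> \<circ> \<pi>) (\<alpha> \<circ> \<pi>) = pairing n k N \<rho> \<alpha>"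
proof -
  have \<pi>: "\<pi> s < N" if "s < N" for s using permutes_in_image[OF assms(5), of s] that by simp
  let ?M = "\<lambda>s p q. if p div n = q div n then unit_entry (\<rho> s) (\<alpha> s) (p mod n) (q mod n) else 0"
  have "pairing n k N (\<rho> \<circ> \<pi>) (\<alpha> \<circ> \<pi>) = mixdisc N (\<lambda>s. ?M (\<pi> s))"
    using pairing_eq_mixdisc[OF assms(1,2), of "\<lambda>s. \<rho> (\<pi> s)" "\<lambda>s. \<alpha> (\<pi> s)"]
      funs_less[OF assms(3) \<pi>] funs_less[OF assms(4) \<pi>] by (simp add: comp_def)
  also have "\<dots> = mixdisc N ?M" by (rule mixdisc_permute[OF assms(5)])
  also have "\<dots> = pairing n k N \<rho> \<alpha>"
    by (rule pairing_eq_mixdisc[OF assms(1,2) funs_less[OF assms(3)] funs_less[OF assms(4)]])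
  finally show ?thesis .
qed

definition gram :: "nat \<Rightarrow> nat \<Rightarrow> nat \<Rightarrow> complex" where
  "gram n k N = (\<Sum>\<rho>\<in>funs N {..<n}. \<Sum>\<alpha>\<in>funs N {..<n}. pairing n k N \<rho> \<alpha> * pairing n k N \<rho> \<alpha>)"

lemma cnj_altprod_slot: "cnj (altprod N (\<lambda>s. slot n (\<beta> s) (\<rho> s))) = altprod N (\<lambda>s. slot n (\<beta> s) (\<rho> s))"
proof -
  have "cnj (slot n b a p) = slot n b a p" for b a p by (simp add: slot_def)
  then show ?thesis by (simp add: altprod_def)
qed

text \<open>All values of \<open>pairing\<close> are real, so \<open>gram\<close> is a sum of
  squares. On the diagonal \<open>\<alpha> = \<rho>\<close> the pairing is itself a sum of squares,
  so one nonzero \<open>altprod\<close> suffices.\<close>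

lemma gram_nonzero:
  assumes n: "0 < n" and N: "N = k * n"
  shows "gram n k N \<noteq> 0"
proof
  assume g: "gram n k N = 0"
  have real: "cnj (pairing n k N \<rho> \<alpha>) = pairing n k N \<rho> \<alpha>" for \<rho> \<alpha>
    by (simp add: pairing_def cnj_altprod_slot)
  have fin: "finite (funs N {..<i})" for i :: nat by (simp add: finite_PiE)
  let ?R = "funs N {..<n} \<times> funs N {..<n}"
  have "(\<Sum>(\<rho>, \<alpha>)\<in>?R. cnj (pairing n k N \<rho> \<alpha>) * pairing n k N \<rho> \<alpha>) = 0"
    using g by (simp add: gram_def real sum.cartesian_product)
  then have "(\<Sum>x\<in>?R. cnj (pairing n k N (fst x) (snd x)) * pairing n k N (fst x) (snd x)) + (\<Sum>l\<in>({}::nat set). cnj 0 * 0) = 0"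
    by (simp add: case_prod_beta)
  from sum_cnj_self_eq_0(1)[OF _ this] fin
  have p0: "pairing n k N \<rho> \<alpha> = 0" if "\<rho> \<in> funs N {..<n}" "\<alpha> \<in> funs N {..<n}" for \<rho> \<alpha>
    using that by (auto dest!: bspec[of _ _ "(\<rho>, \<alpha>)"])
  \<comment> \<open>With these choices \<open>\<beta> s * n + \<rho> s = s\<close>, so the vectors
    are the standard basis and their determinant is 1.\<close>
  define \<rho> where "\<rho> = restrict (\<lambda>s. s mod n) {..<N}"
  define \<beta> where "\<beta> = restrict (\<lambda>s. s div n) {..<N}"
  have \<rho>: "\<rho> \<in> funs N {..<n}" using n by (auto simp: \<rho>_def)
  have \<beta>: "\<beta> \<in> funs N {..<k}" by (auto simp: \<beta>_def N less_mult_imp_div_less)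
  have "(\<Sum>\<beta>\<in>funs N {..<k}. cnj (altprod N (\<lambda>s. slot n (\<beta> s) (\<rho> s))) * altprod N (\<lambda>s. slot n (\<beta> s) (\<rho> s)))
    + (\<Sum>l\<in>({}::nat set). cnj 0 * 0) = 0"
    using p0[OF \<rho> \<rho>] by (simp add: pairing_def cnj_altprod_slot)
  from sum_cnj_self_eq_0(1)[OF fin this] \<beta> have "altprod N (\<lambda>s. slot n (\<beta> s) (\<rho> s)) = 0" by simp
  moreover have "altprod N (\<lambda>s. slot n (\<beta> s) (\<rho> s)) = (\<Sum>\<pi>\<in>perms N. if \<pi> = id then 1 else 0)"
    unfolding altprod_def
  proof (rule sum.cong[OF refl])
    fix \<pi> assume \<pi>: "\<pi> \<in> perms N"
    show "of_int (sign \<pi>) * (\<Prod>s<N. slot n (\<beta> s) (\<rho> s) (\<pi> s)) = (if \<pi> = id then 1 else 0)"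
    proof (cases "\<pi> = id")
      case True
      have "(\<Prod>s<N. slot n (\<beta> s) (\<rho> s) (\<pi> s)) = (\<Prod>s<N. 1)"
        by (intro prod.cong) (auto simp: True slot_def \<beta>_def \<rho>_def)
      then show ?thesis using True by (simp add: sign_id)
    next
      case False
      then obtain s where s: "\<pi> s \<noteq> s" by (auto simp: fun_eq_iff)
      then have "s < N" using permutes_not_in[of \<pi> "{..<N}" s] \<pi> by auto
      then have "slot n (\<beta> s) (\<rho> s) (\<pi> s) = 0" using s by (simp add: slot_def \<beta>_def \<rho>_def)
      then have "(\<Prod>s<N. slot n (\<beta> s) (\<rho> s) (\<pi> s)) = 0" using \<open>s < N\<close> by (intro prod_zero) auto
      then show ?thesis using False by simp
    qed
  qed
  moreover have "(\<Sum>\<pi>\<in>perms N. if \<pi> = id then 1 else 0 :: complex) = 1"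
    by (subst sum.delta) (auto simp: permutes_id finite_permutations)
  ultimately show False by simp
qed

text \<open>
  One half of the first fundamental theorem: a function of \<open>A\<close> that is a constant times \<open>det A ^ k\<close>
  is polarized and paired with \<open>det A ^ k\<close>; the pairing of \<open>det A ^ k\<close> with itself is \<open>gram\<close>.
\<close>

lemma fft_step:
  fixes c :: "'t \<Rightarrow> complex" and y :: "'t \<Rightarrow> nat \<Rightarrow> nat \<Rightarrow> complex"
  assumes n: "0 < n" and N: "N = k * n"
    and r: "\<And>t s. t \<in> S \<Longrightarrow> s < N \<Longrightarrow> r t s < n"
    and eq: "\<And>A. (\<Sum>t\<in>S. c t * (\<Prod>s<N. \<Sum>a<n. A (r t s) a * y t s a)) = det (mat n n (\<lambda>(a, b). A a b)) ^ k * q"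
  shows "gram n k N * q = fact N * (\<Sum>t\<in>S. c t * (\<Sum>\<alpha>\<in>funs N {..<n}. pairing n k N (restrict (r t) {..<N}) \<alpha> * (\<Prod>s<N. y t s (\<alpha> s))))"
proof -
  let ?P = "funs N {..<n}"
  have finP: "finite ?P" by (simp add: finite_PiE)
  \<comment> \<open>\<open>A\<close> is set to the sum over \<open>j\<close> in \<open>I\<close> of
    the matrix units with row \<open>\<rho> j\<close> and column \<open>\<alpha> j\<close>, and
    \<open>pol\<close> is applied. Ryser's formula turns the left side into a sum over permutations;
    the right side becomes the polarization of the power of the determinant.\<close>
  have polarized: "(\<Sum>t\<in>S. c t * (\<Sum>\<pi>\<in>perms N. \<Prod>s<N. if \<rho> (\<pi> s) = r t s then y t s (\<alpha> (\<pi> s)) else 0)) = pairing n k N \<rho> \<alpha> * q"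
    if \<rho>: "\<rho> \<in> ?P" and \<alpha>: "\<alpha> \<in> ?P" for \<rho> \<alpha>
  proof -
    let ?M = "\<lambda>j. unit_entry (\<rho> j) (\<alpha> j)"
    have "(\<Sum>t\<in>S. c t * (\<Sum>\<pi>\<in>perms N. \<Prod>s<N. \<Sum>a<n. ?M (\<pi> s) (r t s) a * y t s a))
      = (\<Sum>t\<in>S. c t * pol N (\<lambda>I. \<Prod>s<N. \<Sum>j\<in>I. \<Sum>a<n. ?M j (r t s) a * y t s a))"
      unfolding ryser ..
    also have "\<dots> = pol N (\<lambda>I. \<Sum>t\<in>S. c t * (\<Prod>s<N. \<Sum>j\<in>I. \<Sum>a<n. ?M j (r t s) a * y t s a))"
      by (simp only: pol_sum pol_mult_left)
    also have "\<dots> = pol N (\<lambda>I. \<Sum>t\<in>S. c t * (\<Prod>s<N. \<Sum>a<n. (\<Sum>j\<in>I. ?M j (r t s) a) * y t s a))"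
      unfolding sum_distrib_right by (subst sum.swap) (rule refl)
    also have "\<dots> = pol N (\<lambda>I. det (mat n n (\<lambda>(a, b). \<Sum>j\<in>I. ?M j a b)) ^ k * q)"
      using eq[of "\<lambda>a b. \<Sum>j\<in>I. ?M j a b" for I] by simp
    also have "\<dots> = pol N (\<lambda>I. det (mat N N (\<lambda>(p, q). \<Sum>j\<in>I. if p div n = q div n then ?M j (p mod n) (q mod n) else 0))) * q"
    proof -
      have "det (mat n n (\<lambda>(a, b). \<Sum>j\<in>I. ?M j a b)) ^ k
        = det (mat N N (\<lambda>(p, q). \<Sum>j\<in>I. if p div n = q div n then ?M j (p mod n) (q mod n) else 0))" for I
      proof -
        have "(\<lambda>(p, q). \<Sum>j\<in>I. if p div n = q div n then ?M j (p mod n) (q mod n) else 0)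
          = (\<lambda>(p, q). if p div n = q div n then \<Sum>j\<in>I. ?M j (p mod n) (q mod n) else 0)"
          by (auto simp: fun_eq_iff)
        then show ?thesis unfolding N using det_block_diagonal[OF n, of k "\<lambda>a b. \<Sum>j\<in>I. ?M j a b"] by simp
      qed
      then show ?thesis by (simp only: pol_mult_right)
    qed
    also have "\<dots> = pairing n k N \<rho> \<alpha> * q"
      using pairing_eq_mixdisc[OF n N, of \<rho> \<alpha>] funs_less[OF \<rho>] funs_less[OF \<alpha>] by (simp add: mixdisc_def)
    finally have "(\<Sum>t\<in>S. c t * (\<Sum>\<pi>\<in>perms N. \<Prod>s<N. \<Sum>a<n. ?M (\<pi> s) (r t s) a * y t s a)) = pairing n k N \<rho> \<alpha> * q" .
    moreover have "(\<Prod>s<N. \<Sum>a<n. ?M (\<pi> s) (r t s) a * y t s a) = (\<Prod>s<N. if \<rho> (\<pi> s) = r t s then y t s (\<alpha> (\<pi> s)) else 0)"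
      if "\<pi> \<in> perms N" for \<pi> t
    proof (rule prod.cong[OF refl])
      fix s assume "s \<in> {..<N}"
      then have "\<pi> s < N" using permutes_in_image[of \<pi> "{..<N}" s] that by simp
      then have \<alpha>s: "\<alpha> (\<pi> s) < n" by (rule funs_less[OF \<alpha>])
      have "(\<Sum>a<n. ?M (\<pi> s) (r t s) a * y t s a) = (\<Sum>a<n. if a = \<alpha> (\<pi> s) then (if \<rho> (\<pi> s) = r t s then y t s a else 0) else 0)"
        by (intro sum.cong) (auto simp: unit_entry_def)
      then show "(\<Sum>a<n. ?M (\<pi> s) (r t s) a * y t s a) = (if \<rho> (\<pi> s) = r t s then y t s (\<alpha> (\<pi> s)) else 0)"
        using \<alpha>s by simp
    qed
    ultimately show ?thesis by simp
  qed
  have comp: "\<rho> \<circ> \<pi> \<in> ?P" if "\<rho> \<in> ?P" "\<pi> permutes {..<N}" for \<rho> \<pi>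
    using that(1) permutes_in_image[OF that(2)] permutes_not_in[OF that(2)] by (auto simp: PiE_iff extensional_def)
  define G where "G t \<rho> \<alpha> = (\<Prod>s<N. if \<rho> s = r t s then y t s (\<alpha> s) else 0)" for t \<rho> \<alpha>
  \<comment> \<open>Since \<open>pairing\<close> does not change when \<open>\<rho>\<close> and
    \<open>\<alpha>\<close> are permuted together, all permutations \<open>\<pi>\<close> contribute
    equally; this is the factor \<open>fact N\<close>.\<close>
  have reindex: "(\<Sum>\<rho>\<in>?P. \<Sum>\<alpha>\<in>?P. pairing n k N \<rho> \<alpha> * G t (\<rho> \<circ> \<pi>) (\<alpha> \<circ> \<pi>)) = (\<Sum>\<rho>\<in>?P. \<Sum>\<alpha>\<in>?P. pairing n k N \<rho> \<alpha> * G t \<rho> \<alpha>)"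
    if "\<pi> \<in> perms N" for \<pi> t
  proof -
    have \<pi>: "\<pi> permutes {..<N}" using that by simp
    then have \<pi>': "inv_into UNIV \<pi> permutes {..<N}" by (rule permutes_inv)
    have inv1: "f \<circ> \<pi> \<circ> inv_into UNIV \<pi> = f" "f \<circ> inv_into UNIV \<pi> \<circ> \<pi> = f" for f :: "nat \<Rightarrow> nat"
      using permutes_inv_o[OF \<pi>] by (simp_all add: comp_assoc)
    have re: "(\<Sum>\<rho>\<in>?P. F (\<rho> \<circ> \<pi>)) = (\<Sum>\<rho>\<in>?P. F \<rho>)" for F :: "(nat \<Rightarrow> nat) \<Rightarrow> complex"
      by (rule sum.reindex_bij_witness[of _ "\<lambda>f. f \<circ> inv_into UNIV \<pi>" "\<lambda>f. f \<circ> \<pi>"])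
        (auto simp only: inv1 intro!: comp \<pi> \<pi>')
    have "(\<Sum>\<rho>\<in>?P. \<Sum>\<alpha>\<in>?P. pairing n k N \<rho> \<alpha> * G t (\<rho> \<circ> \<pi>) (\<alpha> \<circ> \<pi>))
      = (\<Sum>\<rho>\<in>?P. \<Sum>\<alpha>\<in>?P. pairing n k N (\<rho> \<circ> \<pi>) (\<alpha> \<circ> \<pi>) * G t (\<rho> \<circ> \<pi>) (\<alpha> \<circ> \<pi>))"
      by (intro sum.cong refl) (simp add: pairing_permute[OF n N _ _ \<pi>])
    also have "\<dots> = (\<Sum>\<rho>\<in>?P. \<Sum>\<alpha>\<in>?P. pairing n k N (\<rho> \<circ> \<pi>) \<alpha> * G t (\<rho> \<circ> \<pi>) \<alpha>)"
      by (rule sum.cong[OF refl], rule re)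
    also have "\<dots> = (\<Sum>\<rho>\<in>?P. \<Sum>\<alpha>\<in>?P. pairing n k N \<rho> \<alpha> * G t \<rho> \<alpha>)"
      by (rule re)
    finally show ?thesis .
  qed
  \<comment> \<open>\<open>G t \<rho> \<alpha>\<close> vanishes unless \<open>\<rho>\<close> agrees
    with \<open>r t\<close> below \<open>N\<close>.\<close>
  have pick: "(\<Sum>\<rho>\<in>?P. \<Sum>\<alpha>\<in>?P. pairing n k N \<rho> \<alpha> * G t \<rho> \<alpha>)
    = (\<Sum>\<alpha>\<in>?P. pairing n k N (restrict (r t) {..<N}) \<alpha> * (\<Prod>s<N. y t s (\<alpha> s)))" if t: "t \<in> S" for t
  proof -
    let ?r = "restrict (r t) {..<N}"
    have rP: "?r \<in> ?P" using r[OF t] by auto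
    have "(\<Sum>\<rho>\<in>?P. \<Sum>\<alpha>\<in>?P. pairing n k N \<rho> \<alpha> * G t \<rho> \<alpha>)
      = (\<Sum>\<rho>\<in>?P. if \<rho> = ?r then (\<Sum>\<alpha>\<in>?P. pairing n k N \<rho> \<alpha> * (\<Prod>s<N. y t s (\<alpha> s))) else 0)"
    proof (rule sum.cong[OF refl])
      fix \<rho> assume \<rho>: "\<rho> \<in> ?P"
      show "(\<Sum>\<alpha>\<in>?P. pairing n k N \<rho> \<alpha> * G t \<rho> \<alpha>) = (if \<rho> = ?r then (\<Sum>\<alpha>\<in>?P. pairing n k N \<rho> \<alpha> * (\<Prod>s<N. y t s (\<alpha> s))) else 0)"
      proof (cases "\<rho> = ?r")
        case True
        then have "G t \<rho> \<alpha> = (\<Prod>s<N. y t s (\<alpha> s))" for \<alpha> unfolding G_def by (intro prod.cong) auto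
        then show ?thesis using True by simp
      next
        case False
        have "\<exists>s<N. \<rho> s \<noteq> r t s"
        proof (rule ccontr)
          assume "\<not> ?thesis"
          then have "\<rho> = ?r" by (intro PiE_ext[OF \<rho> rP]) auto
          then show False using False by simp
        qed
        then obtain s where "s < N" "\<rho> s \<noteq> r t s" by blast
        then have "G t \<rho> \<alpha> = 0" for \<alpha> unfolding G_def by (intro prod_zero) auto
        then show ?thesis using False by simp
      qed
    qed
    then show ?thesis using rP finP by simp
  qed
  have "gram n k N * q = (\<Sum>\<rho>\<in>?P. \<Sum>\<alpha>\<in>?P. pairing n k N \<rho> \<alpha> * (pairing n k N \<rho> \<alpha> * q))"
    by (simp add: gram_def sum_distrib_right mult.assoc)
  also have "\<dots> = (\<Sum>\<rho>\<in>?P. \<Sum>\<alpha>\<in>?P. \<Sum>t\<in>S. \<Sum>\<pi>\<in>perms N. c t * (pairing n k N \<rho> \<alpha> * G t (\<rho> \<circ> \<pi>) (\<alpha> \<circ> \<pi>)))"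
  proof (rule sum.cong[OF refl], rule sum.cong[OF refl])
    fix \<rho> \<alpha> assume "\<rho> \<in> ?P" "\<alpha> \<in> ?P"
    from polarized[OF this, symmetric]
    show "pairing n k N \<rho> \<alpha> * (pairing n k N \<rho> \<alpha> * q) = (\<Sum>t\<in>S. \<Sum>\<pi>\<in>perms N. c t * (pairing n k N \<rho> \<alpha> * G t (\<rho> \<circ> \<pi>) (\<alpha> \<circ> \<pi>)))"
      unfolding G_def comp_def by (simp add: sum_distrib_left mult_ac)
  qed
  also have "\<dots> = (\<Sum>\<rho>\<in>?P. \<Sum>t\<in>S. \<Sum>\<alpha>\<in>?P. \<Sum>\<pi>\<in>perms N. c t * (pairing n k N \<rho> \<alpha> * G t (\<rho> \<circ> \<pi>) (\<alpha> \<circ> \<pi>)))"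
    by (rule sum.cong[OF refl], rule sum.swap)
  also have "\<dots> = (\<Sum>t\<in>S. \<Sum>\<rho>\<in>?P. \<Sum>\<alpha>\<in>?P. \<Sum>\<pi>\<in>perms N. c t * (pairing n k N \<rho> \<alpha> * G t (\<rho> \<circ> \<pi>) (\<alpha> \<circ> \<pi>)))"
    by (rule sum.swap)
  also have "\<dots> = (\<Sum>t\<in>S. \<Sum>\<rho>\<in>?P. \<Sum>\<pi>\<in>perms N. \<Sum>\<alpha>\<in>?P. c t * (pairing n k N \<rho> \<alpha> * G t (\<rho> \<circ> \<pi>) (\<alpha> \<circ> \<pi>)))"
    by (rule sum.cong[OF refl], rule sum.cong[OF refl], rule sum.swap)
  also have "\<dots> = (\<Sum>t\<in>S. \<Sum>\<pi>\<in>perms N. \<Sum>\<rho>\<in>?P. \<Sum>\<alpha>\<in>?P. c t * (pairing n k N \<rho> \<alpha> * G t (\<rho> \<circ> \<pi>) (\<alpha> \<circ> \<pi>)))"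
    by (rule sum.cong[OF refl], rule sum.swap)
  also have "\<dots> = (\<Sum>t\<in>S. \<Sum>\<pi>\<in>perms N. c t * (\<Sum>\<rho>\<in>?P. \<Sum>\<alpha>\<in>?P. pairing n k N \<rho> \<alpha> * G t \<rho> \<alpha>))"
    unfolding sum_distrib_left[symmetric] using reindex by (intro sum.cong refl) simp
  also have "\<dots> = (\<Sum>t\<in>S. fact N * (c t * (\<Sum>\<alpha>\<in>?P. pairing n k N (restrict (r t) {..<N}) \<alpha> * (\<Prod>s<N. y t s (\<alpha> s)))))"
    using pick by (intro sum.cong refl) (simp add: card_permutations[of "{..<N}" N])
  finally show ?thesis by (simp add: sum_distrib_left)
qed

section \<open>Semi-invariants as combinations of blow-up determinants\<close>

text \<open>Polarization needs the factors of a monomial numbered, with repetitions.\<close>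

lemma mev_as_product:
  assumes "supp t \<subseteq> V"
  shows "\<exists>l. (\<forall>s<mdeg t. l s \<in> V) \<and> (\<forall>x::'v \<Rightarrow> 'a::comm_ring_1. mev x t = (\<Prod>s<mdeg t. x (l s)))"
  using assms
proof (induction "mdeg t" arbitrary: t)
  case 0
  then have "t = 0" by (simp add: mdeg_eq_0_iff)
  then show ?case by simp
next
  case (Suc k)
  then have "t \<noteq> 0" by auto
  then obtain v where v: "v \<in> supp t" by (metis ex_in_conv keys_eq_empty)
  then obtain t' where t': "t = sgl v 1 + t'" "supp t' \<subseteq> supp t" by (rule supp_split_var)
  have k: "mdeg t' = k" using Suc(2) t'(1) by simp
  with Suc(1)[of t'] Suc.prems t'(2) obtain l where l: "\<forall>s<k. l s \<in> V" "\<forall>x::'v \<Rightarrow> 'a. mev x t' = (\<Prod>s<k. x (l s))"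
    by auto
  have "v \<in> V" using v Suc.prems by auto
  then show ?case
    using l k by (intro exI[of _ "l(k := v)"]) (auto simp: t'(1) mev_add less_Suc_eq mult.commute)
qed

text \<open>Each term of the inclusion-exclusion sum is a blow-up determinant: \<open>T l\<close>
  collects the matrix units at \<open>(\<beta> j, \<gamma> j)\<close> for those \<open>j\<close> in
  \<open>I\<close> with \<open>i j = l\<close>.\<close>

lemma mixdisc_blow_zero:
  assumes n: "0 < n" and N: "N = k * n"
    and van: "\<And>T. blow_det n m k X T = 0" and i: "\<And>s. s < N \<Longrightarrow> i s < m"
  shows "mixdisc N (\<lambda>s p q. if p div n = \<beta> s \<and> q div n = \<gamma> s then X (i s) (p mod n) (q mod n) else 0) = 0"
  unfolding mixdisc_def pol_def
proof (intro sum.neutral ballI)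
  fix I assume "I \<in> Pow {..<N}"
  then have im: "i j < m" if "j \<in> I" for j using i that by auto
  define T where "T l x z = (\<Sum>j\<in>I. if i j = l \<and> x = \<beta> j \<and> z = \<gamma> j then 1 else 0 :: 'a)" for l x z
  have "(\<Sum>j\<in>I. if p div n = \<beta> j \<and> q div n = \<gamma> j then X (i j) (p mod n) (q mod n) else 0) = blow n m X T p q" for p q
  proof -
    have "blow n m X T p q = (\<Sum>l<m. \<Sum>j\<in>I. if l = i j then (if p div n = \<beta> j \<and> q div n = \<gamma> j then X (i j) (p mod n) (q mod n) else 0) else 0)"
      unfolding blow_def T_def sum_distrib_right by (intro sum.cong refl) auto
    also have "\<dots> = (\<Sum>j\<in>I. \<Sum>l<m. if l = i j then (if p div n = \<beta> j \<and> q div n = \<gamma> j then X (i j) (p mod n) (q mod n) else 0) else 0)"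
      by (rule sum.swap)
    also have "\<dots> = (\<Sum>j\<in>I. if p div n = \<beta> j \<and> q div n = \<gamma> j then X (i j) (p mod n) (q mod n) else 0)"
      using im by (intro sum.cong refl) simp
    finally show ?thesis by simp
  qed
  then show "(- 1) ^ card ({..<N} - I) * det (mat N N (\<lambda>(p, q). \<Sum>j\<in>I. if p div n = \<beta> j \<and> q div n = \<gamma> j then X (i j) (p mod n) (q mod n) else 0)) = 0"
    using van[of T] by (simp add: N)
qed

text \<open>A matrix with the single nonzero block \<open>Y s\<close> is a sum of \<open>n\<close>
  rank one matrices, one for each column of \<open>Y s\<close>.\<close>

lemma mixdisc_blow:
  assumes n: "0 < n" and N: "N = k * n"
  shows "mixdisc N (\<lambda>s p q. if p div n = \<beta> s \<and> q div n = \<gamma> s then Y s (p mod n) (q mod n) else 0)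
    = (\<Sum>\<alpha>'\<in>funs N {..<n}. \<Sum>\<alpha>\<in>funs N {..<n}. (\<Prod>s<N. Y s (\<alpha> s) (\<alpha>' s))
      * altprod N (\<lambda>s. slot n (\<beta> s) (\<alpha> s)) * altprod N (\<lambda>s. slot n (\<gamma> s) (\<alpha>' s)))"
proof -
  have iff: "x = b * n + a \<longleftrightarrow> x div n = b \<and> x mod n = a" if "a < n" for x b a using that by auto
  have "mixdisc N (\<lambda>s p q. if p div n = \<beta> s \<and> q div n = \<gamma> s then Y s (p mod n) (q mod n) else 0)
    = (\<Sum>\<alpha>'\<in>funs N {..<n}. altprod N (\<lambda>s p. \<Sum>a<n. Y s a (\<alpha>' s) * slot n (\<beta> s) a p) * altprod N (\<lambda>s. slot n (\<gamma> s) (\<alpha>' s)))"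
  proof (rule mixdisc_rank_one_sums[of "{..<n}" N _ "\<lambda>s a' p. \<Sum>a<n. Y s a a' * slot n (\<beta> s) a p" "\<lambda>s. slot n (\<gamma> s)"])
    fix s p q
    have u: "(\<Sum>a<n. Y s a a' * slot n (\<beta> s) a p) = (if p div n = \<beta> s then Y s (p mod n) a' else 0)" for a'
    proof -
      have "(\<Sum>a<n. Y s a a' * slot n (\<beta> s) a p) = (\<Sum>a<n. if a = p mod n then (if p div n = \<beta> s then Y s a a' else 0) else 0)"
        by (intro sum.cong refl) (auto simp: slot_def iff)
      then show ?thesis using n by simp
    qed
    have "(\<Sum>b<n. (\<Sum>a<n. Y s a b * slot n (\<beta> s) a p) * slot n (\<gamma> s) b q)
      = (\<Sum>b<n. if b = q mod n then (if p div n = \<beta> s \<and> q div n = \<gamma> s then Y s (p mod n) b else 0) else 0)"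
      unfolding u by (intro sum.cong refl) (auto simp: slot_def iff)
    then show "(if p div n = \<beta> s \<and> q div n = \<gamma> s then Y s (p mod n) (q mod n) else 0)
      = (\<Sum>b<n. (\<Sum>a<n. Y s a b * slot n (\<beta> s) a p) * slot n (\<gamma> s) b q)"
      using n by simp
  qed simp
  also have "\<dots> = (\<Sum>\<alpha>'\<in>funs N {..<n}. \<Sum>\<alpha>\<in>funs N {..<n}. (\<Prod>s<N. Y s (\<alpha> s) (\<alpha>' s))
      * altprod N (\<lambda>s. slot n (\<beta> s) (\<alpha> s)) * altprod N (\<lambda>s. slot n (\<gamma> s) (\<alpha>' s)))"
    by (intro sum.cong refl) (simp add: altprod_multilinear sum_distrib_right)
  finally show ?thesis .
qed

text \<open>\<open>fft_step\<close> is applied to the row action and then to the column action. This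
  writes \<open>gram^2\<close> times the value of \<open>h\<close> as a combination of mixed
  discriminants of blocks \<open>X i\<close>, and these are polarized blow-up determinants.\<close>

theorem semi_invariant_vanishes:
  fixes h :: "(nat \<times> nat \<times> nat, complex) mp" and X :: "nat \<times> nat \<times> nat \<Rightarrow> complex"
  assumes n: "0 < n" and h: "h \<in> HP ({..<m} \<times> {..<n} \<times> {..<n}) (k * n)"
    and semi: "\<And>A B. ev (\<lambda>(i, r, c). \<Sum>a<n. \<Sum>b<n. A r a * X (i, a, b) * B b c) h
      = det (mat n n (\<lambda>(a, b). A a b)) ^ k * det (mat n n (\<lambda>(a, b). B a b)) ^ k * ev X h"
    and van: "\<And>T. blow_det n m k (\<lambda>i a b. X (i, a, b)) T = 0"
  shows "ev X h = 0"
proof -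
  define N where "N = k * n"
  let ?P = "funs N {..<n}"
  have "\<exists>l. (\<forall>s<N. l s \<in> {..<m} \<times> {..<n} \<times> {..<n}) \<and> (\<forall>x::nat \<times> nat \<times> nat \<Rightarrow> complex. mev x t = (\<Prod>s<N. x (l s)))"
    if "t \<in> supp h" for t
  proof -
    have "supp t \<subseteq> {..<m} \<times> {..<n} \<times> {..<n}" "mdeg t = N" using h that by (auto simp: HP_def N_def)
    then show ?thesis using mev_as_product[of t] by blast
  qed
  then have "\<forall>t\<in>supp h. \<exists>l. (\<forall>s<N. l s \<in> {..<m} \<times> {..<n} \<times> {..<n}) \<and> (\<forall>x::nat \<times> nat \<times> nat \<Rightarrow> complex. mev x t = (\<Prod>s<N. x (l s)))" by blast
  from bchoice[OF this] obtain L where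
    L: "\<forall>t\<in>supp h. (\<forall>s<N. L t s \<in> {..<m} \<times> {..<n} \<times> {..<n}) \<and> (\<forall>x::nat \<times> nat \<times> nat \<Rightarrow> complex. mev x t = (\<Prod>s<N. x (L t s)))" ..
  define i where "i t s = fst (L t s)" for t s
  define r where "r t s = fst (snd (L t s))" for t s
  define c where "c t s = snd (snd (L t s))" for t s
  have L_eq: "L t s = (i t s, r t s, c t s)" for t s by (simp add: i_def r_def c_def)
  have bounds: "i t s < m" "r t s < n" "c t s < n" if "t \<in> supp h" "s < N" for t s
    using L that by (auto simp: i_def r_def c_def mem_Times_iff)
  have ev_h: "ev x h = (\<Sum>t\<in>supp h. cf h t * (\<Prod>s<N. x (i t s, r t s, c t s)))" for x
    unfolding hev_def using L by (intro sum.cong refl) (simp add: L_eq)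
  have step1: "gram n k N * (det (mat n n (\<lambda>(a, b). B a b)) ^ k * ev X h)
    = fact N * (\<Sum>t\<in>supp h. cf h t * (\<Sum>\<alpha>\<in>?P. pairing n k N (restrict (r t) {..<N}) \<alpha> * (\<Prod>s<N. \<Sum>b<n. X (i t s, \<alpha> s, b) * B b (c t s))))" for B
  proof (rule fft_step[OF n N_def, of "supp h" r "cf h" "\<lambda>t s a. \<Sum>b<n. X (i t s, a, b) * B b (c t s)"])
    fix A
    have "(\<Sum>t\<in>supp h. cf h t * (\<Prod>s<N. \<Sum>a<n. A (r t s) a * (\<Sum>b<n. X (i t s, a, b) * B b (c t s))))
      = ev (\<lambda>(i, r, c). \<Sum>a<n. \<Sum>b<n. A r a * X (i, a, b) * B b c) h"
      unfolding ev_h by (simp add: sum_distrib_left mult.assoc)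
    also have "\<dots> = det (mat n n (\<lambda>(a, b). A a b)) ^ k * (det (mat n n (\<lambda>(a, b). B a b)) ^ k * ev X h)"
      unfolding semi by (rule mult.assoc)
    finally show "(\<Sum>t\<in>supp h. cf h t * (\<Prod>s<N. \<Sum>a<n. A (r t s) a * (\<Sum>b<n. X (i t s, a, b) * B b (c t s))))
      = det (mat n n (\<lambda>(a, b). A a b)) ^ k * (det (mat n n (\<lambda>(a, b). B a b)) ^ k * ev X h)" .
  qed (use bounds in auto)
  \<comment> \<open>The second application runs over pairs of a monomial and the index function
    \<open>\<alpha>\<close> left over by the first one; the matrix is transposed because
    \<open>B\<close> acts from the right.\<close>
  let ?c = "\<lambda>(t, \<alpha>). fact N * cf h t * pairing n k N (restrict (r t) {..<N}) \<alpha>"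
  have "gram n k N * (gram n k N * ev X h)
    = fact N * (\<Sum>x\<in>supp h \<times> ?P. ?c x * (\<Sum>\<alpha>'\<in>?P. pairing n k N (restrict (c (fst x)) {..<N}) \<alpha>' * (\<Prod>s<N. X (i (fst x) s, snd x s, \<alpha>' s))))"
  proof (rule fft_step[OF n N_def, of "supp h \<times> ?P" "\<lambda>x. c (fst x)" ?c "\<lambda>x s b. X (i (fst x) s, snd x s, b)"])
    fix A
    have "(\<Sum>x\<in>supp h \<times> ?P. ?c x * (\<Prod>s<N. \<Sum>b<n. A (c (fst x) s) b * X (i (fst x) s, snd x s, b)))
      = fact N * (\<Sum>t\<in>supp h. cf h t * (\<Sum>\<alpha>\<in>?P. pairing n k N (restrict (r t) {..<N}) \<alpha> * (\<Prod>s<N. \<Sum>b<n. X (i t s, \<alpha> s, b) * A (c t s) b)))"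
      by (simp add: sum.cartesian_product case_prod_beta sum_distrib_left mult_ac)
    also have "\<dots> = gram n k N * (det (mat n n (\<lambda>(a, b). A b a)) ^ k * ev X h)"
      by (rule step1[of "\<lambda>a b. A b a", symmetric])
    also have "det (mat n n (\<lambda>(a, b). A b a)) = det (mat n n (\<lambda>(a, b). A a b))" by (rule det_mat_transpose)
    also have "gram n k N * (det (mat n n (\<lambda>(a, b). A a b)) ^ k * ev X h)
      = det (mat n n (\<lambda>(a, b). A a b)) ^ k * (gram n k N * ev X h)" by (rule mult.left_commute)
    finally show "(\<Sum>x\<in>supp h \<times> ?P. ?c x * (\<Prod>s<N. \<Sum>b<n. A (c (fst x) s) b * X (i (fst x) s, snd x s, b)))
      = det (mat n n (\<lambda>(a, b). A a b)) ^ k * (gram n k N * ev X h)" .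
  qed (use bounds in auto)
  also have "(\<Sum>x\<in>supp h \<times> ?P. ?c x * (\<Sum>\<alpha>'\<in>?P. pairing n k N (restrict (c (fst x)) {..<N}) \<alpha>' * (\<Prod>s<N. X (i (fst x) s, snd x s, \<alpha>' s))))
    = (\<Sum>t\<in>supp h. fact N * cf h t * (\<Sum>\<alpha>\<in>?P. \<Sum>\<alpha>'\<in>?P. pairing n k N (restrict (r t) {..<N}) \<alpha> * pairing n k N (restrict (c t) {..<N}) \<alpha>' * (\<Prod>s<N. X (i t s, \<alpha> s, \<alpha>' s))))"
    unfolding sum.cartesian_product' by (simp add: sum_distrib_left mult_ac)
  also have "\<dots> = 0"
  proof (intro sum.neutral ballI)
    fix t assume t: "t \<in> supp h"
    let ?D = "\<lambda>\<beta> \<alpha>. altprod N (\<lambda>s. slot n (\<beta> s) (\<alpha> s))"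
    let ?K = "funs N {..<k}"
    let ?r = "restrict (r t) {..<N}" and ?c = "restrict (c t) {..<N}"
    let ?X = "\<lambda>\<alpha> \<alpha>'. \<Prod>s<N. X (i t s, \<alpha> s, \<alpha>' s)"
    have zero: "(\<Sum>\<alpha>\<in>?P. \<Sum>\<alpha>'\<in>?P. ?D \<beta> \<alpha> * ?D \<gamma> \<alpha>' * ?X \<alpha> \<alpha>') = 0" for \<beta> \<gamma>
    proof -
      have "(\<Sum>\<alpha>\<in>?P. \<Sum>\<alpha>'\<in>?P. ?D \<beta> \<alpha> * ?D \<gamma> \<alpha>' * ?X \<alpha> \<alpha>') = (\<Sum>\<alpha>'\<in>?P. \<Sum>\<alpha>\<in>?P. ?X \<alpha> \<alpha>' * ?D \<beta> \<alpha> * ?D \<gamma> \<alpha>')"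
        by (subst sum.swap) (simp add: mult_ac)
      also have "\<dots> = 0"
        using mixdisc_blow[OF n N_def, of \<beta> \<gamma> "\<lambda>s a b. X (i t s, a, b)"]
          mixdisc_blow_zero[OF n N_def van, of "i t" \<beta> \<gamma>] bounds[OF t] by simp
      finally show ?thesis .
    qed
    have "(\<Sum>\<alpha>\<in>?P. \<Sum>\<alpha>'\<in>?P. pairing n k N ?r \<alpha> * pairing n k N ?c \<alpha>' * ?X \<alpha> \<alpha>')
      = (\<Sum>\<alpha>\<in>?P. \<Sum>\<alpha>'\<in>?P. \<Sum>\<beta>\<in>?K. \<Sum>\<gamma>\<in>?K. ?D \<beta> ?r * ?D \<gamma> ?c * (?D \<beta> \<alpha> * ?D \<gamma> \<alpha>' * ?X \<alpha> \<alpha>'))"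
      unfolding pairing_def sum_product unfolding sum_distrib_right by (simp only: mult_ac)
    also have "\<dots> = (\<Sum>\<alpha>\<in>?P. \<Sum>\<beta>\<in>?K. \<Sum>\<alpha>'\<in>?P. \<Sum>\<gamma>\<in>?K. ?D \<beta> ?r * ?D \<gamma> ?c * (?D \<beta> \<alpha> * ?D \<gamma> \<alpha>' * ?X \<alpha> \<alpha>'))"
      by (rule sum.cong[OF refl], rule sum.swap)
    also have "\<dots> = (\<Sum>\<beta>\<in>?K. \<Sum>\<alpha>\<in>?P. \<Sum>\<alpha>'\<in>?P. \<Sum>\<gamma>\<in>?K. ?D \<beta> ?r * ?D \<gamma> ?c * (?D \<beta> \<alpha> * ?D \<gamma> \<alpha>' * ?X \<alpha> \<alpha>'))"
      by (rule sum.swap)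
    also have "\<dots> = (\<Sum>\<beta>\<in>?K. \<Sum>\<alpha>\<in>?P. \<Sum>\<gamma>\<in>?K. \<Sum>\<alpha>'\<in>?P. ?D \<beta> ?r * ?D \<gamma> ?c * (?D \<beta> \<alpha> * ?D \<gamma> \<alpha>' * ?X \<alpha> \<alpha>'))"
      by (rule sum.cong[OF refl], rule sum.cong[OF refl], rule sum.swap)
    also have "\<dots> = (\<Sum>\<beta>\<in>?K. \<Sum>\<gamma>\<in>?K. \<Sum>\<alpha>\<in>?P. \<Sum>\<alpha>'\<in>?P. ?D \<beta> ?r * ?D \<gamma> ?c * (?D \<beta> \<alpha> * ?D \<gamma> \<alpha>' * ?X \<alpha> \<alpha>'))"
      by (rule sum.cong[OF refl], rule sum.swap)
    also have "\<dots> = 0"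
      unfolding sum_distrib_left[symmetric] zero by simp
    finally show "fact N * cf h t * (\<Sum>\<alpha>\<in>?P. \<Sum>\<alpha>'\<in>?P. pairing n k N ?r \<alpha> * pairing n k N ?c \<alpha>' * ?X \<alpha> \<alpha>') = 0" by simp
  qed
  finally show ?thesis using gram_nonzero[OF n N_def] by simp
qed

section \<open>Weighted forms and linear subspaces of polynomials\<close>

text \<open>Two weights matter: with weight 1 (\<open>dot\<close>) the form expresses linear
  functionals, with the factorial weight \<open>mono_fact\<close> (\<open>apolar\<close>) it makes
  transposed substitutions adjoint.\<close>

definition wform :: "('v mono \<Rightarrow> 'a) \<Rightarrow> ('v, 'a::comm_ring_1) mp \<Rightarrow> ('v, 'a) mp \<Rightarrow> 'a" where
  "wform W p q = (\<Sum>t\<in>supp p. W t * cf p t * cf q t)"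

lemma wform_superset: "finite T \<Longrightarrow> supp p \<subseteq> T \<Longrightarrow> wform W p q = (\<Sum>t\<in>T. W t * cf p t * cf q t)"
  unfolding wform_def by (rule sum.mono_neutral_left) (auto simp: in_keys_iff)

lemma wform_superset_right:
  assumes "finite T" "supp q \<subseteq> T" shows "wform W p q = (\<Sum>t\<in>T. W t * cf p t * cf q t)"
proof -
  have "wform W p q = (\<Sum>t\<in>supp p \<union> T. W t * cf p t * cf q t)" by (rule wform_superset) (use assms in auto)
  also have "\<dots> = (\<Sum>t\<in>T. W t * cf p t * cf q t)"
  proof (rule sum.mono_neutral_right)
    show "\<forall>t\<in>supp p \<union> T - T. W t * cf p t * cf q t = 0"
    proof
      fix t assume "t \<in> supp p \<union> T - T"
      then have "t \<notin> supp q" using assms(2) by blast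
      then show "W t * cf p t * cf q t = 0" by (simp add: in_keys_iff)
    qed
  qed (use assms in auto)
  finally show ?thesis .
qed

lemma wform_commute: "wform W p q = wform W q p"
proof -
  have "wform W p q = (\<Sum>t\<in>supp q. W t * cf p t * cf q t)" by (rule wform_superset_right) auto
  also have "\<dots> = wform W q p" unfolding wform_def by (rule sum.cong[OF refl]) (simp add: mult_ac)
  finally show ?thesis .
qed

lemma wform_add_right: "wform W p (q + r) = wform W p q + wform W p r"
  by (simp add: wform_def lookup_add distrib_left sum.distrib)

lemma wform_add_left: "wform W (q + r) p = wform W q p + wform W r p"
  by (simp only: wform_commute[of W _ p] wform_add_right)

lemma wform_Const_right: "wform W p (Const c * q) = c * wform W p q"
  unfolding wform_def mp_Const_mult_cf sum_distrib_left by (rule sum.cong[OF refl]) (simp add: mult_ac)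

lemma wform_Const_left: "wform W (Const c * q) p = c * wform W q p"
  by (simp only: wform_commute[of W _ p] wform_Const_right)

lemma wform_diff_right: "wform W p (q - r) = wform W p q - wform W p r"
  by (simp add: wform_def lookup_minus right_diff_distrib sum_subtractf)

lemma wform_diff_left: "wform W (q - r) p = wform W q p - wform W r p"
  by (simp only: wform_commute[of W _ p] wform_diff_right)

lemma wform_0 [simp]: "wform W 0 p = 0" "wform W p 0 = 0"
  by (simp_all add: wform_def)

lemma wform_sum_right: "wform W p (\<Sum>i\<in>I. f i) = (\<Sum>i\<in>I. wform W p (f i))"
  by (induction I rule: infinite_finite_induct) (auto simp: wform_add_right)

lemma wform_self_eq_0:
  fixes p :: "('v, 'a::linordered_field) mp"
  assumes "\<And>t. 0 < W t" "wform W p p = 0" shows "p = 0"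
proof -
  have "(\<Sum>t\<in>supp p. W t * cf p t * cf p t) = 0" using assms(2) by (simp add: wform_def)
  moreover have pos: "0 < W t * cf p t * cf p t" if "t \<in> supp p" for t
  proof -
    have "cf p t \<noteq> 0" using that by (simp add: in_keys_iff)
    then have "0 < cf p t * cf p t" by (metis linorder_neqE mult_neg_neg mult_pos_pos)
    then show ?thesis using assms(1)[of t] by (simp add: mult.assoc)
  qed
  ultimately have "supp p = {}"
    using sum_pos[OF finite_keys _ pos, of p] by force
  then show ?thesis by simp
qed

definition lin :: "('v, 'a::comm_ring_1) mp set \<Rightarrow> bool" where
  "lin U \<longleftrightarrow> 0 \<in> U \<and> (\<forall>p\<in>U. \<forall>q\<in>U. p + q \<in> U) \<and> (\<forall>p\<in>U. \<forall>c. Const c * p \<in> U)"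

lemma linI:
  assumes "0 \<in> U" "\<And>p q. p \<in> U \<Longrightarrow> q \<in> U \<Longrightarrow> p + q \<in> U" "\<And>p c. p \<in> U \<Longrightarrow> Const c * p \<in> U"
  shows "lin U"
  using assms by (simp add: lin_def)

lemma lin_0: "lin U \<Longrightarrow> 0 \<in> U" by (simp add: lin_def)
lemma lin_add: "lin U \<Longrightarrow> p \<in> U \<Longrightarrow> q \<in> U \<Longrightarrow> p + q \<in> U" by (simp add: lin_def)
lemma lin_Const: "lin U \<Longrightarrow> p \<in> U \<Longrightarrow> Const c * p \<in> U" by (simp add: lin_def)
lemma Const_minus_1: "Const (- 1) * p = - (p :: ('v, 'a::comm_ring_1) mp)"
  by (rule poly_mapping_eqI) (simp add: mp_Const_mult_cf)
lemma lin_diff: "lin U \<Longrightarrow> p \<in> U \<Longrightarrow> q \<in> U \<Longrightarrow> p - q \<in> U"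
  using lin_add[of U p "- q"] lin_Const[of U q "- 1"] by (simp add: Const_minus_1)
lemma lin_sum: "lin U \<Longrightarrow> (\<And>i. i \<in> I \<Longrightarrow> f i \<in> U) \<Longrightarrow> (\<Sum>i\<in>I. f i) \<in> U"
  by (induction I rule: infinite_finite_induct) (auto simp: lin_0 lin_add)

lemma lin_HP: "lin (HP V e :: ('v, 'a::comm_ring_1) mp set)"
  by (rule linI) (auto intro: HP_add HP_Const_mult)

text \<open>Gram-Schmidt without norms, valid over any ordered field: the elements of
  \<open>U\<close> without the monomial \<open>t\<close> form a subspace of codimension at most one,
  to which the induction hypothesis applies.\<close>

lemma orthogonal_projection:
  fixes U :: "('v, 'a::linordered_field) mp set"
  assumes "finite T" "lin U" "\<And>p. p \<in> U \<Longrightarrow> supp p \<subseteq> T" and W: "\<And>t. 0 < W t"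
  shows "\<exists>u\<in>U. \<forall>u'\<in>U. wform W (h - u) u' = 0"
  using assms(1-3)
proof (induction T arbitrary: U h rule: finite_induct)
  case empty
  then have "U \<subseteq> {0}" by auto
  then show ?case using lin_0[OF empty(1)] by (intro bexI[of _ 0]) auto
next
  case (insert t T)
  define U0 where "U0 = {u\<in>U. cf u t = 0}"
  have U0: "lin U0"
    using insert.prems(1) by (auto simp: lin_def U0_def lookup_add mp_Const_mult_cf)
  have U0T: "supp p \<subseteq> T" if "p \<in> U0" for p
    using insert.prems(2)[of p] that by (auto simp: U0_def in_keys_iff)
  have proj: "\<exists>u\<in>U0. \<forall>u'\<in>U0. wform W (h - u) u' = 0" for h
    by (rule insert.IH[OF U0 U0T])
  show ?case
  proof (cases "\<forall>u\<in>U. cf u t = 0")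
    case True
    then have "U0 = U" by (auto simp: U0_def)
    then show ?thesis using proj by simp
  next
    case False
    then obtain u1 where u1: "u1 \<in> U" "cf u1 t \<noteq> 0" by blast
    obtain a1 where a1: "a1 \<in> U0" "\<forall>u'\<in>U0. wform W (u1 - a1) u' = 0" using proj by blast
    \<comment> \<open>\<open>e\<close> is orthogonal to \<open>U0\<close> and together with it spans
      \<open>U\<close>.\<close>
    define e where "e = u1 - a1"
    have e: "e \<in> U" "cf e t \<noteq> 0" "\<And>u'. u' \<in> U0 \<Longrightarrow> wform W e u' = 0"
      using u1 a1 lin_diff[OF insert.prems(1)] by (auto simp: e_def U0_def lookup_minus)
    have ee: "wform W e e \<noteq> 0" using wform_self_eq_0[of W e, OF W] e(2) by auto
    obtain a where a: "a \<in> U0" "\<forall>u'\<in>U0. wform W (h - a) u' = 0" using proj by blast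
    define b where "b = wform W h e / wform W e e"
    have aU: "a \<in> U" using a by (simp add: U0_def)
    show ?thesis
    proof (intro bexI[of _ "a + Const b * e"] ballI)
      show "a + Const b * e \<in> U" by (intro lin_add lin_Const insert.prems aU e)
      fix u' assume u': "u' \<in> U"
      define c where "c = cf u' t / cf e t"
      define v where "v = u' - Const c * e"
      have v: "v \<in> U0"
        using u' e lin_diff[OF insert.prems(1) u' lin_Const[OF insert.prems(1) e(1)]]
        by (simp add: U0_def v_def c_def lookup_minus mp_Const_mult_cf)
      have 1: "wform W (h - (a + Const b * e)) v = 0"
        using a(2) v e(3)[OF v] by (simp add: wform_diff_left wform_add_left wform_Const_left)
      have "wform W a e = 0" using e(3)[OF a(1)] by (simp add: wform_commute)
      then have 2: "wform W (h - (a + Const b * e)) e = 0"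
        using ee by (simp add: wform_diff_left wform_add_left wform_Const_left b_def)
      have "u' = v + Const c * e" by (simp add: v_def)
      then show "wform W (h - (a + Const b * e)) u' = 0"
        using 1 2 by (simp add: wform_add_right wform_Const_right)
    qed
  qed
qed

text \<open>The induction of \<open>orthogonal_projection\<close>, with any element containing
  \<open>t\<close> as the additional generator.\<close>

lemma finite_spanning_set:
  fixes U :: "('v, 'a::field) mp set"
  assumes "finite T" "lin U" "\<And>p. p \<in> U \<Longrightarrow> supp p \<subseteq> T"
  shows "\<exists>B. finite B \<and> B \<subseteq> U \<and> (\<forall>p\<in>U. \<exists>c. p = (\<Sum>b\<in>B. Const (c b) * b))"
  using assms
proof (induction T arbitrary: U rule: finite_induct)
  case empty
  then have "U \<subseteq> {0}" by auto
  then show ?case by (intro exI[of _ "{}"]) auto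
next
  case (insert t T)
  define U0 where "U0 = {u\<in>U. cf u t = 0}"
  have U0: "lin U0"
    using insert.prems(1) by (auto simp: lin_def U0_def lookup_add mp_Const_mult_cf)
  have U0T: "supp p \<subseteq> T" if "p \<in> U0" for p
    using insert.prems(2)[of p] that by (auto simp: U0_def in_keys_iff)
  obtain B where B: "finite B" "B \<subseteq> U0" "\<And>p. p \<in> U0 \<Longrightarrow> \<exists>c. p = (\<Sum>b\<in>B. Const (c b) * b)"
    using insert.IH[OF U0 U0T] by blast
  show ?case
  proof (cases "\<forall>u\<in>U. cf u t = 0")
    case True
    then have "U0 = U" by (auto simp: U0_def)
    then show ?thesis using B by blast
  next
    case False
    then obtain e where e: "e \<in> U" "cf e t \<noteq> 0" by blast
    then have eB: "e \<notin> B" using B(2) by (auto simp: U0_def)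
    have "\<exists>c. p = (\<Sum>b\<in>insert e B. Const (c b) * b)" if p: "p \<in> U" for p
    proof -
      define k where "k = cf p t / cf e t"
      have "p - Const k * e \<in> U0"
        using p e lin_diff[OF insert.prems(1) p lin_Const[OF insert.prems(1) e(1)]]
        by (simp add: U0_def k_def lookup_minus mp_Const_mult_cf)
      from B(3)[OF this] obtain c where "p - Const k * e = (\<Sum>b\<in>B. Const (c b) * b)" ..
      then have "p = Const k * e + (\<Sum>b\<in>B. Const (c b) * b)" by (simp add: algebra_simps)
      also have "(\<Sum>b\<in>B. Const (c b) * b) = (\<Sum>b\<in>B. Const ((c(e := k)) b) * b)"
        using eB by (intro sum.cong) auto
      finally show ?thesis using B(1) eB by (intro exI[of _ "c(e := k)"]) simp
    qed
    then show ?thesis using B e by (intro exI[of _ "insert e B"]) (auto simp: U0_def)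
  qed
qed

lemma finite_HP_monos: "finite V \<Longrightarrow> finite {t :: 'v mono. supp t \<subseteq> V \<and> mdeg t = e}"
  by (rule finite_subset[OF _ finite_monos[of V e]]) auto

lemma HP_supp: "p \<in> HP V e \<Longrightarrow> supp p \<subseteq> {t. supp t \<subseteq> V \<and> mdeg t = e}"
  by (auto simp: HP_def)

abbreviation dot :: "('v, 'a::comm_ring_1) mp \<Rightarrow> ('v, 'a) mp \<Rightarrow> 'a" where
  "dot \<equiv> wform (\<lambda>_. 1)"

lemma linear_combinations_lin:
  fixes f :: "nat \<Rightarrow> ('v, 'a::comm_ring_1) mp"
  assumes "lin H" shows "lin {\<Sum>i<r. h i * f i | h. \<forall>i<r. h i \<in> H}"
proof (rule linI)
  show "0 \<in> {\<Sum>i<r. h i * f i | h. \<forall>i<r. h i \<in> H}"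
    by (rule CollectI, rule exI[of _ "\<lambda>_. 0"]) (simp add: lin_0[OF assms])
  fix p assume "p \<in> {\<Sum>i<r. h i * f i | h. \<forall>i<r. h i \<in> H}"
  then obtain h where h: "p = (\<Sum>i<r. h i * f i)" "\<forall>i<r. h i \<in> H" by blast
  show "Const c * p \<in> {\<Sum>i<r. h i * f i | h. \<forall>i<r. h i \<in> H}" for c
    by (rule CollectI, rule exI[of _ "\<lambda>i. Const c * h i"]) (use h lin_Const[OF assms] in \<open>auto simp: sum_distrib_left mult.assoc\<close>)
  fix q assume "q \<in> {\<Sum>i<r. h i * f i | h. \<forall>i<r. h i \<in> H}"
  then obtain k where k: "q = (\<Sum>i<r. k i * f i)" "\<forall>i<r. k i \<in> H" by blast
  show "p + q \<in> {\<Sum>i<r. h i * f i | h. \<forall>i<r. h i \<in> H}"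
    by (rule CollectI, rule exI[of _ "\<lambda>i. h i + k i"]) (use h k lin_add[OF assms] in \<open>auto simp: distrib_right sum.distrib\<close>)
qed

text \<open>Ideal membership over the rationals is detected by linear functionals, which can be evaluated
  over the complex numbers or, after clearing denominators, modulo a prime.\<close>

lemma ideal_membership_test:
  fixes f :: "nat \<Rightarrow> ('v, 'a::linordered_field) mp"
  assumes V: "finite V" and f: "\<And>i. i < r \<Longrightarrow> f i \<in> HP V \<delta>" and g: "g \<in> HP V e" and "\<delta> \<le> e"
    and test: "\<And>w. w \<in> HP V e \<Longrightarrow> (\<And>i u. i < r \<Longrightarrow> supp u \<subseteq> V \<Longrightarrow> dot w (sgl u 1 * f i) = 0) \<Longrightarrow> dot w g = 0"
  shows "\<exists>h. (\<forall>i<r. h i \<in> HP V (e - \<delta>)) \<and> g = (\<Sum>i<r. h i * f i)"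
proof -
  define U where "U = {\<Sum>i<r. h i * f i | h. \<forall>i<r. h i \<in> HP V (e - \<delta>)}"
  have linU: "lin U" unfolding U_def by (rule linear_combinations_lin[OF lin_HP])
  have prod_HP: "h * f i \<in> HP V e" if "i < r" "h \<in> HP V (e - \<delta>)" for h i
    using HP_mult[OF that(2) f[OF that(1)]] assms(4) by simp
  have U_HP: "U \<subseteq> HP V e" unfolding U_def by (auto intro!: HP_sum prod_HP)
  have "\<exists>u\<in>U. \<forall>u'\<in>U. dot (g - u) u' = 0"
  proof (rule orthogonal_projection[OF finite_HP_monos[OF V] linU])
    show "p \<in> U \<Longrightarrow> supp p \<subseteq> {t. supp t \<subseteq> V \<and> mdeg t = e}" for p
      using U_HP HP_supp by blast
  qed simp
  then obtain u where u: "u \<in> U" "\<And>u'. u' \<in> U \<Longrightarrow> dot (g - u) u' = 0" by blast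
  \<comment> \<open>The component of \<open>g\<close> orthogonal to the degree \<open>e\<close> part
    of the ideal. If the functional \<open>dot w\<close> also kills \<open>g\<close>, then
    \<open>dot w w = 0\<close> and \<open>g\<close> lies in the ideal.\<close>
  define w where "w = g - u"
  have w: "w \<in> HP V e" using g u(1) U_HP by (auto simp: w_def intro: HP_diff)
  have "dot w (sgl t 1 * f i) = 0" if i: "i < r" and t: "supp t \<subseteq> V" for i t
  proof (cases "mdeg t = e - \<delta>")
    case True
    have "sgl t 1 * f i = (\<Sum>j<r. (if j = i then sgl t 1 else 0) * f j)"
      using i by (simp add: if_distrib[of "\<lambda>x. x * _"] cong: if_cong)
    moreover have "\<forall>j<r. (if j = i then sgl t 1 else 0) \<in> HP V (e - \<delta>)"
      using HP_sgl[OF t, of 1] True by auto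
    ultimately have "sgl t 1 * f i \<in> U"
      unfolding U_def by (intro CollectI exI[of _ "\<lambda>j. if j = i then sgl t 1 else 0"] conjI)
    then show ?thesis using u(2) by (simp add: w_def)
  next
    case False
    have m: "sgl t 1 * f i \<in> HP V (mdeg t + \<delta>)" by (intro HP_mult HP_sgl t f i)
    have "cf w s * cf (sgl t 1 * f i) s = 0" for s
    proof (cases "mdeg s = e")
      case True
      then have "mdeg s \<noteq> mdeg t + \<delta>" using False by auto
      then have "s \<notin> supp (sgl t 1 * f i)" using m unfolding HP_def by blast
      then show ?thesis by (simp add: in_keys_iff)
    next
      case False
      then have "s \<notin> supp w" using w unfolding HP_def by blast
      then show ?thesis by (simp add: in_keys_iff)
    qed
    then show ?thesis unfolding wform_def mult_1_left by (intro sum.neutral ballI)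
  qed
  then have "dot w g = 0" by (intro test w)
  moreover have "dot w u = 0" using u by (simp add: w_def)
  moreover have "dot w w = dot w g - dot w u" by (subst (2) w_def) (rule wform_diff_right)
  ultimately have "dot w w = 0" by simp
  then have "w = 0" using wform_self_eq_0[of "\<lambda>_. 1" w] by simp
  then have "g \<in> U" using u(1) by (simp add: w_def)
  then show ?thesis unfolding U_def mem_Collect_eq by (elim exE conjE) (rule exI, rule conjI)
qed

section \<open>Noether normalization\<close>

text \<open>The exponent of \<open>v0\<close> is determined by the others and the degree. The
  exponent \<open>card V - 1\<close> obtained in this way is what the count in
  \<open>drop_one_form\<close> lives on.\<close>

lemma card_HP_monos:
  assumes V: "finite V" "v0 \<in> V"
  shows "card {t :: 'v mono. supp t \<subseteq> V \<and> mdeg t = d} \<le> (d + 1) ^ (card V - 1)"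
proof -
  let ?T = "{t :: 'v mono. supp t \<subseteq> V \<and> mdeg t = d}"
  let ?V = "V - {v0}"
  let ?r = "\<lambda>t :: 'v mono. restrict (cf t) ?V"
  have split: "mdeg t = cf t v0 + (\<Sum>v\<in>?V. cf t v)" if "t \<in> ?T" for t
    using that mdeg_superset[OF V(1), of t] sum.remove[OF V, of "cf t"] by simp
  have "inj_on ?r ?T"
  proof (rule inj_onI, rule poly_mapping_eqI)
    fix s t k assume *: "s \<in> ?T" "t \<in> ?T" "?r s = ?r t"
    have eq: "cf s v = cf t v" if "v \<in> ?V" for v
      using fun_cong[OF *(3), of v] that by simp
    have "(\<Sum>v\<in>?V. cf s v) = (\<Sum>v\<in>?V. cf t v)" by (rule sum.cong[OF refl eq])
    then have "cf s v0 = cf t v0" using split[OF *(1)] split[OF *(2)] *(1,2) by simp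
    moreover have "cf s k = 0 \<and> cf t k = 0" if "k \<notin> V" using * that by (auto simp: in_keys_iff)
    ultimately show "cf s k = cf t k" using eq by (cases "k \<in> V"; cases "k = v0") auto
  qed
  moreover have "?r ` ?T \<subseteq> ?V \<rightarrow>\<^sub>E {..d}"
  proof
    fix x assume "x \<in> ?r ` ?T"
    then obtain t where t: "t \<in> ?T" "x = ?r t" by blast
    have "cf t v \<le> d" if "v \<in> ?V" for v
      using member_le_sum[of v V "cf t"] V t(1) that by (auto simp: mdeg_superset[of V])
    then show "x \<in> ?V \<rightarrow>\<^sub>E {..d}" using t by auto
  qed
  moreover have "finite (?V \<rightarrow>\<^sub>E {..d})" using V by (intro finite_PiE) auto
  ultimately have "card ?T \<le> card (?V \<rightarrow>\<^sub>E {..d})" by (rule card_inj_on_le)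
  then show ?thesis using V by (simp add: card_PiE card_Diff_singleton)
qed

definition fun_mono :: "nat \<Rightarrow> (nat \<Rightarrow> nat) \<Rightarrow> nat mono" where
  "fun_mono m \<alpha> = (\<Sum>i<m. sgl i (\<alpha> i))"

lemma cf_fun_mono: "cf (fun_mono m \<alpha>) i = (if i < m then \<alpha> i else 0)"
proof -
  have "cf (fun_mono m \<alpha>) i = (\<Sum>j<m. if j = i then \<alpha> j else 0)"
    unfolding fun_mono_def lookup_sum by (rule sum.cong[OF refl]) (simp add: lookup_single when_def)
  then show ?thesis by simp
qed

lemma mev_fun_mono: "mev x (fun_mono m \<alpha>) = (\<Prod>i<m. x i ^ \<alpha> i)"
proof -
  have "mev x (fun_mono m \<alpha>) = (\<Prod>i<m. x i ^ cf (fun_mono m \<alpha>) i)"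
    by (rule mev_superset) (auto simp: in_keys_iff cf_fun_mono split: if_splits)
  then show ?thesis by (simp add: cf_fun_mono)
qed

text \<open>More than \<open>card V\<close> forms of equal degree satisfy a homogeneous relation; evaluating it at
  suitable ratios \<open>l\<close> shows that replacing each \<open>f i\<close> by \<open>f i - l i * f m\<close>
  and dropping \<open>f m\<close> leaves the common zeros unchanged.\<close>

lemma drop_one_form:
  fixes f :: "nat \<Rightarrow> ('v, rat) mp"
  assumes V: "finite V" "V \<noteq> {}" and f: "\<And>i. i \<le> m \<Longrightarrow> f i \<in> HP V \<delta>" and \<delta>: "0 < \<delta>" and m: "card V \<le> m"
  shows "\<exists>l. \<forall>x :: 'v \<Rightarrow> complex.
    (\<forall>i<m. hev of_rat x (f i - Const (l i) * f m) = 0) \<longrightarrow> (\<forall>i\<le>m. hev of_rat x (f i) = 0)"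
proof -
  define N where "N = card V"
  \<comment> \<open>Chosen to make the count close: there are \<open>(u + 1) ^ m\<close> products
    \<open>P \<alpha>\<close>, while the forms of their degree have dimension at most
    \<open>((u + 1) * (m * \<delta>)) ^ (N - 1) = (u + 1) ^ (N - 1) * u\<close>.\<close>
  define u where "u = (m * \<delta>) ^ (N - 1)"
  define t where "t = m * u"
  define A where "A = {..<m} \<rightarrow>\<^sub>E {..u}"
  define P where "P \<alpha> = (\<Prod>i<m. f i ^ \<alpha> i) * f m ^ (t - (\<Sum>i<m. \<alpha> i))" for \<alpha>
  define T where "T = {s :: 'v mono. supp s \<subseteq> V \<and> mdeg s = t * \<delta>}"
  obtain v0 where v0: "v0 \<in> V" using V by blast
  have N: "0 < N" using V by (simp add: N_def card_gt_0_iff)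
  have finA: "finite A" unfolding A_def by (intro finite_PiE) auto
  have finT: "finite T" unfolding T_def using V(1) by (rule finite_HP_monos)
  have At: "(\<Sum>i<m. \<alpha> i) \<le> t" if "\<alpha> \<in> A" for \<alpha>
    using sum_bounded_above[of "{..<m}" \<alpha> u] that by (auto simp: A_def t_def)
  have PHP: "P \<alpha> \<in> HP V (t * \<delta>)" if "\<alpha> \<in> A" for \<alpha>
  proof -
    have "(\<Prod>i<m. f i ^ \<alpha> i) * f m ^ (t - (\<Sum>i<m. \<alpha> i)) \<in> HP V ((\<Sum>i<m. \<alpha> i * \<delta>) + (t - (\<Sum>i<m. \<alpha> i)) * \<delta>)"
      by (rule HP_mult, rule HP_prod) (auto intro!: HP_power f)
    moreover have "(\<Sum>i<m. \<alpha> i * \<delta>) + (t - (\<Sum>i<m. \<alpha> i)) * \<delta> = t * \<delta>"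
      using At[OF that] by (metis add_mult_distrib le_add_diff_inverse sum_distrib_right)
    ultimately show ?thesis by (simp add: P_def)
  qed
  have "card T \<le> (t * \<delta> + 1) ^ (N - 1)" unfolding T_def N_def by (rule card_HP_monos[OF V(1) v0])
  also have "\<dots> \<le> ((u + 1) * (m * \<delta>)) ^ (N - 1)"
  proof (rule power_mono)
    have "0 < m * \<delta>" using \<delta> N m by (simp add: N_def)
    then show "t * \<delta> + 1 \<le> (u + 1) * (m * \<delta>)" by (simp add: t_def algebra_simps)
  qed simp
  also have "\<dots> < (u + 1) ^ N"
  proof -
    have "((u + 1) * (m * \<delta>)) ^ (N - 1) = (u + 1) ^ (N - 1) * u" 
      unfolding power_mult_distrib[of "u + 1" "m * \<delta>"] by (simp only: u_def[symmetric])
    also have "\<dots> < (u + 1) ^ (N - 1) * (u + 1)" by (rule mult_strict_left_mono) auto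
    also have "\<dots> = (u + 1) ^ N" using N power_Suc2[of "u + 1" "N - 1"] by simp
    finally show ?thesis .
  qed
  also have "\<dots> \<le> (u + 1) ^ m" using m by (intro power_increasing) (auto simp: N_def)
  also have "\<dots> = card A" by (simp add: A_def card_PiE)
  finally have "card T < card A" .
  from underdetermined_system[OF finT finA this, of "\<lambda>s \<alpha>. cf (P \<alpha>) s"]
  obtain c where c: "\<exists>\<alpha>\<in>A. c \<alpha> \<noteq> 0" "\<And>s. s \<in> T \<Longrightarrow> (\<Sum>\<alpha>\<in>A. cf (P \<alpha>) s * c \<alpha>) = 0" by blast
  have rel: "(\<Sum>\<alpha>\<in>A. Const (c \<alpha>) * P \<alpha>) = 0"
  proof (rule poly_mapping_eqI)
    fix s
    have "(\<Sum>\<alpha>\<in>A. cf (P \<alpha>) s * c \<alpha>) = 0"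
    proof (cases "s \<in> T")
      case False
      then have "cf (P \<alpha>) s = 0" if "\<alpha> \<in> A" for \<alpha>
        using PHP[OF that] by (auto simp: HP_def T_def in_keys_iff)
      then show ?thesis by simp
    qed (rule c(2))
    then show "cf (\<Sum>\<alpha>\<in>A. Const (c \<alpha>) * P \<alpha>) s = cf 0 s"
      unfolding lookup_sum mp_Const_mult_cf mult.commute[of "c _"] by simp
  qed
  \<comment> \<open>The relation between the products, dehomogenized by setting \<open>f m\<close>
    to 1; \<open>l\<close> is a point where it does not vanish.\<close>
  define C where "C = (\<Sum>\<alpha>\<in>A. sgl (fun_mono m \<alpha>) (c \<alpha>))"
  have inj: "fun_mono m \<alpha> = fun_mono m \<beta> \<longleftrightarrow> \<alpha> = \<beta>" if "\<alpha> \<in> A" "\<beta> \<in> A" for \<alpha> \<beta>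
  proof
    assume "fun_mono m \<alpha> = fun_mono m \<beta>"
    then have "\<alpha> i = \<beta> i" if "i < m" for i using cf_fun_mono[of m \<alpha> i] cf_fun_mono[of m \<beta> i] that by simp
    then show "\<alpha> = \<beta>" using that unfolding A_def by (intro PiE_ext) auto
  qed simp
  obtain \<beta> where \<beta>: "\<beta> \<in> A" "c \<beta> \<noteq> 0" using c(1) by blast
  have "cf C (fun_mono m \<beta>) = (\<Sum>\<alpha>\<in>A. if \<alpha> = \<beta> then c \<alpha> else 0)"
    unfolding C_def lookup_sum by (rule sum.cong[OF refl]) (simp add: lookup_single when_def inj \<beta>)
  also have "\<dots> = c \<beta>" using \<beta>(1) finA by simp
  finally have "C \<noteq> 0" using \<beta>(2) by auto
  moreover have "C \<in> PV {..<m}"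
    unfolding C_def by (intro PV_sum HP_PV[OF HP_sgl]) (auto simp: in_keys_iff cf_fun_mono split: if_splits)
  ultimately obtain l where l: "ev l C \<noteq> 0" using mp_nonzero_point[of "{..<m}" C] by blast
  have evC: "ev l C = (\<Sum>\<alpha>\<in>A. c \<alpha> * (\<Prod>i<m. l i ^ \<alpha> i))"
    unfolding C_def ev.hom_sum by (simp add: hev_sgl mev_fun_mono)
  show ?thesis
  proof (intro exI[of _ l] allI impI)
    fix x :: "'v \<Rightarrow> complex" and i
    assume z: "\<forall>i<m. hev of_rat x (f i - Const (l i) * f m) = 0" and i: "i \<le> m"
    interpret h: comm_ring_hom "hev (of_rat :: rat \<Rightarrow> complex) x" by (rule of_rat_hom.comm_ring_hom_hev)
    define y where "y = hev of_rat x (f m)"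
    have fi: "hev of_rat x (f i) = of_rat (l i) * y" if "i < m" for i
      using z that by (simp add: h.hom_minus h.hom_mult of_rat_hom.hev_Const y_def)
    \<comment> \<open>At a common zero of the new forms, \<open>f i\<close> is \<open>l i\<close>
      times the value \<open>y\<close> of \<open>f m\<close>, so the homogeneous relation reads
      \<open>C(l) * y ^ t = 0\<close> and \<open>y = 0\<close>.\<close>
    have hP: "hev of_rat x (P \<alpha>) = of_rat (\<Prod>i<m. l i ^ \<alpha> i) * y ^ t" if "\<alpha> \<in> A" for \<alpha>
    proof -
      have "hev of_rat x (P \<alpha>) = (\<Prod>i<m. (of_rat (l i) * y) ^ \<alpha> i) * y ^ (t - (\<Sum>i<m. \<alpha> i))"
        unfolding P_def h.hom_mult h.hom_prod h.hom_power using fi by (simp add: y_def)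
      also have "(\<Prod>i<m. (of_rat (l i) * y) ^ \<alpha> i) = of_rat (\<Prod>i<m. l i ^ \<alpha> i) * y ^ (\<Sum>i<m. \<alpha> i)"
        by (simp add: power_mult_distrib prod.distrib of_rat_hom.hom_prod of_rat_hom.hom_power power_sum)
      finally show ?thesis using At[OF that] by (simp add: mult.assoc flip: power_add)
    qed
    have "0 = hev of_rat x (\<Sum>\<alpha>\<in>A. Const (c \<alpha>) * P \<alpha>)" by (simp add: rel)
    also have "\<dots> = (\<Sum>\<alpha>\<in>A. of_rat (c \<alpha>) * (of_rat (\<Prod>i<m. l i ^ \<alpha> i) * y ^ t))"
      unfolding h.hom_sum h.hom_mult of_rat_hom.hev_Const by (rule sum.cong[OF refl]) (simp add: hP)
    also have "\<dots> = of_rat (ev l C) * y ^ t"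
      unfolding evC of_rat_hom.hom_sum of_rat_hom.hom_mult sum_distrib_right by (rule sum.cong[OF refl]) (simp add: mult.assoc)
    finally have "y = 0" using l by simp
    then show "hev of_rat x (f i) = 0" using fi[of i] i by (cases "i = m") (auto simp: y_def)
  qed
qed

section \<open>Hilbert's basis theorem\<close>

lemma cf_sgl_mult: "cf (sgl u 1 * p) (u + s) = cf (p :: ('v, 'a::comm_ring_1) mp) s"
  and cf_sgl_mult_notin: "(\<And>s. t \<noteq> u + s) \<Longrightarrow> cf (sgl u 1 * p) t = 0"
proof -
  have eq: "sgl u 1 * p = (\<Sum>r\<in>supp p. sgl (u + r) (cf p r))"
    by (subst (1) mp_decomp) (simp add: sum_distrib_left mult_single)
  have "cf (sgl u 1 * p) (u + s) = (\<Sum>r\<in>supp p. if r = s then cf p r else 0)"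
    unfolding eq lookup_sum by (rule sum.cong[OF refl]) (simp add: lookup_single when_def)
  then show "cf (sgl u 1 * p) (u + s) = cf p s" by (simp add: in_keys_iff)
  show "cf (sgl u 1 * p) t = 0" if "\<And>s. t \<noteq> u + s"
    unfolding eq lookup_sum using that[symmetric] by (simp add: lookup_single when_def)
qed

lemma mono_le_add: "(\<And>v. cf s v \<le> cf t v) \<Longrightarrow> t = s + (t - s :: 'v mono)"
  by (rule poly_mapping_eqI) (simp add: lookup_add lookup_minus)

text \<open>Induction on the variables. Members of \<open>A0\<close> divide every monomial of
  \<open>M\<close> whose exponent at \<open>v\<close> is at least \<open>c\<close>; the finitely
  many smaller exponents are treated slice by slice.\<close>

lemma dickson:
  assumes "finite V" "\<And>t. t \<in> M \<Longrightarrow> supp t \<subseteq> V"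
  shows "\<exists>M0\<subseteq>M. finite M0 \<and> (\<forall>t\<in>M. \<exists>s\<in>M0. \<forall>v. cf s v \<le> (cf t v :: nat))"
  using assms
proof (induction V arbitrary: M rule: finite_induct)
  case empty
  show ?case
  proof (cases "M = {}")
    case False
    then obtain t where "t \<in> M" by blast
    moreover have "cf s v = 0" if "s \<in> M" for s v using empty[OF that] by (auto simp: in_keys_iff)
    ultimately show ?thesis by (intro exI[of _ "{t}"]) auto
  qed auto
next
  case (insert v V)
  define rm where "rm t = t - sgl v (cf t v)" for t :: "'a mono"
  have rm: "cf (rm t) w = (if w = v then 0 else cf t w)" for t w
    by (simp add: rm_def lookup_minus lookup_single when_def)
  have proj: "\<exists>A0. A0 \<subseteq> A \<and> finite A0 \<and> (\<forall>t\<in>A. \<exists>s\<in>A0. \<forall>w. w \<noteq> v \<longrightarrow> cf s w \<le> cf t w)" if A: "A \<subseteq> M" for A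
  proof -
    have "\<exists>M0\<subseteq>rm ` A. finite M0 \<and> (\<forall>t\<in>rm ` A. \<exists>s\<in>M0. \<forall>v. cf s v \<le> cf t v)"
    proof (rule insert.IH)
      fix t assume "t \<in> rm ` A"
      then obtain t' where t': "t' \<in> A" "t = rm t'" by blast
      then have "supp t' \<subseteq> insert v V" using A insert.prems by blast
      moreover have "x \<noteq> v \<and> x \<in> supp t'" if "x \<in> supp t" for x
        using that by (auto simp: in_keys_iff rm t'(2) split: if_splits)
      ultimately show "supp t \<subseteq> V" by blast
    qed
    then obtain M0 where M0: "M0 \<subseteq> rm ` A" "finite M0" "\<And>t. t \<in> A \<Longrightarrow> \<exists>s\<in>M0. \<forall>v. cf s v \<le> cf (rm t) v"
      by blast
    then obtain A0 where A0: "A0 \<subseteq> A" "finite A0" "M0 = rm ` A0" by (meson finite_subset_image)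
    have "\<exists>s\<in>A0. \<forall>w. w \<noteq> v \<longrightarrow> cf s w \<le> cf t w" if t: "t \<in> A" for t
    proof -
      from M0(3)[OF t] A0(3) obtain s where s: "s \<in> A0" "\<And>w. cf (rm s) w \<le> cf (rm t) w" by blast
      have "cf s w \<le> cf t w" if "w \<noteq> v" for w using s(2)[of w] that by (simp add: rm)
      then show ?thesis using s(1) by blast
    qed
    then show ?thesis using A0 by blast
  qed
  from proj[of M] obtain A0 where A0: "A0 \<subseteq> M" "finite A0"
    "\<And>t. t \<in> M \<Longrightarrow> \<exists>s\<in>A0. \<forall>w. w \<noteq> v \<longrightarrow> cf s w \<le> cf t w" by blast
  define c where "c = (\<Sum>s\<in>A0. cf s v)"
  have c: "cf s v \<le> c" if "s \<in> A0" for s unfolding c_def by (rule member_le_sum[OF that]) (use A0 in auto)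
  have "\<forall>j. \<exists>B. B \<subseteq> {t\<in>M. cf t v = j} \<and> finite B \<and>
      (\<forall>t\<in>{t\<in>M. cf t v = j}. \<exists>s\<in>B. \<forall>w. w \<noteq> v \<longrightarrow> cf s w \<le> cf t w)"
    by (rule allI, rule proj) blast
  then obtain B where B: "\<And>j. B j \<subseteq> {t\<in>M. cf t v = j} \<and> finite (B j) \<and>
      (\<forall>t\<in>{t\<in>M. cf t v = j}. \<exists>s\<in>B j. \<forall>w. w \<noteq> v \<longrightarrow> cf s w \<le> cf t w)"
    by (auto dest!: choice)
  define M0 where "M0 = A0 \<union> (\<Union>j<c. B j)"
  have "\<exists>s\<in>M0. \<forall>w. cf s w \<le> cf t w" if t: "t \<in> M" for t
  proof (cases "c \<le> cf t v")
    case True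
    obtain s where s: "s \<in> A0" "\<forall>w. w \<noteq> v \<longrightarrow> cf s w \<le> cf t w" using A0(3)[OF t] by blast
    then have "cf s w \<le> cf t w" for w using c[OF s(1)] True by (cases "w = v") auto
    then show ?thesis using s(1) by (auto simp: M0_def)
  next
    case False
    define j where "j = cf t v"
    obtain s where s: "s \<in> B j" "\<forall>w. w \<noteq> v \<longrightarrow> cf s w \<le> cf t w" using B[of j] t j_def by blast
    then have "cf s v = j" using B[of j] by blast
    then have "cf s w \<le> cf t w" for w using s(2) j_def by (cases "w = v") auto
    moreover have "s \<in> M0" using s(1) False by (auto simp: M0_def j_def)
    ultimately show ?thesis by blast
  qed
  moreover have "B j \<subseteq> M" "finite (B j)" for j using B[of j] by auto
  then have "M0 \<subseteq> M" "finite M0" using A0(1,2) by (auto simp: M0_def)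
  ultimately show ?case by blast
qed

definition idl :: "'v set \<Rightarrow> ('v, 'a::comm_ring_1) mp set \<Rightarrow> ('v, 'a) mp set" where
  "idl V H = {\<Sum>h\<in>H. a h * h | a. \<forall>h\<in>H. a h \<in> PV V}"

lemma idlI: "(\<And>h. h \<in> H \<Longrightarrow> a h \<in> PV V) \<Longrightarrow> (\<Sum>h\<in>H. a h * h) \<in> idl V H"
  unfolding idl_def by blast

lemma idlE:
  assumes "p \<in> idl V H" obtains a where "p = (\<Sum>h\<in>H. a h * h)" "\<And>h. h \<in> H \<Longrightarrow> a h \<in> PV V"
  using assms unfolding idl_def by blast

lemma idl_add: "p \<in> idl V H \<Longrightarrow> q \<in> idl V H \<Longrightarrow> p + q \<in> idl V H"
  by (elim idlE) (simp add: PV_add idlI flip: sum.distrib distrib_right)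

lemma idl_mult: "c \<in> PV V \<Longrightarrow> p \<in> idl V H \<Longrightarrow> c * p \<in> idl V H"
  by (elim idlE) (simp add: PV_mult idlI sum_distrib_left flip: mult.assoc)

lemma idl_uminus: "p \<in> idl V H \<Longrightarrow> - p \<in> idl V H"
  using idl_mult[of "- 1" V p H] by (simp add: PV_uminus PV_1)

lemma idl_mono:
  assumes "finite H'" "H \<subseteq> H'" "p \<in> idl V H" shows "p \<in> idl V H'"
proof -
  obtain a where a: "p = (\<Sum>h\<in>H. a h * h)" "\<And>h. h \<in> H \<Longrightarrow> a h \<in> PV V" using assms(3) by (rule idlE) blast
  have "p = (\<Sum>h\<in>H'. (if h \<in> H then a h else 0) * h)"
    unfolding a(1) using assms(1,2) by (intro sum.mono_neutral_cong_left) auto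
  then show ?thesis using a(2) idlI[of H' "\<lambda>h. if h \<in> H then a h else 0" V] by auto
qed

lemma idl_self: "finite H \<Longrightarrow> h \<in> H \<Longrightarrow> h \<in> idl V H"
  using idl_mono[of H "{h}" h V] idlI[of "{h}" "\<lambda>_. 1" V] by (simp add: PV_1)

text \<open>A Groebner basis argument: by Dickson's lemma finitely many ideal elements have leading
  monomials dividing all others, and each of these elements uses only finitely many members of
  \<open>G\<close>. The monomial order is the linear order on finitely supported functions, which is
  compatible with addition.\<close>

lemma hilbert_basis:
  fixes G :: "('v::linorder, 'a::field) mp set"
  assumes V: "finite V" and G: "\<And>g. g \<in> G \<Longrightarrow> \<exists>e. g \<in> HP V e"
  shows "\<exists>H\<subseteq>G. finite H \<and> G \<subseteq> idl V H"
proof -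
  define I where "I = {p. (\<exists>e. p \<in> HP V e) \<and> (\<exists>H\<subseteq>G. finite H \<and> p \<in> idl V H)}"
  define lm where "lm p = Max (supp p)" for p :: "('v, 'a) mp"
  have lm_in: "lm p \<in> supp p" if "p \<noteq> 0" for p using that by (simp add: lm_def)
  have lm_ge: "t \<le> lm p" if "t \<in> supp p" for t p using that by (simp add: lm_def)
  have lmV: "supp t \<subseteq> V" if "t \<in> lm ` (I - {0})" for t
    using that lm_in by (force simp: I_def HP_def)
 have "\<exists>M0\<subseteq>lm ` (I - {0}). finite M0 \<and> (\<forall>t\<in>lm ` (I - {0}). \<exists>s\<in>M0. \<forall>v. cf s v \<le> cf t v)"
    by (rule dickson[OF V]) (rule lmV)
  then obtain M0 where M0: "M0 \<subseteq> lm ` (I - {0})" "finite M0"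
    "\<And>t. t \<in> lm ` (I - {0}) \<Longrightarrow> \<exists>s\<in>M0. \<forall>v. cf s v \<le> cf t v"
    by (elim exE conjE) (rule that, assumption+, erule bspec)
  obtain I0 where I0: "I0 \<subseteq> I - {0}" "finite I0" "M0 = lm ` I0"
    using finite_subset_image[OF M0(2,1)] by (elim exE conjE) (rule that)
  have "\<forall>i\<in>I0. \<exists>H. H \<subseteq> G \<and> finite H \<and> i \<in> idl V H"
  proof
    fix i assume "i \<in> I0"
    then have "i \<in> I" using I0(1) by blast
    then show "\<exists>H. H \<subseteq> G \<and> finite H \<and> i \<in> idl V H" by (simp add: I_def)
  qed
  from bchoice[OF this] obtain h where h: "\<And>i. i \<in> I0 \<Longrightarrow> h i \<subseteq> G \<and> finite (h i) \<and> i \<in> idl V (h i)"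
    by (elim exE) (rule that, erule bspec)
  define H where "H = (\<Union>i\<in>I0. h i)"
  have H: "H \<subseteq> G" "finite H" using h I0(2) by (auto simp: H_def)
  have I0H: "i \<in> idl V H" if "i \<in> I0" for i
    by (rule idl_mono[of H "h i"]) (use h[OF that] H that in \<open>auto simp: H_def\<close>)
  have IH: "p \<in> idl V H" if p: "p \<in> I" "p \<in> HP V e" for p e
  proof (rule ccontr)
    assume "p \<notin> idl V H"
    \<comment> \<open>Counterexamples of degree \<open>e\<close>. Only finitely many monomials have
      this degree, so one with smallest leading monomial exists.\<close>
    define C where "C = {p \<in> I \<inter> HP V e. p \<notin> idl V H}"
    have 0: "0 \<in> idl V H" using idlI[of H "\<lambda>_. 0" V] by simp
    have "lm ` C \<subseteq> {t. supp t \<subseteq> V \<and> mdeg t = e}"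
    proof
      fix t assume "t \<in> lm ` C"
      then obtain p where p: "p \<in> C" "t = lm p" by blast
      then have "p \<noteq> 0" using 0 by (auto simp: C_def)
      then have "t \<in> supp p" using p lm_in by simp
      then show "t \<in> {t. supp t \<subseteq> V \<and> mdeg t = e}" using p(1) by (auto simp: C_def HP_def)
    qed
    then have fin: "finite (lm ` C)" by (rule finite_subset) (rule finite_HP_monos[OF V])
    have "p \<in> C" using p \<open>p \<notin> idl V H\<close> by (simp add: C_def)
    then have "Min (lm ` C) \<in> lm ` C" using fin by (intro Min_in) auto
    then obtain q where q: "q \<in> C" "lm q = Min (lm ` C)" by force
    have q0: "q \<noteq> 0" "q \<in> I" "q \<in> HP V e" "q \<notin> idl V H" using q(1) 0 by (auto simp: C_def)
    then have "lm q \<in> lm ` (I - {0})" by blast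
    from M0(3)[OF this] I0(3) obtain i where i: "i \<in> I0" "\<forall>v. cf (lm i) v \<le> cf (lm q) v" by blast
    have iI: "i \<noteq> 0" "i \<in> I" using i(1) I0(1) by auto
    define u where "u = lm q - lm i"
    have lmq: "lm q = u + lm i" using mono_le_add[of "lm i" "lm q"] i(2) by (simp add: u_def add.commute)
    define c where "c = cf q (lm q) / cf i (lm i)"
    \<comment> \<open>\<open>r\<close> has the same leading term as \<open>q\<close> and lies in the
      ideal of \<open>H\<close>, so \<open>q - r\<close> is a counterexample with a smaller leading
      monomial.\<close>
    define r where "r = Const c * (sgl u 1 * i)"
    have "supp (u + lm i) \<subseteq> V" using lm_in[OF q0(1)] q0(3) unfolding HP_def lmq by blast
    then have uV: "supp u \<subseteq> V" by (simp add: supp_add_nat)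
    obtain d where d: "i \<in> HP V d" using iI(2) by (auto simp: I_def)
    have "mdeg u + d = e"
    proof -
      have "mdeg (lm q) = e" using lm_in[OF q0(1)] q0(3) by (auto simp: HP_def)
      moreover have "mdeg (lm i) = d" using lm_in[OF iI(1)] d by (auto simp: HP_def)
      ultimately show ?thesis by (simp add: lmq)
    qed
    then have rHP: "r \<in> HP V e" unfolding r_def using HP_mult[OF HP_sgl[OF uV] d] by (intro HP_Const_mult) auto
    have r_idl: "r \<in> idl V H'" if "i \<in> idl V H'" for H'
      unfolding r_def by (intro idl_mult PV_Const HP_PV[OF HP_sgl[OF uV]] that)
    have cfi: "cf i (lm i) \<noteq> 0" using lm_in[OF iI(1)] by (simp add: in_keys_iff)
    have "cf (q - r) (lm q) = 0"
      using cfi by (simp add: lookup_minus r_def mp_Const_mult_cf lmq cf_sgl_mult c_def)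
    have less: "t < lm q" if t: "t \<in> supp (q - r)" for t
    proof -
      have "t \<noteq> lm q" using t \<open>cf (q - r) (lm q) = 0\<close> by (auto simp: in_keys_iff)
      moreover have "t \<le> lm q"
      proof (cases "t \<in> supp q")
        case False
        then have "cf (sgl u 1 * i) t \<noteq> 0" using t by (auto simp: in_keys_iff lookup_minus r_def mp_Const_mult_cf)
        then obtain s where s: "t = u + s" using cf_sgl_mult_notin[of t u i] by blast
        with \<open>cf (sgl u 1 * i) t \<noteq> 0\<close> have "s \<in> supp i" by (simp add: cf_sgl_mult in_keys_iff)
        then show ?thesis unfolding s lmq by (intro add_left_mono lm_ge)
      qed (rule lm_ge)
      ultimately show ?thesis by simp
    qed
    have "q - r \<in> I"
    proof -
      from q0(2) obtain Hq where Hq: "Hq \<subseteq> G" "finite Hq" "q \<in> idl V Hq" by (auto simp: I_def)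
      have "q \<in> idl V (Hq \<union> H)" "- r \<in> idl V (Hq \<union> H)"
        using idl_mono[of "Hq \<union> H" Hq q V] idl_mono[of "Hq \<union> H" H "- r" V] Hq H idl_uminus[OF r_idl[OF I0H[OF i(1)]]]
        by auto
      then have mem: "q - r \<in> idl V (Hq \<union> H)" using idl_add[of q V "Hq \<union> H" "- r"] by simp
      show ?thesis unfolding I_def
      proof (rule CollectI, intro conjI)
        show "\<exists>e. q - r \<in> HP V e" by (rule exI) (rule HP_diff[OF q0(3) rHP])
        show "\<exists>H\<subseteq>G. finite H \<and> q - r \<in> idl V H"
          by (rule exI[of _ "Hq \<union> H"]) (simp add: mem Hq H)
      qed
    qed
    moreover have "q - r \<notin> idl V H"
    proof
      assume "q - r \<in> idl V H"
      then have "(q - r) + r \<in> idl V H" using r_idl[OF I0H[OF i(1)]] by (rule idl_add)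
      then show False using q0(4) by simp
    qed
    moreover note HP_diff[OF q0(3) rHP]
    ultimately have qr: "q - r \<in> C" by (simp add: C_def)
    then have "q - r \<notin> idl V H" by (simp add: C_def)
    then have "q - r \<noteq> 0" using 0 by metis
    then have "lm (q - r) < lm q" using less lm_in by blast
    moreover have "lm q \<le> lm (q - r)" using fin qr unfolding q(2) by (intro Min_le imageI)
    ultimately show False by simp
  qed
  have "G \<subseteq> idl V H"
  proof
    fix g assume g: "g \<in> G"
    then obtain e where e: "g \<in> HP V e" using G by blast
    have "g \<in> I" using g e idl_self[of "{g}" g V] by (auto simp: I_def intro!: exI[of _ "{g}"])
    then show "g \<in> idl V H" using e by (rule IH)
  qed
  then show ?thesis using H by blast
qed

section \<open>Graded rings with a Reynolds operator\<close>

lemma hcomp_mult_HP_less: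
  fixes a :: "('v, 'a::comm_ring_1) mp"
  assumes "a \<in> HP V d" "e < d" shows "hcomp e (a * h) = 0"
proof (rule poly_mapping_eqI)
  fix t
  have "t \<notin> supp (a * h)" if "mdeg t = e"
  proof
    assume "t \<in> supp (a * h)"
    then obtain s u where "t = s + u" "s \<in> supp a" using supp_mult[of a h] by blast
    then have "d \<le> mdeg t" using assms(1) by (auto simp: HP_def)
    then show False using that assms(2) by simp
  qed
  then show "cf (hcomp e (a * h)) t = cf 0 t" by (auto simp: cf_hcomp in_keys_iff)
qed

definition ideal_of :: "'v set \<Rightarrow> nat \<Rightarrow> (nat \<Rightarrow> ('v, 'a::comm_ring_1) mp) \<Rightarrow> ('v, 'a) mp set" where
  "ideal_of V r F = {\<Sum>i<r. h i * F i | h. \<forall>i<r. h i \<in> PV V}"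

lemma ideal_ofI: "p = (\<Sum>i<r. h i * F i) \<Longrightarrow> (\<And>i. i < r \<Longrightarrow> h i \<in> PV V) \<Longrightarrow> p \<in> ideal_of V r F"
  unfolding ideal_of_def by blast

lemma ideal_ofE:
  assumes "p \<in> ideal_of V r F" obtains h where "p = (\<Sum>i<r. h i * F i)" "\<And>i. i < r \<Longrightarrow> h i \<in> PV V"
  using assms unfolding ideal_of_def by blast

lemma ideal_in_ideal_of:
  assumes "\<And>i. i < r \<Longrightarrow> F i \<in> PV V" shows "ideal_in V (ideal_of V r F)"
  unfolding ideal_in_def
proof (intro conjI ballI)
  show "ideal_of V r F \<subseteq> PV V" by (auto elim!: ideal_ofE intro!: PV_sum PV_mult assms)
  show "0 \<in> ideal_of V r F" by (rule ideal_ofI[where h="\<lambda>_. 0"]) auto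
  fix p assume "p \<in> ideal_of V r F"
  then obtain h where h: "p = (\<Sum>i<r. h i * F i)" "\<And>i. i < r \<Longrightarrow> h i \<in> PV V" by (rule ideal_ofE) blast
  show "c * p \<in> ideal_of V r F" if "c \<in> PV V" for c
    by (rule ideal_ofI[where h="\<lambda>i. c * h i"]) (simp_all add: h sum_distrib_left mult.assoc PV_mult that)
  fix q assume "q \<in> ideal_of V r F"
  then obtain k where k: "q = (\<Sum>i<r. k i * F i)" "\<And>i. i < r \<Longrightarrow> k i \<in> PV V" by (rule ideal_ofE) blast
  show "p + q \<in> ideal_of V r F"
    by (rule ideal_ofI[where h="\<lambda>i. h i + k i"]) (simp_all add: h k sum.distrib distrib_right PV_add)
qed

lemma ideal_of_self: "i < r \<Longrightarrow> F i \<in> ideal_of V r F"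
  by (rule ideal_ofI[where h="\<lambda>j. if j = i then 1 else 0"])
    (simp_all add: PV_1 if_distrib[of "\<lambda>x. x * _"] cong: if_cong)

lemma dot_mult_eq_0:
  fixes W F :: "('v, 'a::comm_ring_1) mp"
  assumes "\<And>u. supp u \<subseteq> V \<Longrightarrow> dot W (sgl u 1 * F) = 0" "h \<in> PV V"
  shows "dot W (h * F) = 0"
proof -
  have "h * F = (\<Sum>t\<in>supp h. Const (cf h t) * (sgl t 1 * F))"
    by (subst (1) mp_decomp)
      (simp add: sum_distrib_right flip: mult.assoc sgl_eq_Const_mult)
  then show ?thesis
    using assms by (simp add: wform_sum_right wform_Const_right PV_def)
qed

lemma dot_pmap:
  assumes "comm_ring_hom \<phi>" shows "dot (pmap \<phi> p) (pmap \<phi> q) = \<phi> (dot p q)"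
proof -
  interpret f: comm_ring_hom \<phi> by fact
  have "dot (pmap \<phi> p) (pmap \<phi> q) = (\<Sum>t\<in>supp p. 1 * cf (pmap \<phi> p) t * cf (pmap \<phi> q) t)"
    by (rule wform_superset) (auto simp: supp_pmap)
  then show ?thesis by (simp add: cf_pmap wform_def f.hom_sum f.hom_mult)
qed

lemma clear_denominators:
  "\<exists>k>0. Const (of_nat k) * (p :: ('v, rat) mp) \<in> range (pmap of_int)"
proof -
  interpret pm: comm_ring_hom "pmap (of_int :: int \<Rightarrow> rat) :: ('v, int) mp \<Rightarrow> _"
    by (rule comm_ring_hom_pmap) (rule of_int_hom.comm_ring_hom_axioms)
  have C: "pmap of_int (Const a :: ('v, int) mp) = Const (of_int a :: rat)" for a by (simp add: pmap_Const)
  have "p \<in> PV UNIV" by simp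
  then show ?thesis
  proof (induction rule: PV_induct)
    case (Const c)
    obtain a b where ab: "quotient_of c = (a, b)" by fastforce
    then have "b > 0" "c = of_int a / of_int b" using quotient_of_denom_pos quotient_of_div by blast+
    then have "Const (of_nat (nat b)) * Const c = (pmap of_int (Const a) :: ('v, rat) mp)" "nat b > 0"
      by (simp_all add: C flip: Const_mult)
    then show ?case by blast
  next
    case (add p q)
    then obtain k l p' q' where "k > 0" "Const (of_nat k) * p = pmap of_int p'" "l > 0" "Const (of_nat l) * q = pmap of_int q'"
      by blast
    moreover have "Const (of_nat (k * l)) * (p + q)
        = Const (of_nat l) * (Const (of_nat k) * p) + Const (of_nat k) * (Const (of_nat l) * q)"
      by (simp add: Const_mult algebra_simps)
    ultimately have "Const (of_nat (k * l)) * (p + q)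
        = pmap of_int (Const (of_nat l) * p' + Const (of_nat k) * q')" "k * l > 0"
      by (simp_all add: pm.hom_add pm.hom_mult C)
    then show ?case by blast
  next
    case (Var v p)
    then obtain k p' where "k > 0" "Const (of_nat k) * p = pmap of_int p'" by blast
    then have "Const (of_nat k) * (Var v * p) = pmap of_int (Var v * p')"
      by (simp add: pm.hom_mult pmap_Var mult.left_commute)
    then show ?case using \<open>k > 0\<close> by blast
  qed
qed

text \<open>Spanning is expressed by containment in every linear subspace around \<open>B\<close>,
  so scaling the elements of \<open>B\<close> to integral ones requires no bookkeeping of
  coefficients.\<close>

lemma finite_integral_spanning_set:
  fixes U :: "('v, rat) mp set"
  assumes "finite T" and U: "lin U" and "\<And>p. p \<in> U \<Longrightarrow> supp p \<subseteq> T"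
  shows "\<exists>B. finite B \<and> B \<subseteq> U \<inter> range (pmap of_int) \<and> (\<forall>U'. lin U' \<longrightarrow> B \<subseteq> U' \<longrightarrow> U \<subseteq> U')"
proof -
  have "\<exists>B. finite B \<and> B \<subseteq> U \<and> (\<forall>p\<in>U. \<exists>c. p = (\<Sum>b\<in>B. Const (c b) * b))"
    by (rule finite_spanning_set[OF assms])
  then obtain B where B: "finite B" "B \<subseteq> U" "\<forall>p\<in>U. \<exists>c. p = (\<Sum>b\<in>B. Const (c b) * b)"
    by (elim exE conjE) (rule that)
  have "\<forall>b :: ('v, rat) mp. \<exists>k. k > 0 \<and> Const (of_nat k) * b \<in> range (pmap of_int)"
    using clear_denominators by (intro allI)
  from choice[OF this] obtain k where
    k: "\<And>b :: ('v, rat) mp. k b > 0 \<and> Const (of_nat (k b)) * b \<in> range (pmap of_int)"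
    by (elim exE) (rule that, erule spec)
  define B' where "B' = (\<lambda>b. Const (of_nat (k b)) * b) ` B"
  have "U \<subseteq> U'" if U': "lin U'" "B' \<subseteq> U'" for U'
  proof
    fix p assume "p \<in> U"
    then obtain c where c: "p = (\<Sum>b\<in>B. Const (c b) * b)" using B(3) by blast
    have "b \<in> U'" if "b \<in> B" for b
    proof -
      have "Const (of_nat (k b)) * b \<in> U'" using that subsetD[OF U'(2)] unfolding B'_def by blast
      then have "Const (1 / of_nat (k b)) * (Const (of_nat (k b)) * b) \<in> U'" by (rule lin_Const[OF U'(1)])
      moreover have "1 / of_nat (k b) * of_nat (k b) = (1 :: rat)" using k[of b] by simp
      then have "Const (1 / of_nat (k b)) * (Const (of_nat (k b)) * b) = b"
        unfolding mult.assoc[symmetric] Const_mult[symmetric] by simp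
      ultimately show ?thesis by simp
    qed
    then show "p \<in> U'" unfolding c by (intro lin_sum[OF U'(1)] lin_Const[OF U'(1)])
  qed
  moreover have "finite B'" using B(1) by (simp add: B'_def)
  moreover have "B' \<subseteq> U \<inter> range (pmap of_int)"
    unfolding B'_def using lin_Const[OF U] B(2) k by (intro image_subsetI IntI) (blast, blast)
  ultimately show ?thesis by (intro exI[of _ B'] conjI allI impI)
qed

text \<open>\<open>R e\<close> is the degree \<open>e\<close> part of a graded ring. The Reynolds
  operator enters only through its effect: in a presentation of an element of \<open>R\<close> by
  elements of \<open>R\<close>, the coefficients can be taken from \<open>R\<close>.\<close>

locale graded_reynolds =
  fixes V :: "'v::linorder set" and R :: "nat \<Rightarrow> ('v, rat) mp set"
  assumes finite_V: "finite V" and V_ne: "V \<noteq> {}"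
    and R_HP: "p \<in> R e \<Longrightarrow> p \<in> HP V e"
    and lin_R: "lin (R e)"
    and one_R: "1 \<in> R 0"
    and mult_R: "p \<in> R d \<Longrightarrow> q \<in> R e \<Longrightarrow> p * q \<in> R (d + e)"
    and reynolds: "finite (J :: nat set) \<Longrightarrow>
      (\<And>j. j \<in> J \<Longrightarrow> D j \<le> e \<and> a j \<in> R (D j) \<and> h j \<in> HP V (e - D j)) \<Longrightarrow>
      (\<Sum>j\<in>J. h j * a j) \<in> R e \<Longrightarrow>
      \<exists>b. (\<forall>j\<in>J. b j \<in> R (e - D j)) \<and> (\<Sum>j\<in>J. h j * a j) = (\<Sum>j\<in>J. b j * a j)"
begin

text \<open>Taking the component of degree \<open>e\<close> replaces each coefficient by a
  homogeneous one and drops the terms with \<open>D j > e\<close>; then \<open>reynolds\<close>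
  applies.\<close>

lemma reynolds_PV:
  fixes l :: nat
  assumes p: "p \<in> R e" "p = (\<Sum>j<l. c j * a j)"
    and a: "\<And>j. j < l \<Longrightarrow> a j \<in> R (D j)" and c: "\<And>j. j < l \<Longrightarrow> c j \<in> PV V"
  shows "\<exists>b. (\<forall>j<l. D j \<le> e \<longrightarrow> b j \<in> R (e - D j)) \<and> p = (\<Sum>j\<in>{j. j < l \<and> D j \<le> e}. b j * a j)"
proof -
  let ?J = "{j. j < l \<and> D j \<le> e}"
  have "p = hcomp e p" using hcomp_same[OF R_HP[OF p(1)]] by simp
  also have "\<dots> = (\<Sum>j<l. hcomp e (a j * c j))" by (simp add: p(2) hcomp_sum mult.commute)
  also have "\<dots> = (\<Sum>j<l. if D j \<le> e then hcomp (e - D j) (c j) * a j else 0)"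
  proof (rule sum.cong[OF refl])
    fix j assume "j \<in> {..<l}"
    then have j: "a j \<in> HP V (D j)" "c j \<in> PV V" using a c R_HP by auto
    show "hcomp e (a j * c j) = (if D j \<le> e then hcomp (e - D j) (c j) * a j else 0)"
      using hcomp_mult_HP[OF j(1) _ j(2), of e] hcomp_mult_HP_less[OF j(1), of e "c j"]
      by (simp add: mult.commute)
  qed
  also have "\<dots> = (\<Sum>j\<in>?J. hcomp (e - D j) (c j) * a j)"
    by (rule sum.mono_neutral_cong_right) auto
  finally have eq: "p = (\<Sum>j\<in>?J. hcomp (e - D j) (c j) * a j)" .
  have "\<exists>b. (\<forall>j\<in>?J. b j \<in> R (e - D j)) \<and>
      (\<Sum>j\<in>?J. hcomp (e - D j) (c j) * a j) = (\<Sum>j\<in>?J. b j * a j)"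
    by (rule reynolds) (use a c p(1) eq in \<open>auto intro: hcomp_HP\<close>)
  then show ?thesis using eq by auto
qed

text \<open>Hilbert's finiteness argument: the ideal generated by all elements of positive degree in
  \<open>R\<close> is generated by finitely many of them.\<close>

lemma generators:
  "\<exists>(l :: nat) h D. (\<forall>j<l. 1 \<le> D j \<and> h j \<in> R (D j)) \<and>
    (\<forall>e\<ge>1. \<forall>p\<in>R e. \<exists>c. (\<forall>j<l. c j \<in> PV V) \<and> p = (\<Sum>j<l. c j * h j))"
proof -
  define G where "G = (\<Union>e\<in>{1..}. R e)"
  have "\<exists>H\<subseteq>G. finite H \<and> G \<subseteq> idl V H"
    by (rule hilbert_basis[OF finite_V]) (use R_HP in \<open>auto simp: G_def\<close>)
  then obtain H where H: "H \<subseteq> G" "finite H" "G \<subseteq> idl V H" by blast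
  obtain h where h: "bij_betw h {..<card H} H"
    using ex_bij_betw_nat_finite[OF H(2)] by (auto simp: atLeast0LessThan)
  have "\<forall>j\<in>{..<card H}. \<exists>e. 1 \<le> e \<and> h j \<in> R e"
    using bij_betwE[OF h] H(1) unfolding G_def by blast
  from bchoice[OF this] obtain D where D: "\<forall>j\<in>{..<card H}. 1 \<le> D j \<and> h j \<in> R (D j)" by blast
  have "\<exists>c. (\<forall>j<card H. c j \<in> PV V) \<and> p = (\<Sum>j<card H. c j * h j)" if "1 \<le> e" "p \<in> R e" for e p
  proof -
    have "p \<in> idl V H" using H(3) that by (auto simp: G_def)
    then obtain a where a: "p = (\<Sum>g\<in>H. a g * g)" "\<And>g. g \<in> H \<Longrightarrow> a g \<in> PV V" by (rule idlE) blast
    have "p = (\<Sum>j<card H. a (h j) * h j)" unfolding a(1) by (rule sum.reindex_bij_betw[OF h, symmetric])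
    then show ?thesis using a(2) bij_betwE[OF h] by (intro exI[of _ "\<lambda>j. a (h j)"]) auto
  qed
  then show ?thesis
    by - (rule exI[of _ "card H"], rule exI[of _ h], rule exI[of _ D], rule conjI, use D in auto)
qed

text \<open>The ideal generators also generate the ring: \<open>p\<close> is a combination of the
  \<open>h j\<close> with coefficients from \<open>R\<close> of lower degree. Quantifying over
  linear subspaces \<open>U\<close> stands for taking the span.\<close>

lemma monomials_span:
  fixes l :: nat
  assumes h: "\<And>j. j < l \<Longrightarrow> 1 \<le> D j \<and> h j \<in> R (D j)"
    and gen: "\<And>e p. 1 \<le> e \<Longrightarrow> p \<in> R e \<Longrightarrow> \<exists>c. (\<forall>j<l. c j \<in> PV V) \<and> p = (\<Sum>j<l. c j * h j)"
    and "p \<in> R e" "lin U" "\<And>\<alpha>. (\<Sum>j<l. \<alpha> j * D j) = e \<Longrightarrow> (\<Prod>j<l. h j ^ \<alpha> j) \<in> U"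
  shows "p \<in> U"
  using assms(3-5)
proof (induction e arbitrary: p U rule: less_induct)
  case (less e)
  show ?case
  proof (cases "e = 0")
    case True
    then have "p = Const (cf p 0) * 1" using HP_0_eq[of p V] R_HP[OF less.prems(1)] by simp
    moreover have "1 \<in> U" using less.prems(3)[of "\<lambda>_. 0"] True by simp
    ultimately show ?thesis using lin_Const[OF less.prems(2)] by metis
  next
    case False
    then obtain c where c: "\<forall>j<l. c j \<in> PV V" "p = (\<Sum>j<l. c j * h j)"
      using gen[of e p] less.prems(1) by auto
    obtain b where b: "\<forall>j<l. D j \<le> e \<longrightarrow> b j \<in> R (e - D j)"
      "p = (\<Sum>j\<in>{j. j < l \<and> D j \<le> e}. b j * h j)"
      using reynolds_PV[OF less.prems(1) c(2), of D] h c(1) by auto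
    have "b j * h j \<in> U" if j: "j < l" "D j \<le> e" for j
    proof -
      \<comment> \<open>The induction hypothesis is used for this subspace in place of
        \<open>U\<close>, which moves the factor \<open>h j\<close> into the monomial.\<close>
      let ?U = "{q. q * h j \<in> U}"
      have "b j \<in> ?U"
      proof (rule less.IH)
        show "e - D j < e" "b j \<in> R (e - D j)" using b(1) j h[OF j(1)] by auto
        show "lin ?U"
          by (rule linI) (auto simp: lin_0[OF less.prems(2)] distrib_right mult.assoc
            intro: lin_add[OF less.prems(2)] lin_Const[OF less.prems(2)])
        fix \<alpha> assume \<alpha>: "(\<Sum>j<l. \<alpha> j * D j) = e - D j"
        define \<beta> where "\<beta> = \<alpha>(j := \<alpha> j + 1)"
        have "(\<Sum>k<l. \<beta> k * D k) = (\<Sum>k<l. \<alpha> k * D k + (if k = j then D j else 0))"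
          by (rule sum.cong[OF refl]) (simp add: \<beta>_def)
        also have "\<dots> = e" using j \<alpha> by (simp add: sum.distrib)
        finally have "(\<Prod>k<l. h k ^ \<beta> k) \<in> U" by (rule less.prems(3))
        moreover have "(\<Prod>k<l. h k ^ \<beta> k) = (\<Prod>k<l. h k ^ \<alpha> k * (if k = j then h j else 1))"
          by (rule prod.cong[OF refl]) (simp add: \<beta>_def mult.commute)
        then have "(\<Prod>k<l. h k ^ \<beta> k) = (\<Prod>k<l. h k ^ \<alpha> k) * h j"
          using j by (simp add: prod.distrib)
        ultimately show "(\<Prod>k<l. h k ^ \<alpha> k) \<in> ?U" by simp
      qed
      then show ?thesis by simp
    qed
    then show ?thesis unfolding b(2) by (intro lin_sum[OF less.prems(2)]) auto
  qed
qed

end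

text \<open>The parameters \<open>f i\<close> are integral, for reduction modulo primes, and
  \<open>null\<close> says that over the complex numbers they cut out the null cone.\<close>

locale graded_reynolds_null = graded_reynolds V R for V :: "'v::linorder set" and R +
  fixes \<delta> r :: nat and f :: "nat \<Rightarrow> ('v, rat) mp"
  assumes \<delta>: "1 \<le> \<delta>" and r: "1 \<le> r"
    and f: "i < r \<Longrightarrow> f i \<in> R \<delta>" and f_int: "i < r \<Longrightarrow> f i \<in> range (pmap of_int)"
    and null: "(\<And>i. i < r \<Longrightarrow> hev of_rat x (f i) = 0) \<Longrightarrow> 1 \<le> e \<Longrightarrow> p \<in> R e \<Longrightarrow> hev (of_rat :: rat \<Rightarrow> complex) x p = 0"
begin

text \<open>The Nullstellensatz puts a power into the complex ideal. The descent to rational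
  coefficients uses that a rational functional killing the rational ideal also kills its complex
  extension.\<close>

lemma power_in_ideal:
  assumes "1 \<le> e" "p \<in> R e" shows "\<exists>s. p ^ s \<in> ideal_of V r f"
proof -
  define F where "F i = pmap (of_rat :: rat \<Rightarrow> complex) (f i)" for i
  have FPV: "F i \<in> PV V" if "i < r" for i
    unfolding F_def by (rule pmap_PV) (use HP_PV[OF R_HP[OF f[OF that]]] in auto)
  have cr: "comm_ring_hom (of_rat :: rat \<Rightarrow> complex)" by (rule of_rat_hom.comm_ring_hom_axioms)
  interpret pm: comm_ring_hom "pmap (of_rat :: rat \<Rightarrow> complex) :: ('v, rat) mp \<Rightarrow> _"
    by (rule comm_ring_hom_pmap[OF cr])
  have "\<exists>s. pmap of_rat p ^ s \<in> ideal_of V r F"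
  proof (rule nullstellensatz_complex[OF finite_V ideal_in_ideal_of])
    show "pmap of_rat p \<in> PV V" by (rule pmap_PV) (use HP_PV[OF R_HP[OF assms(2)]] in auto)
    fix x :: "'v \<Rightarrow> complex" assume x: "\<And>g. g \<in> ideal_of V r F \<Longrightarrow> ev x g = 0"
    have "hev of_rat x p = 0"
    proof (rule null[OF _ assms])
      fix i assume "i < r"
      from x[OF ideal_of_self[OF this]] show "hev of_rat x (f i) = 0" by (simp add: F_def ev_pmap)
    qed
    then show "ev x (pmap of_rat p) = 0" by (simp add: ev_pmap)
  qed (rule FPV)
  then obtain s where s: "pmap of_rat p ^ s \<in> ideal_of V r F" ..
  \<comment> \<open>The additional \<open>\<delta>\<close> factors bring the degree to at least
    \<open>\<delta>\<close>, as the membership test demands.\<close>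
  define g where "g = p ^ (\<delta> + s)"
  have "pmap of_rat p ^ \<delta> \<in> PV V"
    by (intro PV_power pmap_PV) (use HP_PV[OF R_HP[OF assms(2)]] in auto)
  then have "pmap of_rat p ^ \<delta> * pmap of_rat p ^ s \<in> ideal_of V r F"
    by (intro ideal_inD(3)[OF ideal_in_ideal_of] s FPV)
  then have "pmap of_rat g \<in> ideal_of V r F" by (simp add: g_def pm.hom_power pm.hom_mult power_add)
  then obtain h where h: "pmap of_rat g = (\<Sum>i<r. h i * F i)" "\<And>i. i < r \<Longrightarrow> h i \<in> PV V"
    by (rule ideal_ofE) blast
  have "\<exists>h. (\<forall>i<r. h i \<in> HP V ((\<delta> + s) * e - \<delta>)) \<and> g = (\<Sum>i<r. h i * f i)"
  proof (rule ideal_membership_test[OF finite_V])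
    show "g \<in> HP V ((\<delta> + s) * e)" unfolding g_def by (intro HP_power R_HP assms)
    show "\<delta> \<le> (\<delta> + s) * e" using assms(1) by (metis add_leD1 mult_le_mono2 nat_mult_1_right)
    show "f i \<in> HP V \<delta>" if "i < r" for i by (rule R_HP[OF f[OF that]])
    fix w assume w: "\<And>i u. i < r \<Longrightarrow> supp u \<subseteq> V \<Longrightarrow> dot w (sgl u 1 * f i) = 0"
    let ?W = "pmap (of_rat :: rat \<Rightarrow> complex) w"
    have "dot ?W (h i * F i) = 0" if i: "i < r" for i
    proof (rule dot_mult_eq_0[OF _ h(2)[OF i]])
      fix u :: "'v mono" assume u: "supp u \<subseteq> V"
      have "sgl u 1 * F i = pmap of_rat (sgl u 1 * f i)"
        unfolding F_def pm.hom_mult by (rule arg_cong2[where f="(*)"])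
          (auto intro!: poly_mapping_eqI simp: cf_pmap lookup_single when_def)
      then show "dot ?W (sgl u 1 * F i) = 0" using w[OF i u] by (simp add: dot_pmap[OF cr])
    qed
    then have "dot ?W (pmap of_rat g) = 0" unfolding h(1) wform_sum_right by simp
    then show "dot w g = 0" by (simp add: dot_pmap[OF cr])
  qed
  then obtain k where k: "\<forall>i<r. k i \<in> HP V ((\<delta> + s) * e - \<delta>)" "g = (\<Sum>i<r. k i * f i)" by blast
  have "g \<in> ideal_of V r f" by (rule ideal_ofI[OF k(2)]) (rule HP_PV[OF k(1)[THEN spec, THEN mp]])
  then show ?thesis unfolding g_def by (rule exI)
qed

lemma lin_ideal: "lin (ideal_of V r f)"
proof (rule linI)
  have I: "ideal_in V (ideal_of V r f)" by (rule ideal_in_ideal_of) (rule HP_PV[OF R_HP[OF f]])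
  show "0 \<in> ideal_of V r f" by (rule ideal_inD(1)[OF I])
  show "p \<in> ideal_of V r f \<Longrightarrow> q \<in> ideal_of V r f \<Longrightarrow> p + q \<in> ideal_of V r f" for p q by (rule ideal_inD(2)[OF I])
  show "p \<in> ideal_of V r f \<Longrightarrow> Const c * p \<in> ideal_of V r f" for p c by (rule ideal_inD(3)[OF I _ PV_Const])
qed

text \<open>If a monomial in the generators \<open>h j\<close> has degree above the sum of all
  \<open>s j * D j\<close>, some exponent is at least \<open>s j\<close>, and
  \<open>h j ^ s j\<close> lies in the ideal.\<close>

lemma eventually_in_ideal: "\<exists>e0. \<forall>e\<ge>e0. R e \<subseteq> ideal_of V r f"
proof -
  from generators obtain l :: nat and h D where h': "\<forall>j<l. 1 \<le> D j \<and> h j \<in> R (D j)"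
    and gen': "\<forall>e\<ge>1. \<forall>p\<in>R e. \<exists>c. (\<forall>j<l. c j \<in> PV V) \<and> p = (\<Sum>j<l. c j * h j)"
    by (elim exE conjE) (rule that)
  have h: "1 \<le> D j \<and> h j \<in> R (D j)" if "j < l" for j using h' that by blast
  have gen: "\<exists>c. (\<forall>j<l. c j \<in> PV V) \<and> p = (\<Sum>j<l. c j * h j)" if "1 \<le> e" "p \<in> R e" for e p
    using gen' that by blast
  have "\<forall>j\<in>{..<l}. \<exists>s. h j ^ s \<in> ideal_of V r f" using h power_in_ideal by blast
  from bchoice[OF this] obtain s where s: "\<And>j. j < l \<Longrightarrow> h j ^ s j \<in> ideal_of V r f" by blast
  define e0 where "e0 = (\<Sum>j<l. s j * D j) + 1"
  have I: "ideal_in V (ideal_of V r f)" by (rule ideal_in_ideal_of) (rule HP_PV[OF R_HP[OF f]])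
  have "R e \<subseteq> ideal_of V r f" if e: "e0 \<le> e" for e
  proof
    fix p assume p: "p \<in> R e"
    show "p \<in> ideal_of V r f"
    proof (rule monomials_span[OF h gen p lin_ideal])
      fix \<alpha> assume \<alpha>: "(\<Sum>j<l. \<alpha> j * D j) = e"
      have "\<exists>j<l. s j \<le> \<alpha> j"
      proof (rule ccontr)
        assume "\<not> ?thesis"
        then have "(\<Sum>j<l. \<alpha> j * D j) \<le> (\<Sum>j<l. s j * D j)" by (intro sum_mono mult_le_mono1) auto
        then show False using \<alpha> e by (simp add: e0_def)
      qed
      then obtain j where j: "j < l" "s j \<le> \<alpha> j" by blast
      have "(\<Prod>k<l. h k ^ \<alpha> k) = h j ^ \<alpha> j * (\<Prod>k\<in>{..<l} - {j}. h k ^ \<alpha> k)"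
        using j by (intro prod.remove) auto
      also have "h j ^ \<alpha> j = h j ^ (\<alpha> j - s j) * h j ^ s j" using j(2) by (simp flip: power_add)
      finally have eq: "(\<Prod>k<l. h k ^ \<alpha> k) = (h j ^ (\<alpha> j - s j) * (\<Prod>k\<in>{..<l} - {j}. h k ^ \<alpha> k)) * h j ^ s j"
        by (simp only: mult_ac)
      show "(\<Prod>k<l. h k ^ \<alpha> k) \<in> ideal_of V r f"
        unfolding eq by (intro ideal_inD(3)[OF I] s j PV_mult PV_power PV_prod) (use h j HP_PV[OF R_HP] in auto)
    qed auto
  qed
  then show ?thesis by blast
qed

text \<open>Graded Nakayama: from degree \<open>e0\<close> on, an element of \<open>R\<close> is a
  combination of the \<open>f i\<close> with coefficients from \<open>R\<close> of degree lower by
  \<open>\<delta>\<close>. So \<open>R\<close> is spanned by products of the \<open>f i\<close> with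
  integral elements of degree below \<open>e0\<close>.\<close>

lemma finite_module:
  "\<exists>e0 B. (\<forall>e. finite (B e) \<and> B e \<subseteq> R e \<inter> range (pmap of_int)) \<and>
    (\<forall>e p U. p \<in> R e \<longrightarrow> lin U \<longrightarrow>
      (\<forall>\<alpha> d b. d < e0 \<longrightarrow> b \<in> B d \<longrightarrow> (\<Sum>i<r. \<alpha> i) * \<delta> + d = e \<longrightarrow> (\<Prod>i<r. f i ^ \<alpha> i) * b \<in> U) \<longrightarrow> p \<in> U)"
proof -
  from eventually_in_ideal obtain e1 where e1: "\<And>e. e1 \<le> e \<Longrightarrow> R e \<subseteq> ideal_of V r f" by blast
  define e0 where "e0 = e1 + \<delta>"
  have "\<forall>e. \<exists>B. finite B \<and> B \<subseteq> R e \<inter> range (pmap of_int) \<and> (\<forall>U. lin U \<longrightarrow> B \<subseteq> U \<longrightarrow> R e \<subseteq> U)"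
  proof
    fix e
    show "\<exists>B. finite B \<and> B \<subseteq> R e \<inter> range (pmap of_int) \<and> (\<forall>U. lin U \<longrightarrow> B \<subseteq> U \<longrightarrow> R e \<subseteq> U)"
      by (rule finite_integral_spanning_set[OF finite_HP_monos[OF finite_V] lin_R]) (use R_HP HP_supp in blast)
  qed
  from choice[OF this] obtain B where
    B0: "\<forall>e. finite (B e) \<and> B e \<subseteq> R e \<inter> range (pmap of_int) \<and> (\<forall>U. lin U \<longrightarrow> B e \<subseteq> U \<longrightarrow> R e \<subseteq> U)"
    by (elim exE) (rule that)
  have B: "finite (B e)" "B e \<subseteq> R e \<inter> range (pmap of_int)" "lin U \<Longrightarrow> B e \<subseteq> U \<Longrightarrow> R e \<subseteq> U" for e U
    using B0[THEN spec, of e] by simp_all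
  have "p \<in> U" if "p \<in> R e" "lin U"
    "\<And>\<alpha> d b. d < e0 \<Longrightarrow> b \<in> B d \<Longrightarrow> (\<Sum>i<r. \<alpha> i) * \<delta> + d = e \<Longrightarrow> (\<Prod>i<r. f i ^ \<alpha> i) * b \<in> U" for e p U
    using that
  proof (induction e arbitrary: p U rule: less_induct)
    case (less e)
    show ?case
    proof (cases "e < e0")
      case True
      have "b \<in> U" if "b \<in> B e" for b using less.prems(3)[of e b "\<lambda>_. 0"] True that by simp
      then show ?thesis using B(3)[OF less.prems(2), of e] less.prems(1) by blast
    next
      case False
      then have le: "\<delta> \<le> e" "e1 \<le> e" by (auto simp: e0_def)
      obtain c where c: "p = (\<Sum>i<r. c i * f i)" "\<And>i. i < r \<Longrightarrow> c i \<in> PV V"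
        using e1[OF le(2)] less.prems(1) by (blast elim: ideal_ofE)
      have J: "{j. j < r \<and> \<delta> \<le> e} = {..<r}" using le by auto
      have "\<exists>b. (\<forall>i<r. \<delta> \<le> e \<longrightarrow> b i \<in> R (e - \<delta>)) \<and> p = (\<Sum>i\<in>{j. j < r \<and> \<delta> \<le> e}. b i * f i)"
        by (rule reynolds_PV[OF less.prems(1) c(1) f c(2)])
      then obtain b where b: "\<forall>i<r. b i \<in> R (e - \<delta>)" "p = (\<Sum>i<r. b i * f i)"
        unfolding J using le by blast
      have "b j * f j \<in> U" if j: "j < r" for j
      proof -
        let ?U = "{q. q * f j \<in> U}"
        have "b j \<in> ?U"
        proof (rule less.IH)
          show "e - \<delta> < e" "b j \<in> R (e - \<delta>)" using b(1) j \<delta> le by auto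
          show "lin ?U"
            by (rule linI) (auto simp: lin_0[OF less.prems(2)] distrib_right mult.assoc
              intro: lin_add[OF less.prems(2)] lin_Const[OF less.prems(2)])
          fix \<alpha> d x assume \<alpha>: "d < e0" "x \<in> B d" "(\<Sum>i<r. \<alpha> i) * \<delta> + d = e - \<delta>"
          define \<beta> where "\<beta> = \<alpha>(j := \<alpha> j + 1)"
          have "(\<Sum>k<r. \<beta> k) = (\<Sum>k<r. \<alpha> k + (if k = j then 1 else 0))"
            by (rule sum.cong[OF refl]) (simp add: \<beta>_def)
          then have "(\<Sum>k<r. \<beta> k) = (\<Sum>k<r. \<alpha> k) + 1" using j by (simp add: sum.distrib)
          then have "(\<Prod>k<r. f k ^ \<beta> k) * x \<in> U"
            using \<alpha>(3) le by (intro less.prems(3)[OF \<alpha>(1,2)]) simp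
          moreover have "(\<Prod>k<r. f k ^ \<beta> k) = (\<Prod>k<r. f k ^ \<alpha> k * (if k = j then f j else 1))"
            by (rule prod.cong[OF refl]) (simp add: \<beta>_def mult.commute)
          then have "(\<Prod>k<r. f k ^ \<beta> k) = (\<Prod>k<r. f k ^ \<alpha> k) * f j"
            using j by (simp add: prod.distrib)
          ultimately show "(\<Prod>k<r. f k ^ \<alpha> k) * x \<in> ?U" by (simp add: mult_ac)
        qed
        then show ?thesis by simp
      qed
      then show ?thesis unfolding b(2) by (intro lin_sum[OF less.prems(2)]) auto
    qed
  qed
  then show ?thesis
    by - (rule exI[of _ e0], rule exI[of _ B], rule conjI, rule allI, rule conjI, rule B(1), rule B(2), intro allI impI, blast)
qed

end

section \<open>Ideal membership modulo large primes\<close>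

lemma binomial_prime_cong:
  fixes x y :: "'a::comm_ring_1"
  assumes "prime p" shows "of_nat p dvd (x + y) ^ p - (x ^ p + y ^ p)"
proof -
  have p: "p > 0" using assms by (simp add: prime_gt_0_nat)
  have "(x + y) ^ p = (\<Sum>k\<le>p. of_nat (p choose k) * x ^ k * y ^ (p - k))" by (rule binomial_ring)
  also have "{..p} = insert 0 (insert p {0<..<p})" using p by auto
  also have "(\<Sum>k\<in>insert 0 (insert p {0<..<p}). of_nat (p choose k) * x ^ k * y ^ (p - k))
      = y ^ p + (x ^ p + (\<Sum>k\<in>{0<..<p}. of_nat (p choose k) * x ^ k * y ^ (p - k)))"
    using p by simp
  finally have eq: "(x + y) ^ p - (x ^ p + y ^ p) = (\<Sum>k\<in>{0<..<p}. of_nat (p choose k) * x ^ k * y ^ (p - k))"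
    by simp
  show ?thesis unfolding eq
  proof (rule dvd_sum)
    fix k assume "k \<in> {0<..<p}"
    then have "p dvd (p choose k)" using p assms by (intro dvd_choose_prime) auto
    then have "(of_nat p :: 'a) dvd of_nat (p choose k)" by (metis dvd_def of_nat_mult)
    then show "(of_nat p :: 'a) dvd of_nat (p choose k) * x ^ k * y ^ (p - k)" by (simp add: dvd_mult2)
  qed
qed

definition pmono :: "nat \<Rightarrow> 'v mono \<Rightarrow> 'v mono" where
  "pmono p t = Poly_Mapping.map ((*) p) t"

lemma cf_pmono: "cf (pmono p t) v = p * cf t v"
  by (simp add: pmono_def Poly_Mapping.map.rep_eq when_def)

lemma pmono_add: "pmono p (s + t) = pmono p s + pmono p t"
  by (rule poly_mapping_eqI) (simp add: cf_pmono lookup_add distrib_left)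

lemma pmono_0 [simp]: "pmono p 0 = 0"
  by (rule poly_mapping_eqI) (simp add: cf_pmono)

text \<open>The lift of the Frobenius map to characteristic zero that fixes the
  coefficients.\<close>

definition frob :: "nat \<Rightarrow> ('v, 'a::comm_ring_1) mp \<Rightarrow> ('v, 'a) mp" where
  "frob p = subst (\<lambda>v. Var v ^ p)"

interpretation frob: comm_ring_hom "frob p"
  unfolding frob_def by (rule subst.comm_ring_hom_axioms)

lemma frob_eq:
  fixes h :: "('v, 'a::comm_ring_1) mp"
  shows "frob p h = (\<Sum>s\<in>supp h. sgl (pmono p s) (cf h s))"
proof -
  have power: "sgl t 1 ^ p = sgl (pmono p t) (1 :: 'a)" for t :: "'v mono"
  proof (induction p)
    case 0
    have "pmono 0 t = 0" by (rule poly_mapping_eqI) (simp add: cf_pmono)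
    then show ?case by simp
  next
    case (Suc p)
    have "pmono (Suc p) t = t + pmono p t" by (rule poly_mapping_eqI) (simp add: cf_pmono lookup_add)
    then show ?case by (simp add: Suc mult_single)
  qed
  have "mev (\<lambda>v. Var v ^ p) s = (mev Var s ^ p :: ('v, 'a) mp)" for s :: "'v mono"
    by (simp add: mev_def prod_power_distrib mult.commute flip: power_mult)
  then show ?thesis unfolding frob_def hev_def mev_Var
    by (intro sum.cong[OF refl]) (simp add: mev_Var power flip: sgl_eq_Const_mult)
qed

lemma fermat_int: "prime p \<Longrightarrow> int p dvd c ^ p - c"
proof (induction c rule: int_induct[where k = 0])
  case base
  then show ?case by (simp add: prime_gt_0_nat power_0_left)
next
  case (step1 i)
  have "int p dvd (i + 1) ^ p - (i ^ p + 1 ^ p)" using binomial_prime_cong[OF step1(3), of i 1] by simp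
  moreover have "(i + 1) ^ p - (i ^ p + 1 ^ p) + (i ^ p - i) = (i + 1) ^ p - (i + 1)" by simp
  ultimately show ?case using step1(2)[OF step1(3)] by (metis dvd_add)
next
  case (step2 i)
  have "int p dvd (i - 1 + 1) ^ p - ((i - 1) ^ p + 1 ^ p)" using binomial_prime_cong[OF step2(3), of "i - 1" 1] by simp
  moreover have "(i ^ p - i) - ((i - 1 + 1) ^ p - ((i - 1) ^ p + 1 ^ p)) = (i - 1) ^ p - (i - 1)" by simp
  ultimately show ?case using step2(2)[OF step2(3)] by (metis dvd_diff)
qed

lemma of_nat_mp: "of_nat n = (Const (of_nat n) :: ('v, 'a::comm_ring_1) mp)"
  by (induction n) (simp_all add: Const_add)

text \<open>Additivity modulo \<open>p\<close> comes from the binomial coefficients, and Fermat's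
  little theorem settles the constants.\<close>

lemma frob_cong:
  fixes h :: "('v, int) mp"
  assumes "prime p" shows "of_nat p dvd h ^ p - frob p h"
proof -
  interpret C: comm_ring_hom "Const :: int \<Rightarrow> ('v, int) mp" by (rule comm_ring_hom_Const)
  have "h \<in> PV UNIV" by simp
  then show ?thesis
  proof (induction rule: PV_induct)
    case (Const c)
    obtain k where "c ^ p - c = int p * k" using fermat_int[OF assms] by (blast elim: dvdE)
    then have "Const c ^ p - frob p (Const c) = of_nat p * (Const k :: ('v, int) mp)"
      unfolding of_nat_mp frob_def by (simp flip: C.hom_power C.hom_minus C.hom_mult)
    then show ?case by simp
  next
    case (add x y)
    have "(x + y) ^ p - frob p (x + y)
        = ((x + y) ^ p - (x ^ p + y ^ p)) + (x ^ p - frob p x) + (y ^ p - frob p y)"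
      by (simp add: frob.hom_add)
    then show ?case using binomial_prime_cong[OF assms, of x y] add by (simp only: dvd_add)
  next
    case (Var v h)
    have "(Var v * h) ^ p - frob p (Var v * h) = Var v ^ p * (h ^ p - frob p h)"
      unfolding frob.hom_mult by (simp add: frob_def power_mult_distrib right_diff_distrib)
    then show ?case using Var by simp
  qed
qed

text \<open>Modulo \<open>p\<close> the functional below sends \<open>a * h ^ p\<close> to a value of the functional \<open>dot w\<close> on
  a multiple of \<open>h\<close>.\<close>

definition cartier :: "('v, 'a::comm_ring_1) mp \<Rightarrow> nat \<Rightarrow> ('v, 'a) mp \<Rightarrow> 'a" where
  "cartier w p h = (\<Sum>t\<in>supp w. cf w t * cf h (pmono p t))"

lemma cartier_add: "cartier w p (h + k) = cartier w p h + cartier w p k"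
  by (simp add: cartier_def lookup_add distrib_left sum.distrib)

lemma cartier_Const: "cartier w p (Const c * h) = c * cartier w p h"
  unfolding cartier_def mp_Const_mult_cf sum_distrib_left by (rule sum.cong[OF refl]) (rule mult.left_commute)

lemma cartier_sum: "cartier w p (\<Sum>i\<in>I. h i) = (\<Sum>i\<in>I. cartier w p (h i))"
  by (induction I rule: infinite_finite_induct) (auto simp: cartier_add, auto simp: cartier_def)

text \<open>In a monomial times \<open>frob p h\<close>, the exponents divisible by \<open>p\<close>
  arise only when that monomial is itself a \<open>p\<close>-th power; dividing them by
  \<open>p\<close> gives the product of the root with \<open>h\<close>.\<close>

lemma cartier_frob:
  fixes w h :: "('v, 'a::comm_ring_1) mp"
  assumes p: "p > 0"
  shows "cartier w p (sgl (pmono p u) 1 * frob p h) = dot w (sgl u 1 * h)"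
    and "(\<And>u'. u \<noteq> pmono p u') \<Longrightarrow> cartier w p (sgl u 1 * frob p h) = 0"
proof -
  have eq: "sgl u 1 * frob p h = (\<Sum>s\<in>supp h. sgl (u + pmono p s) (cf h s))" for u
    unfolding frob_eq by (simp add: sum_distrib_left mult_single)
  have inj: "pmono p s = pmono p t \<longleftrightarrow> s = t" for s t :: "'v mono"
    using p by (auto simp: poly_mapping_eq_iff fun_eq_iff cf_pmono)
  have "cf (sgl (pmono p u) 1 * frob p h) (pmono p t) = cf (sgl u 1 * h) t" for t
  proof -
    have "sgl u 1 * h = (\<Sum>s\<in>supp h. sgl (u + s) (cf h s))"
      by (subst (1) mp_decomp) (simp add: sum_distrib_left mult_single)
    then show ?thesis
      unfolding eq by (simp add: lookup_sum lookup_single inj when_def flip: pmono_add)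
  qed
  then show "cartier w p (sgl (pmono p u) 1 * frob p h) = dot w (sgl u 1 * h)"
    by (simp add: cartier_def wform_def)
  assume u: "\<And>u'. u \<noteq> pmono p u'"
  have "u + pmono p s \<noteq> pmono p t" for s t
  proof
    assume *: "u + pmono p s = pmono p t"
    have "u = pmono p (t - s)"
    proof (rule poly_mapping_eqI)
      fix v
      have "cf u v + p * cf s v = p * cf t v" using arg_cong[OF *, of "\<lambda>x. cf x v"] by (simp add: lookup_add cf_pmono)
      then show "cf u v = cf (pmono p (t - s)) v" by (simp add: cf_pmono lookup_minus diff_mult_distrib2)
    qed
    then show False using u by blast
  qed
  then show "cartier w p (sgl u 1 * frob p h) = 0"
    unfolding eq by (simp add: cartier_def lookup_sum lookup_single when_def)
qed

lemma cartier_power_cong: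
  fixes w h a :: "('v, int) mp"
  assumes "prime p" shows "int p dvd cartier w p (a * h ^ p) - cartier w p (a * frob p h)"
proof -
  obtain k where "h ^ p - frob p h = of_nat p * k" using frob_cong[OF assms, of h] by (blast elim: dvdE)
  then have "a * h ^ p = a * frob p h + Const (int p) * (a * k)"
    by (simp add: of_nat_mp algebra_simps)
  then show ?thesis by (simp add: cartier_add cartier_Const)
qed

text \<open>Modulo \<open>p\<close> the power of \<open>h\<close> is \<open>frob p h\<close>, and
  then every monomial of \<open>a\<close> contributes either zero or the value of
  \<open>dot w\<close> on a multiple of \<open>h\<close>.\<close>

lemma cartier_power_ideal:
  fixes w h a :: "('v, int) mp"
  assumes p: "prime p" and w: "\<And>u. dot w (sgl u 1 * h) = 0"
  shows "int p dvd cartier w p (a * h ^ p)"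
proof -
  have "a * frob p h = (\<Sum>u\<in>supp a. Const (cf a u) * (sgl u 1 * frob p h))"
    by (subst (1) mp_decomp) (simp add: sum_distrib_right flip: mult.assoc sgl_eq_Const_mult)
  moreover have "cartier w p (sgl u 1 * frob p h) = 0" for u
  proof (cases "\<exists>u'. u = pmono p u'")
    case True
    then show ?thesis using cartier_frob(1)[OF prime_gt_0_nat[OF p]] w by metis
  next
    case False
    then show ?thesis by (intro cartier_frob(2)[OF prime_gt_0_nat[OF p]]) blast
  qed
  ultimately have "cartier w p (a * frob p h) = 0" by (simp add: cartier_sum cartier_Const)
  then show ?thesis using cartier_power_cong[OF p, of w a h] by simp
qed

lemma dot_outside:
  assumes "w \<in> PV V" "\<not> supp u \<subseteq> V" shows "dot w (sgl u 1 * h) = 0"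
  unfolding wform_def
proof (rule sum.neutral, rule ballI)
  fix t assume "t \<in> supp w"
  then have "supp t \<subseteq> V" using assms(1) by (simp add: PV_def)
  then have "t \<noteq> u + s" for s using assms(2) by (auto simp: supp_add_nat)
  then have "cf (sgl u 1 * h) t = 0" by (rule cf_sgl_mult_notin)
  then show "1 * cf w t * cf (sgl u 1 * h) t = 0" by simp
qed

text \<open>Let an integral functional kill the ideal and let \<open>y\<close> be its value at
  \<open>g\<close>. Applying \<open>cartier\<close> to the given identity yields
  \<open>c * d ^ p * y = 0\<close> modulo \<open>p\<close>; as \<open>c\<close>, \<open>d\<close>
  and \<open>y\<close> do not depend on \<open>p\<close>, a large prime forces
  \<open>y = 0\<close>.\<close>

lemma prime_powers_ideal_membership:
  fixes f :: "nat \<Rightarrow> ('v, rat) mp" and g :: "('v, rat) mp" and f' :: "nat \<Rightarrow> ('v, int) mp"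
  assumes V: "finite V" and f: "\<And>i. i < r \<Longrightarrow> f i \<in> HP V \<delta>" "\<And>i. i < r \<Longrightarrow> f i = pmap of_int (f' i)"
    and g: "g \<in> HP V e" "g = pmap of_int g'" and le: "\<delta> \<le> e" and c: "0 < c" "0 < d"
    and pow: "\<And>p. prime p \<Longrightarrow> p0 \<le> p \<Longrightarrow> \<exists>A. Const (of_nat (c * d ^ p)) * g' ^ p = (\<Sum>i<r. A i * f' i ^ p)"
  shows "g \<in> ideal_of V r f"
proof -
  have cr: "comm_ring_hom (of_int :: int \<Rightarrow> rat)" by (rule of_int_hom.comm_ring_hom_axioms)
  interpret pm: comm_ring_hom "pmap (of_int :: int \<Rightarrow> rat) :: ('v, int) mp \<Rightarrow> _" by (rule comm_ring_hom_pmap[OF cr])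
  have sgl1: "pmap of_int (sgl u 1 :: ('v, int) mp) = (sgl u 1 :: ('v, rat) mp)" for u
    by (auto intro!: poly_mapping_eqI simp: cf_pmap lookup_single when_def)
  have "\<exists>h. (\<forall>i<r. h i \<in> HP V (e - \<delta>)) \<and> g = (\<Sum>i<r. h i * f i)"
  proof (rule ideal_membership_test[OF V f(1) g(1) le])
    fix w assume w: "w \<in> HP V e" "\<And>i u. i < r \<Longrightarrow> supp u \<subseteq> V \<Longrightarrow> dot w (sgl u 1 * f i) = 0"
    obtain k w' where k: "k > 0" "Const (of_nat k) * w = pmap of_int w'" using clear_denominators[of w] by blast
    have scale: "dot (pmap of_int w') q = of_nat k * dot w q" for q
      by (simp add: wform_Const_left flip: k(2))
    have "dot w' (sgl u 1 * f' i) = 0" if i: "i < r" for i u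
    proof -
      have "dot w (sgl u 1 * f i) = 0"
        using w(2)[OF i] dot_outside[OF HP_PV[OF w(1)]] by blast
      then have "dot (pmap (of_int :: int \<Rightarrow> rat) w') (pmap of_int (sgl u 1 * f' i)) = 0"
        by (simp add: scale pm.hom_mult sgl1 f(2)[OF i])
      then show ?thesis unfolding dot_pmap[OF cr] by simp
    qed note w' = this
    define y where "y = dot w' g'"
    \<comment> \<open>Beyond \<open>c\<close> and \<open>d\<close>, so that it does not divide
      \<open>c * d ^ p\<close>, and beyond the absolute value of \<open>y\<close>, so that it
      divides \<open>y\<close> only if \<open>y = 0\<close>.\<close>
    obtain p where p: "prime p" "p0 + c + d + nat \<bar>y\<bar> < p" using bigger_prime by blast
    obtain A where A: "Const (of_nat (c * d ^ p)) * g' ^ p = (\<Sum>i<r. A i * f' i ^ p)"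
      using pow[OF p(1)] p(2) by auto
    have "int p dvd cartier w' p (\<Sum>i<r. A i * f' i ^ p)"
      unfolding cartier_sum by (intro dvd_sum cartier_power_ideal p w') auto
    then have 1: "int p dvd int (c * d ^ p) * cartier w' p (1 * g' ^ p)"
      by (simp add: cartier_Const flip: A)
    have "cartier w' p (1 * frob p g') = y"
      using cartier_frob(1)[OF prime_gt_0_nat[OF p(1)], of w' 0 g'] by (simp add: y_def)
    then have "int p dvd cartier w' p (1 * g' ^ p) - y" using cartier_power_cong[OF p(1), of w' 1 g'] by simp
    from dvd_diff[OF 1 dvd_mult[OF this, of "int (c * d ^ p)"]]
    have "int p dvd int (c * d ^ p) * y" by (simp add: algebra_simps)
    moreover have "\<not> p dvd c * d ^ p"
    proof
      assume "p dvd c * d ^ p"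
      then have "p dvd c \<or> p dvd d" using p(1) by (meson prime_dvd_multD prime_dvd_power)
      then have "p \<le> c \<or> p \<le> d" using c by (auto dest: dvd_imp_le)
      then show False using p(2) by linarith
    qed
    then have "\<not> int p dvd int (c * d ^ p)" by (simp only: int_dvd_int_iff not_False_eq_True)
    moreover have "prime (int p)" using p(1) by simp
    ultimately have "int p dvd y" using prime_dvd_multD by blast
    have "y = 0"
    proof (rule ccontr)
      assume "y \<noteq> 0"
      then have "\<bar>int p\<bar> \<le> \<bar>y\<bar>" using \<open>int p dvd y\<close> by (rule dvd_imp_le_int)
      then show False using p(2) by linarith
    qed
    then have "dot (pmap (of_int :: int \<Rightarrow> rat) w') (pmap of_int g') = 0" unfolding dot_pmap[OF cr] y_def by simp
    then show "dot w g = 0" using k(1) by (simp add: scale g(2))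
  qed
  then obtain h where h: "\<forall>i<r. h i \<in> HP V (e - \<delta>)" "g = (\<Sum>i<r. h i * f i)" by blast
  show ?thesis by (rule ideal_ofI[OF h(2)]) (rule HP_PV[OF h(1)[THEN spec, THEN mp]])
qed

section \<open>Integral spans and control of denominators\<close>

definition addgrp :: "'a::ab_group_add set \<Rightarrow> bool" where
  "addgrp U \<longleftrightarrow> 0 \<in> U \<and> (\<forall>x\<in>U. \<forall>y\<in>U. x + y \<in> U) \<and> (\<forall>x\<in>U. - x \<in> U)"

lemma addgrpI:
  "0 \<in> U \<Longrightarrow> (\<And>x y. x \<in> U \<Longrightarrow> y \<in> U \<Longrightarrow> x + y \<in> U) \<Longrightarrow> (\<And>x. x \<in> U \<Longrightarrow> - x \<in> U) \<Longrightarrow> addgrp U"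
  by (simp add: addgrp_def)

lemma addgrpD:
  assumes "addgrp U"
  shows "0 \<in> U" "x \<in> U \<Longrightarrow> y \<in> U \<Longrightarrow> x + y \<in> U" "x \<in> U \<Longrightarrow> - x \<in> U"
  using assms by (auto simp: addgrp_def)

lemma addgrp_of_int:
  fixes U :: "('v, 'a::comm_ring_1) mp set"
  assumes U: "addgrp U" and p: "p \<in> U" shows "Const (of_int k) * p \<in> U"
proof (induction k rule: int_induct[where k = 0])
  case base
  then show ?case by (simp add: addgrpD(1)[OF U])
next
  case (step1 i)
  have "Const (of_int (i + 1)) * p = Const (of_int i) * p + p" by (simp add: Const_add distrib_right)
  then show ?case using addgrpD(2)[OF U step1(2) p] by simp
next
  case (step2 i)
  have "Const (of_int (i - 1)) * p = Const (of_int i) * p + - p"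
    using Const_add[of "of_int (i - 1) :: 'a" 1, where 'v = 'v] by (simp add: algebra_simps)
  then show ?case using addgrpD(2)[OF U step2(2) addgrpD(3)[OF U p]] by simp
qed

lemma addgrp_of_nat:
  fixes U :: "('v, 'a::comm_ring_1) mp set"
  shows "addgrp U \<Longrightarrow> p \<in> U \<Longrightarrow> Const (of_nat k) * p \<in> U"
  using addgrp_of_int[of U p "int k"] by simp

lemma addgrp_vimage: "addgrp U \<Longrightarrow> addgrp {x. c * x \<in> (U :: 'a::comm_ring_1 set)}"
  by (simp add: addgrp_def distrib_left)

definition zspan :: "'a::ab_group_add set \<Rightarrow> 'a set" where
  "zspan G = {x. \<forall>U. addgrp U \<longrightarrow> G \<subseteq> U \<longrightarrow> x \<in> U}"

lemma zspanD: "x \<in> zspan G \<Longrightarrow> addgrp U \<Longrightarrow> G \<subseteq> U \<Longrightarrow> x \<in> U" by (simp add: zspan_def)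

lemma zspan_mem: "x \<in> G \<Longrightarrow> x \<in> zspan G" by (auto simp: zspan_def)

lemma addgrp_zspan: "addgrp (zspan G)"
  unfolding zspan_def by (intro addgrpI) (auto intro: addgrpD)

text \<open>The elements with a positive multiple in the integral span form a linear subspace over
  the rationals that contains \<open>G\<close>.\<close>

lemma lin_zspan:
  fixes G :: "('v, rat) mp set"
  assumes p: "\<And>U. lin U \<Longrightarrow> G \<subseteq> U \<Longrightarrow> p \<in> U"
  shows "\<exists>k>0. Const (of_nat k) * p \<in> zspan G"
proof -
  let ?U = "{p. \<exists>k>0. Const (of_nat k) * p \<in> zspan G}"
  have Z: "addgrp (zspan G)" by (rule addgrp_zspan)
  have "p \<in> ?U"
  proof (rule p)
    show "G \<subseteq> ?U" using zspan_mem[of _ G] by (auto intro!: exI[of _ "1 :: nat"])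
    show "lin ?U"
    proof (rule linI)
      show "0 \<in> ?U" using addgrpD(1)[OF Z] by (auto intro: exI[of _ "1 :: nat"])
      fix x assume "x \<in> ?U"
      then obtain k where k: "k > 0" "Const (of_nat k) * x \<in> zspan G" by blast
      show "Const c * x \<in> ?U" for c
      proof -
        obtain a b where ab: "quotient_of c = (a, b)" by fastforce
        then have b: "b > 0" "c = of_int a / of_int b" using quotient_of_denom_pos quotient_of_div by blast+
        have "Const (of_nat (k * nat b)) * (Const c * x) = Const (of_int a) * (Const (of_nat k) * x)"
        proof -
          have "of_nat (k * nat b) * c = of_int a * of_nat k" using b by simp
          then show ?thesis unfolding mult.assoc[symmetric] Const_mult[symmetric] by (simp only:)
        qed
        then have "Const (of_nat (k * nat b)) * (Const c * x) \<in> zspan G" using addgrp_of_int[OF Z k(2), of a] by simp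
        moreover have "k * nat b > 0" using k b by simp
        ultimately show ?thesis by blast
      qed
      fix y assume "y \<in> ?U"
      then obtain l where l: "l > 0" "Const (of_nat l) * y \<in> zspan G" by blast
      have "Const (of_nat (k * l)) * (x + y)
          = Const (of_nat l) * (Const (of_nat k) * x) + Const (of_nat k) * (Const (of_nat l) * y)"
        by (simp add: Const_mult algebra_simps)
      then have "Const (of_nat (k * l)) * (x + y) \<in> zspan G"
        using addgrpD(2)[OF Z addgrp_of_nat[OF Z k(2)] addgrp_of_nat[OF Z l(2)]] by simp
      moreover have "k * l > 0" using k l by simp
      ultimately show "x + y \<in> ?U" by blast
    qed
  qed
  then show ?thesis by simp
qed

context graded_reynolds_null
begin

definition module_gens :: "nat \<Rightarrow> (nat \<Rightarrow> ('v, rat) mp set) \<Rightarrow> nat \<Rightarrow> ('v, rat) mp set" where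
  "module_gens e0 B e = {(\<Prod>i<r. f i ^ \<alpha> i) * b | \<alpha> d b. d < e0 \<and> b \<in> B d \<and> (\<Sum>i<r. \<alpha> i) * \<delta> + d = e}"

lemma module_gensI:
  "d < e0 \<Longrightarrow> b \<in> B d \<Longrightarrow> (\<Sum>i<r. \<alpha> i) * \<delta> + d = e \<Longrightarrow> (\<Prod>i<r. f i ^ \<alpha> i) * b \<in> module_gens e0 B e"
  unfolding module_gens_def by blast

text \<open>\<open>D\<close> clears the denominators of multiplication by \<open>g\<close> on the
  finitely many module generators, and \<open>c\<close> those of 1. Multiplying \<open>q\<close>
  times costs just \<open>D ^ q\<close>, so no other primes ever enter.\<close>

lemma integral_powers:
  assumes B: "\<And>e. finite (B e)" "\<And>e. B e \<subseteq> R e"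
    and span: "\<And>e p U. p \<in> R e \<Longrightarrow> lin U \<Longrightarrow> module_gens e0 B e \<subseteq> U \<Longrightarrow> p \<in> U"
    and g: "g \<in> R e"
  shows "\<exists>c>0. \<exists>d>0. \<forall>q. Const (of_nat (c * d ^ q)) * g ^ q \<in> zspan (module_gens e0 B (q * e))"
proof -
  let ?Z = "\<lambda>e. zspan (module_gens e0 B e)"
  define S where "S = (SIGMA d:{..<e0}. B d)"
  have S: "finite S" unfolding S_def using B by (intro finite_SigmaI) auto
  have den: "\<exists>k>0. Const (of_nat k) * p \<in> ?Z e" if "p \<in> R e" for p e
    by (rule lin_zspan) (rule span[OF that])
  have "\<forall>s\<in>S. \<exists>k. k > 0 \<and> Const (of_nat k) * (g * snd s) \<in> ?Z (e + fst s)"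
  proof
    fix s assume "s \<in> S"
    then have "snd s \<in> R (fst s)" using subsetD[OF B(2)] by (auto simp: S_def)
    from den[OF mult_R[OF g this]] show "\<exists>k. k > 0 \<and> Const (of_nat k) * (g * snd s) \<in> ?Z (e + fst s)" by blast
  qed
  from bchoice[OF this] obtain k where k: "\<And>s. s \<in> S \<Longrightarrow> k s > 0 \<and> Const (of_nat (k s)) * (g * snd s) \<in> ?Z (e + fst s)"
    by (elim exE) (rule that, erule bspec)
  define D where "D = (\<Prod>s\<in>S. k s)"
  have D: "D > 0" unfolding D_def using k by (intro prod_pos) blast
  have Dgb: "Const (of_nat D) * (g * b) \<in> ?Z (e + d)" if b: "d < e0" "b \<in> B d" for d b
  proof -
    have s: "(d, b) \<in> S" using b by (simp add: S_def)
    have D': "D = (\<Prod>s\<in>S - {(d, b)}. k s) * k (d, b)" unfolding D_def by (simp add: prod.remove[OF S s] mult.commute)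
    have "Const (of_nat D) * (g * b)
        = Const (of_nat (\<Prod>s\<in>S - {(d, b)}. k s)) * (Const (of_nat (k (d, b))) * (g * b))"
      by (simp only: D' of_nat_mult Const_mult mult.assoc)
    then show ?thesis using addgrp_of_nat[OF addgrp_zspan conjunct2[OF k[OF s]]] by (simp only: fst_conv snd_conv)
  qed
  have shift: "(\<Prod>i<r. f i ^ \<alpha> i) * y \<in> ?Z ((\<Sum>i<r. \<alpha> i) * \<delta> + e)" if "y \<in> ?Z e" for \<alpha> y e
  proof -
    let ?U = "{y. (\<Prod>i<r. f i ^ \<alpha> i) * y \<in> ?Z ((\<Sum>i<r. \<alpha> i) * \<delta> + e)}"
    have "module_gens e0 B e \<subseteq> ?U"
    proof
      fix x assume "x \<in> module_gens e0 B e"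
      then obtain \<beta> d b where x: "x = (\<Prod>i<r. f i ^ \<beta> i) * b" "d < e0" "b \<in> B d" "(\<Sum>i<r. \<beta> i) * \<delta> + d = e"
        unfolding module_gens_def by blast
      have m: "(\<Prod>i<r. f i ^ (\<alpha> i + \<beta> i)) * b \<in> module_gens e0 B ((\<Sum>i<r. \<alpha> i) * \<delta> + e)"
        by (rule module_gensI, rule x(2), rule x(3), simp add: sum.distrib add_mult_distrib flip: x(4))
      have eq: "(\<Prod>i<r. f i ^ (\<alpha> i + \<beta> i)) * b = (\<Prod>i<r. f i ^ \<alpha> i) * x"
        unfolding x(1) power_add prod.distrib by (rule mult.assoc)
      show "x \<in> ?U" using zspan_mem[OF m] unfolding eq by (rule CollectI)
    qed
    then have "y \<in> ?U" by (rule zspanD[OF that addgrp_vimage[OF addgrp_zspan]])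
    then show ?thesis by simp
  qed
  have step: "Const (of_nat D) * g * x \<in> ?Z (e + e')" if "x \<in> ?Z e'" for x e'
  proof -
    let ?U = "{x. Const (of_nat D) * g * x \<in> ?Z (e + e')}"
    have "module_gens e0 B e' \<subseteq> ?U"
    proof
      fix x assume "x \<in> module_gens e0 B e'"
      then obtain \<beta> d b where x: "x = (\<Prod>i<r. f i ^ \<beta> i) * b" "d < e0" "b \<in> B d" "(\<Sum>i<r. \<beta> i) * \<delta> + d = e'"
        unfolding module_gens_def by blast
      have "(\<Prod>i<r. f i ^ \<beta> i) * (Const (of_nat D) * (g * b)) \<in> ?Z ((\<Sum>i<r. \<beta> i) * \<delta> + (e + d))"
        by (rule shift[OF Dgb[OF x(2,3)]])
      moreover have "(\<Prod>i<r. f i ^ \<beta> i) * (Const (of_nat D) * (g * b)) = Const (of_nat D) * g * x"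
        by (simp add: x(1) mult_ac)
      moreover have "(\<Sum>i<r. \<beta> i) * \<delta> + (e + d) = e + e'" using x(4) by simp
      ultimately show "x \<in> ?U" by simp
    qed
    then have "x \<in> ?U" by (rule zspanD[OF that addgrp_vimage[OF addgrp_zspan]])
    then show ?thesis by simp
  qed
  obtain c where c: "c > 0" "Const (of_nat c) * 1 \<in> ?Z 0" using den[OF one_R] by blast
  have "Const (of_nat (c * D ^ q)) * g ^ q \<in> ?Z (q * e)" for q
  proof (induction q)
    case 0
    then show ?case using c(2) by simp
  next
    case (Suc q)
    have "Const (of_nat (c * D ^ Suc q)) * g ^ Suc q
        = Const (of_nat D) * g * (Const (of_nat (c * D ^ q)) * g ^ q)"
      by (simp only: of_nat_mult power_Suc Const_mult mult_ac)
    then show ?case using step[OF Suc] by (simp only: mult_Suc)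
  qed
  then show ?thesis using c(1) D by blast
qed

text \<open>The degree count behind the bound: with all exponents below \<open>p\<close> the degree
  would be less than \<open>r * \<delta> * p + p\<close>, hence less than
  \<open>p * e\<close>.\<close>

lemma large_exponent:
  assumes "r * \<delta> < e" "(\<Sum>i<r. \<alpha> i) * \<delta> + d = p * e" "d < p"
  shows "\<exists>i<r. p \<le> \<alpha> i"
proof (rule ccontr)
  assume "\<not> ?thesis"
  then have "(\<Sum>i<r. \<alpha> i) \<le> (\<Sum>i<r. p)" by (intro sum_mono) auto
  then have "(\<Sum>i<r. \<alpha> i) * \<delta> \<le> (r * p) * \<delta>" by (intro mult_le_mono1) simp
  also have "\<dots> + p = p * (r * \<delta> + 1)" by (simp add: algebra_simps)
  also have "\<dots> \<le> p * e" using assms(1) by (intro mult_le_mono2) simp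
  finally have "(\<Sum>i<r. \<alpha> i) * \<delta> + p \<le> p * e" by simp
  then show False using assms(2,3) by linarith
qed

text \<open>For \<open>p \<ge> e0\<close> every module generator occurring in the
  \<open>p\<close>-th power of \<open>g\<close> has degree below \<open>p\<close>, so by
  \<open>large_exponent\<close> each term is divisible by some \<open>f i ^ p\<close>. Membership
  modulo large primes then gives membership of \<open>g\<close>, and \<open>reynolds_PV\<close> puts
  the coefficients into \<open>R\<close>.\<close>

theorem generated_by_parameters:
  assumes e: "r * \<delta> < e" and g: "g \<in> R e"
  shows "\<exists>b. (\<forall>i<r. b i \<in> R (e - \<delta>)) \<and> g = (\<Sum>i<r. b i * f i)"
proof -
  have cr: "comm_ring_hom (of_int :: int \<Rightarrow> rat)" by (rule of_int_hom.comm_ring_hom_axioms)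
  interpret pm: comm_ring_hom "pmap (of_int :: int \<Rightarrow> rat) :: ('v, int) mp \<Rightarrow> _" by (rule comm_ring_hom_pmap[OF cr])
  have "\<delta> \<le> r * \<delta>" using r by simp
  also note less_imp_le[OF e]
  finally have le: "\<delta> \<le> e" .
  from finite_module obtain e0 B where B: "\<forall>e. finite (B e) \<and> B e \<subseteq> R e \<inter> range (pmap of_int)"
    and span: "\<forall>e p U. p \<in> R e \<longrightarrow> lin U \<longrightarrow>
      (\<forall>\<alpha> d b. d < e0 \<longrightarrow> b \<in> B d \<longrightarrow> (\<Sum>i<r. \<alpha> i) * \<delta> + d = e \<longrightarrow> (\<Prod>i<r. f i ^ \<alpha> i) * b \<in> U) \<longrightarrow> p \<in> U"
    by (elim exE conjE) (rule that)
  have span': "p \<in> U" if "p \<in> R e" "lin U" "module_gens e0 B e \<subseteq> U" for e p U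
    using span[THEN spec, THEN spec, THEN spec, THEN mp, THEN mp, THEN mp, OF that(1,2)] that(3) module_gensI by blast
  have "\<forall>i\<in>{..<r}. \<exists>f'. f i = pmap of_int f'" using f_int by blast
  from bchoice[OF this] obtain f' where f': "\<And>i. i < r \<Longrightarrow> f i = pmap of_int (f' i)" by auto
  obtain k g' where k: "k > 0" "Const (of_nat k) * g = pmap of_int g'" using clear_denominators[of g] by blast
  let ?g = "Const (of_nat k) * g"
  have gR: "?g \<in> R e" by (rule lin_Const[OF lin_R g])
  have "\<exists>c>0. \<exists>d>0. \<forall>q. Const (of_nat (c * d ^ q)) * ?g ^ q \<in> zspan (module_gens e0 B (q * e))"
    by (rule integral_powers[OF _ _ span' gR]) (use B in auto)
  then obtain c d where cd: "c > 0" "d > 0" "\<And>q. Const (of_nat (c * d ^ q)) * ?g ^ q \<in> zspan (module_gens e0 B (q * e))"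
    by blast
  have "?g \<in> ideal_of V r f"
  proof (rule prime_powers_ideal_membership[OF finite_V R_HP[OF f] f' R_HP[OF gR] k(2) le cd(1,2)])
    fix p :: nat assume p: "prime p" "e0 \<le> p"
    \<comment> \<open>Integral combinations of the \<open>f i ^ p\<close>; integrality matters
      because the identity is to be read modulo \<open>p\<close>.\<close>
    let ?U = "{\<Sum>i<r. pmap of_int (A i) * f i ^ p | A. True}"
    have UI: "x \<in> ?U" if "x = (\<Sum>i<r. pmap of_int (A i) * f i ^ p)" for x A using that by blast
    have "addgrp ?U"
    proof (rule addgrpI)
      show "0 \<in> ?U" by (rule UI[of _ "\<lambda>_. 0"]) simp
      fix x assume "x \<in> ?U"
      then obtain A where A: "x = (\<Sum>i<r. pmap of_int (A i) * f i ^ p)" by blast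
      show "- x \<in> ?U" by (rule UI[of _ "\<lambda>i. - A i"]) (simp add: A pm.hom_uminus sum_negf)
      fix y assume "y \<in> ?U"
      then obtain A' where A': "y = (\<Sum>i<r. pmap of_int (A' i) * f i ^ p)" by blast
      show "x + y \<in> ?U" by (rule UI[of _ "\<lambda>i. A i + A' i"]) (simp add: A A' pm.hom_add sum.distrib distrib_right)
    qed
    moreover have "module_gens e0 B (p * e) \<subseteq> ?U"
    proof
      fix x assume "x \<in> module_gens e0 B (p * e)"
      then obtain \<alpha> d b where x: "x = (\<Prod>i<r. f i ^ \<alpha> i) * b" "d < e0" "b \<in> B d" "(\<Sum>i<r. \<alpha> i) * \<delta> + d = p * e"
        unfolding module_gens_def by blast
      obtain j where j: "j < r" "p \<le> \<alpha> j" using large_exponent[OF e x(4)] x(2) p(2) by auto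
      obtain b' where b': "b = pmap of_int b'" using B x(3) by blast
      define a where "a = f' j ^ (\<alpha> j - p) * (\<Prod>i\<in>{..<r} - {j}. f' i ^ \<alpha> i) * b'"
      have "pmap of_int a = f j ^ (\<alpha> j - p) * (\<Prod>i\<in>{..<r} - {j}. f i ^ \<alpha> i) * b"
        using j(1) by (simp add: a_def pm.hom_mult pm.hom_power pm.hom_prod f' b')
      moreover have "x = f j ^ \<alpha> j * (\<Prod>i\<in>{..<r} - {j}. f i ^ \<alpha> i) * b"
        unfolding x(1) using prod.remove[of "{..<r}" j "\<lambda>i. f i ^ \<alpha> i"] j(1) by simp
      moreover have "f j ^ \<alpha> j = f j ^ (\<alpha> j - p) * f j ^ p" using j(2) by (simp flip: power_add)
      ultimately have "x = pmap of_int a * f j ^ p" by (simp only: mult_ac)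
      also have "\<dots> = (\<Sum>i<r. pmap of_int (if i = j then a else 0) * f i ^ p)"
        using j(1) by (simp add: if_distrib[of "pmap _"] if_distrib[of "\<lambda>x. x * _"] cong: if_cong)
      finally show "x \<in> ?U" by (rule UI)
    qed
    ultimately have "Const (of_nat (c * d ^ p)) * ?g ^ p \<in> ?U" using zspanD[OF cd(3)[of p]] by blast
    then obtain A where A: "Const (of_nat (c * d ^ p)) * ?g ^ p = (\<Sum>i<r. pmap of_int (A i) * f i ^ p)" by blast
    have "pmap of_int (Const (of_nat (c * d ^ p)) * g' ^ p) = (pmap of_int (\<Sum>i<r. A i * f' i ^ p) :: ('v, rat) mp)"
      using A by (simp add: pm.hom_mult pm.hom_power pm.hom_sum pmap_Const f' flip: k(2))
    then have "Const (of_nat (c * d ^ p)) * g' ^ p = (\<Sum>i<r. A i * f' i ^ p)"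
      by (auto simp: poly_mapping_eq_iff fun_eq_iff cf_pmap)
    then show "\<exists>A. Const (of_nat (c * d ^ p)) * g' ^ p = (\<Sum>i<r. A i * f' i ^ p)" by (rule exI[of _ A])
  qed
  then have "Const (1 / of_nat k) * ?g \<in> ideal_of V r f" by (rule lin_Const[OF lin_ideal])
  moreover have "1 / of_nat k * of_nat k = (1 :: rat)" using k(1) by simp
  then have "Const (1 / of_nat k) * ?g = g" unfolding mult.assoc[symmetric] Const_mult[symmetric] by simp
  ultimately have "g \<in> ideal_of V r f" by simp
  then obtain h where h: "g = (\<Sum>i<r. h i * f i)" "\<And>i. i < r \<Longrightarrow> h i \<in> PV V" by (rule ideal_ofE) blast
  have J: "{j. j < r \<and> \<delta> \<le> e} = {..<r}" using le by auto
  have "\<exists>b. (\<forall>i<r. \<delta> \<le> e \<longrightarrow> b i \<in> R (e - \<delta>)) \<and> g = (\<Sum>i\<in>{j. j < r \<and> \<delta> \<le> e}. b i * f i)"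
    by (rule reynolds_PV[OF g h(1) f h(2)])
  then show ?thesis unfolding J using le by blast
qed

end

section \<open>Reduction to as many parameters as variables\<close>

context graded_reynolds
begin

text \<open>\<open>drop_one_form\<close> removes one form at a time until \<open>card V\<close> are
  left; a shorter list is padded with zeros.\<close>

lemma few_forms:
  fixes f :: "nat \<Rightarrow> ('v, rat) mp"
  assumes "1 \<le> \<delta>" "\<And>i. i < l \<Longrightarrow> f i \<in> R \<delta>"
  shows "\<exists>f'. (\<forall>i<card V. f' i \<in> R \<delta>) \<and>
    (\<forall>x :: 'v \<Rightarrow> complex. (\<forall>i<card V. hev of_rat x (f' i) = 0) \<longrightarrow> (\<forall>i<l. hev of_rat x (f i) = 0))"
  using assms(2)
proof (induction l arbitrary: f)
  case 0
  then show ?case using lin_0[OF lin_R] by (intro exI[of _ "\<lambda>_. 0"]) auto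
next
  case (Suc l)
  show ?case
  proof (cases "card V \<le> l")
    case False
    let ?f = "\<lambda>i. if i < Suc l then f i else 0"
    have "\<forall>i<card V. ?f i \<in> R \<delta>" using Suc.prems lin_0[OF lin_R] by auto
    moreover have "hev of_rat x (f i) = 0" if "\<forall>i<card V. hev of_rat x (?f i) = 0" "i < Suc l" for i and x :: "'v \<Rightarrow> complex"
      using spec[OF that(1), of i] that(2) False by simp
    ultimately show ?thesis by (intro exI[of _ ?f]) blast
  next
    case True
    have "\<exists>c. \<forall>x :: 'v \<Rightarrow> complex.
        (\<forall>i<l. hev of_rat x (f i - Const (c i) * f l) = 0) \<longrightarrow> (\<forall>i\<le>l. hev of_rat x (f i) = 0)"
      by (rule drop_one_form[OF finite_V V_ne _ _ True, of f \<delta>]) (use Suc.prems R_HP assms(1) in auto)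
    then obtain c where c: "\<And>x :: 'v \<Rightarrow> complex.
        \<forall>i<l. hev of_rat x (f i - Const (c i) * f l) = 0 \<Longrightarrow> \<forall>i\<le>l. hev of_rat x (f i) = 0" by blast
    have "\<exists>f'. (\<forall>i<card V. f' i \<in> R \<delta>) \<and> (\<forall>x :: 'v \<Rightarrow> complex.
        (\<forall>i<card V. hev of_rat x (f' i) = 0) \<longrightarrow> (\<forall>i<l. hev of_rat x (f i - Const (c i) * f l) = 0))"
      by (rule Suc.IH) (intro lin_diff lin_Const lin_R Suc.prems, auto)
    then obtain f' where "\<forall>i<card V. f' i \<in> R \<delta>" "\<forall>x :: 'v \<Rightarrow> complex.
        (\<forall>i<card V. hev of_rat x (f' i) = 0) \<longrightarrow> (\<forall>i<l. hev of_rat x (f i - Const (c i) * f l) = 0)" by blast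
    then show ?thesis using c by (intro exI[of _ f']) (simp add: less_Suc_eq_le)
  qed
qed

text \<open>A basis of \<open>R \<delta>\<close> cuts out the null cone by \<open>null\<close>;
  \<open>few_forms\<close> shrinks it to \<open>card V\<close> forms, which serve as the
  parameters.\<close>

theorem generated_by_null_degree:
  assumes \<delta>: "1 \<le> \<delta>" and e: "card V * \<delta> < e" and p: "p \<in> R e"
    and null: "\<And>(x :: 'v \<Rightarrow> complex) e p. (\<And>q. q \<in> R \<delta> \<Longrightarrow> hev of_rat x q = 0) \<Longrightarrow> 1 \<le> e \<Longrightarrow> p \<in> R e \<Longrightarrow> hev of_rat x p = 0"
  shows "\<exists>b f. (\<forall>i<card V. f i \<in> R \<delta> \<and> b i \<in> R (e - \<delta>)) \<and> p = (\<Sum>i<card V. b i * f i)"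
proof -
  have "\<exists>B. finite B \<and> B \<subseteq> R \<delta> \<inter> range (pmap of_int) \<and> (\<forall>U'. lin U' \<longrightarrow> B \<subseteq> U' \<longrightarrow> R \<delta> \<subseteq> U')"
    by (rule finite_integral_spanning_set[OF finite_HP_monos[OF finite_V] lin_R]) (use R_HP HP_supp in blast)
  then obtain B where B: "finite B" "B \<subseteq> R \<delta>" "\<And>U'. lin U' \<Longrightarrow> B \<subseteq> U' \<Longrightarrow> R \<delta> \<subseteq> U'" by blast
  obtain g where g: "bij_betw g {..<card B} B"
    using ex_bij_betw_nat_finite[OF B(1)] by (auto simp: atLeast0LessThan)
  have "\<exists>f'. (\<forall>i<card V. f' i \<in> R \<delta>) \<and>
      (\<forall>x :: 'v \<Rightarrow> complex. (\<forall>i<card V. hev of_rat x (f' i) = 0) \<longrightarrow> (\<forall>i<card B. hev of_rat x (g i) = 0))"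
    by (rule few_forms[OF \<delta>]) (use bij_betwE[OF g] B(2) in auto)
  then obtain f where f: "\<forall>i<card V. f i \<in> R \<delta>" "\<And>x :: 'v \<Rightarrow> complex.
      \<forall>i<card V. hev of_rat x (f i) = 0 \<Longrightarrow> \<forall>i<card B. hev of_rat x (g i) = 0" by blast
  \<comment> \<open>Scaling makes the parameters integral and leaves their zeros unchanged.\<close>
  have "\<forall>i. \<exists>k. k > 0 \<and> Const (of_nat k) * f i \<in> range (pmap of_int)" using clear_denominators by blast
  from choice[OF this] obtain k where k: "\<And>i. k i > 0 \<and> Const (of_nat (k i)) * f i \<in> range (pmap of_int)" by blast
  let ?f = "\<lambda>i. Const (of_nat (k i)) * f i"
  interpret graded_reynolds_null V R \<delta> "card V" ?f
  proof
    show "1 \<le> card V" using finite_V V_ne by (simp add: Suc_le_eq card_gt_0_iff)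
    fix x :: "'v \<Rightarrow> complex" and e p assume z: "\<And>i. i < card V \<Longrightarrow> hev of_rat x (?f i) = 0" and *: "1 \<le> e" "p \<in> R e"
    have "hev of_rat x (f i) = 0" if "i < card V" for i
      using z[OF that] k[of i] by (simp add: of_rat_hom.hev_mult of_rat_hom.hev_Const)
    then have gz: "\<forall>i<card B. hev of_rat x (g i) = 0" using f(2) by blast
    have "lin {q. hev of_rat x q = 0}"
      by (rule linI) (simp_all add: of_rat_hom.hev_0 of_rat_hom.hev_add of_rat_hom.hev_mult)
    moreover have "B \<subseteq> {q. hev of_rat x q = 0}" 
      using gz by (subst bij_betw_imp_surj_on[OF g, symmetric]) auto
    ultimately have "R \<delta> \<subseteq> {q. hev of_rat x q = 0}" by (rule B(3))
    then have "hev of_rat x q = 0" if "q \<in> R \<delta>" for q using that by (auto dest: subsetD)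
    then show "hev of_rat x p = 0" using * by (rule null)
  qed (use \<delta> f(1) k lin_Const[OF lin_R] in auto)
  from generated_by_parameters[OF e p] obtain b where "\<forall>i<card V. b i \<in> R (e - \<delta>)" "p = (\<Sum>i<card V. b i * ?f i)" by blast
  then show ?thesis using f(1) lin_Const[OF lin_R] by (intro exI[of _ b] exI[of _ ?f]) auto
qed

end

section \<open>The apolar form and the Reynolds property\<close>

definition pderiv_mp :: "'v \<Rightarrow> ('v, 'a::comm_ring_1) mp \<Rightarrow> ('v, 'a) mp" where
  "pderiv_mp u p = (\<Sum>t\<in>supp p. sgl (t - sgl u 1) (of_nat (cf t u) * cf p t))"

lemma cf_pderiv_mp: "cf (pderiv_mp u p) t = of_nat (cf t u + 1) * cf p (t + sgl u 1)"
proof -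
  have "cf (pderiv_mp u p) t = (\<Sum>s\<in>supp p. if s = t + sgl u 1 then of_nat (cf s u) * cf p s else 0)"
    unfolding pderiv_mp_def lookup_sum
  proof (rule sum.cong[OF refl])
    fix s
    show "cf (sgl (s - sgl u 1) (of_nat (cf s u) * cf p s)) t = (if s = t + sgl u 1 then of_nat (cf s u) * cf p s else 0)"
    proof (cases "cf s u = 0")
      case False
      then have "cf (sgl u 1) v \<le> cf s v" for v by (cases "u = v") (auto simp: lookup_single)
      then have *: "s = sgl u 1 + (s - sgl u 1)" by (rule mono_le_add)
      have "s - sgl u 1 = t \<longleftrightarrow> s = t + sgl u 1"
      proof
        assume t: "s - sgl u 1 = t"
        show "s = t + sgl u 1" using * unfolding t by (simp only: add.commute)
      qed simp
      then show ?thesis by (simp only: lookup_single when_def if_True if_False cong: if_cong)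
    next
      case True
      then show ?thesis unfolding True of_nat_0 mult_zero_left single_zero lookup_zero by (simp only: if_cancel)
    qed
  qed
  also have "\<dots> = of_nat (cf (t + sgl u 1) u) * cf p (t + sgl u 1)" by (simp add: in_keys_iff)
  finally show ?thesis by (simp add: lookup_add)
qed

lemma pderiv_mp_add: "pderiv_mp u (p + q) = pderiv_mp u p + pderiv_mp u q"
  by (rule poly_mapping_eqI) (simp add: cf_pderiv_mp lookup_add distrib_left)

lemma pderiv_mp_Const_mult: "pderiv_mp u (Const c * p) = Const c * pderiv_mp u p"
  by (rule poly_mapping_eqI) (simp only: cf_pderiv_mp mp_Const_mult_cf mult.left_commute)

lemma pderiv_mp_Const: "pderiv_mp u (Const c) = 0"
proof (rule poly_mapping_eqI)
  fix t
  have "0 \<noteq> t + sgl u (1 :: nat)" by (metis lookup_add lookup_single_eq lookup_zero add_is_0 one_neq_zero)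
  then show "cf (pderiv_mp u (Const c)) t = cf 0 t" by (simp add: cf_pderiv_mp Const_def lookup_single)
qed

lemma pderiv_mp_sum: "pderiv_mp u (\<Sum>i\<in>I. h i) = (\<Sum>i\<in>I. pderiv_mp u (h i))"
  by (induction I rule: infinite_finite_induct) (auto simp: pderiv_mp_add pderiv_mp_Const[of u 0, simplified])

lemma pderiv_mp_Var_mult:
  fixes p :: "('v, 'a::comm_ring_1) mp"
  shows "pderiv_mp u (Var v * p) = (if u = v then p else 0) + Var v * pderiv_mp u p"
proof (rule poly_mapping_eqI)
  fix t
  show "cf (pderiv_mp u (Var v * p)) t = cf ((if u = v then p else 0) + Var v * pderiv_mp u p) t"
  proof (cases "v \<in> supp t")
    case True
    then obtain s where s: "t = sgl v 1 + s" by (rule supp_split_var)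
    have "cf (Var v * p) (t + sgl u 1) = cf p (s + sgl u 1)"
      unfolding Var_def s add.assoc by (rule cf_sgl_mult)
    moreover have "cf (Var v * pderiv_mp u p) t = of_nat (cf s u + 1) * cf p (s + sgl u 1)"
      unfolding Var_def s cf_sgl_mult by (rule cf_pderiv_mp)
    ultimately show ?thesis
      unfolding cf_pderiv_mp lookup_add by (simp add: s lookup_add lookup_single when_def algebra_simps)
  next
    case False
    have "cf (Var v * q) t = 0" for q :: "('v, 'a) mp"
      unfolding Var_def by (rule cf_sgl_mult_notin) (use False in \<open>auto simp: supp_add_nat\<close>)
    moreover have "cf (Var v * p) (t + sgl u 1) = (if u = v then cf p t else 0)"
    proof (cases "u = v")
      case True
      then show ?thesis using cf_sgl_mult[of "sgl v 1" p t] by (simp add: Var_def add.commute)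
    next
      case False
      have "t + sgl u 1 \<noteq> sgl v 1 + s" for s
      proof
        assume "t + sgl u 1 = sgl v 1 + s"
        then have "cf t v = 1 + cf s v"
          using arg_cong[of _ _ "\<lambda>x. cf x v"] False by (metis (no_types) add_0_right lookup_add lookup_single_eq lookup_single_not_eq)
        then show False using \<open>v \<notin> supp t\<close> by (simp add: in_keys_iff)
      qed
      then show ?thesis using False unfolding Var_def by (simp add: cf_sgl_mult_notin)
    qed
    moreover have "cf t v = 0" using False by (simp add: in_keys_iff)
    ultimately show ?thesis by (simp add: cf_pderiv_mp lookup_add)
  qed
qed

definition linsub :: "'v set \<Rightarrow> ('v \<Rightarrow> 'v \<Rightarrow> 'a) \<Rightarrow> ('v, 'a::comm_ring_1) mp \<Rightarrow> ('v, 'a) mp" where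
  "linsub V L = subst (\<lambda>v. \<Sum>u\<in>V. Const (L v u) * Var u)"

interpretation linsub: comm_ring_hom "linsub V L"
  unfolding linsub_def by (rule subst.comm_ring_hom_axioms)

lemma linsub_Const [simp]: "linsub V L (Const c) = Const c" by (simp add: linsub_def)
lemma linsub_Var: "linsub V L (Var v) = (\<Sum>u\<in>V. Const (L v u) * Var u)" by (simp add: linsub_def)
lemma linsub_HP: "p \<in> HP V e \<Longrightarrow> linsub V L p \<in> HP V e"
  unfolding linsub_def by (erule subst_HP) (rule HP_sum, rule HP_Const_mult, rule HP_Var)
lemma ev_linsub: "ev x (linsub V L p) = ev (\<lambda>v. \<Sum>u\<in>V. L v u * x u) p"
  unfolding linsub_def ev_subst by (simp add: ev.hom_sum ev.hom_mult)

text \<open>The chain rule for a linear substitution; only the product rule for a variable factor is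
  used in the induction.\<close>

lemma pderiv_mp_linsub:
  assumes V: "finite V" and u: "u \<in> V" and q: "q \<in> PV V"
  shows "pderiv_mp u (linsub V L q) = (\<Sum>v\<in>V. Const (L v u) * linsub V L (pderiv_mp v q))"
  using q
proof (induction rule: PV_induct)
  case (Const c)
  then show ?case by (simp add: pderiv_mp_Const)
next
  case (add p q)
  then show ?case by (simp add: linsub.hom_add pderiv_mp_add distrib_left sum.distrib)
next
  case (Var w p)
  define l where "l = (\<Sum>v\<in>V. Const (L w v) * (Var v :: ('a, 'b) mp))"
  define h where "h = linsub V L p"
  have "pderiv_mp u (l * h) = (\<Sum>v\<in>V. Const (L w v) * pderiv_mp u (Var v * h))"
    unfolding l_def sum_distrib_right pderiv_mp_sum mult.assoc pderiv_mp_Const_mult ..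
  also have "\<dots> = (\<Sum>v\<in>V. (if u = v then Const (L w u) * h else 0) + Const (L w v) * (Var v * pderiv_mp u h))"
    unfolding pderiv_mp_Var_mult by (rule sum.cong[OF refl]) (simp add: distrib_left)
  also have "\<dots> = Const (L w u) * h + l * pderiv_mp u h"
    unfolding sum.distrib using V u by (simp add: l_def sum_distrib_right mult.assoc)
  also have "l * pderiv_mp u h = (\<Sum>v\<in>V. Const (L v u) * (l * linsub V L (pderiv_mp v p)))"
    unfolding h_def Var.IH sum_distrib_left by (simp only: mult.left_commute)
  also have "Const (L w u) * h = (\<Sum>v\<in>V. if v = w then Const (L v u) * h else 0)"
    using V Var.hyps by simp
  finally have *: "pderiv_mp u (l * h) = (\<Sum>v\<in>V. (if v = w then Const (L v u) * h else 0)
      + Const (L v u) * (l * linsub V L (pderiv_mp v p)))"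
    by (simp add: sum.distrib)
  have "linsub V L (pderiv_mp v (Var w * p)) = (if v = w then h else 0) + l * linsub V L (pderiv_mp v p)" for v
    unfolding pderiv_mp_Var_mult linsub.hom_add linsub.hom_mult linsub_Var l_def h_def by simp
  moreover have "linsub V L (Var w * p) = l * h" by (simp add: linsub.hom_mult linsub_Var l_def h_def)
  ultimately show ?case by (simp only: *) (rule sum.cong[OF refl], simp add: distrib_left)
qed

text \<open>The product of the factorials of the exponents, the weight for which multiplication by a
  variable is adjoint to differentiation.\<close>

definition mono_fact :: "'v mono \<Rightarrow> rat" where
  "mono_fact t = (\<Prod>v\<in>supp t. fact (cf t v))"

lemma mono_fact_pos: "0 < mono_fact t"
  unfolding mono_fact_def by (rule prod_pos) simp

lemma mono_fact_Suc: "mono_fact (sgl u 1 + s) = of_nat (cf s u + 1) * mono_fact s"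
proof -
  let ?S = "insert u (supp s)"
  have eq: "mono_fact t = (\<Prod>v\<in>?S. fact (cf t v))" if "supp t \<subseteq> ?S" for t
    unfolding mono_fact_def by (rule prod.mono_neutral_left) (use that in \<open>auto simp: in_keys_iff\<close>)
  have "mono_fact (sgl u 1 + s) = (\<Prod>v\<in>?S. fact (cf (sgl u 1 + s) v))"
    by (rule eq) (auto simp: supp_add_nat)
  also have "\<dots> = (\<Prod>v\<in>?S. (if v = u then of_nat (cf s u + 1) else 1) * fact (cf s v))"
    by (rule prod.cong[OF refl]) (auto simp: lookup_add lookup_single when_def)
  also have "\<dots> = of_nat (cf s u + 1) * mono_fact s"
    by (subst eq[of s]) (auto simp: prod.distrib prod.delta simp del: prod.insert prod.insert_remove)
  finally show ?thesis .
qed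

abbreviation apolar :: "('v, rat) mp \<Rightarrow> ('v, rat) mp \<Rightarrow> rat" where
  "apolar \<equiv> wform mono_fact"

lemma apolar_Const: "apolar (Const c) q = c * cf q 0"
  by (subst wform_superset[of "{0}"]) (auto simp: Const_def mono_fact_def)

lemma apolar_Var_mult: "apolar (Var u * p) q = apolar p (pderiv_mp u q)"
proof -
  let ?S = "(\<lambda>s. sgl u 1 + s) ` supp p"
  have "supp (Var u * p) \<subseteq> ?S"
  proof
    fix t assume "t \<in> supp (Var u * p)"
    then obtain s where "t = sgl u 1 + s" using cf_sgl_mult_notin[of t "sgl u 1" p] by (auto simp: Var_def in_keys_iff)
    with \<open>t \<in> supp (Var u * p)\<close> show "t \<in> ?S" by (auto simp: Var_def in_keys_iff cf_sgl_mult)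
  qed
  then have "apolar (Var u * p) q = (\<Sum>t\<in>?S. mono_fact t * cf (Var u * p) t * cf q t)"
    by (intro wform_superset) auto
  also have "\<dots> = (\<Sum>s\<in>supp p. mono_fact (sgl u 1 + s) * cf (Var u * p) (sgl u 1 + s) * cf q (sgl u 1 + s))"
    by (subst sum.reindex) (auto simp: inj_on_def)
  also have "\<dots> = (\<Sum>s\<in>supp p. mono_fact s * cf p s * cf (pderiv_mp u q) s)"
    unfolding Var_def cf_sgl_mult mono_fact_Suc cf_pderiv_mp add.commute[of _ "sgl u 1"]
    by (rule sum.cong[OF refl]) (simp only: mult_ac)
  finally show ?thesis by (simp add: wform_def)
qed

lemma pderiv_mp_PV: "q \<in> PV V \<Longrightarrow> pderiv_mp u q \<in> PV V"
proof -
  assume q: "q \<in> PV V"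
  have "supp t \<subseteq> V" if "t \<in> supp (pderiv_mp u q)" for t
  proof -
    have "t + sgl u 1 \<in> supp q" using that by (auto simp: in_keys_iff cf_pderiv_mp)
    then have "supp (t + sgl u 1) \<subseteq> V" using q by (simp add: PV_def)
    then show ?thesis by (simp add: supp_add_nat)
  qed
  then show ?thesis by (simp add: PV_def)
qed

lemma cf_0_eq_ev:
  fixes p :: "('v, 'a::comm_ring_1) mp"
  shows "cf p 0 = ev (\<lambda>_. 0) p"
proof -
  have "ev (\<lambda>_. 0) p = (\<Sum>t\<in>supp p. if t = 0 then cf p t else 0)"
    unfolding hev_def
  proof (rule sum.cong[OF refl])
    fix t
    show "cf p t * mev (\<lambda>_. 0) t = (if t = 0 then cf p t else 0)"
    proof (cases "t = 0")
      case False
      then obtain v where "v \<in> supp t" by (metis ex_in_conv keys_eq_empty)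
      then have "mev (\<lambda>_. 0 :: 'a) t = 0" by (auto simp: mev_def in_keys_iff power_0_left intro!: prod_zero bexI[of _ v])
      then show ?thesis using False by simp
    qed simp
  qed
  then show ?thesis by (simp add: in_keys_iff)
qed

text \<open>Multiplying \<open>p\<close> by a variable is moved to the other side as a derivative,
  where the chain rule brings in the transposed matrix.\<close>

lemma apolar_linsub:
  assumes V: "finite V" and p: "p \<in> PV V" and q: "q \<in> PV V"
  shows "apolar (linsub V L p) q = apolar p (linsub V (\<lambda>v u. L u v) q)"
  using p q
proof (induction arbitrary: q rule: PV_induct)
  case (Const c)
  then show ?case by (simp add: apolar_Const cf_0_eq_ev ev_linsub)
next
  case (add p p')
  then show ?case by (simp add: linsub.hom_add wform_add_left)
next
  case (Var v p)
  have "apolar (linsub V L (Var v * p)) q = (\<Sum>u\<in>V. L v u * apolar (Var u * linsub V L p) q)"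
    unfolding linsub.hom_mult linsub_Var sum_distrib_right mult.assoc
    by (simp add: wform_commute[of _ _ q] wform_sum_right wform_Const_right)
  also have "\<dots> = (\<Sum>u\<in>V. L v u * apolar p (linsub V (\<lambda>v u. L u v) (pderiv_mp u q)))"
    unfolding apolar_Var_mult by (simp add: Var.IH[OF pderiv_mp_PV[OF Var.prems]])
  also have "\<dots> = apolar p (pderiv_mp v (linsub V (\<lambda>v u. L u v) q))"
    unfolding pderiv_mp_linsub[OF V Var.hyps(1) Var.prems] by (simp add: wform_sum_right wform_Const_right)
  finally show ?case by (simp add: apolar_Var_mult)
qed

definition lspan :: "('v, 'a::comm_ring_1) mp set \<Rightarrow> ('v, 'a) mp set" where
  "lspan G = {x. \<forall>U. lin U \<longrightarrow> G \<subseteq> U \<longrightarrow> x \<in> U}"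

lemma lspan_mem: "x \<in> G \<Longrightarrow> x \<in> lspan G" by (auto simp: lspan_def)
lemma lspanD: "x \<in> lspan G \<Longrightarrow> lin U \<Longrightarrow> G \<subseteq> U \<Longrightarrow> x \<in> U" by (simp add: lspan_def)
lemma lspan_subset: "lin U \<Longrightarrow> G \<subseteq> U \<Longrightarrow> lspan G \<subseteq> U" by (auto simp: lspan_def)
lemma lin_lspan: "lin (lspan G)"
  unfolding lspan_def by (rule linI) (auto intro: lin_0 lin_add lin_Const)

definition invs :: "'v set \<Rightarrow> ('v \<Rightarrow> 'v \<Rightarrow> 'a::comm_ring_1) set \<Rightarrow> nat \<Rightarrow> ('v, 'a) mp set" where
  "invs V G e = {p \<in> HP V e. \<forall>L\<in>G. linsub V L p = p}"

lemma lin_invs: "lin (invs V G e)"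
  by (rule linI) (auto simp: invs_def linsub.hom_add linsub.hom_mult intro: HP_add HP_Const_mult)

lemma invs_1: "1 \<in> invs V G 0"
  by (simp add: invs_def HP_1)

lemma invs_mult: "p \<in> invs V G d \<Longrightarrow> q \<in> invs V G e \<Longrightarrow> p * q \<in> invs V G (d + e)"
  by (simp add: invs_def linsub.hom_mult HP_mult)

locale transpose_closed =
  fixes V :: "'v set" and G :: "('v \<Rightarrow> 'v \<Rightarrow> rat) set"
  assumes finite_V: "finite V" and transpose: "L \<in> G \<Longrightarrow> (\<lambda>v u. L u v) \<in> G"
begin

text \<open>\<open>moved e\<close> is the orthogonal complement of the invariants of degree \<open>e\<close> and is stable under
  multiplication by invariants, so the orthogonal projection is a Reynolds operator.\<close>

definition moved :: "nat \<Rightarrow> ('v, rat) mp set" where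
  "moved e = lspan {linsub V L p - p | L p. L \<in> G \<and> p \<in> HP V e}"

lemma moved_HP: "moved e \<subseteq> HP V e"
  unfolding moved_def by (rule lspan_subset[OF lin_HP]) (auto intro: HP_diff linsub_HP)

text \<open>By adjointness, pairing \<open>linsub V L p - p\<close> with \<open>q\<close> is pairing
  \<open>p\<close> with the change of \<open>q\<close> under the transposed substitution, and that
  change is zero.\<close>

lemma moved_orthogonal:
  assumes x: "x \<in> moved e" and q: "q \<in> invs V G e" shows "apolar x q = 0"
proof -
  have "x \<in> {x. apolar x q = 0}"
  proof (rule lspanD[OF x[unfolded moved_def]])
    show "lin {x. apolar x q = 0}" by (rule linI) (auto simp: wform_add_left wform_Const_left)
    show "{linsub V L p - p | L p. L \<in> G \<and> p \<in> HP V e} \<subseteq> {x. apolar x q = 0}"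
    proof clarify
      fix L and p :: "('v, rat) mp" assume L: "L \<in> G" and p: "p \<in> HP V e"
      have "apolar (linsub V L p) q = apolar p (linsub V (\<lambda>v u. L u v) q)"
        by (rule apolar_linsub[OF finite_V HP_PV[OF p]]) (use q in \<open>auto simp: invs_def HP_PV\<close>)
      also have "linsub V (\<lambda>v u. L u v) q = q" using transpose[OF L] q by (simp add: invs_def)
      finally show "apolar (linsub V L p - p) q = 0" by (simp add: wform_diff_left)
    qed
  qed
  then show ?thesis by simp
qed

lemma moved_mult:
  assumes a: "a \<in> invs V G d" and x: "x \<in> moved e" shows "a * x \<in> moved (d + e)"
proof -
  have "x \<in> {x. a * x \<in> moved (d + e)}"
  proof (rule lspanD[OF x[unfolded moved_def]])
    show "lin {x. a * x \<in> moved (d + e)}"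
      using lin_lspan unfolding moved_def
      by (intro linI) (auto simp: lin_0 distrib_left mult.left_commute[of a "Const _"] intro: lin_add lin_Const)
    show "{linsub V L p - p | L p. L \<in> G \<and> p \<in> HP V e} \<subseteq> {x. a * x \<in> moved (d + e)}"
    proof clarify
      fix L and p :: "('v, rat) mp" assume L: "L \<in> G" and p: "p \<in> HP V e"
      have "a * (linsub V L p - p) = linsub V L (a * p) - a * p"
        using a L by (simp add: invs_def linsub.hom_mult right_diff_distrib)
      moreover have "a * p \<in> HP V (d + e)" using a p by (intro HP_mult) (auto simp: invs_def)
      ultimately show "a * (linsub V L p - p) \<in> moved (d + e)"
        unfolding moved_def using L by (intro lspan_mem) blast
    qed
  qed
  then show ?thesis by simp
qed

text \<open>Orthogonal projection onto \<open>moved e\<close> leaves a remainder \<open>b\<close>;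
  what must be shown is that orthogonality to all moved elements makes \<open>b\<close>
  invariant.\<close>

lemma reynolds_operator:
  assumes h: "h \<in> HP V e" shows "\<exists>b\<in>invs V G e. h - b \<in> moved e"
proof -
  have "\<exists>u\<in>moved e. \<forall>u'\<in>moved e. apolar (h - u) u' = 0"
  proof (rule orthogonal_projection[OF finite_HP_monos[OF finite_V]])
    show "lin (moved e)" unfolding moved_def by (rule lin_lspan)
    show "supp p \<subseteq> {t. supp t \<subseteq> V \<and> mdeg t = e}" if "p \<in> moved e" for p
      using moved_HP HP_supp that by blast
  qed (rule mono_fact_pos)
  then obtain u where u: "u \<in> moved e" "\<And>u'. u' \<in> moved e \<Longrightarrow> apolar (h - u) u' = 0" by blast
  define b where "b = h - u"
  have b: "b \<in> HP V e" unfolding b_def using h u(1) moved_HP by (intro HP_diff) auto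
  have "linsub V L b = b" if L: "L \<in> G" for L
  proof -
    \<comment> \<open>The change of \<open>b\<close> under \<open>L\<close>. Its square is the
      pairing of \<open>b\<close> with the change of \<open>z\<close> under the transposed
      substitution, which is a moved element.\<close>
    define z where "z = linsub V L b - b"
    have z: "z \<in> HP V e" unfolding z_def by (intro HP_diff linsub_HP b)
    let ?L = "\<lambda>v u. L u v"
    have "linsub V ?L z - z \<in> moved e"
      unfolding moved_def using transpose[OF L] z by (intro lspan_mem) blast
    then have "apolar b (linsub V ?L z - z) = 0" unfolding b_def by (rule u(2))
    then have "0 = apolar (linsub V ?L z) b - apolar z b"
      by (simp add: wform_diff_right wform_commute[of _ b])
    also have "apolar (linsub V ?L z) b = apolar z (linsub V L b)"
      using apolar_linsub[OF finite_V HP_PV[OF z] HP_PV[OF b], of ?L] by simp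
    finally have "apolar z z = 0" by (simp add: z_def wform_diff_right)
    then have "z = 0" by (rule wform_self_eq_0[of mono_fact, OF mono_fact_pos])
    then show ?thesis by (simp add: z_def)
  qed
  then have "b \<in> invs V G e" using b by (simp add: invs_def)
  then show ?thesis using u(1) by (intro bexI[of _ b]) (simp_all add: b_def)
qed

text \<open>Each \<open>h j\<close> is replaced by its invariant part. The resulting error is
  invariant, and it is moved since moved elements absorb invariant factors; so it is orthogonal to
  itself.\<close>

lemma reynolds_combination:
  assumes J: "finite J" and a: "\<And>j. j \<in> J \<Longrightarrow> D j \<le> e \<and> a j \<in> invs V G (D j) \<and> h j \<in> HP V (e - D j)"
    and inv: "(\<Sum>j\<in>J. h j * a j) \<in> invs V G e"
  shows "\<exists>b. (\<forall>j\<in>J. b j \<in> invs V G (e - D j)) \<and> (\<Sum>j\<in>J. h j * a j) = (\<Sum>j\<in>J. b j * a j)"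
proof -
  have "\<forall>j\<in>J. \<exists>b. b \<in> invs V G (e - D j) \<and> h j - b \<in> moved (e - D j)" using a reynolds_operator by blast
  from bchoice[OF this] obtain b where b: "\<And>j. j \<in> J \<Longrightarrow> b j \<in> invs V G (e - D j) \<and> h j - b j \<in> moved (e - D j)" by blast
  define z where "z = (\<Sum>j\<in>J. a j * (h j - b j))"
  have lin_moved: "lin (moved e)" unfolding moved_def by (rule lin_lspan)
  have "a j * (h j - b j) \<in> moved e" if j: "j \<in> J" for j
    using moved_mult[of "a j" "D j" "h j - b j" "e - D j"] a[OF j] b[OF j] by simp
  then have z: "z \<in> moved e" unfolding z_def by (rule lin_sum[OF lin_moved])
  have eq: "z = (\<Sum>j\<in>J. h j * a j) - (\<Sum>j\<in>J. b j * a j)"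
    by (simp add: z_def right_diff_distrib sum_subtractf mult.commute)
  have "b j * a j \<in> invs V G e" if j: "j \<in> J" for j
    using invs_mult[of "b j" V G "e - D j" "a j" "D j"] a[OF j] b[OF j] by simp
  then have "(\<Sum>j\<in>J. b j * a j) \<in> invs V G e" by (rule lin_sum[OF lin_invs])
  then have "z \<in> invs V G e" unfolding eq by (rule lin_diff[OF lin_invs inv])
  then have "apolar z z = 0" by (rule moved_orthogonal[OF z])
  then have "z = 0" by (rule wform_self_eq_0[of mono_fact, OF mono_fact_pos])
  then show ?thesis using b eq by (intro exI[of _ b]) auto
qed

end

lemma graded_reynolds_invs:
  fixes V :: "'v::linorder set"
  assumes "transpose_closed V G" "V \<noteq> {}" shows "graded_reynolds V (invs V G)"
proof -
  interpret transpose_closed V G by fact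
  show ?thesis
  proof
    show "\<exists>b. (\<forall>j\<in>J. b j \<in> invs V G (e - D j)) \<and> (\<Sum>j\<in>J. h j * a j) = (\<Sum>j\<in>J. b j * a j)"
      if "finite (J :: nat set)" "\<And>j. j \<in> J \<Longrightarrow> D j \<le> e \<and> a j \<in> invs V G (D j) \<and> h j \<in> HP V (e - D j)"
        "(\<Sum>j\<in>J. h j * a j) \<in> invs V G e" for J D e a h
      using that by (rule reynolds_combination)
  qed (auto simp: finite_V assms(2) lin_invs invs_1 invs_mult, simp add: invs_def)
qed

text \<open>The decomposable elements: the degree \<open>e\<close> part of the square of the ideal
  of positive degree. Generation in bounded degree means that from some degree on everything is
  decomposable.\<close>

definition decs :: "(nat \<Rightarrow> ('v, 'a::comm_ring_1) mp set) \<Rightarrow> nat \<Rightarrow> ('v, 'a) mp set" where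
  "decs R e = lspan {a * b | a b d. 1 \<le> d \<and> d < e \<and> a \<in> R d \<and> b \<in> R (e - d)}"

lemma decs_mem: "1 \<le> d \<Longrightarrow> d < e \<Longrightarrow> a \<in> R d \<Longrightarrow> b \<in> R (e - d) \<Longrightarrow> a * b \<in> decs R e"
  unfolding decs_def by (rule lspan_mem) blast

lemma lin_decs: "lin (decs R e)" unfolding decs_def by (rule lin_lspan)

lemma decs_subset:
  assumes "lin U" "\<And>a b d. 1 \<le> d \<Longrightarrow> d < e \<Longrightarrow> a \<in> R d \<Longrightarrow> b \<in> R (e - d) \<Longrightarrow> a * b \<in> U"
  shows "decs R e \<subseteq> U"
  unfolding decs_def by (rule lspan_subset[OF assms(1)]) (use assms(2) in blast)

lemma decs_invs: "decs (invs V G) e \<subseteq> invs V G e"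
proof (rule decs_subset[OF lin_invs])
  fix a b d assume "d < e" "a \<in> invs V G d" "b \<in> invs V G (e - d)"
  then show "a * b \<in> invs V G e" using invs_mult[of a V G d b "e - d"] by simp
qed

section \<open>Semi-invariance under the general linear group\<close>

abbreviation detf :: "nat \<Rightarrow> (nat \<Rightarrow> nat \<Rightarrow> 'a::comm_ring_1) \<Rightarrow> 'a" where
  "detf n A \<equiv> det (mat n n (\<lambda>(a, b). A a b))"

abbreviation VV :: "nat \<Rightarrow> nat \<Rightarrow> (nat \<times> nat \<times> nat) set" where
  "VV m n \<equiv> {..<m} \<times> {..<n} \<times> {..<n}"

text \<open>The second matrix multiplies without inversion, so the result is polynomial in its
  entries; matrices of determinant 1 being closed under inverses, the invariants are the
  same.\<close>

definition mact :: "nat \<Rightarrow> (nat \<Rightarrow> nat \<Rightarrow> 'a) \<Rightarrow> (nat \<Rightarrow> nat \<Rightarrow> 'a) \<Rightarrow>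
    (nat \<times> nat \<times> nat \<Rightarrow> 'a) \<Rightarrow> nat \<times> nat \<times> nat \<Rightarrow> 'a::comm_ring_1" where
  "mact n A B X = (\<lambda>(i, r, c). \<Sum>a<n. \<Sum>b<n. A r a * X (i, a, b) * B b c)"

definition lmat :: "(nat \<Rightarrow> nat \<Rightarrow> 'a) \<Rightarrow> (nat \<Rightarrow> nat \<Rightarrow> 'a) \<Rightarrow>
    nat \<times> nat \<times> nat \<Rightarrow> nat \<times> nat \<times> nat \<Rightarrow> 'a::comm_ring_1" where
  "lmat A B = (\<lambda>(i, a, b) (j, c, d). if i = j then A a c * B d b else 0)"

definition sl_acts :: "nat \<Rightarrow> (nat \<times> nat \<times> nat \<Rightarrow> nat \<times> nat \<times> nat \<Rightarrow> 'a::comm_ring_1) set" where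
  "sl_acts n = {lmat A B | A B. detf n A = 1 \<and> detf n B = 1}"

lemma finite_VV: "finite (VV m n)" by simp

lemma detf_transpose: "detf n (\<lambda>a b. A b a) = detf n (A :: nat \<Rightarrow> nat \<Rightarrow> 'a::field)"
  by (rule det_mat_transpose)

lemma transpose_closed_sl: "transpose_closed (VV m n) (sl_acts n)"
proof
  fix L :: "nat \<times> nat \<times> nat \<Rightarrow> nat \<times> nat \<times> nat \<Rightarrow> rat" assume "L \<in> sl_acts n"
  then obtain A B where L: "L = lmat A B" "detf n A = 1" "detf n B = 1" by (auto simp: sl_acts_def)
  have "(\<lambda>v u. L u v) = lmat (\<lambda>a b. A b a) (\<lambda>a b. B b a)"
    by (auto simp: L(1) lmat_def fun_eq_iff)
  moreover have "detf n (\<lambda>a b. A b a) = 1" "detf n (\<lambda>a b. B b a) = 1"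
    using L(2,3) detf_transpose[of n A] detf_transpose[of n B] by simp_all
  ultimately show "(\<lambda>v u. L u v) \<in> sl_acts n" unfolding sl_acts_def mem_Collect_eq by (intro exI conjI)
qed simp

lemma ev_linsub_lmat:
  assumes "p \<in> PV (VV m n)" shows "ev X (linsub (VV m n) (lmat A B) p) = ev (mact n A B X) p"
  unfolding ev_linsub
proof (rule hev_cong[OF _ assms])
  fix v assume "v \<in> VV m n"
  then obtain i r c where v: "v = (i, r, c)" "i < m" by auto
  have "(\<Sum>u\<in>VV m n. lmat A B v u * X u) = (\<Sum>j<m. \<Sum>a<n. \<Sum>b<n. lmat A B v (j, a, b) * X (j, a, b))"
    by (simp add: sum.cartesian_product')
  also have "\<dots> = (\<Sum>j<m. if j = i then (\<Sum>a<n. \<Sum>b<n. A r a * X (i, a, b) * B b c) else 0)"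
    by (rule sum.cong[OF refl]) (auto simp: lmat_def v mult_ac intro!: sum.cong)
  also have "\<dots> = mact n A B X v" using v by (simp add: mact_def)
  finally show "(\<Sum>u\<in>VV m n. lmat A B v u * X u) = mact n A B X v" .
qed

lemma invs_ev:
  assumes "p \<in> invs (VV m n) (sl_acts n) e" "detf n A = 1" "detf n B = 1"
  shows "ev (mact n A B X) p = ev X p"
proof -
  have "lmat A B \<in> sl_acts n" using assms(2,3) by (auto simp: sl_acts_def)
  then have "linsub (VV m n) (lmat A B) p = p" using assms(1) by (simp add: invs_def)
  moreover have "p \<in> PV (VV m n)" using assms(1) by (simp add: invs_def HP_PV[of p _ e])
  ultimately show ?thesis using ev_linsub_lmat[of p m n X A B] by simp
qed

lemma detf_scale_rows: "detf n (\<lambda>a b. d a * A a b) = (\<Prod>a<n. d a) * detf n A"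
  unfolding det_eq_perms sum_distrib_left by (rule sum.cong[OF refl]) (simp add: prod.distrib mult_ac)

lemma detf_scale_cols: "detf n (\<lambda>a b. A a b * d b) = detf n A * (\<Prod>a<n. d a :: 'a::field)"
  using detf_transpose[of n "\<lambda>a b. A a b * d b"] detf_scale_rows[of n d "\<lambda>a b. A b a"] detf_transpose[of n A]
  by (simp add: mult.commute)

lemma detf_id: "detf n (\<lambda>a b. if a = b then 1 else 0) = 1"
proof -
  have "mat n n (\<lambda>(a, b). if a = b then 1 else 0) = (1\<^sub>m n :: 'a mat)" by (auto intro!: eq_matI)
  then show ?thesis by simp
qed

text \<open>Balancing a diagonal matrix with entries \<open>2\<close> and \<open>1/2\<close> shows that all indices have
  the same degree in \<open>p\<close>; \<open>g\<close> reads off the row or the column index of a variable.\<close>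

lemma torus_weight:
  fixes p :: "('v, rat) mp" and g :: "'v \<Rightarrow> nat"
  assumes n: "0 < n" and V: "finite V" "\<And>v. v \<in> V \<Longrightarrow> g v < n" and p: "p \<in> HP V e" "p \<noteq> 0"
    and inv: "\<And>d x. (\<Prod>a<n. d a) = 1 \<Longrightarrow> ev (\<lambda>v. d (g v) * x v) p = ev x p"
  shows "\<exists>k. e = k * n \<and> (\<forall>d x. ev (\<lambda>v. d (g v) * x v) p = (\<Prod>a<n. d a) ^ k * ev x p)"
proof -
  define w where "w a t = (\<Sum>v\<in>{v\<in>supp t. g v = a}. cf t v)" for a and t :: "'v mono"
  have tV: "supp t \<subseteq> V" "mdeg t = e" if "t \<in> supp p" for t using p(1) that by (auto simp: HP_def)
  have mev_d: "mev (\<lambda>v. d (g v)) t = (\<Prod>a<n. d a ^ w a t)" if t: "t \<in> supp p" for d :: "nat \<Rightarrow> rat" and t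
  proof -
    have "g ` supp t \<subseteq> {..<n}" using tV(1)[OF t] V(2) by blast
    then have "mev (\<lambda>v. d (g v)) t = (\<Prod>a<n. \<Prod>v\<in>{v\<in>supp t. g v = a}. d (g v) ^ cf t v)"
      unfolding mev_def by (intro prod.group[symmetric]) auto
    also have "\<dots> = (\<Prod>a<n. d a ^ w a t)"
      unfolding w_def power_sum by (intro prod.cong refl) auto
    finally show ?thesis .
  qed
  have scale: "mev (\<lambda>v. d (g v) * x v) t = mev (\<lambda>v. d (g v)) t * mev x t" for d x :: "_ \<Rightarrow> rat" and t :: "'v mono"
    unfolding mev_def by (simp add: power_mult_distrib prod.distrib)
  have coeff: "(\<Prod>a<n. d a ^ w a t) = 1" if d: "(\<Prod>a<n. d a) = 1" and t: "t \<in> supp p" for d :: "nat \<Rightarrow> rat" and t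
  proof -
    \<comment> \<open>The scaled polynomial minus \<open>p\<close>. It vanishes everywhere, hence
      each monomial of \<open>p\<close> is invariant on its own.\<close>
    define q where "q = (\<Sum>t\<in>supp p. sgl t (cf p t * (mev (\<lambda>v. d (g v)) t - 1)))"
    have "q = 0"
    proof (rule mp_eqI)
      fix x
      have "ev x q = (\<Sum>t\<in>supp p. cf p t * mev (\<lambda>v. d (g v) * x v) t - cf p t * mev x t)"
        unfolding q_def ev.hom_sum scale by (rule sum.cong[OF refl]) (simp add: hev_sgl algebra_simps)
      also have "\<dots> = ev (\<lambda>v. d (g v) * x v) p - ev x p" by (simp add: sum_subtractf hev_def)
      finally show "ev x q = ev x 0" by (simp add: inv[OF d])
    qed
    have "cf q t = (\<Sum>s\<in>supp p. if s = t then cf p s * (mev (\<lambda>v. d (g v)) s - 1) else 0)"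
      unfolding q_def lookup_sum by (rule sum.cong[OF refl]) (simp add: lookup_single when_def)
    also have "\<dots> = cf p t * (mev (\<lambda>v. d (g v)) t - 1)" using t by simp
    finally have "mev (\<lambda>v. d (g v)) t = 1" using \<open>q = 0\<close> t by (simp add: in_keys_iff)
    then show ?thesis by (simp add: mev_d[OF t])
  qed
  have w_eq: "w a t = w 0 t" if t: "t \<in> supp p" and a: "a < n" for a t
  proof (cases "a = 0")
    case False
    define d :: "nat \<Rightarrow> rat" where "d = (\<lambda>b. if b = a then 2 else if b = 0 then 1 / 2 else 1)"
    have d: "d a = 2" "d 0 = 1 / 2" "\<And>b. b \<noteq> a \<Longrightarrow> b \<noteq> 0 \<Longrightarrow> d b = 1" using False by (simp_all add: d_def)
    have split: "{..<n} = insert a (insert 0 ({..<n} - {a, 0}))" using a n by auto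
    have prod: "(\<Prod>b<n. d b ^ k b) = 2 ^ k a * (1 / 2) ^ k 0" for k
    proof -
      have "(\<Prod>b<n. d b ^ k b) = d a ^ k a * (d 0 ^ k 0 * (\<Prod>b\<in>{..<n} - {a, 0}. d b ^ k b))"
        using False by (subst split, subst prod.insert, simp, simp, subst prod.insert) auto
      also have "(\<Prod>b\<in>{..<n} - {a, 0}. d b ^ k b) = 1" by (rule prod.neutral) (simp add: d)
      finally show ?thesis by (simp add: d(1,2))
    qed
    have "(\<Prod>b<n. d b) = 1" using prod[of "\<lambda>_. 1"] by simp
    from coeff[OF this t] have "2 ^ w a t * (1 / 2) ^ w 0 t = (1 :: rat)" unfolding prod .
    then have "(2 :: rat) ^ w a t = 2 ^ w 0 t" by (simp add: power_one_over field_simps)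
    then show ?thesis by simp
  qed simp
  have e: "e = n * w 0 t" if t: "t \<in> supp p" for t
  proof -
    have "mdeg t = (\<Sum>a<n. w a t)"
      unfolding mdeg_def w_def
    proof (rule sum.group[symmetric])
      show "g ` supp t \<subseteq> {..<n}" using tV(1)[OF t] V(2) by blast
    qed simp_all
    also have "\<dots> = (\<Sum>a<n. w 0 t)" by (rule sum.cong[OF refl], rule w_eq[OF t]) simp
    finally show ?thesis using tV(2)[OF t] by (simp only: sum_constant card_lessThan of_nat_id)
  qed
  obtain t0 where t0: "t0 \<in> supp p" using p(2) by (metis ex_in_conv keys_eq_empty)
  define k where "k = w 0 t0"
  have k: "w a t = k" if "t \<in> supp p" "a < n" for a t
    using e[OF that(1)] e[OF t0] n w_eq[OF that] by (simp add: k_def)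
  have "ev (\<lambda>v. d (g v) * x v) p = (\<Prod>a<n. d a) ^ k * ev x p" for d x
    unfolding hev_def sum_distrib_left
  proof (rule sum.cong[OF refl])
    fix t assume t: "t \<in> supp p"
    have "(\<Prod>a<n. d a ^ w a t) = (\<Prod>a<n. d a) ^ k"
      unfolding prod_power_distrib by (rule prod.cong[OF refl]) (simp add: k[OF t])
    then show "cf p t * mev (\<lambda>v. d (g v) * x v) t = (\<Prod>a<n. d a) ^ k * (cf p t * mev x t)"
      by (simp add: scale mev_d[OF t])
  qed
  moreover have "e = k * n" using e[OF t0] by (simp add: k_def mult.commute)
  ultimately show ?thesis by blast
qed

lemma mact_scale:
  "mact n (\<lambda>a b. d a * A a b) (\<lambda>a b. B a b * d' b) X (i, r, c) = d r * (d' c * mact n A B X (i, r, c))"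
  unfolding mact_def sum_distrib_left prod.case by (intro sum.cong refl) (simp add: mult_ac)

lemma mact_id:
  assumes "r < n" "c < n"
  shows "mact n (\<lambda>a b. if a = b then 1 else 0) (\<lambda>a b. if a = b then 1 else 0) X (i, r, c) = X (i, r, c)"
proof -
  have "mact n (\<lambda>a b. if a = b then 1 else 0) (\<lambda>a b. if a = b then 1 else 0) X (i, r, c)
      = (\<Sum>a<n. \<Sum>b<n. if b = c then (if a = r then X (i, a, c) else 0) else 0)"
    unfolding mact_def prod.case by (rule sum.cong[OF refl], rule sum.cong[OF refl]) simp
  then show ?thesis using assms by simp
qed

text \<open>Diagonal matrices of determinant 1 force equal degrees in all rows and in all columns;
  this fixes the weight \<open>k\<close> and the effect of arbitrary diagonal matrices.\<close>

lemma invs_semi_rat: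
  fixes p :: "(nat \<times> nat \<times> nat, rat) mp"
  assumes n: "0 < n" and p: "p \<in> invs (VV m n) (sl_acts n) e" "p \<noteq> 0"
  shows "\<exists>k. e = k * n \<and> (\<forall>A B X. detf n A \<noteq> 0 \<longrightarrow> detf n B \<noteq> 0 \<longrightarrow>
    ev (mact n A B X) p = detf n A ^ k * detf n B ^ k * ev X p)"
proof -
  let ?I = "\<lambda>a b :: nat. if a = b then 1 else 0 :: rat"
  have pHP: "p \<in> HP (VV m n) e" using p(1) by (simp add: invs_def)
  have row: "ev (\<lambda>v. d (fst (snd v)) * x v) p = ev x p" if d: "(\<Prod>a<n. d a) = 1" for d x
  proof -
    have "ev (\<lambda>v. d (fst (snd v)) * x v) p = ev (mact n (\<lambda>a b. d a * ?I a b) (\<lambda>a b. ?I a b * 1) x) p"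
    proof (rule hev_cong[OF _ HP_PV[OF pHP]])
      fix v assume "v \<in> VV m n"
      then obtain i r c where v: "v = (i, r, c)" "r < n" "c < n" by auto
      show "d (fst (snd v)) * x v = mact n (\<lambda>a b. d a * ?I a b) (\<lambda>a b. ?I a b * 1) x v"
        unfolding v mact_scale mact_id[OF v(2,3)] by simp
    qed
    also have "\<dots> = ev x p"
      by (rule invs_ev[OF p(1)]) (use d in \<open>simp_all only: detf_scale_rows detf_id mult_1_right\<close>)
    finally show ?thesis .
  qed
  have col: "ev (\<lambda>v. d (snd (snd v)) * x v) p = ev x p" if d: "(\<Prod>a<n. d a) = 1" for d x
  proof -
    have "ev (\<lambda>v. d (snd (snd v)) * x v) p = ev (mact n (\<lambda>a b. 1 * ?I a b) (\<lambda>a b. ?I a b * d b) x) p"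
    proof (rule hev_cong[OF _ HP_PV[OF pHP]])
      fix v assume "v \<in> VV m n"
      then obtain i r c where v: "v = (i, r, c)" "r < n" "c < n" by auto
      show "d (snd (snd v)) * x v = mact n (\<lambda>a b. 1 * ?I a b) (\<lambda>a b. ?I a b * d b) x v"
        unfolding v mact_scale mact_id[OF v(2,3)] by simp
    qed
    also have "\<dots> = ev x p"
      by (rule invs_ev[OF p(1)]) (use d in \<open>simp_all only: detf_scale_cols detf_id mult_1_left\<close>)
    finally show ?thesis .
  qed
  have "\<exists>k. e = k * n \<and> (\<forall>d x. ev (\<lambda>v. d (fst (snd v)) * x v) p = (\<Prod>a<n. d a) ^ k * ev x p)"
    by (rule torus_weight[where g = "\<lambda>v. fst (snd v)", OF n finite_VV _ pHP p(2) row]) auto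
  then obtain k where k: "e = k * n" "\<And>d x. ev (\<lambda>v. d (fst (snd v)) * x v) p = (\<Prod>a<n. d a) ^ k * ev x p" by blast
  have "\<exists>k. e = k * n \<and> (\<forall>d x. ev (\<lambda>v. d (snd (snd v)) * x v) p = (\<Prod>a<n. d a) ^ k * ev x p)"
    by (rule torus_weight[where g = "\<lambda>v. snd (snd v)", OF n finite_VV _ pHP p(2) col]) auto
  then obtain k' where k': "e = k' * n" "\<And>d x. ev (\<lambda>v. d (snd (snd v)) * x v) p = (\<Prod>a<n. d a) ^ k' * ev x p" by blast
  have "k' = k" using k(1) k'(1) n by simp
  have "ev (mact n A B X) p = detf n A ^ k * detf n B ^ k * ev X p" if AB: "detf n A \<noteq> 0" "detf n B \<noteq> 0" for A B X
  proof -
    \<comment> \<open>\<open>A\<close> is split into the diagonal matrix with entries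
      \<open>det A, 1, ..., 1\<close> and a matrix of determinant 1, and likewise
      \<open>B\<close>.\<close>
    define d d' where "d = (\<lambda>a :: nat. if a = 0 then detf n A else 1)" and "d' = (\<lambda>a :: nat. if a = 0 then detf n B else 1)"
    have prod_d: "(\<Prod>a<n. d a) = detf n A" "(\<Prod>a<n. d' a) = detf n B"
      using n by (simp_all add: d_def d'_def)
    define A' B' where "A' = (\<lambda>a b. inverse (d a) * A a b)" and "B' = (\<lambda>a b. B a b * inverse (d' b))"
    have "A = (\<lambda>a b. d a * A' a b)" "B = (\<lambda>a b. B' a b * d' b)"
      using AB by (auto simp: A'_def B'_def d_def d'_def fun_eq_iff)
    then have eq: "mact n A B X (i, r, c) = d r * (d' c * mact n A' B' X (i, r, c))" for i r c
      using mact_scale[of n d A' B' d' X] by simp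
    have det1: "detf n A' = 1" "detf n B' = 1"
      unfolding A'_def B'_def detf_scale_rows detf_scale_cols prod_inversef[symmetric, unfolded o_def] using AB prod_d
      by (simp_all add: prod_inversef[unfolded o_def])
    have "ev (mact n A B X) p = ev (\<lambda>v. d (fst (snd v)) * (d' (snd (snd v)) * mact n A' B' X v)) p"
      by (rule hev_cong[OF _ HP_PV[OF pHP]]) (auto simp: eq)
    also have "\<dots> = detf n A ^ k * (detf n B ^ k * ev (mact n A' B' X) p)"
      
      using k(2)[of d "\<lambda>v. d' (snd (snd v)) * mact n A' B' X v"] k'(2)[of d' "mact n A' B' X"]
      by (simp only: prod_d \<open>k' = k\<close>)
    also have "ev (mact n A' B' X) p = ev X p" by (rule invs_ev[OF p(1) det1])
    finally show ?thesis by (simp add: mult_ac)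
  qed
  then show ?thesis using k(1) by blast
qed

lemma hev_detf: "comm_ring_hom \<phi> \<Longrightarrow> hev \<phi> y (detf n M) = detf n (\<lambda>a b. hev \<phi> y (M a b))"
proof -
  assume "comm_ring_hom \<phi>"
  then interpret h: comm_ring_hom "hev \<phi> y" by (rule comm_ring_hom.comm_ring_hom_hev)
  have "map_mat (hev \<phi> y) (mat n n (\<lambda>(a, b). M a b)) = mat n n (\<lambda>(a, b). hev \<phi> y (M a b))" by (auto intro!: eq_matI)
  then show ?thesis by (metis h.hom_det)
qed

text \<open>The two matrices of the group element become the matrices number \<open>m\<close> and \<open>m + 1\<close> of
  variables, which turns semi-invariance into a polynomial identity valid over every field.\<close>

theorem invs_semi:
  assumes n: "0 < n" and p: "p \<in> invs (VV m n) (sl_acts n) e" "p \<noteq> 0"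
  shows "\<exists>k. e = k * n \<and> (\<forall>(A :: nat \<Rightarrow> nat \<Rightarrow> 'a::field_char_0) B X. hev of_rat (mact n A B X) p = detf n A ^ k * detf n B ^ k * hev of_rat X p)"
proof -
  obtain k where k: "e = k * n" and semi: "\<And>A B X. detf n A \<noteq> 0 \<Longrightarrow> detf n B \<noteq> 0 \<Longrightarrow>
      ev (mact n A B X) p = detf n A ^ k * detf n B ^ k * ev X p"
    using invs_semi_rat[OF n p] by (elim exE conjE) (rule that, assumption, blast)
  have pPV: "p \<in> PV (VV m n)" using p(1) by (simp add: invs_def HP_PV[of p _ e])
  let ?M = "\<lambda>i r c :: nat. Var (i :: nat, r, c) :: (nat \<times> nat \<times> nat, rat) mp"
  let ?dA = "detf n (?M m)" and ?dB = "detf n (?M (m + 1))"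
  let ?P = "subst (mact n (?M m) (?M (m + 1)) Var) p"
  have evP: "hev \<phi> y ?P = hev \<phi> (mact n (\<lambda>a b. y (m, a, b)) (\<lambda>a b. y (m + 1, a, b)) y) p"
    and evd: "hev \<phi> y (detf n (?M i)) = detf n (\<lambda>a b. y (i, a, b))"
    if "comm_ring_hom \<phi>" for \<phi> :: "rat \<Rightarrow> 'b::comm_ring_1" and y i
  proof -
    interpret f: comm_ring_hom \<phi> by fact
    show "hev \<phi> y (detf n (?M i)) = detf n (\<lambda>a b. y (i, a, b))" by (simp add: hev_detf[OF that] f.hev_Var)
    have "(\<lambda>v. hev \<phi> y (mact n (?M m) (?M (m + 1)) Var v)) = mact n (\<lambda>a b. y (m, a, b)) (\<lambda>a b. y (m + 1, a, b)) y"
      by (auto simp: fun_eq_iff mact_def f.hev_sum f.hev_mult f.hev_Var)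
    then show "hev \<phi> y ?P = hev \<phi> (mact n (\<lambda>a b. y (m, a, b)) (\<lambda>a b. y (m + 1, a, b)) y) p"
      unfolding hev_subst[OF that] by simp
  qed
  let ?Q = "?dA ^ k * ?dB ^ k * p"
  \<comment> \<open>The factor \<open>?dA * ?dB\<close> covers the singular matrices, about which
    \<open>semi\<close> says nothing; it cancels because polynomials form an integral
    domain.\<close>
  have zero: "?dA * ?dB * (?P - ?Q) = 0"
  proof (rule mp_eqI)
    fix y
    show "ev y (?dA * ?dB * (?P - ?Q)) = ev y 0"
      using semi[of "\<lambda>a b. y (m, a, b)" "\<lambda>a b. y (m + 1, a, b)" y]
      unfolding ev.hom_mult ev.hom_minus ev.hom_power evP[OF comm_ring_hom_id] evd[OF comm_ring_hom_id] ev.hom_zero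
      by auto
  qed
  have "detf n (?M i) \<noteq> 0" for i
  proof
    assume "detf n (?M i) = 0"
    then have "detf n (\<lambda>a b :: nat. if a = b then 1 else 0 :: rat) = 0"
      using evd[OF comm_ring_hom_id, of "\<lambda>(i, a, b). if a = b then 1 else 0" i] by simp
    then show False by (simp add: detf_id)
  qed
  note dM = this
  have "?dA * ?dB = 0 \<or> ?P - ?Q = 0" using zero by (rule mult_eq_0_iff[THEN iffD1])
  moreover have "?dA * ?dB \<noteq> 0"
  proof
    assume "?dA * ?dB = 0"
    then have "?dA = 0 \<or> ?dB = 0" by (rule mult_eq_0_iff[THEN iffD1])
    then show False using dM[of m] dM[of "m + 1"] by (elim disjE) (erule notE, assumption)+
  qed
  ultimately have "?P - ?Q = 0" by (elim disjE) (erule notE, assumption)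
  then have PQ: "?P = ?Q" by (rule iffD2[OF eq_iff_diff_eq_0])
  have "hev of_rat (mact n A B X) p = detf n A ^ k * detf n B ^ k * hev of_rat X p" for A B :: "nat \<Rightarrow> nat \<Rightarrow> 'a" and X
  proof -
    have cr: "comm_ring_hom (of_rat :: rat \<Rightarrow> 'a)" by (rule of_rat_hom.comm_ring_hom_axioms)
    interpret h: comm_ring_hom "hev (of_rat :: rat \<Rightarrow> 'a) y" for y :: "nat \<times> nat \<times> nat \<Rightarrow> 'a"
      by (rule of_rat_hom.comm_ring_hom_hev)
    define y where "y = (\<lambda>(i, a, b). if i = m then A a b else if i = m + 1 then B a b else X (i, a, b))"
    have y: "(\<lambda>a b. y (m, a, b)) = A" "(\<lambda>a b. y (m + 1, a, b)) = B" "\<And>i a b. i < m \<Longrightarrow> y (i, a, b) = X (i, a, b)"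
      by (auto simp: y_def fun_eq_iff)
    have "hev of_rat (mact n A B X) p = hev of_rat (mact n A B y) p"
      by (rule hev_cong[OF _ pPV]) (auto simp: mact_def y(3))
    also have "\<dots> = hev of_rat y ?P" unfolding evP[OF cr] y(1,2) ..
    also have "\<dots> = detf n A ^ k * detf n B ^ k * hev of_rat y p"
      unfolding PQ h.hom_mult h.hom_power evd[OF cr] y(1,2) ..
    also have "hev of_rat y p = hev of_rat X p" by (rule hev_cong[OF _ pPV]) (auto simp: y(3))
    finally show ?thesis .
  qed
  then show ?thesis using k by blast
qed

section \<open>Blow-up determinants as invariants, and the null cone\<close>

lemma det_matrix_product:
  "det (mat N N (\<lambda>(p, q). \<Sum>r<N. A p r * B r q)) = det (mat N N (\<lambda>(p, q). A p q)) * det (mat N N (\<lambda>(p, q). B p q))"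
proof -
  have "mat N N (\<lambda>(p, q). \<Sum>r<N. A p r * B r q) = mat N N (\<lambda>(p, q). A p q) * mat N N (\<lambda>(p, q). B p q)"
    by (auto intro!: eq_matI simp: scalar_prod_def lessThan_atLeast0)
  then show ?thesis by (simp add: det_mult[of _ N])
qed

text \<open>The blow-up is multiplied from the left and from the right by block diagonal matrices
  with \<open>k\<close> blocks \<open>A\<close> and \<open>B\<close>.\<close>

lemma blow_det_mact:
  fixes A B :: "nat \<Rightarrow> nat \<Rightarrow> 'a::field"
  assumes n: "0 < n"
  shows "blow_det n m k (\<lambda>i a b. mact n A B X (i, a, b)) T
    = detf n A ^ k * blow_det n m k (\<lambda>i a b. X (i, a, b)) T * detf n B ^ k"
proof -
  let ?N = "k * n"
  let ?D = "\<lambda>M p q. if p div n = q div n then M (p mod n) (q mod n) else 0 :: 'a"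
  let ?X = "\<lambda>p q. blow n m (\<lambda>i a b. X (i, a, b)) T p q"
  have left: "(\<Sum>r<?N. ?D M p r * F r) = (\<Sum>a<n. M (p mod n) a * F ((p div n) * n + a))" if p: "p < ?N" for M F p
  proof -
    have j: "p div n < k" using p by (simp add: less_mult_imp_div_less)
    have "(\<Sum>r<?N. ?D M p r * F r) = (\<Sum>j<k. \<Sum>a<n. ?D M p (j * n + a) * F (j * n + a))"
      by (rule sum_blocks)
    also have "\<dots> = (\<Sum>j<k. if j = p div n then (\<Sum>a<n. M (p mod n) a * F (j * n + a)) else 0)"
      by (rule sum.cong[OF refl]) (auto intro!: sum.cong)
    finally show ?thesis using j by simp
  qed
  have right: "(\<Sum>r<?N. F r * ?D M r q) = (\<Sum>b<n. F ((q div n) * n + b) * M b (q mod n))" if q: "q < ?N" for M F q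
  proof -
    have j: "q div n < k" using q by (simp add: less_mult_imp_div_less)
    have "(\<Sum>r<?N. F r * ?D M r q) = (\<Sum>j<k. \<Sum>b<n. F (j * n + b) * ?D M (j * n + b) q)"
      by (rule sum_blocks)
    also have "\<dots> = (\<Sum>j<k. if j = q div n then (\<Sum>b<n. F (j * n + b) * M b (q mod n)) else 0)"
      by (rule sum.cong[OF refl]) (auto intro!: sum.cong)
    finally show ?thesis using j by simp
  qed
  have eq: "blow n m (\<lambda>i a b. mact n A B X (i, a, b)) T p q = (\<Sum>r<?N. (\<Sum>s<?N. ?D A p s * ?X s r) * ?D B r q)"
    if pq: "p < ?N" "q < ?N" for p q
  proof -
    have "(\<Sum>r<?N. (\<Sum>s<?N. ?D A p s * ?X s r) * ?D B r q)
        = (\<Sum>b<n. (\<Sum>a<n. A (p mod n) a * (\<Sum>i<m. T i (p div n) (q div n) * X (i, a, b))) * B b (q mod n))"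
    proof -
      have "?X (p div n * n + a) (q div n * n + b) = (\<Sum>i<m. T i (p div n) (q div n) * X (i, a, b))"
        if "a < n" "b < n" for a b using that by (simp add: blow_def)
      then have inner: "(\<Sum>s<?N. ?D A p s * ?X s (q div n * n + b))
          = (\<Sum>a<n. A (p mod n) a * (\<Sum>i<m. T i (p div n) (q div n) * X (i, a, b)))" if "b < n" for b
        unfolding left[where M = A and F = "\<lambda>s. ?X s (q div n * n + b)", OF pq(1)]
        using that by (intro sum.cong refl) simp
      have "(\<Sum>r<?N. (\<Sum>s<?N. ?D A p s * ?X s r) * ?D B r q)
          = (\<Sum>b<n. (\<Sum>s<?N. ?D A p s * ?X s (q div n * n + b)) * B b (q mod n))"
        by (rule right[where M = B and F = "\<lambda>r. \<Sum>s<?N. ?D A p s * ?X s r", OF pq(2)])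
      also have "\<dots> = (\<Sum>b<n. (\<Sum>a<n. A (p mod n) a * (\<Sum>i<m. T i (p div n) (q div n) * X (i, a, b))) * B b (q mod n))"
        by (rule sum.cong[OF refl]) (simp only: inner lessThan_iff)
      finally show ?thesis .
    qed
    also have "\<dots> = (\<Sum>b<n. \<Sum>a<n. \<Sum>i<m. T i (p div n) (q div n) * (A (p mod n) a * X (i, a, b) * B b (q mod n)))"
      unfolding sum_distrib_left sum_distrib_right
      by (rule sum.cong[OF refl], rule sum.cong[OF refl], rule sum.cong[OF refl]) (simp only: mult_ac)
    also have "\<dots> = (\<Sum>a<n. \<Sum>b<n. \<Sum>i<m. T i (p div n) (q div n) * (A (p mod n) a * X (i, a, b) * B b (q mod n)))"
      by (rule sum.swap)
    also have "\<dots> = (\<Sum>a<n. \<Sum>i<m. \<Sum>b<n. T i (p div n) (q div n) * (A (p mod n) a * X (i, a, b) * B b (q mod n)))"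
      by (rule sum.cong[OF refl], rule sum.swap)
    also have "\<dots> = (\<Sum>i<m. \<Sum>a<n. \<Sum>b<n. T i (p div n) (q div n) * (A (p mod n) a * X (i, a, b) * B b (q mod n)))"
      by (rule sum.swap)
    also have "\<dots> = blow n m (\<lambda>i a b. mact n A B X (i, a, b)) T p q"
      by (simp add: blow_def mact_def sum_distrib_left)
    finally show ?thesis ..
  qed
  have "blow_det n m k (\<lambda>i a b. mact n A B X (i, a, b)) T
      = det (mat ?N ?N (\<lambda>(p, q). \<Sum>r<?N. (\<Sum>s<?N. ?D A p s * ?X s r) * ?D B r q))"
    by (rule arg_cong[where f = det]) (auto intro!: eq_matI simp: eq)
  also have "\<dots> = detf n A ^ k * blow_det n m k (\<lambda>i a b. X (i, a, b)) T * detf n B ^ k"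
    unfolding det_matrix_product det_block_diagonal[OF n] ..
  finally show ?thesis .
qed

lemma Const_diff: "Const (a - b) = Const a - (Const b :: ('v, 'a::comm_ring_1) mp)"
  by (simp add: Const_def single_diff)

definition blow_poly :: "nat \<Rightarrow> nat \<Rightarrow> nat \<Rightarrow> (nat \<Rightarrow> nat \<Rightarrow> nat \<Rightarrow> 'a::comm_ring_1) \<Rightarrow> (nat \<times> nat \<times> nat, 'a) mp" where
  "blow_poly n m k T = blow_det n m k (\<lambda>i a b. Var (i, a, b)) (\<lambda>i j l. Const (T i j l))"

lemma hev_blow_poly:
  fixes \<phi> :: "'a::comm_ring_1 \<Rightarrow> 'b::comm_ring_1"
  assumes "comm_ring_hom \<phi>"
  shows "hev \<phi> x (blow_poly n m k T) = blow_det n m k (\<lambda>i a b. x (i, a, b)) (\<lambda>i j l. \<phi> (T i j l))"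
proof -
  interpret f: comm_ring_hom \<phi> by fact
  show ?thesis
    unfolding blow_poly_def hev_detf[OF assms] blow_def f.hev_sum f.hev_mult f.hev_Var f.hev_Const ..
qed

lemma blow_poly_HP: "0 < n \<Longrightarrow> blow_poly n m k T \<in> HP (VV m n) (k * n)"
proof -
  assume n: "0 < n"
  have entry: "blow n m (\<lambda>i a b. Var (i, a, b)) (\<lambda>i j l. Const (T i j l)) p q \<in> HP (VV m n) 1" for p q
    unfolding blow_def using n by (intro HP_sum HP_Const_mult HP_Var) auto
  have sgn: "(of_int z :: (nat \<times> nat \<times> nat, 'a) mp) = Const (of_int z)" for z
    by (induction z rule: int_induct[where k = 0]) (simp_all add: Const_add Const_diff)
  show ?thesis
    unfolding blow_poly_def det_eq_perms sgn
  proof (intro HP_sum HP_Const_mult)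
    fix \<sigma>
    have "(\<Prod>p<k * n. blow n m (\<lambda>i a b. Var (i, a, b)) (\<lambda>i j l. Const (T i j l)) p (\<sigma> p)) \<in> HP (VV m n) (\<Sum>p<k * n. 1)"
      by (rule HP_prod) (simp_all add: entry[unfolded One_nat_def])
    then show "(\<Prod>p<k * n. blow n m (\<lambda>i a b. Var (i, a, b)) (\<lambda>i j l. Const (T i j l)) p (\<sigma> p)) \<in> HP (VV m n) (k * n)"
      by simp
  qed
qed

lemma blow_poly_invs:
  fixes T :: "nat \<Rightarrow> nat \<Rightarrow> nat \<Rightarrow> 'a::field_char_0"
  assumes n: "0 < n" shows "blow_poly n m k T \<in> invs (VV m n) (sl_acts n) (k * n)"
proof -
  have "linsub (VV m n) L (blow_poly n m k T) = blow_poly n m k T" if "L \<in> sl_acts n" for L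
  proof (rule mp_eqI)
    fix x
    obtain A B where L: "L = lmat A B" "detf n A = 1" "detf n B = 1" using \<open>L \<in> sl_acts n\<close> by (auto simp: sl_acts_def)
    have "ev x (linsub (VV m n) L (blow_poly n m k T)) = ev (mact n A B x) (blow_poly n m k T)"
      unfolding L(1) by (rule ev_linsub_lmat[OF HP_PV[OF blow_poly_HP[OF n]]])
    also have "\<dots> = ev x (blow_poly n m k T)"
      unfolding hev_blow_poly[OF comm_ring_hom_id] blow_det_mact[OF n] by (simp add: L)
    finally show "ev x (linsub (VV m n) L (blow_poly n m k T)) = ev x (blow_poly n m k T)" .
  qed
  then show ?thesis using blow_poly_HP[OF n] by (simp add: invs_def)
qed

text \<open>The rational blow-up determinants of size \<open>n\<close> are invariants of degree
  \<open>n * n\<close>. Their vanishing at \<open>x\<close> spreads to complex \<open>T\<close>, to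
  every size at least \<open>n\<close>, and then to all semi-invariants of those weights.\<close>

lemma null_cone:
  fixes x :: "nat \<times> nat \<times> nat \<Rightarrow> complex"
  assumes n: "0 < n" and x: "\<And>q. q \<in> invs (VV m n) (sl_acts n) (n * n) \<Longrightarrow> hev of_rat x q = 0"
    and e: "1 \<le> e" and p: "p \<in> invs (VV m n) (sl_acts n) e"
  shows "hev of_rat x p = 0"
proof (cases "p = 0")
  case True
  then show ?thesis by (simp add: of_rat_hom.hev_0)
next
  case False
  let ?X = "\<lambda>i a b. x (i, a, b)"
  have cr: "comm_ring_hom (of_rat :: rat \<Rightarrow> complex)" by (rule of_rat_hom.comm_ring_hom_axioms)
  interpret h: comm_ring_hom "hev (of_rat :: rat \<Rightarrow> complex) y" for y :: "nat \<times> nat \<times> nat \<Rightarrow> complex"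
    by (rule of_rat_hom.comm_ring_hom_hev)
  interpret pm: comm_ring_hom "pmap (of_rat :: rat \<Rightarrow> complex) :: (nat \<times> nat \<times> nat, rat) mp \<Rightarrow> _"
    by (rule comm_ring_hom_pmap[OF cr])
  have full: "blow_det n m n ?X T = 0" for T
  proof (rule ccontr)
    assume T: "blow_det n m n ?X T \<noteq> 0"
    \<comment> \<open>The determinant as a polynomial in the entries of \<open>T\<close>. If it does
      not vanish at a complex point, it does not vanish at some rational one, where it is the value
      of an invariant with rational coefficients.\<close>
    define G where "G = blow_det n m n (\<lambda>i a b. Const (x (i, a, b))) (\<lambda>i j l. Var (i, j, l))"
    have evG: "ev y G = blow_det n m n ?X (\<lambda>i j l. y (i, j, l))" for y
      unfolding G_def hev_detf[OF comm_ring_hom_id] blow_def ev.hom_sum ev.hom_mult ev_Var ev_Const ..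
    have "G \<noteq> 0"
    proof
      assume "G = 0"
      then have "ev (\<lambda>(i, j, l). T i j l) G = 0" by (simp only: ev.hom_zero)
      then show False using T unfolding evG by simp
    qed
    moreover have "infinite (range (of_rat :: rat \<Rightarrow> complex))"
    proof -
      have "inj (of_rat :: rat \<Rightarrow> complex)" by (simp add: inj_def)
      then show ?thesis by (simp add: finite_image_iff infinite_UNIV_char_0)
    qed
    moreover have "G \<in> PV (\<Union>t\<in>supp G. supp t)" unfolding PV_def by blast
    ultimately have "\<exists>y. (\<forall>v. y v \<in> range of_rat) \<and> ev y G \<noteq> 0"
      by - (rule mp_nonzero_point_in[OF _ finite_vars])
    then obtain y where y: "\<forall>v. y v \<in> range of_rat" "ev y G \<noteq> 0" by (elim exE conjE)
    have "\<forall>v. \<exists>c. y v = of_rat c" using y(1) by blast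
    from choice[OF this] obtain z where z: "\<And>v. y v = of_rat (z v)" by blast
    have "ev y G = hev of_rat x (blow_poly n m n (\<lambda>i j l. z (i, j, l)))"
      unfolding evG hev_blow_poly[OF cr] z ..
    also have "\<dots> = 0" by (rule x[OF blow_poly_invs[OF n]])
    finally show False using y(2) by simp
  qed
  obtain k where k: "e = k * n" "\<And>(A :: nat \<Rightarrow> nat \<Rightarrow> complex) B X.
      hev of_rat (mact n A B X) p = detf n A ^ k * detf n B ^ k * hev of_rat X p"
    using invs_semi[OF n p False, where 'a = complex] by (elim exE conjE) (rule that, assumption, blast)
  have k1: "1 \<le> k" using e k(1) by (cases k) auto
  \<comment> \<open>The weight \<open>k\<close> of \<open>p\<close> may be below \<open>n\<close>;
    the \<open>n\<close>-th power has weight \<open>n * k\<close>, which is at least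
    \<open>n\<close> as \<open>blow_full_at_n\<close> requires.\<close>
  define h where "h = pmap (of_rat :: rat \<Rightarrow> complex) (p ^ n)"
  have evh: "ev y h = hev of_rat y p ^ n" for y by (simp add: h_def ev_pmap h.hom_power)
  have "ev x h = 0"
  proof (rule semi_invariant_vanishes[OF n])
    have "p ^ n \<in> HP (VV m n) (n * e)" using p by (intro HP_power) (simp add: invs_def)
    then have "p ^ n \<in> HP (VV m n) ((n * k) * n)" by (simp add: k(1) mult.assoc)
    then show "h \<in> HP (VV m n) ((n * k) * n)" unfolding h_def by (rule pmap_HP[rotated]) simp
    show "ev (\<lambda>(i, r, c). \<Sum>a<n. \<Sum>b<n. A r a * x (i, a, b) * B b c) h
      = detf n A ^ (n * k) * detf n B ^ (n * k) * ev x h" for A B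
      using k(2)[of A B x] by (simp add: evh mact_def power_mult_distrib mult.commute[of n k] flip: power_mult)
    show "blow_det n m (n * k) ?X T = 0" for T
      using blow_full_at_n[OF n, of "n * k" m ?X T] full k1 by fastforce
  qed
  then show ?thesis using n by (simp add: evh)
qed

section \<open>Reduction to at most \<open>n\<^sup>2\<close> matrices\<close>

abbreviation RR :: "nat \<Rightarrow> nat \<Rightarrow> nat \<Rightarrow> (nat \<times> nat \<times> nat, rat) mp set" where
  "RR n m \<equiv> invs (VV m n) (sl_acts n)"

text \<open>With \<open>m * n^2\<close> variables and null cone degree \<open>n^2\<close> the bound
  is \<open>m * n^4\<close>, at most \<open>n^6\<close>. Both factors of each product have positive
  degree because \<open>n^2 < e\<close>.\<close>

lemma decs_few_matrices:
  assumes n: "0 < n" and m: "0 < m" "m \<le> n * n" and e: "n ^ 6 < e" shows "RR n m e \<subseteq> decs (RR n m) e"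
proof
  fix p assume p: "p \<in> RR n m e"
  have ne: "VV m n \<noteq> {}" using n m by auto
  interpret graded_reynolds "VV m n" "RR n m" by (rule graded_reynolds_invs[OF transpose_closed_sl ne])
  have "card (VV m n) * (n * n) = m * (n * n) * (n * n)" by simp
  also have "\<dots> \<le> (n * n) * (n * n) * (n * n)" using m by (intro mult_le_mono1) simp
  also have "\<dots> = n ^ 6" by (simp add: eval_nat_numeral mult_ac)
  finally have less: "card (VV m n) * (n * n) < e" using e by simp
  have "\<exists>b f. (\<forall>i<card (VV m n). f i \<in> RR n m (n * n) \<and> b i \<in> RR n m (e - n * n)) \<and> p = (\<Sum>i<card (VV m n). b i * f i)"
  proof (rule generated_by_null_degree[OF _ less p])
    show "1 \<le> n * n" using n by simp
    show "hev of_rat x q = 0" if "\<And>q. q \<in> RR n m (n * n) \<Longrightarrow> hev of_rat x q = 0" "1 \<le> d" "q \<in> RR n m d"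
      for x :: "nat \<times> nat \<times> nat \<Rightarrow> complex" and d q
      by (rule null_cone[OF n that])
  qed
  then obtain b f where bf: "\<forall>i<card (VV m n). f i \<in> RR n m (n * n) \<and> b i \<in> RR n m (e - n * n)"
    "p = (\<Sum>i<card (VV m n). b i * f i)" by (elim exE conjE)
  have c1: "1 \<le> card (VV m n)" using n m by simp
  have "n * n \<le> card (VV m n) * (n * n)" using c1 by simp
  then have ne: "n * n < e" using less by (rule le_less_trans)
  have "f i * b i \<in> decs (RR n m) e" if "i < card (VV m n)" for i
    using bf(1) that n ne by (intro decs_mem[of "n * n"]) auto
  then show "p \<in> decs (RR n m) e" unfolding bf(2) mult.commute[of "b _"] by (intro lin_sum[OF lin_decs]) simp
qed

text \<open>\<open>C\<close> tensored with the identity: it forms linear combinations of the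
  \<open>m\<close> matrices, and it commutes with the group action
  (\<open>cact_mact\<close>).\<close>

definition cmat :: "(nat \<Rightarrow> nat \<Rightarrow> 'a) \<Rightarrow> nat \<times> nat \<times> nat \<Rightarrow> nat \<times> nat \<times> nat \<Rightarrow> 'a::comm_ring_1" where
  "cmat C = (\<lambda>(i, a, b) (j, c, d). if a = c \<and> b = d then C i j else 0)"

definition cact :: "nat \<Rightarrow> (nat \<Rightarrow> nat \<Rightarrow> 'a) \<Rightarrow> (nat \<times> nat \<times> nat \<Rightarrow> 'a) \<Rightarrow> nat \<times> nat \<times> nat \<Rightarrow> 'a::comm_ring_1" where
  "cact m C x = (\<lambda>(i, a, b). \<Sum>j<m. C i j * x (j, a, b))"

lemma ev_linsub_cmat:
  assumes "p \<in> PV (VV m n)" shows "ev x (linsub (VV m n) (cmat C) p) = ev (cact m C x) p"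
  unfolding ev_linsub
proof (rule hev_cong[OF _ assms])
  fix v assume "v \<in> VV m n"
  then obtain i a b where v: "v = (i, a, b)" "a < n" "b < n" by auto
  have "(\<Sum>u\<in>VV m n. cmat C v u * x u) = (\<Sum>j<m. \<Sum>c<n. \<Sum>d<n. cmat C v (j, c, d) * x (j, c, d))"
    by (simp add: sum.cartesian_product')
  also have "\<dots> = (\<Sum>j<m. \<Sum>c<n. \<Sum>d<n. if d = b then (if c = a then C i j * x (j, a, b) else 0) else 0)"
    by (rule sum.cong[OF refl], rule sum.cong[OF refl], rule sum.cong[OF refl]) (simp add: v cmat_def)
  also have "\<dots> = cact m C x v" using v by (simp add: cact_def)
  finally show "(\<Sum>u\<in>VV m n. cmat C v u * x u) = cact m C x v" .
qed

lemma cact_mact: "cact m C (mact n A B x) = mact n A B (cact m C x)"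
proof
  fix v :: "nat \<times> nat \<times> nat"
  obtain i r c where v: "v = (i, r, c)" by (cases v)
  have "cact m C (mact n A B x) v = (\<Sum>j<m. \<Sum>a<n. \<Sum>b<n. A r a * (C i j * x (j, a, b)) * B b c)"
    unfolding v cact_def mact_def prod.case sum_distrib_left
    by (rule sum.cong[OF refl], rule sum.cong[OF refl], rule sum.cong[OF refl]) (simp only: mult_ac)
  also have "\<dots> = (\<Sum>a<n. \<Sum>j<m. \<Sum>b<n. A r a * (C i j * x (j, a, b)) * B b c)" by (rule sum.swap)
  also have "\<dots> = (\<Sum>a<n. \<Sum>b<n. \<Sum>j<m. A r a * (C i j * x (j, a, b)) * B b c)"
    by (rule sum.cong[OF refl], rule sum.swap)
  also have "\<dots> = mact n A B (cact m C x) v"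
    unfolding v cact_def mact_def prod.case sum_distrib_left sum_distrib_right ..
  finally show "cact m C (mact n A B x) v = mact n A B (cact m C x) v" .
qed

lemma RR_I:
  assumes p: "p \<in> HP (VV m n) e" and inv: "\<And>A B x. detf n A = 1 \<Longrightarrow> detf n B = 1 \<Longrightarrow> ev (mact n A B x) p = ev x p"
  shows "p \<in> RR n m e"
proof -
  have "linsub (VV m n) L p = p" if "L \<in> sl_acts n" for L
  proof (rule mp_eqI)
    fix x
    obtain A B where L: "L = lmat A B" "detf n A = 1" "detf n B = 1" using \<open>L \<in> sl_acts n\<close> by (auto simp: sl_acts_def)
    show "ev x (linsub (VV m n) L p) = ev x p"
      unfolding L(1) ev_linsub_lmat[OF HP_PV[OF p]] by (rule inv[OF L(2,3)])
  qed
  then show ?thesis using p by (simp add: invs_def)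
qed

lemma RR_HP: "p \<in> RR n m e \<Longrightarrow> p \<in> HP (VV m n) e" by (simp add: invs_def)

lemma RR_mono: "m \<le> m' \<Longrightarrow> RR n m e \<subseteq> RR n m' e"
proof
  fix p assume m: "m \<le> m'" and p: "p \<in> RR n m e"
  show "p \<in> RR n m' e"
    by (rule RR_I[OF HP_mono[OF _ RR_HP[OF p]]]) (use m in auto, rule invs_ev[OF p])
qed

lemma RR_cmat: "p \<in> RR n m e \<Longrightarrow> linsub (VV m n) (cmat C) p \<in> RR n m e"
proof -
  assume p: "p \<in> RR n m e"
  note PV = HP_PV[OF RR_HP[OF p]]
  show ?thesis
  proof (rule RR_I[OF linsub_HP[OF RR_HP[OF p]]])
    fix A B :: "nat \<Rightarrow> nat \<Rightarrow> rat" and x assume "detf n A = 1" "detf n B = 1"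
    then show "ev (mact n A B x) (linsub (VV m n) (cmat C) p) = ev x (linsub (VV m n) (cmat C) p)"
      unfolding ev_linsub_cmat[OF PV] cact_mact by (rule invs_ev[OF p])
  qed
qed

lemma decs_cmat: "p \<in> decs (RR n m) e \<Longrightarrow> linsub (VV m n) (cmat C) p \<in> decs (RR n m) e"
proof -
  assume p: "p \<in> decs (RR n m) e"
  let ?U = "{q. linsub (VV m n) (cmat C) q \<in> decs (RR n m) e}"
  have "decs (RR n m) e \<subseteq> ?U"
  proof (rule decs_subset)
    show "lin ?U"
      by (rule linI) (auto simp: linsub.hom_add linsub.hom_mult intro: lin_0 lin_add lin_Const lin_decs)
    fix a b d assume *: "1 \<le> d" "d < e" "a \<in> RR n m d" "b \<in> RR n m (e - d)"
    show "a * b \<in> ?U" unfolding mem_Collect_eq linsub.hom_mult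
      by (rule decs_mem[OF *(1,2) RR_cmat[OF *(3)] RR_cmat[OF *(4)]])
  qed
  then show ?thesis using p by blast
qed

text \<open>Let \<open>U\<close> be the orthogonal complement of the decomposable invariants. It is
  stable under all \<open>cmat C\<close>, since the transpose of such a matrix is of the same kind.
  Restriction to \<open>n^2\<close> matrices kills \<open>U\<close>, and every tuple arises by
  linear combinations from the \<open>n^2\<close> matrix units, so \<open>U\<close> is zero.\<close>

lemma decs_all_matrices:
  assumes n: "0 < n" and m: "0 < m" and e: "n ^ 6 < e" shows "RR n m e \<subseteq> decs (RR n m) e"
proof (cases "m \<le> n * n")
  case True
  then show ?thesis using decs_few_matrices[OF n m _ e] by blast
next
  case False
  define D where "D = n * n"
  have D: "0 < D" "D < m" using n False by (auto simp: D_def)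
  define U where "U = {p \<in> RR n m e. \<forall>q\<in>decs (RR n m) e. apolar p q = 0}"
  have U_cmat: "linsub (VV m n) (cmat C) p \<in> U" if p: "p \<in> U" for p C
  proof -
    have pR: "p \<in> RR n m e" using p by (simp add: U_def)
    have "apolar (linsub (VV m n) (cmat C) p) q = 0" if q: "q \<in> decs (RR n m) e" for q
    proof -
      have qR: "q \<in> RR n m e" using decs_invs q by blast
      have tr: "(\<lambda>v u. cmat C u v) = cmat (\<lambda>i j. C j i)" by (auto simp: cmat_def fun_eq_iff)
      have "apolar (linsub (VV m n) (cmat C) p) q = apolar p (linsub (VV m n) (\<lambda>v u. cmat C u v) q)"
        by (rule apolar_linsub[OF finite_VV HP_PV[OF RR_HP[OF pR]] HP_PV[OF RR_HP[OF qR]]])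
      also have "\<dots> = 0" unfolding tr using p decs_cmat[OF q] by (simp add: U_def)
      finally show ?thesis .
    qed
    then show ?thesis using RR_cmat[OF pR] by (simp add: U_def)
  qed
  define P :: "nat \<Rightarrow> nat \<Rightarrow> rat" where "P = (\<lambda>i j. if i = j \<and> i < D then 1 else 0)"
  \<comment> \<open>\<open>P\<close> keeps the first \<open>D\<close> matrices and sets the others
    to zero. The image \<open>p'\<close> is decomposable by the case of few matrices and still lies
    in \<open>U\<close>, so it is orthogonal to itself.\<close>
  have proj: "linsub (VV m n) (cmat P) p = 0" if p: "p \<in> U" for p
  proof -
    define p' where "p' = linsub (VV m n) (cmat P) p"
    have p'U: "p' \<in> U" unfolding p'_def by (rule U_cmat[OF p])
    then have p'R: "p' \<in> RR n m e" by (simp add: U_def)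
    have "p \<in> HP (VV m n) e" using p RR_HP by (simp add: U_def)
    then have "p' \<in> HP (VV D n) e"
      unfolding p'_def linsub_def
    proof (rule subst_HP)
      fix v assume "v \<in> VV m n"
      show "(\<Sum>u\<in>VV m n. Const (cmat P v u) * Var u) \<in> HP (VV D n) 1"
      proof (rule HP_sum)
        fix u assume "u \<in> VV m n"
        then show "Const (cmat P v u) * Var u \<in> HP (VV D n) 1"
          by (cases "u \<in> VV D n") (auto simp: cmat_def P_def split: prod.splits intro!: HP_Const_mult HP_Var[unfolded One_nat_def])
      qed
    qed
    then have "p' \<in> RR n D e" by (rule RR_I) (rule invs_ev[OF p'R])
    moreover have "RR n D e \<subseteq> decs (RR n D) e" by (rule decs_few_matrices[OF n D(1) _ e]) (simp add: D_def)
    moreover have "decs (RR n D) e \<subseteq> decs (RR n m) e"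
    proof (rule decs_subset[OF lin_decs])
      fix a b d assume *: "1 \<le> d" "d < e" "a \<in> RR n D d" "b \<in> RR n D (e - d)"
      show "a * b \<in> decs (RR n m) e"
        using * subsetD[OF RR_mono[OF less_imp_le[OF D(2)]]] by (intro decs_mem[of d]) blast+
    qed
    ultimately have "p' \<in> decs (RR n m) e" by blast
    then have "apolar p' p' = 0" using p'U by (simp add: U_def)
    then show ?thesis unfolding p'_def[symmetric] by (rule wform_self_eq_0[of mono_fact, OF mono_fact_pos])
  qed
  have U0: "p = 0" if p: "p \<in> U" for p
  proof (rule mp_eqI)
    fix x :: "nat \<times> nat \<times> nat \<Rightarrow> rat"
    \<comment> \<open>\<open>E\<close> is the tuple of matrix units, numbered by
      \<open>j = a * n + b\<close> and zero from \<open>D\<close> on, and \<open>C\<close> contains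
      the coordinates of the matrices of \<open>x\<close> in this basis. Hence \<open>x\<close> is
      \<open>C\<close> applied to \<open>E\<close>, and \<open>P\<close> fixes
      \<open>E\<close>.\<close>
    define C where "C i j = (if j < D then x (i, j div n, j mod n) else 0)" for i j
    define E :: "nat \<times> nat \<times> nat \<Rightarrow> rat" where "E = (\<lambda>(j, a, b). if j < D \<and> j div n = a \<and> j mod n = b then 1 else 0)"
    have pR: "p \<in> RR n m e" using p by (simp add: U_def)
    note PV = HP_PV[OF RR_HP[OF pR]]
    define q where "q = linsub (VV m n) (cmat C) p"
    have q: "q \<in> U" unfolding q_def by (rule U_cmat[OF p])
    then have "q \<in> RR n m e" by (simp add: U_def)
    then have qPV: "q \<in> PV (VV m n)" by (rule HP_PV[OF RR_HP])
    have "ev x p = ev (cact m C E) p"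
    proof (rule hev_cong[OF _ PV])
      fix v assume "v \<in> VV m n"
      then obtain i a b where v: "v = (i, a, b)" "a < n" "b < n" by auto
      have j: "a * n + b < D" using block_index_less[of a n b n] v by (simp add: D_def)
      have "cact m C E v = (\<Sum>j<m. if j = a * n + b then x v else 0)"
        unfolding cact_def v(1) prod.case
      proof (rule sum.cong[OF refl])
        fix j
        have "j < D \<and> j div n = a \<and> j mod n = b \<longleftrightarrow> j = a * n + b"
        proof
          assume "j < D \<and> j div n = a \<and> j mod n = b"
          then show "j = a * n + b" using div_mult_mod_eq[of j n] by auto
        qed (use j v in auto)
        then show "C i j * E (j, a, b) = (if j = a * n + b then x (i, a, b) else 0)"
          using v(2,3) j by (auto simp: C_def E_def)
      qed
      then show "x v = cact m C E v" using j D(2) by simp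
    qed
    also have "\<dots> = ev E q" unfolding q_def ev_linsub_cmat[OF PV] ..
    also have "\<dots> = ev (cact m P E) q"
    proof (rule hev_cong[OF _ qPV])
      fix v assume "v \<in> VV m n"
      then obtain i a b where v: "v = (i, a, b)" "i < m" by auto
      have "cact m P E v = (\<Sum>j<m. if j = i then E v else 0)"
        unfolding cact_def v(1) prod.case by (rule sum.cong[OF refl]) (auto simp: P_def E_def)
      then show "E v = cact m P E v" using v(2) by simp
    qed
    also have "\<dots> = ev E (linsub (VV m n) (cmat P) q)" unfolding ev_linsub_cmat[OF qPV] ..
    also have "\<dots> = ev x 0" by (simp add: proj[OF q])
    finally show "ev x p = ev x 0" .
  qed
  show ?thesis
  proof
    fix p assume p: "p \<in> RR n m e"
    have "\<exists>u\<in>decs (RR n m) e. \<forall>u'\<in>decs (RR n m) e. apolar (p - u) u' = 0"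
      by (rule orthogonal_projection[OF finite_HP_monos[OF finite_VV] lin_decs _ mono_fact_pos])
        (use decs_invs RR_HP HP_supp in blast)
    then obtain u where u: "u \<in> decs (RR n m) e" "\<forall>u'\<in>decs (RR n m) e. apolar (p - u) u' = 0" by blast
    have "p - u \<in> RR n m e" using decs_invs u(1) by (intro lin_diff[OF lin_invs p]) blast
    then have "p - u = 0" using u(2) by (intro U0) (simp add: U_def)
    then show "p \<in> decs (RR n m) e" using u(1) by simp
  qed
qed

section \<open>Descent to the base field and conclusion\<close>

text \<open>Coordinates with respect to a basis of the field over the rationals; finitely many basis
  elements suffice for the finite set \<open>F\<close>.\<close>

lemma rational_coordinates:
  fixes F :: "'a::field_char_0 set"
  assumes F: "finite F"
  shows "\<exists>I \<rho>. finite I \<and> (\<forall>b x y. \<rho> b (x + y) = \<rho> b x + \<rho> b y) \<and>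
    (\<forall>b q x. \<rho> b (of_rat q * x) = q * \<rho> b x) \<and> (\<forall>x\<in>F. x = (\<Sum>b\<in>I. of_rat (\<rho> b x) * b))"
proof -
  interpret vs: vector_space "\<lambda>(q :: rat) (x :: 'a). of_rat q * x"
    by unfold_locales (simp_all add: distrib_left distrib_right of_rat_add of_rat_mult)
  define Bs where "Bs = vs.extend_basis {}"
  have Bs: "vs.independent Bs" "vs.span Bs = UNIV"
    unfolding Bs_def using vs.independent_extend_basis vs.span_extend_basis vs.independent_empty by auto
  define \<rho> where "\<rho> b x = vs.representation Bs x b" for b x
  define I where "I = (\<Union>x\<in>F. {b. vs.representation Bs x b \<noteq> 0})"
  have finI: "finite I" unfolding I_def using F vs.finite_representation by auto
  have "x = (\<Sum>b\<in>I. of_rat (\<rho> b x) * b)" if x: "x \<in> F" for x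
  proof -
    have "x = (\<Sum>b | vs.representation Bs x b \<noteq> 0. of_rat (vs.representation Bs x b) * b)"
      using vs.sum_nonzero_representation_eq[OF Bs(1), of x] Bs(2) by simp
    also have "\<dots> = (\<Sum>b\<in>I. of_rat (\<rho> b x) * b)"
      unfolding \<rho>_def by (rule sum.mono_neutral_left[OF finI]) (use x in \<open>auto simp: I_def\<close>)
    finally show ?thesis .
  qed
  moreover have "\<rho> b (x + y) = \<rho> b x + \<rho> b y" for b x y
    unfolding \<rho>_def using vs.representation_add[OF Bs(1)] Bs(2) by simp
  moreover have "\<rho> b (of_rat q * x) = q * \<rho> b x" for b q x
    unfolding \<rho>_def using vs.representation_scale[OF Bs(1)] Bs(2) by simp
  ultimately show ?thesis using finI by blast
qed

lemma hcomp_linsub: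
  assumes p: "p \<in> PV V" shows "hcomp e (linsub V L p) = linsub V L (hcomp e p)"
proof -
  have HP: "linsub V L (hcomp d p) \<in> HP V d" for d by (intro linsub_HP hcomp_HP p)
  have "hcomp e (linsub V L p) = hcomp e (linsub V L (\<Sum>d\<in>mdeg ` supp p. hcomp d p))"
    by (subst (1) sum_hcomp[of p]) (rule refl)
  also have "\<dots> = (\<Sum>d\<in>mdeg ` supp p. hcomp e (linsub V L (hcomp d p)))"
    unfolding linsub.hom_sum hcomp_sum ..
  also have "\<dots> = (\<Sum>d\<in>mdeg ` supp p. if d = e then linsub V L (hcomp e p) else 0)"
    by (rule sum.cong[OF refl]) (use hcomp_same[OF HP] hcomp_other[OF HP] in auto)
  also have "\<dots> = linsub V L (hcomp e p)"
  proof -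
    have "hcomp e p = 0" if "e \<notin> mdeg ` supp p"
    proof (rule poly_mapping_eqI)
      fix t
      have "cf p t = 0" if "mdeg t = e" using \<open>e \<notin> mdeg ` supp p\<close> that by (metis image_eqI in_keys_iff)
      then show "cf (hcomp e p) t = cf 0 t" by (simp add: cf_hcomp)
    qed
    then show ?thesis by (simp add: linsub.hom_zero)
  qed
  finally show ?thesis .
qed

section \<open>Polynomial functions and the invariant ring over the base field\<close>

definition pt :: "(nat \<Rightarrow> 'a mat) \<Rightarrow> nat \<times> nat \<times> nat \<Rightarrow> 'a" where
  "pt X = (\<lambda>(k, i, j). X k $$ (i, j))"

definition pfun :: "nat \<Rightarrow> nat \<Rightarrow> (nat \<times> nat \<times> nat, 'a::field) mp \<Rightarrow> (nat \<Rightarrow> 'a mat) \<Rightarrow> 'a" where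
  "pfun n m p = (\<lambda>X\<in>mat_tuples n m. ev (pt X) p)"

lemma eval_mpoly_eq_ev: "eval_mpoly p X = ev (pt X) p"
  unfolding eval_mpoly_def hev_def mev_def pt_def by (intro sum.cong refl arg_cong2[of _ _ _ _ "(*)"] prod.cong) auto

lemma poly_functions_le_eq:
  "poly_functions_le n m d = {pfun n m p | p. p \<in> PV (VV m n) \<and> (\<forall>t\<in>supp p. mdeg t \<le> d)}"
proof -
  have "poly_vars p \<subseteq> VV m n \<longleftrightarrow> p \<in> PV (VV m n)" for p :: "(nat \<times> nat \<times> nat, 'a) mp"
    by (auto simp: poly_vars_def PV_def)
  moreover have "restrict (eval_mpoly p) (mat_tuples n m) = pfun n m p" for p :: "(nat \<times> nat \<times> nat, 'a) mp"
    unfolding pfun_def by (auto simp: eval_mpoly_eq_ev)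
  ultimately show ?thesis by (simp add: poly_functions_le_def monomial_degree_def mdeg_def)
qed

lemma pfun_in_poly_functions: "p \<in> PV (VV m n) \<Longrightarrow> pfun n m p \<in> poly_functions n m"
proof -
  assume p: "p \<in> PV (VV m n)"
  have "mdeg t \<le> (\<Sum>t\<in>supp p. mdeg t)" if "t \<in> supp p" for t
    by (rule member_le_sum[OF that]) auto
  then show ?thesis using p unfolding poly_functions_def poly_functions_le_eq by blast
qed

lemma poly_functionsE:
  assumes "f \<in> poly_functions n m" obtains p where "p \<in> PV (VV m n)" "f = pfun n m p"
  using assms unfolding poly_functions_def poly_functions_le_eq by blast

lemma pfun_add: "pfun n m (p + q) = (\<lambda>X\<in>mat_tuples n m. pfun n m p X + pfun n m q X)"
  by (auto simp: pfun_def ev.hom_add)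
lemma pfun_mult: "pfun n m (p * q) = (\<lambda>X\<in>mat_tuples n m. pfun n m p X * pfun n m q X)"
  by (auto simp: pfun_def ev.hom_mult)
lemma pfun_Const: "pfun n m (Const c) = (\<lambda>X\<in>mat_tuples n m. c)"
  by (auto simp: pfun_def)

lemma SL_elem: "A \<in> carrier (SL n) \<Longrightarrow> A \<in> carrier_mat n n \<and> detf n (\<lambda>a b. A $$ (a, b)) = 1"
proof -
  assume A: "A \<in> carrier (SL n)"
  then have "mat n n (\<lambda>(a, b). A $$ (a, b)) = A" by (auto simp: SL_def intro!: eq_matI)
  then show ?thesis using A by (simp add: SL_def)
qed

lemma pt_act:
  fixes A B :: "'a::field mat"
  assumes A: "A \<in> carrier (SL n)" and B: "B \<in> carrier (SL n)" and X: "X \<in> mat_tuples n m" and v: "v \<in> VV m n"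
  shows "pt (act n m (A, B) X) v = mact n (\<lambda>a b. A $$ (a, b)) (\<lambda>a b. (inv\<^bsub>SL n\<^esub> B) $$ (a, b)) (pt X) v"
proof -
  obtain k i j where k: "v = (k, i, j)" "k < m" "i < n" "j < n" using v by auto
  have c: "A \<in> carrier_mat n n" "inv\<^bsub>SL n\<^esub> B \<in> carrier_mat n n" "X k \<in> carrier_mat n n"
    using SL_elem[OF A] SL_elem[OF group.inv_closed[OF group_SL B]] X k by (auto simp: mat_tuples_def)
  have "pt (act n m (A, B) X) v = (\<Sum>a<n. A $$ (i, a) * (\<Sum>b<n. X k $$ (a, b) * (inv\<^bsub>SL n\<^esub> B) $$ (b, j)))"
    using c k by (simp add: pt_def act_def scalar_prod_def lessThan_atLeast0)
  then show ?thesis by (simp add: k(1) mact_def pt_def sum_distrib_left mult.assoc)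
qed

lemma invariant_ringI:
  assumes "f \<in> poly_functions n m"
    and "\<And>g X. g \<in> carrier (SL n \<times>\<times> SL n) \<Longrightarrow> X \<in> mat_tuples n m \<Longrightarrow> act n m g X \<in> mat_tuples n m \<Longrightarrow> f (act n m g X) = f X"
  shows "f \<in> invariant_ring n m"
  unfolding invariant_ring_def using assms act_closed by blast

lemma invariant_ringD:
  assumes "f \<in> invariant_ring n m"
  shows "f \<in> poly_functions n m"
    and "g \<in> carrier (SL n \<times>\<times> SL n) \<Longrightarrow> X \<in> mat_tuples n m \<Longrightarrow> f (act n m g X) = f X"
  using assms unfolding invariant_ring_def by blast+

text \<open>Invariance was defined with rational group elements only; the polynomial identity of
  \<open>invs_semi\<close> extends it to matrices of determinant 1 over the base field.\<close>

lemma rational_invariant: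
  assumes n: "0 < n" and p: "p \<in> RR n m e"
  shows "pfun n m (pmap of_rat p) \<in> (invariant_ring n m \<inter> poly_functions_le n m e :: ((nat \<Rightarrow> 'a::field_char_0 mat) \<Rightarrow> 'a) set)"
proof -
  let ?p = "pmap (of_rat :: rat \<Rightarrow> 'a) p"
  have HP: "?p \<in> HP (VV m n) e" by (rule pmap_HP[OF _ RR_HP[OF p]]) simp
  have le: "pfun n m ?p \<in> poly_functions_le n m e"
    unfolding poly_functions_le_eq
    by (rule CollectI, rule exI[of _ ?p]) (use HP in \<open>simp add: HP_def PV_def\<close>)
  have "pfun n m ?p (act n m g X) = pfun n m ?p X"
    if g: "g \<in> carrier (SL n \<times>\<times> SL n)" and X: "X \<in> mat_tuples n m" for g and X :: "nat \<Rightarrow> 'a mat"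
  proof -
    obtain A B where g': "g = (A, B)" "A \<in> carrier (SL n)" "B \<in> carrier (SL n)"
      using g by (auto simp: DirProd_def)
    let ?A = "\<lambda>a b. A $$ (a, b)" and ?B = "\<lambda>a b. (inv\<^bsub>SL n\<^esub> B) $$ (a, b)"
    have dets: "detf n ?A = 1" "detf n ?B = 1"
      using SL_elem[OF g'(2)] SL_elem[OF group.inv_closed[OF group_SL g'(3)]] by auto
    have "ev (pt (act n m g X)) ?p = ev (mact n ?A ?B (pt X)) ?p"
      unfolding g'(1) by (rule hev_cong[OF _ HP_PV[OF HP]]) (rule pt_act[OF g'(2,3) X])
    also have "\<dots> = ev (pt X) ?p"
    proof (cases "p = 0")
      case True
      then show ?thesis by (simp add: ev_pmap of_rat_hom.hev_0)
    next
      case False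
      obtain k where "hev of_rat (mact n ?A ?B (pt X)) p = detf n ?A ^ k * detf n ?B ^ k * hev of_rat (pt X) p"
        using invs_semi[OF n p False, where 'a = 'a] by blast
      then show ?thesis unfolding dets power_one mult_1 by (simp add: ev_pmap)
    qed
    finally show ?thesis using X act_closed[OF g X] by (simp add: pfun_def)
  qed
  moreover have "pfun n m ?p \<in> poly_functions n m" by (rule pfun_in_poly_functions[OF HP_PV[OF HP]])
  ultimately show ?thesis using le by (intro IntI invariant_ringI)
qed

lemma invariant_ring_closed:
  assumes "f \<in> generated_algebra (mat_tuples n m) (invariant_ring n m \<inter> S)"
  shows "f \<in> (invariant_ring n m :: ((nat \<Rightarrow> 'a::field mat) \<Rightarrow> 'a) set)"
  using assms
proof induction
  case (gen f)
  then show ?case by simp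
next
  case (const c)
  have "(\<lambda>x\<in>mat_tuples n m. c) \<in> poly_functions n m"
    using pfun_in_poly_functions[OF PV_Const] unfolding pfun_Const .
  then show ?case by (rule invariant_ringI) simp
next
  case (add f g)
  then have fg: "f \<in> invariant_ring n m" "g \<in> invariant_ring n m" by blast+
  note fg(1)[THEN invariant_ringD(1)] fg(2)[THEN invariant_ringD(1)]
  then obtain p q where pq: "p \<in> PV (VV m n)" "f = pfun n m p" "q \<in> PV (VV m n)" "g = pfun n m q"
    by (elim poly_functionsE) (rule that)
  have "(\<lambda>x\<in>mat_tuples n m. f x + g x) \<in> poly_functions n m"
    using pfun_in_poly_functions[OF PV_add[OF pq(1,3)]] unfolding pfun_add pq(2,4) .
  then show ?case by (rule invariant_ringI) (simp add: fg[THEN invariant_ringD(2)])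
next
  case (mult f g)
  then have fg: "f \<in> invariant_ring n m" "g \<in> invariant_ring n m" by blast+
  note fg(1)[THEN invariant_ringD(1)] fg(2)[THEN invariant_ringD(1)]
  then obtain p q where pq: "p \<in> PV (VV m n)" "f = pfun n m p" "q \<in> PV (VV m n)" "g = pfun n m q"
    by (elim poly_functionsE) (rule that)
  have "(\<lambda>x\<in>mat_tuples n m. f x * g x) \<in> poly_functions n m"
    using pfun_in_poly_functions[OF PV_mult[OF pq(1,3)]] unfolding pfun_mult pq(2,4) .
  then show ?case by (rule invariant_ringI) (simp add: fg[THEN invariant_ringD(2)])
qed

lemma lin_generated:
  "lin {p. pfun n m p \<in> generated_algebra (mat_tuples n m) S}"
proof (rule linI)
  show "0 \<in> {p. pfun n m p \<in> generated_algebra (mat_tuples n m) S}"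
    using generated_algebra.const[where V = "mat_tuples n m" and c = 0 and S = S]
    unfolding mem_Collect_eq pfun_Const[symmetric] Const_0 .
  fix p assume p: "p \<in> {p. pfun n m p \<in> generated_algebra (mat_tuples n m) S}"
  show "Const c * p \<in> {p. pfun n m p \<in> generated_algebra (mat_tuples n m) S}" for c
    using p unfolding mem_Collect_eq pfun_mult by (intro generated_algebra.mult) (simp_all only: pfun_Const generated_algebra.const)
  fix q assume "q \<in> {p. pfun n m p \<in> generated_algebra (mat_tuples n m) S}"
  with p show "p + q \<in> {p. pfun n m p \<in> generated_algebra (mat_tuples n m) S}"
    unfolding mem_Collect_eq pfun_add by (rule generated_algebra.add)
qed

text \<open>Induction on the degree: above \<open>n^6\<close> an invariant is a combination of
  products of invariants of smaller degree.\<close>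

lemma rational_generated:
  fixes S :: "((nat \<Rightarrow> 'a::field_char_0 mat) \<Rightarrow> 'a) set"
  assumes n: "0 < n" and m: "0 < m" and S: "invariant_ring n m \<inter> poly_functions_le n m (n ^ 6) \<subseteq> S"
    and p: "p \<in> RR n m e"
  shows "pfun n m (pmap of_rat p) \<in> generated_algebra (mat_tuples n m) S"
  using p
proof (induction e arbitrary: p rule: less_induct)
  case (less e)
  interpret pm: comm_ring_hom "pmap (of_rat :: rat \<Rightarrow> 'a) :: (nat \<times> nat \<times> nat, rat) mp \<Rightarrow> _"
    by (rule comm_ring_hom_pmap) (rule of_rat_hom.comm_ring_hom_axioms)
  let ?U = "{p. pfun n m p \<in> generated_algebra (mat_tuples n m) S}"
  show ?case
  proof (cases "e \<le> n ^ 6")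
    case True
    have "poly_functions_le n m e \<subseteq> (poly_functions_le n m (n ^ 6) :: ((nat \<Rightarrow> 'a mat) \<Rightarrow> 'a) set)"
      unfolding poly_functions_le_eq using True by (blast intro: le_trans)
    then have "pfun n m (pmap of_rat p) \<in> S" using rational_invariant[OF n less.prems, where 'a = 'a] S by blast
    then show ?thesis by (rule generated_algebra.gen)
  next
    case False
    have "decs (RR n m) e \<subseteq> {q. pmap of_rat q \<in> ?U}"
    proof (rule decs_subset)
      show "lin {q. pmap of_rat q \<in> ?U}"
      proof (rule linI)
        show "0 \<in> {q. pmap of_rat q \<in> ?U}" using lin_0[OF lin_generated] by simp
        show "p + q \<in> {q. pmap of_rat q \<in> ?U}" if "p \<in> {q. pmap of_rat q \<in> ?U}" "q \<in> {q. pmap of_rat q \<in> ?U}" for p q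
          using lin_add[OF lin_generated] that unfolding mem_Collect_eq pm.hom_add by blast
        show "Const c * p \<in> {q. pmap of_rat q \<in> ?U}" if "p \<in> {q. pmap of_rat q \<in> ?U}" for p c
          using lin_Const[OF lin_generated, of "pmap of_rat p"] that unfolding mem_Collect_eq pm.hom_mult
          by (simp add: pmap_Const)
      qed
      fix a b d assume "1 \<le> d" "d < e" "a \<in> RR n m d" "b \<in> RR n m (e - d)"
      then have "pfun n m (pmap of_rat a) \<in> generated_algebra (mat_tuples n m) S"
        "pfun n m (pmap of_rat b) \<in> generated_algebra (mat_tuples n m) S"
        using less.IH[of d a] less.IH[of "e - d" b] by simp_all
      then show "a * b \<in> {q. pmap of_rat q \<in> ?U}"
        unfolding mem_Collect_eq pm.hom_mult pfun_mult by (rule generated_algebra.mult)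
    qed
    moreover have "p \<in> decs (RR n m) e" using decs_all_matrices[OF n m, of e] False less.prems by auto
    ultimately show ?thesis by blast
  qed
qed

text \<open>An invariant over the field is in particular fixed by the rational group elements. So
  are its coordinates over the rationals, and it is a linear combination of these rational
  invariants over the field.\<close>

lemma invariant_generated:
  fixes f :: "(nat \<Rightarrow> 'a::field_char_0 mat) \<Rightarrow> 'a"
  assumes n: "0 < n" and m: "0 < m" and S: "invariant_ring n m \<inter> poly_functions_le n m (n ^ 6) \<subseteq> S"
    and f: "f \<in> invariant_ring n m"
  shows "f \<in> generated_algebra (mat_tuples n m) S"
proof -
  obtain P where P: "P \<in> PV (VV m n)" "f = pfun n m P"
    using invariant_ringD(1)[OF f] by (rule poly_functionsE)
  interpret pm: comm_ring_hom "pmap (of_rat :: rat \<Rightarrow> 'a) :: (nat \<times> nat \<times> nat, rat) mp \<Rightarrow> _"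
    by (rule comm_ring_hom_pmap) (rule of_rat_hom.comm_ring_hom_axioms)
  let ?r = "of_rat :: rat \<Rightarrow> 'a"
  have inv: "ev (mact n (\<lambda>a b. ?r (A a b)) (\<lambda>a b. ?r (B a b)) y) P = ev y P"
    if AB: "detf n A = 1" "detf n B = 1" for A B y
  proof -
    let ?A = "mat n n (\<lambda>(a, b). ?r (A a b))" and ?B = "mat n n (\<lambda>(a, b). ?r (B a b))"
    define X where "X = (\<lambda>k\<in>{..<m}. mat n n (\<lambda>(i, j). y (k, i, j)))"
    have X: "X \<in> mat_tuples n m" by (auto simp: X_def mat_tuples_def)
    have "?A = map_mat ?r (mat n n (\<lambda>(a, b). A a b))" "?B = map_mat ?r (mat n n (\<lambda>(a, b). B a b))" by (auto intro!: eq_matI)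
    then have "det ?A = 1" "det ?B = 1" using AB by simp_all
    then have A: "?A \<in> carrier (SL n)" and B: "?B \<in> carrier (SL n)" by (simp_all add: SL_def)
    have iB: "inv\<^bsub>SL n\<^esub> ?B \<in> carrier (SL n)" by (rule group.inv_closed[OF group_SL B])
    \<comment> \<open>\<open>act\<close> inverts its second component, so the inverse of
      \<open>?B\<close> is supplied.\<close>
    have g: "(?A, inv\<^bsub>SL n\<^esub> ?B) \<in> carrier (SL n \<times>\<times> SL n)" using A iB by (simp add: DirProd_def)
    have "ev (pt (act n m (?A, inv\<^bsub>SL n\<^esub> ?B) X)) P = ev (pt X) P"
      using invariant_ringD(2)[OF f g X] X act_closed[OF g X] by (simp add: P(2) pfun_def)
    moreover have "ev (pt (act n m (?A, inv\<^bsub>SL n\<^esub> ?B) X)) P = ev (mact n (\<lambda>a b. ?r (A a b)) (\<lambda>a b. ?r (B a b)) y) P"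
    proof (rule hev_cong[OF _ P(1)])
      fix v assume v: "v \<in> VV m n"
      show "pt (act n m (?A, inv\<^bsub>SL n\<^esub> ?B) X) v = mact n (\<lambda>a b. ?r (A a b)) (\<lambda>a b. ?r (B a b)) y v"
        unfolding pt_act[OF A iB X v] group.inv_inv[OF group_SL B]
        using v by (auto simp: mact_def pt_def X_def)
    qed
    moreover have "ev (pt X) P = ev y P" by (rule hev_cong[OF _ P(1)]) (auto simp: pt_def X_def)
    ultimately show ?thesis by simp
  qed
  have "finite (cf P ` supp P)" by simp
  from rational_coordinates[OF this] obtain I \<rho> where I: "finite I"
    and add': "\<forall>b x y. \<rho> b (x + y) = \<rho> b x + \<rho> b y" and scale': "\<forall>b q x. \<rho> b (?r q * x) = q * \<rho> b x"
    and coord: "\<forall>x\<in>cf P ` supp P. x = (\<Sum>b\<in>I. ?r (\<rho> b x) * b)"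
    by (elim exE conjE) (rule that)
  note add = add'[rule_format] and scale = scale'[rule_format]
  have \<rho>0: "\<rho> b 0 = 0" for b using scale[of b 0 0] by simp
  have \<rho>sum: "\<rho> b (\<Sum>i\<in>J. g i) = (\<Sum>i\<in>J. \<rho> b (g i))" for b g and J :: "(nat \<times> nat \<times> nat) mono set"
    by (induction J rule: infinite_finite_induct) (simp_all add: \<rho>0 add)
  \<comment> \<open>The polynomial of the \<open>b\<close>-coordinates of the coefficients of
    \<open>P\<close>. At rational points, evaluation commutes with taking coordinates, which
    transfers invariance from \<open>P\<close> to \<open>Q b\<close>.\<close>
  define Q where "Q b = pmap (\<rho> b) P" for b
  have QPV: "Q b \<in> PV (VV m n)" for b unfolding Q_def by (rule pmap_PV[of "\<rho> b"], rule \<rho>0, rule P(1))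
  have evQ: "ev x (Q b) = \<rho> b (ev (\<lambda>v. ?r (x v)) P)" for x :: "nat \<times> nat \<times> nat \<Rightarrow> rat" and b
  proof -
    have "mev (\<lambda>v. ?r (x v)) t = ?r (mev x t)" for t :: "(nat \<times> nat \<times> nat) mono" by (simp add: mev_def of_rat_hom.hom_prod of_rat_hom.hom_power)
    then have "\<rho> b (ev (\<lambda>v. ?r (x v)) P) = (\<Sum>t\<in>supp P. \<rho> b (?r (mev x t) * cf P t))"
      unfolding hev_def \<rho>sum by (simp add: mult.commute)
    also have "\<dots> = hev (\<rho> b) x P" unfolding scale hev_def by (simp add: mult.commute)
    finally show ?thesis by (simp add: Q_def ev_pmap \<rho>0)
  qed
  have Qinv: "ev (mact n A B x) (Q b) = ev x (Q b)" if AB: "detf n A = 1" "detf n B = 1" for A B x b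
  proof -
    have "(\<lambda>v. ?r (mact n A B x v)) = mact n (\<lambda>a b. ?r (A a b)) (\<lambda>a b. ?r (B a b)) (\<lambda>v. ?r (x v))"
      by (auto simp: mact_def fun_eq_iff of_rat_hom.hom_sum of_rat_mult)
    then show ?thesis by (simp add: evQ inv[OF AB])
  qed
  have "hcomp e (Q b) \<in> RR n m e" for e b
  proof -
    have "linsub (VV m n) L (Q b) = Q b" if "L \<in> sl_acts n" for L
    proof (rule mp_eqI)
      fix x
      obtain A B where L: "L = lmat A B" "detf n A = 1" "detf n B = 1" using \<open>L \<in> sl_acts n\<close> by (auto simp: sl_acts_def)
      show "ev x (linsub (VV m n) L (Q b)) = ev x (Q b)"
        unfolding L(1) ev_linsub_lmat[OF QPV] by (rule Qinv[OF L(2,3)])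
    qed
    then show ?thesis unfolding invs_def by (auto simp: hcomp_HP[OF QPV] hcomp_linsub[OF QPV, symmetric])
  qed
  note gen = rational_generated[OF n m S this]
  let ?U = "{p. pfun n m p \<in> generated_algebra (mat_tuples n m) S}"
  have "pmap ?r (Q b) \<in> ?U" for b
  proof -
    have "pmap ?r (Q b) = (\<Sum>e\<in>mdeg ` supp (Q b). pmap ?r (hcomp e (Q b)))"
      by (subst sum_hcomp[of "Q b"]) (rule pm.hom_sum)
    also have "\<dots> \<in> ?U" using gen by (intro lin_sum[OF lin_generated]) simp
    finally show ?thesis .
  qed
  then have "(\<Sum>b\<in>I. Const b * pmap ?r (Q b)) \<in> ?U" by (intro lin_sum[OF lin_generated] lin_Const[OF lin_generated])
  moreover have "P = (\<Sum>b\<in>I. Const b * pmap ?r (Q b))"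
  proof (rule poly_mapping_eqI)
    fix t
    have "cf P t = (\<Sum>b\<in>I. ?r (\<rho> b (cf P t)) * b)"
    proof (cases "t \<in> supp P")
      case False
      then have "cf P t = 0" by (simp add: in_keys_iff)
      then show ?thesis by (simp add: \<rho>0)
    qed (rule bspec[OF coord], simp)
    then show "cf P t = cf (\<Sum>b\<in>I. Const b * pmap ?r (Q b)) t"
      unfolding lookup_sum mp_Const_mult_cf by (simp add: cf_pmap Q_def \<rho>0 mult.commute)
  qed
  ultimately show ?thesis unfolding P(2) by simp
qed

theorem corollary1p3:
  fixes n m :: nat
  assumes "n \<ge> 1" and "m \<ge> 1"
  shows "beta TYPE('a::field_char_0) n m \<le> n ^ 6
    \<and> generated_in_degree_le TYPE('a) n m (n ^ 6)"
proof -
  have "generated_in_degree_le TYPE('a) n m (n ^ 6)"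
    unfolding generated_in_degree_le_def
  proof (intro equalityI subsetI)
    fix f :: "(nat \<Rightarrow> 'a mat) \<Rightarrow> 'a" assume "f \<in> invariant_ring n m"
    then show "f \<in> generated_algebra (mat_tuples n m) (invariant_ring n m \<inter> poly_functions_le n m (n ^ 6))"
      using assms by (intro invariant_generated) auto
  qed (rule invariant_ring_closed)
  then show ?thesis unfolding beta_def by (blast intro: Least_le)
qed

end
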